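(* There exists a closed $3$-manifold $M$ carrying two non-orbit equivalent, non-transitive Anosov flows $\varphi_1,\varphi_2$ such that $\mathcal{P}(\varphi_1)=\mathcal{P}(\varphi_2)$.
   Context: An orbit equivalence between two flows on $M$ is a homeomorphism of $M$ taking orbits of the first flow to orbits of the second (it need not preserve the orientation of orbits). A flow is transitive if it has a dense orbit. $\mathcal{P}(\varphi)$ is the set of conjugacy classes of elements $\gamma\in\pi_1(M)$ such that $\gamma$ or $\gamma^{-1}$ represents the free homotopy class of a periodic orbit of $\varphi$, i.e. the set of unoriented free homotopy classes of closed loops in the foliation of $M$ by orbits. *)

theory Defs
  imports "HOL-Analysis.Analysis" "HOL-Algebra.Group"
begin

section \<open>Smooth closed 3-manifolds\<close>

text \<open>For an open set \<open>S\<close>; in finite dimensions continuity of all the directional derivatives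
  of order at most \<open>k\<close> is continuity of the Frechet derivatives.\<close>

primrec Ck_on ::
  "nat \<Rightarrow> 'a::real_normed_vector set \<Rightarrow> ('a \<Rightarrow> 'b::real_normed_vector) \<Rightarrow> bool" where
  "Ck_on 0 S f \<longleftrightarrow> continuous_on S f"
| "Ck_on (Suc k) S f \<longleftrightarrow>
     (\<forall>x\<in>S. f differentiable (at x)) \<and> (\<forall>v. Ck_on k S (\<lambda>x. frechet_derivative f (at x) v))"

definition smooth_on ::
  "'a::real_normed_vector set \<Rightarrow> ('a \<Rightarrow> 'b::real_normed_vector) \<Rightarrow> bool" where
  "smooth_on S f \<longleftrightarrow> (\<forall>k. Ck_on k S f)"

text \<open>A chart is a domain with a coordinate map; the values of the map off the domain are
  irrelevant.\<close>

type_synonym 'a chart = "'a set \<times> ('a \<Rightarrow> real^3)"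

definition chart_inv :: "'a chart \<Rightarrow> real^3 \<Rightarrow> 'a" where
  "chart_inv c = inv_into (fst c) (snd c)"

definition is_chart :: "'a topology \<Rightarrow> 'a chart \<Rightarrow> bool" where
  "is_chart X c \<longleftrightarrow> openin X (fst c) \<and> open (snd c ` fst c) \<and>
     homeomorphic_map (subtopology X (fst c)) (top_of_set (snd c ` fst c)) (snd c)"

definition smooth_atlas :: "'a topology \<Rightarrow> 'a chart set \<Rightarrow> bool" where
  "smooth_atlas X A \<longleftrightarrow>
     (\<forall>c\<in>A. is_chart X c) \<and> (\<Union>c\<in>A. fst c) = topspace X \<and>
     (\<forall>c\<in>A. \<forall>d\<in>A. smooth_on (snd c ` (fst c \<inter> fst d)) (\<lambda>x. snd d (chart_inv c x)))"

text \<open>As usual when the fundamental group is considered, manifolds are connected (and nonempty).\<close>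

definition closed_3_manifold :: "'a topology \<Rightarrow> 'a chart set \<Rightarrow> bool" where
  "closed_3_manifold X A \<longleftrightarrow>
     Hausdorff_space X \<and> second_countable X \<and> compact_space X \<and>
     connected_space X \<and> topspace X \<noteq> {} \<and> smooth_atlas X A"


section \<open>Tangent data\<close>

text \<open>A tangent vector at \<open>p\<close> is given by its components in the charts around \<open>p\<close>, which
  transform by the derivatives of the transition maps. Accordingly, fields on the manifold are
  families indexed by charts and points, subject to the transformation law.
  \<open>deriv_in c d f p\<close> is the derivative at \<open>p\<close> of a map \<open>f\<close> from the manifold to itself, in
  the chart \<open>c\<close> around \<open>p\<close> and the chart \<open>d\<close> around \<open>f p\<close>; for \<open>f\<close> the identity it is the change
  of components.\<close>

definition deriv_in ::
  "'a chart \<Rightarrow> 'a chart \<Rightarrow> ('a \<Rightarrow> 'a) \<Rightarrow> 'a \<Rightarrow> real^3 \<Rightarrow> real^3" where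
  "deriv_in c d f p = frechet_derivative (\<lambda>x. snd d (f (chart_inv c x))) (at (snd c p))"

definition riemannian_metric ::
  "'a chart set \<Rightarrow> ('a chart \<Rightarrow> 'a \<Rightarrow> real^3 \<Rightarrow> real^3 \<Rightarrow> real) \<Rightarrow> bool" where
  "riemannian_metric A g \<longleftrightarrow>
     (\<forall>c\<in>A. \<forall>p\<in>fst c. bilinear (g c p) \<and> (\<forall>u v. g c p u v = g c p v u) \<and>
        (\<forall>v. v \<noteq> 0 \<longrightarrow> g c p v v > 0)) \<and>
     (\<forall>c\<in>A. \<forall>d\<in>A. \<forall>p\<in>fst c \<inter> fst d. \<forall>u v.
        g d p (deriv_in c d (\<lambda>q. q) p u) (deriv_in c d (\<lambda>q. q) p v) = g c p u v) \<and>
     (\<forall>c\<in>A. \<forall>u v. smooth_on (snd c ` fst c) (\<lambda>x. g c (chart_inv c x) u v))"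

definition metric_norm ::
  "('a chart \<Rightarrow> 'a \<Rightarrow> real^3 \<Rightarrow> real^3 \<Rightarrow> real) \<Rightarrow> 'a chart \<Rightarrow> 'a \<Rightarrow> real^3 \<Rightarrow> real" where
  "metric_norm g c p v = sqrt (g c p v v)"

text \<open>Continuous line subbundles of the tangent bundle.\<close>

definition line_subbundle ::
  "'a topology \<Rightarrow> 'a chart set \<Rightarrow> ('a chart \<Rightarrow> 'a \<Rightarrow> (real^3) set) \<Rightarrow> bool" where
  "line_subbundle X A E \<longleftrightarrow>
     (\<forall>c\<in>A. \<forall>p\<in>fst c. \<exists>W s. openin X W \<and> p \<in> W \<and> W \<subseteq> fst c \<and>
        continuous_map (subtopology X W) euclidean s \<and>
        (\<forall>q\<in>W. s q \<noteq> 0 \<and> E c q = span {s q})) \<and>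
     (\<forall>c\<in>A. \<forall>d\<in>A. \<forall>p\<in>fst c \<inter> fst d. deriv_in c d (\<lambda>q. q) p ` E c p = E d p)"


section \<open>Anosov flows\<close>

definition smooth_flow ::
  "'a topology \<Rightarrow> 'a chart set \<Rightarrow> (real \<Rightarrow> 'a \<Rightarrow> 'a) \<Rightarrow> bool" where
  "smooth_flow X A \<phi> \<longleftrightarrow>
     (\<forall>p\<in>topspace X. \<phi> 0 p = p \<and> (\<forall>s t. \<phi> (s + t) p = \<phi> s (\<phi> t p))) \<and>
     continuous_map (prod_topology euclideanreal X) X (\<lambda>(t, p). \<phi> t p) \<and>
     (\<forall>c\<in>A. \<forall>d\<in>A. smooth_on
        {(t, x). x \<in> snd c ` fst c \<and> \<phi> t (chart_inv c x) \<in> fst d}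
        (\<lambda>(t, x). snd d (\<phi> t (chart_inv c x))))"

definition generator :: "(real \<Rightarrow> 'a \<Rightarrow> 'a) \<Rightarrow> 'a chart \<Rightarrow> 'a \<Rightarrow> real^3" where
  "generator \<phi> c p = vector_derivative (\<lambda>t. snd c (\<phi> t p)) (at 0)"

definition invariant_subbundle ::
  "'a chart set \<Rightarrow> (real \<Rightarrow> 'a \<Rightarrow> 'a) \<Rightarrow> ('a chart \<Rightarrow> 'a \<Rightarrow> (real^3) set) \<Rightarrow> bool" where
  "invariant_subbundle A \<phi> E \<longleftrightarrow>
     (\<forall>t. \<forall>c\<in>A. \<forall>p\<in>fst c. \<forall>d\<in>A. \<phi> t p \<in> fst d \<longrightarrow>
        deriv_in c d (\<phi> t) p ` E c p = E d (\<phi> t p))"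

definition contracted_by ::
  "'a chart set \<Rightarrow> ('a chart \<Rightarrow> 'a \<Rightarrow> real^3 \<Rightarrow> real^3 \<Rightarrow> real) \<Rightarrow> (real \<Rightarrow> 'a \<Rightarrow> 'a) \<Rightarrow>
     ('a chart \<Rightarrow> 'a \<Rightarrow> (real^3) set) \<Rightarrow> bool" where
  "contracted_by A g \<phi> E \<longleftrightarrow>
     (\<exists>C>0. \<exists>\<mu>>0. \<forall>t\<ge>0. \<forall>c\<in>A. \<forall>p\<in>fst c. \<forall>d\<in>A. \<phi> t p \<in> fst d \<longrightarrow>
        (\<forall>v\<in>E c p. metric_norm g d (\<phi> t p) (deriv_in c d (\<phi> t) p v)
                      \<le> C * exp (- \<mu> * t) * metric_norm g c p v))"

text \<open>The splitting is the direct sum of the stable line, the flow direction and the unstable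
  line. Uniqueness of the scalar \<open>r\<close> makes the generator nonzero everywhere.\<close>

definition anosov_flow ::
  "'a topology \<Rightarrow> 'a chart set \<Rightarrow> (real \<Rightarrow> 'a \<Rightarrow> 'a) \<Rightarrow> bool" where
  "anosov_flow X A \<phi> \<longleftrightarrow> smooth_flow X A \<phi> \<and>
     (\<exists>g Es Eu. riemannian_metric A g \<and> line_subbundle X A Es \<and> line_subbundle X A Eu \<and>
        (\<forall>c\<in>A. \<forall>p\<in>fst c. \<forall>v. \<exists>!w. case w of (a, r, b) \<Rightarrow>
           a \<in> Es c p \<and> b \<in> Eu c p \<and> v = a + r *\<^sub>R generator \<phi> c p + b) \<and>
        invariant_subbundle A \<phi> Es \<and> invariant_subbundle A \<phi> Eu \<and>
        contracted_by A g \<phi> Es \<and> contracted_by A g (\<lambda>t. \<phi> (- t)) Eu)"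

definition flow_orbit :: "(real \<Rightarrow> 'a \<Rightarrow> 'a) \<Rightarrow> 'a \<Rightarrow> 'a set" where
  "flow_orbit \<phi> p = range (\<lambda>t. \<phi> t p)"

definition transitive_flow :: "'a topology \<Rightarrow> (real \<Rightarrow> 'a \<Rightarrow> 'a) \<Rightarrow> bool" where
  "transitive_flow X \<phi> \<longleftrightarrow> (\<exists>p\<in>topspace X. X closure_of (flow_orbit \<phi> p) = topspace X)"

definition orbit_equivalent ::
  "'a topology \<Rightarrow> (real \<Rightarrow> 'a \<Rightarrow> 'a) \<Rightarrow> (real \<Rightarrow> 'a \<Rightarrow> 'a) \<Rightarrow> bool" where
  "orbit_equivalent X \<phi> \<psi> \<longleftrightarrow>
     (\<exists>h. homeomorphic_map X X h \<and>
        (\<forall>p\<in>topspace X. h ` flow_orbit \<phi> p = flow_orbit \<psi> (h p)))"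


section \<open>Fundamental group and periodic orbits\<close>

definition loop_at :: "'a topology \<Rightarrow> 'a \<Rightarrow> (real \<Rightarrow> 'a) \<Rightarrow> bool" where
  "loop_at X x0 \<gamma> \<longleftrightarrow> pathin X \<gamma> \<and> \<gamma> 0 = x0 \<and> \<gamma> 1 = x0"

definition loop_class :: "'a topology \<Rightarrow> 'a \<Rightarrow> (real \<Rightarrow> 'a) \<Rightarrow> (real \<Rightarrow> 'a) set" where
  "loop_class X x0 \<gamma> =
     {\<delta>. homotopic_with (\<lambda>h. h 0 = x0 \<and> h 1 = x0) (top_of_set {0..1}) X \<gamma> \<delta>}"

definition concat_loops :: "(real \<Rightarrow> 'a) \<Rightarrow> (real \<Rightarrow> 'a) \<Rightarrow> real \<Rightarrow> 'a" where
  "concat_loops \<gamma> \<delta> = (\<lambda>s. if s \<le> 1/2 then \<gamma> (2 * s) else \<delta> (2 * s - 1))"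

text \<open>The union in the multiplication is over equal sets.\<close>

definition fundamental_group :: "'a topology \<Rightarrow> 'a \<Rightarrow> (real \<Rightarrow> 'a) set monoid" where
  "fundamental_group X x0 =
     \<lparr>carrier = {loop_class X x0 \<gamma> | \<gamma>. loop_at X x0 \<gamma>},
      monoid.mult = (\<lambda>a b. \<Union>\<gamma>\<in>a. \<Union>\<delta>\<in>b. loop_class X x0 (concat_loops \<gamma> \<delta>)),
      one = loop_class X x0 (\<lambda>_. x0)\<rparr>"

definition conjugacy_class :: "('a, 'b) monoid_scheme \<Rightarrow> 'a \<Rightarrow> 'a set" where
  "conjugacy_class G a = {x \<otimes>\<^bsub>G\<^esub> a \<otimes>\<^bsub>G\<^esub> inv\<^bsub>G\<^esub> x | x. x \<in> carrier G}"

definition freely_homotopic :: "'a topology \<Rightarrow> (real \<Rightarrow> 'a) \<Rightarrow> (real \<Rightarrow> 'a) \<Rightarrow> bool" where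
  "freely_homotopic X \<gamma> \<delta> \<longleftrightarrow>
     homotopic_with (\<lambda>h. h 0 = h 1) (top_of_set {0..1}) X \<gamma> \<delta>"

text \<open>\<open>T\<close> is the minimal period: a periodic orbit is regarded as a loop traversed once.\<close>

definition periodic_point :: "'a topology \<Rightarrow> (real \<Rightarrow> 'a \<Rightarrow> 'a) \<Rightarrow> 'a \<Rightarrow> real \<Rightarrow> bool" where
  "periodic_point X \<phi> p T \<longleftrightarrow>
     p \<in> topspace X \<and> T > 0 \<and> \<phi> T p = p \<and> (\<forall>s. 0 < s \<and> s < T \<longrightarrow> \<phi> s p \<noteq> p)"

definition represents_periodic_orbit ::
  "'a topology \<Rightarrow> (real \<Rightarrow> 'a \<Rightarrow> 'a) \<Rightarrow> (real \<Rightarrow> 'a) set \<Rightarrow> bool" where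
  "represents_periodic_orbit X \<phi> a \<longleftrightarrow>
     (\<exists>\<gamma>\<in>a. \<exists>p T. periodic_point X \<phi> p T \<and> freely_homotopic X \<gamma> (\<lambda>s. \<phi> (T * s) p))"

definition periodic_classes ::
  "'a topology \<Rightarrow> 'a \<Rightarrow> (real \<Rightarrow> 'a \<Rightarrow> 'a) \<Rightarrow> (real \<Rightarrow> 'a) set set set" where
  "periodic_classes X x0 \<phi> =
     {conjugacy_class (fundamental_group X x0) a | a.
        a \<in> carrier (fundamental_group X x0) \<and>
        (represents_periodic_orbit X \<phi> a \<or>
         represents_periodic_orbit X \<phi> (inv\<^bsub>fundamental_group X x0\<^esub> a))}"

text \<open>Manifolds below are topologies on subsets of the type \<open>real\<close>. This only uses that a
  nonempty closed 3-manifold has the cardinality of the continuum; the topology is arbitrary and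
  unrelated to that of the real line.\<close>

end

theory Submission
imports Defs
begin

text \<open>A construction in the style of Franks and Williams. Let \<open>fm\<close> be the lift to the plane of a
  derived-from-Anosov map of the torus with three repelling fixed points \<open>cs 0, cs 1, cs 2\<close> on one
  stable leaf, separated by the saddles \<open>(sad 1, 0)\<close> and \<open>(sad 2, 0)\<close>. The suspension of
  \<open>fm\<close> minus the sources is covered by the points \<open>(p, z)\<close> with \<open>z > 0\<close>, where
  \<open>(p, z)\<close> is identified with \<open>(fm p, z / lam)\<close> and \<open>z\<close> grows exponentially; the points with
  \<open>z < 0\<close> cover the same suspension with time reversed. The ends at the sources of the first piece
  are glued to those of the second by \<open>(cs j + u, z) = (cs (pj j) + rot u, - 1 / (z * sq u))\<close>,
  up to a sign \<open>ep j\<close> of \<open>rot u\<close>. The quarter turn makes the foliations transverse, so the flow is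
  Anosov; it is not transitive, since wandering orbits run from the repeller to the attractor.

  Replacing \<open>ep 1\<close> by \<open>- ep 1\<close> changes one glueing map by a half turn, which is isotopic to the
  identity. So the manifold stays the same up to a diffeomorphism \<open>Psi\<close> supported in the wandering set.
  All periodic orbits lie in the attractor and the repeller, where \<open>Psi\<close> is the identity, and hence
  both flows have the same periodic orbits.

  The orbits of the two saddles in both pieces are characterised topologically, and so are the eight
  components of wandering orbits which remain when the closure of their invariant leaves is
  removed. At a saddle orbit four of these components meet like quadrants. For \<open>ep 1 = 1\<close> there are two
  components which meet two different saddle orbits, in opposite quadrants at the first one; for \<open>ep 1 = -1\<close> any two
  components meeting two saddle orbits are adjacent along a half leaf.\<close>

text \<open>At a source \<open>fm\<close> is exactly the homothety by \<open>lam\<close>. So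
  rotations about the source commute with it, which permits the quarter turn of the glueing as well
  as the later twist. Also \<open>(u, z) |-> (rot u, - 1 / (z * sq u))\<close> commutes with
  \<open>u |-> u / lam, z |-> lam * z\<close>, because \<open>sq\<close> has degree two. The price
  is that nothing contracts near a source: \<open>Fx / lam = 1\<close> there. Therefore the
  transverse line field is prescribed exactly around the sources, in agreement with the glueing, and
  continued over the rest of the plane by a uniformly convergent series
  (\<open>cocycle_section\<close>). Contraction is first proved pointwise, by following an orbit
  until it has left the sources or has crossed to the other piece, and then made uniform by
  compactness. Of the three sources the middle one is adjacent to both saddles, the outer ones to
  one each. Since \<open>pj\<close> exchanges an outer source with the middle one, the pattern of
  sectors is irregular enough to detect a half turn at a single glueing. The lattice is the ring of
  integers of the real quadratic field of discriminant 5; the norm of an algebraic integer bounds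
  lattice vectors from below.\<close>

notation scaleR (infixr "*R" 75)
abbreviation (input) equivalent (infixr "<->" 25) where "A <-> B == (A :: bool) = B"
abbreviation (input) seq_tendsto (infixr "---->" 60) where "X ----> L == filterlim X (nhds L) sequentially"
abbreviation (input) "FD == frechet_derivative"

section \<open>Calculus of \<open>Ck_on\<close> and \<open>smooth_on\<close>\<close>

lemma Ck_on_cong:
 assumes "open S" "!!x. x:S ==> f x = g x"
 shows "Ck_on k S f <-> Ck_on k S g"
proof -
 have "Ck_on k S f" if "Ck_on k S g" "!!x. x:S ==> f x = g x" for k and f g :: "'a => 'b"
  using that
 proof (induction k arbitrary: f g)
  case 0
  thus ?case by simp
 next
  case (Suc k)
  have d: "(f has_derivative FD g (at x)) (at x)" if "x:S" for x
  proof -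
   have "(g has_derivative FD g (at x)) (at x)"
    using Suc.prems that by (simp add:frechet_derivative_works)
   thus ?thesis
    using has_derivative_transform_within_open[OF _ assms(1) that] Suc.prems by metis
  qed
  have "FD f (at x) = FD g (at x)" if "x:S" for x
   using d[OF that] frechet_derivative_at by metis
  hence "Ck_on k S (%x. FD f (at x) v)" for v
   using Suc.IH[of "%x. FD g (at x) v" "%x. FD f (at x) v"] Suc.prems by auto
  thus ?case using d by (auto simp:differentiable_def)
 qed
 from this[of k f g] this[of k g f] show ?thesis using assms(2) by auto
qed

lemma Ck_on_subset: "Ck_on k S f ==> T<=S ==> Ck_on k T f"
 by (induction k arbitrary: f) (auto intro:continuous_on_subset)

lemma Ck_on_SucI:
 assumes "open S" "!!x. x:S ==> (f has_derivative f' x) (at x)" "!!v. Ck_on k S (%x. f' x v)"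
 shows "Ck_on (Suc k) S f"
proof -
 have e: "FD f (at x) = f' x" if "x:S" for x
  using frechet_derivative_at[OF assms(2)[OF that]] by simp
 have "Ck_on k S (%x. FD f (at x) v)" for v
  using assms(3)[of v] Ck_on_cong[OF assms(1), of "%x. FD f (at x) v" "%x. f' x v" k] e by simp
 thus ?thesis using assms(2) by (auto simp:differentiable_def)
qed

lemma Ck_on_SucD:
 assumes "Ck_on (Suc k) S f" "x:S"
 shows "(f has_derivative FD f (at x)) (at x)"
 using assms by (simp add:frechet_derivative_works)

lemma Ck_on_continuous: "Ck_on k S f ==> continuous_on S f"
 by (cases k) (auto simp:continuous_on_eq_continuous_within intro:differentiable_imp_continuous_within continuous_at_imp_continuous_within)

lemma Ck_on_Suc_imp: "Ck_on (Suc k) S f ==> Ck_on k S f"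
proof (induction k arbitrary: f)
 case 0
 thus ?case using Ck_on_continuous[OF 0] by simp
next
 case (Suc k)
 thus ?case by auto
qed

lemma Ck_on_open_Union:
 assumes "!!x. x:S ==> EX U. open U & x:U & Ck_on k U f"
 shows "Ck_on k S f"
 using assms
proof (induction k arbitrary: f)
 case 0
 have "isCont f x" if "x:S" for x
  using 0[OF that] by (auto simp:continuous_on_eq_continuous_at)
 thus ?case by (simp add:continuous_at_imp_continuous_on)
next
 case (Suc k)
 have "Ck_on k S (%x. FD f (at x) v)" for v
  by (rule Suc.IH) (use Suc.prems in fastforce)
 thus ?case using Suc.prems by auto
qed

lemma Ck_on_const [intro]: "Ck_on k S (%x. c)"
 by (induction k arbitrary: c) auto

lemma Ck_on_bounded_linear:
 assumes "open S" "bounded_linear h" "Ck_on k S f"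
 shows "Ck_on k S (%x. h (f x))"
 using assms(3)
proof (induction k arbitrary: f)
 case 0
 thus ?case by (auto intro:bounded_linear.continuous_on[OF assms(2)])
next
 case (Suc k)
 show ?case
  by (rule Ck_on_SucI[OF assms(1) bounded_linear.has_derivative[OF assms(2) Ck_on_SucD[OF Suc.prems]]]) (use Suc in auto)
qed

lemma bounded_linear_uminus: "bounded_linear (%x::'a::real_normed_vector. - x)"
 by (rule bounded_linear_minus[OF bounded_linear_ident])

lemma Ck_on_add:
 assumes "open S" "Ck_on k S f" "Ck_on k S g"
 shows "Ck_on k S (%x. f x + g x)"
 using assms(2,3)
proof (induction k arbitrary: f g)
 case 0
 thus ?case by (auto intro:continuous_intros)
next
 case (Suc k)
 show ?case
  by (rule Ck_on_SucI[OF assms(1) has_derivative_add[OF Ck_on_SucD[OF Suc.prems(1)] Ck_on_SucD[OF Suc.prems(2)]]]) (use Suc in auto)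
qed

lemma Ck_on_id: "open S ==> Ck_on k S (%x. x)"
 by (cases k) auto

lemma Ck_on_bilinear:
 assumes "open S" "bounded_bilinear h" "Ck_on k S f" "Ck_on k S g"
 shows "Ck_on k S (%x. h (f x) (g x))"
 using assms(3,4)
proof (induction k arbitrary: f g)
 case 0
 thus ?case by (auto intro:bounded_bilinear.continuous_on[OF assms(2)])
next
 case (Suc k)
 show ?case
 proof (rule Ck_on_SucI[OF assms(1) bounded_bilinear.FDERIV[OF assms(2) Ck_on_SucD[OF Suc.prems(1)] Ck_on_SucD[OF Suc.prems(2)]]])
  fix v
  show "Ck_on k S (%x. h (f x) (FD g (at x) v) + h (FD f (at x) v) (g x))"
   by (intro Ck_on_add assms(1) Suc.IH) (use Suc.prems Ck_on_Suc_imp in auto)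
 qed
qed

lemma Ck_on_sum:
 assumes "open S" "!!i. i:I ==> Ck_on k S (f i)"
 shows "Ck_on k S (%x. \<Sum>i\<in>I. f i x)"
 using assms(2) by (induction I rule:infinite_finite_induct) (auto intro:Ck_on_add assms(1))

lemma Ck_on_Pair:
 assumes "open S" "Ck_on k S f" "Ck_on k S g"
 shows "Ck_on k S (%x. (f x,g x))"
proof -
 have "Ck_on k S (%x. (f x,0) + (0,g x))"
  by (intro Ck_on_add assms Ck_on_bounded_linear[OF assms(1), of "%u. (u,0)" k f]
    Ck_on_bounded_linear[OF assms(1), of "%u. (0,u)" k g] bounded_linear_Pair
    bounded_linear_ident bounded_linear_zero)
 thus ?thesis by simp
qed

lemma Ck_on_compose:
 fixes f :: "'a::real_normed_vector => 'b::euclidean_space" and g :: "'b => 'c::real_normed_vector"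
 assumes "open S" "open T" "!!x. x:S ==> f x:T" "Ck_on k S f" "Ck_on k T g"
 shows "Ck_on k S (%x. g (f x))"
 using assms(4,5)
proof (induction k arbitrary: g)
 case 0
 thus ?case using assms(3) by (auto intro:continuous_on_compose2)
next
 case (Suc k)
 let ?f' = "%x. FD f (at x)" and ?g' = "%y. FD g (at y)"
 have d: "((%x. g (f x)) has_derivative (%v. ?g' (f x) (?f' x v))) (at x)" if "x:S" for x
  using diff_chain_at[OF Ck_on_SucD[OF Suc.prems(1) that] Ck_on_SucD[OF Suc.prems(2) assms(3)[OF that]]] by (simp add:o_def)
 \<comment> \<open>\<open>Ck_on\<close> controls derivatives in fixed directions only, whereas the
   chain rule applies the derivative of \<open>g\<close> to the moving vector
   \<open>?f' x v\<close>. Expanding that vector in the basis leads back to fixed directions, where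
   the induction hypothesis applies.\<close>
 have e: "?g' (f x) w = (\<Sum>b\<in>Basis. (w \<bullet> b) *R ?g' (f x) b)" if "x:S" for x w
 proof -
  have "linear (?g' (f x))"
   using Ck_on_SucD[OF Suc.prems(2) assms(3)[OF that]] has_derivative_linear by blast
  hence "?g' (f x) (\<Sum>b\<in>Basis. (w \<bullet> b) *R b) = (\<Sum>b\<in>Basis. (w \<bullet> b) *R ?g' (f x) b)"
   by (simp add:linear_sum linear_scale)
  thus ?thesis by (simp add:euclidean_representation)
 qed
 show ?case
 proof (rule Ck_on_SucI[OF assms(1)])
  fix x assume "x:S"
  show "((%x. g (f x)) has_derivative
    (%v. \<Sum>b\<in>Basis. (?f' x v \<bullet> b) *R ?g' (f x) b)) (at x)"
   by (rule has_derivative_eq_rhs[OF d[OF `x:S`]]) (rule ext, rule e[OF `x:S`])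
 next
  fix v
  show "Ck_on k S (%x. \<Sum>b\<in>Basis. (?f' x v \<bullet> b) *R ?g' (f x) b)"
  proof (rule Ck_on_sum[OF assms(1)], rule Ck_on_bilinear[OF assms(1) bounded_bilinear_scaleR])
   fix b :: 'b
   show "Ck_on k S (%x. ?f' x v \<bullet> b)"
    by (rule Ck_on_bounded_linear[OF assms(1) bounded_linear_inner_left]) (use Suc.prems(1) in simp)
   show "Ck_on k S (%x. ?g' (f x) b)"
    using Suc.IH[of "%y. ?g' y b"] Suc.prems Ck_on_Suc_imp by auto
  qed
 qed
qed

lemma smooth_on_cong:
 "open S ==> (!!x. x:S ==> f x = g x) ==> smooth_on S f <-> smooth_on S g"
 by (simp add:smooth_on_def Ck_on_cong[of S f g])

lemma smooth_on_subset: "smooth_on S f ==> T<=S ==> smooth_on T f"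
 by (simp add:smooth_on_def Ck_on_subset[of _ S])

lemma smooth_on_local:
 "(!!x. x:S ==> EX U. open U & x:U & smooth_on U f) ==> smooth_on S f"
 unfolding smooth_on_def by (intro allI Ck_on_open_Union) blast

lemma smooth_on_has_derivative:
 "smooth_on S f ==> x:S ==> (f has_derivative FD f (at x)) (at x)"
 using Ck_on_SucD[of 0 S f x] by (simp only:smooth_on_def)

lemma smooth_on_frechet: "smooth_on S f ==> smooth_on S (%x. FD f (at x) v)"
 unfolding smooth_on_def by (metis Ck_on.simps(2))

lemma smooth_on_continuous: "smooth_on S f ==> continuous_on S f"
 by (metis smooth_on_def Ck_on.simps(1))

lemma smooth_on_const: "smooth_on S (%x. c)" by (simp add:smooth_on_def Ck_on_const)
lemma smooth_on_id: "open S ==> smooth_on S (%x. x)" by (simp add:smooth_on_def Ck_on_id)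
lemma smooth_on_bounded_linear:
 "open S ==> bounded_linear h ==> smooth_on S f ==> smooth_on S (%x. h (f x))"
 by (simp add:smooth_on_def Ck_on_bounded_linear)
lemma smooth_on_add:
 "open S ==> smooth_on S f ==> smooth_on S g ==> smooth_on S (%x. f x + g x)"
 by (simp add:smooth_on_def Ck_on_add)
lemma smooth_on_Pair:
 "open S ==> smooth_on S f ==> smooth_on S g ==> smooth_on S (%x. (f x,g x))"
 by (simp add:smooth_on_def Ck_on_Pair)
lemma smooth_on_bilinear:
 "open S ==> bounded_bilinear h ==> smooth_on S f ==> smooth_on S g ==> smooth_on S (%x. h (f x) (g x))"
 by (simp add:smooth_on_def Ck_on_bilinear)
lemma smooth_on_sum:
 "open S ==> (!!i. i:I ==> smooth_on S (f i)) ==> smooth_on S (%x. \<Sum>i\<in>I. f i x)"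
 by (simp add:smooth_on_def Ck_on_sum)
lemma smooth_on_compose:
 fixes f :: "'a::real_normed_vector => 'b::euclidean_space"
 shows "smooth_on T g ==> smooth_on S f ==> open S ==> open T ==> (!!x. x:S ==> f x:T)
  ==> smooth_on S (%x. g (f x))"
 by (simp add:smooth_on_def Ck_on_compose[of S T f _ g])

lemma smooth_on_minus: "open S ==> smooth_on S f ==> smooth_on S (%x. - f x)"
 by (rule smooth_on_bounded_linear[OF _ bounded_linear_uminus])
lemma smooth_on_diff:
 assumes "open S" "smooth_on S f" "smooth_on S g" shows "smooth_on S (%x. f x - g x)"
 using smooth_on_add[OF assms(1,2) smooth_on_minus[OF assms(1,3)]] by simp
lemma smooth_on_fst: "open S ==> smooth_on S f ==> smooth_on S (%x. fst (f x))"
 by (rule smooth_on_bounded_linear) (auto intro:bounded_linear_fst)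
lemma smooth_on_snd: "open S ==> smooth_on S f ==> smooth_on S (%x. snd (f x))"
 by (rule smooth_on_bounded_linear) (auto intro:bounded_linear_snd)
lemma smooth_on_mult:
 fixes f g :: "_ => real"
 shows "open S ==> smooth_on S f ==> smooth_on S g ==> smooth_on S (%x. f x*g x)"
 by (rule smooth_on_bilinear) (auto intro:bounded_bilinear_mult)
lemma smooth_on_scaleR:
 "open S ==> smooth_on S f ==> smooth_on S g ==> smooth_on S (%x. f x *R g x)"
 by (rule smooth_on_bilinear) (auto intro:bounded_bilinear_scaleR)
lemma smooth_on_power:
 fixes f :: "_ => real"
 shows "open S ==> smooth_on S f ==> smooth_on S (%x. f x^n)"
 by (induction n) (auto intro:smooth_on_mult smooth_on_const)

lemma Ck_on_real_deriv:
 fixes g :: "real => real"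
 assumes "open S" "!!x. x:S ==> (g has_real_derivative g' x) (at x)" "Ck_on k S g'"
 shows "Ck_on (Suc k) S g"
proof (rule Ck_on_SucI[OF assms(1)])
 show "(g has_derivative (%v. g' x * v)) (at x)" if "x:S" for x
  using assms(2)[OF that] by (simp add:has_field_derivative_def)
 show "Ck_on k S (%x. g' x * v)" for v
  using Ck_on_bilinear[OF assms(1) bounded_bilinear_mult assms(3) Ck_on_const] .
qed

lemma smooth_on_exp: "open S ==> smooth_on S (exp :: real => real)"
proof -
 assume S: "open S"
 have "Ck_on k S (exp :: real => real)" for k
 proof (induction k)
  case (Suc k)
  thus ?case by (intro Ck_on_real_deriv[OF S DERIV_exp])
 qed (simp add:continuous_on_exp)
 thus ?thesis by (simp add:smooth_on_def)
qed

lemma smooth_on_cos_sin: "open S ==> smooth_on S (cos :: real => real) & smooth_on S (sin :: real => real)"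
proof -
 assume S: "open S"
 have "Ck_on k S (cos :: real => real) & Ck_on k S (sin :: real => real)" for k
 proof (induction k)
  case (Suc k)
  have "Ck_on k S (%x::real. - sin x)"
   using Suc by (intro Ck_on_bounded_linear[OF S bounded_linear_uminus]) auto
  thus ?case
   using Suc by (intro conjI Ck_on_real_deriv[OF S DERIV_cos] Ck_on_real_deriv[OF S DERIV_sin]) auto
 qed (auto intro!:continuous_intros)
 thus ?thesis by (simp add:smooth_on_def)
qed

lemma smooth_on_inverse_real: "smooth_on (- {0}) (inverse :: real => real)"
proof -
 have "Ck_on k (- {0}) (inverse :: real => real)" for k
 proof (induction k)
  case (Suc k)
  have "Ck_on k (- {0}) (%x::real. (- inverse x)*inverse x)"
   by (rule Ck_on_bilinear[OF _ bounded_bilinear_mult Ck_on_bounded_linear[OF _ bounded_linear_uminus Suc] Suc]) auto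
  thus ?case
   using DERIV_inverse[of _ UNIV] by (intro Ck_on_real_deriv[where g' = "%x::real. (- inverse x)*inverse x"]) auto
 qed (auto intro!:continuous_intros)
 thus ?thesis by (simp add:smooth_on_def)
qed

lemma smooth_on_inverse:
 fixes f :: "'a::real_normed_vector => real"
 shows "open S ==> smooth_on S f ==> (!!x. x:S ==> f x~=0) ==> smooth_on S (%x. inverse (f x))"
 by (rule smooth_on_compose[OF smooth_on_inverse_real]) auto

lemma smooth_on_divide:
 fixes f g :: "'a::real_normed_vector => real"
 assumes "open S" "smooth_on S f" "smooth_on S g" "!!x. x:S ==> g x~=0"
 shows "smooth_on S (%x. f x/g x)"
 unfolding divide_inverse by (intro smooth_on_mult smooth_on_inverse assms)

lemma smooth_on_compose_real:
 fixes g :: "real => 'b::real_normed_vector"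
 shows "smooth_on UNIV g ==> open S ==> smooth_on S f ==> smooth_on S (%x. g (f x))"
 by (rule smooth_on_compose) auto

section \<open>Flat functions, cut-off functions and the smooth clamp\<close>

definition flat_exp :: "nat => real => real" where
 "flat_exp n x = (if x>0 then inverse x^n*exp (- inverse x) else 0)"

lemma flat_exp_tendsto: "(flat_exp n \<longlongrightarrow> 0) (at 0)"
proof -
 have "((%t::real. t^n/exp t) \<longlongrightarrow> 0) at_top"
  by (rule tendsto_power_div_exp_0)
 hence "((%x::real. inverse x^n/exp (inverse x)) \<longlongrightarrow> 0) (at_right 0)"
  by (rule filterlim_compose) (rule filterlim_inverse_at_top_right)
 hence "(flat_exp n \<longlongrightarrow> 0) (at_right 0)"
  by (rule Lim_transform_eventually) (auto simp:flat_exp_def eventually_at_filter exp_minus field_simps)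
 moreover have "(flat_exp n \<longlongrightarrow> 0) (at_left 0)"
  by (rule Lim_transform_eventually[OF tendsto_const]) (auto simp:flat_exp_def eventually_at_filter)
 ultimately show ?thesis using filterlim_split_at by blast
qed

text \<open>The index carries the power of \<open>inverse x\<close>, so that the family is closed
  under differentiation up to linear combinations and smoothness follows by induction for all
  \<open>n\<close> at once. At \<open>0\<close> the difference quotient of index \<open>n\<close> is
  the function of index \<open>n + 1\<close>, which tends to \<open>0\<close>.\<close>

lemma flat_exp_deriv: "(flat_exp n has_real_derivative (flat_exp (n + 2) x - real n * flat_exp (n + 1) x)) (at x)"
proof -
 consider "x>0" | "x<0" | "x = 0" by linarith
 thus ?thesis
 proof cases
  case 1
  have "((%x. inverse x^n*exp (- inverse x)) has_real_derivative
    (flat_exp (n + 2) x - real n * flat_exp (n + 1) x)) (at x)"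
   proof (cases n)
   case (Suc m)
   have "((%x. inverse x^Suc m*exp (- inverse x)) has_real_derivative
     real (Suc m)*inverse x^m*(- (inverse x^2))*exp (- inverse x)
     + exp (- inverse x)*(inverse x^2)*inverse x^Suc m) (at x)"
   proof -
    have i: "(inverse has_real_derivative - (inverse x^2)) (at x)"
     using DERIV_inverse[of x UNIV] 1 by (simp add:power2_eq_square)
    have "((%x. inverse x^Suc m) has_real_derivative real (Suc m)*inverse x^m*(- (inverse x^2))) (at x)"
     using DERIV_power[OF i, of "Suc m"] by (simp add:algebra_simps)
    moreover have "((%x. exp (- inverse x)) has_real_derivative exp (- inverse x)*(inverse x^2)) (at x)"
     using DERIV_chain2[OF DERIV_exp DERIV_minus[OF i]] by simp
    ultimately show ?thesis
     using DERIV_mult by blast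
   qed
   thus ?thesis using 1 Suc by (simp add:flat_exp_def algebra_simps power2_eq_square)
  qed (use 1 in "auto intro!:derivative_eq_intros simp:flat_exp_def power2_eq_square")
  thus ?thesis
   by (rule has_field_derivative_transform_within_open[of _ _ _ "{0<..}"]) (use 1 in "auto simp:flat_exp_def")
 next
  case 2
  have "((%x::real. 0) has_real_derivative (flat_exp (n + 2) x - real n * flat_exp (n + 1) x)) (at x)"
   using 2 by (auto simp:flat_exp_def)
  thus ?thesis
   by (rule has_field_derivative_transform_within_open[of _ _ _ "{..<0}"]) (use 2 in "auto simp:flat_exp_def")
 next
  case 3
  have "flat_exp n y/y = flat_exp (n + 1) y" if "y~=0" for y
   by (auto simp:flat_exp_def field_simps)
  hence "((%y. (flat_exp n (0 + y) - flat_exp n 0)/y) \<longlongrightarrow> 0) (at 0)"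
   using Lim_transform_eventually[OF flat_exp_tendsto[of "n+1"], of "%y. flat_exp n y/y"] by (auto simp:flat_exp_def[of n 0] eventually_at_filter)
  thus ?thesis using 3 by (simp add:DERIV_def flat_exp_def[of _ 0])
 qed
qed

lemma smooth_on_flat_exp: "smooth_on UNIV (flat_exp n)"
proof -
 have "Ck_on k UNIV (flat_exp n)" for k
 proof (induction k arbitrary: n)
  case 0
  thus ?case
   by (auto intro!:continuous_at_imp_continuous_on DERIV_isCont[OF flat_exp_deriv])
 next
  case (Suc k)
  have "Ck_on k UNIV (%x. flat_exp (n + 2) x + (- real n * flat_exp (n + 1) x))"
   by (rule Ck_on_add[OF open_UNIV Suc.IH Ck_on_bilinear[OF open_UNIV bounded_bilinear_mult Ck_on_const Suc.IH]])
  thus ?case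
   by (intro Ck_on_real_deriv[OF open_UNIV, where g' = "%x. flat_exp (n + 2) x - real n * flat_exp (n + 1) x"]) (use flat_exp_deriv in auto)
 qed
 thus ?thesis by (simp add:smooth_on_def)
qed

definition smooth_step :: "real => real" where
 "smooth_step x = flat_exp 0 x/(flat_exp 0 x + flat_exp 0 (1 - x))"

lemma flat_exp_pos: "x>0 ==> flat_exp 0 x>0" and flat_exp_nonneg: "flat_exp 0 x>=0"
 and flat_exp_nonpos: "x<=0 ==> flat_exp 0 x = 0"
 by (auto simp:flat_exp_def)

lemma flat_exp_denom: "flat_exp 0 x + flat_exp 0 (1 - x)>0"
 using flat_exp_pos[of x] flat_exp_pos[of "1 - x"] flat_exp_nonneg[of x] flat_exp_nonneg[of "1 - x"] by force

lemma smooth_step_0: "x<=0 ==> smooth_step x = 0"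
 by (simp add:smooth_step_def flat_exp_nonpos)

lemma smooth_step_1: "x>=1 ==> smooth_step x = 1"
 using flat_exp_pos[of x] by (simp add:smooth_step_def flat_exp_nonpos)

lemma smooth_step_range: "0<=smooth_step x" "smooth_step x<=1"
 using flat_exp_denom[of x] flat_exp_nonneg[of x] flat_exp_nonneg[of "1 - x"] by (auto simp:smooth_step_def)

lemma smooth_on_smooth_step: "smooth_on UNIV smooth_step"
proof -
 have "smooth_on UNIV (%x. flat_exp 0 (1 - x))"
  by (rule smooth_on_compose_real[OF smooth_on_flat_exp]) (auto intro!:smooth_on_diff[of _ "%x. 1" "%x. x"] smooth_on_const smooth_on_id)
 hence "smooth_on UNIV (%x. flat_exp 0 x/(flat_exp 0 x + flat_exp 0 (1 - x)))"
  by (intro smooth_on_divide smooth_on_add smooth_on_flat_exp) (use flat_exp_denom in "auto simp:less_imp_neq[symmetric]")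
 thus ?thesis by (simp add:smooth_step_def[abs_def])
qed

lemma mono_smooth_step: "x<=y ==> smooth_step x<=smooth_step y"
proof -
 assume xy: "x<=y"
 have m: "flat_exp 0 x<=flat_exp 0 y" if "x<=y" for x y
  using that by (auto simp:flat_exp_def)
 have "flat_exp 0 x * flat_exp 0 (1 - y)<=flat_exp 0 y * flat_exp 0 (1 - x)"
  using m[OF xy] m[of "1 - y" "1 - x"] xy by (intro mult_mono) (auto simp:flat_exp_nonneg)
 thus ?thesis
  using flat_exp_denom[of x] flat_exp_denom[of y] by (simp add:smooth_step_def field_simps)
qed

definition bump :: "real => real" where
 "bump x = smooth_step (2 - x) * smooth_step (2 + x)"

lemma smooth_on_bump: "smooth_on UNIV bump"
proof -
 have "smooth_on UNIV (%x. smooth_step (2 - x) * smooth_step (2 + x))"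
  by (intro smooth_on_mult smooth_on_compose_real[OF smooth_on_smooth_step] smooth_on_diff smooth_on_add smooth_on_const smooth_on_id) auto
 thus ?thesis by (simp add:bump_def[abs_def])
qed

lemma bump_1: "abs x<=1 ==> bump x = 1"
 by (simp add:bump_def smooth_step_1)

lemma bump_0: "abs x>=2 ==> bump x = 0"
 using smooth_step_0[of "2 - x"] smooth_step_0[of "2 + x"] by (cases "x>=0") (auto simp:bump_def)

lemma bump_range: "0<=bump x" "bump x<=1"
 using smooth_step_range by (auto simp:bump_def intro:mult_le_one)

text \<open>A smoothed version of \<open>max (-1) (min 1 x)\<close>, up to the value \<open>2\<close> of the plateaus.\<close>

definition clamp_fn :: "real => real" where
 "clamp_fn x = x*bump x + 2*(smooth_step x - smooth_step (- x))*(1 - bump x)"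

lemma smooth_on_clamp_fn: "smooth_on UNIV clamp_fn"
proof -
 have "smooth_on UNIV (%x. x*bump x + 2*(smooth_step x - smooth_step (- x))*(1 - bump x))"
  by (intro smooth_on_mult smooth_on_compose_real[OF smooth_on_smooth_step] smooth_on_diff smooth_on_add smooth_on_const smooth_on_id smooth_on_minus smooth_on_bump) auto
 thus ?thesis by (simp add:clamp_fn_def[abs_def])
qed

lemma clamp_fn_id: "abs x<=1 ==> clamp_fn x = x"
 by (simp add:clamp_fn_def bump_1)

lemma clamp_fn_ge: "x>=2 ==> clamp_fn x = 2"
 by (simp add:clamp_fn_def bump_0 smooth_step_0 smooth_step_1)

lemma clamp_fn_minus: "clamp_fn (- x) = - clamp_fn x"
 by (simp add:clamp_fn_def bump_def algebra_simps)

lemma clamp_fn_le: "x <= -2 ==> clamp_fn x = -2"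
 using clamp_fn_minus[of "-x"] clamp_fn_ge[of "-x"] by simp

text \<open>Oddness reduces this to nonnegative arguments. From \<open>1\<close> on the function is
  \<open>2 - (2 - x) * bump x\<close>, and on \<open>[1, 2]\<close> the product is one of two
  nonnegative decreasing factors.\<close>

lemma mono_clamp_fn: "x<=y ==> clamp_fn x<=clamp_fn y"
proof -
 have pos: "clamp_fn x<=clamp_fn y" if "0<=x" "x<=y" for x y
 proof -
  consider "y<=1" | "x>=1" | "x<1" "y>1" by linarith
  have ge1: "clamp_fn x = 2 - (2 - x)*bump x" if "x>=1" for x
   using that by (simp add:clamp_fn_def smooth_step_0 smooth_step_1 algebra_simps)
  have b: "(2 - y)*bump y<=(2 - x)*bump x" if "1<=x" "x<=y" "y<=2" for x y
  proof -
   have "bump y<=bump x"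
    using that mono_smooth_step[of "2 - y" "2 - x"] by (simp add:bump_def smooth_step_1)
   thus ?thesis using that bump_range by (intro mult_mono) auto
  qed
  have up: "clamp_fn x<=clamp_fn y" if "1<=x" "x<=y" for x y
  proof (cases "y<=2")
   case True
   thus ?thesis using b[OF that True] that by (simp add:ge1)
  next
   case False
   have "(2 - x)*bump x>=0"
    using bump_range(1)[of x] bump_0[of x] by force
   thus ?thesis using False that by (simp add:ge1[of x] clamp_fn_ge)
  qed
  consider "y<=1" | "x>=1" | "x<1" "y>1" by linarith
  thus ?thesis
  proof cases
   case 3
   thus ?thesis using up[of 1 y] that by (simp add:clamp_fn_id)
  qed (use that up in "auto simp:clamp_fn_id")
 qed
 have nn: "clamp_fn x>=0" if "x>=0" for x using pos[of 0 x] that clamp_fn_id[of 0] by simp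
 assume xy: "x<=y"
 consider "0<=x" | "y<=0" | "x<0" "0<y" by linarith
 thus ?thesis
 proof cases
  case 1 thus ?thesis using pos xy by blast
 next
  case 2 thus ?thesis using pos[of "-y" "-x"] xy by (simp add:clamp_fn_minus)
 next
  case 3 thus ?thesis using nn[of y] nn[of "-x"] by (simp add:clamp_fn_minus)
 qed
qed

section \<open>Manifolds as quotients by pseudogroups\<close>

definition quot_top :: "'e::topological_space set => ('e => 'a) => 'a topology" where
 "quot_top Y q = topology (%V. V<=q ` Y & open (Y Int q -` V))"

text \<open>\<open>pseudo\<close> stands in for a group action: two points of a fibre are related by
  a smooth local map over the quotient, defined near the first point. \<open>L\<close> and
  \<open>L'\<close> only transfer charts to \<open>real^3\<close>.\<close>

locale local_quotient =
 fixes Y :: "'e::euclidean_space set" and q :: "'e => 'a"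
  and L :: "'e => real^3" and L' :: "real^3 => 'e"
 assumes Y_open: "open Y"
  and lin: "linear L" "linear L'"
  and L'_L [simp]: "L' (L e) = e" and L_L' [simp]: "L (L' x) = x"
  and pseudo: "!!a b. a:Y ==> b:Y ==> q a = q b ==>
   EX U th0. open U & a:U & U<=Y & smooth_on U th0 & th0 a = b & th0 ` U<=Y & (ALL u:U. q (th0 u) = q u)"
  and loc_inj: "!!a. a:Y ==> EX U. open U & a:U & U<=Y & inj_on q U"
begin

abbreviation "M == quot_top Y q"

lemma openin_M: "openin M V <-> V<=q ` Y & open (Y Int q -` V)"
proof -
 have "istopology (%V. V<=q ` Y & open (Y Int q -` V))"
  unfolding istopology_def
 proof (intro conjI allI impI)
  fix S T assume "S<=q ` Y & open (Y Int q -` S)" "T<=q ` Y & open (Y Int q -` T)"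
  thus "S Int T<=q ` Y" "open (Y Int q -` (S Int T))"
   using open_Int[of "Y Int q -` S" "Y Int q -` T"] by (auto simp:Int_assoc Int_left_commute)
 next
  fix K assume K: "ALL V:K. V<=q ` Y & open (Y Int q -` V)"
  thus "\<Union>K<=q ` Y" by blast
  have "Y Int q -` \<Union>K = (UN V:K. Y Int q -` V)" by auto
  moreover have "open (UN V:K. Y Int q -` V)" using K by blast
  ultimately show "open (Y Int q -` \<Union>K)" by simp
 qed
 thus ?thesis by (simp add:quot_top_def)
qed

lemma topspace_M [simp]: "topspace M = q ` Y"
proof
 show "topspace M<=q ` Y" using openin_M by blast
 have "Y Int q -` q ` Y = Y" by auto
 hence "openin M (q ` Y)" using Y_open by (simp add:openin_M)
 thus "q ` Y<=topspace M" by (rule openin_subset)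
qed

lemma sat_open:
 assumes "open U" "U<=Y" shows "open (Y Int q -` (q ` U))"
proof (subst open_subopen, safe)
 fix b u assume b: "b:Y" "q b = q u" "u:U"
 obtain N th0 where N: "open N" "b:N" "N<=Y" "smooth_on N th0" "th0 b = u" "ALL w:N. q (th0 w) = q w"
  using pseudo[of b u] b assms by blast
 have "open (N Int th0 -` U)"
  using N assms smooth_on_continuous continuous_open_preimage by blast
 thus "EX T. open T & b:T & T<=Y Int q -` q ` U"
  using N b by (intro exI[of _ "N Int th0 -` U"]) (auto, metis image_eqI)
qed

lemma open_q: "open U ==> U<=Y ==> openin M (q ` U)"
 unfolding openin_M using sat_open by blast

lemma continuous_q: "continuous_map (top_of_set Y) M q"
proof -
 have "{x:Y. q x:U} = Y Int q -` U" for U by auto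
 thus ?thesis
  unfolding continuous_map using Y_open by (simp add:openin_M openin_open_eq)
qed

definition sheets :: "'e set set" where
 "sheets = {U. open U & U<=Y & inj_on q U}"

definition qchart :: "'e set => 'a chart" where
 "qchart U = (q ` U,%p. L (inv_into U q p))"

definition "qatlas = qchart ` sheets"

lemma sheet_at: "a:Y ==> EX U:sheets. a:U"
 using loc_inj unfolding sheets_def by blast

lemma open_L: "open U ==> open (L ` U)"
proof -
 assume "open U"
 have "L ` U = L' -` U" by (auto simp:image_iff) (metis L_L')
 thus ?thesis
  using `open U` lin(2) by (simp add:continuous_open_vimage linear_continuous_at linear_conv_bounded_linear)
qed

lemma open_L_vimage: "open W ==> open (L -` W)"
 using lin(1) by (simp add:continuous_open_vimage linear_continuous_at linear_conv_bounded_linear)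

lemma qchart_image: "U:sheets ==> snd (qchart U) ` fst (qchart U) = L ` U"
 by (auto simp:qchart_def sheets_def image_image)

lemma qchart_inv: "U:sheets ==> u:U ==> chart_inv (qchart U) (L u) = q u"
proof -
 assume U: "U:sheets" "u:U"
 have "inj_on (snd (qchart U)) (fst (qchart U))"
  by (rule inj_onI) (auto simp:qchart_def, metis L'_L f_inv_into_f image_eqI)
 moreover have "snd (qchart U) (q u) = L u" using U by (simp add:qchart_def sheets_def)
 moreover have "q u:fst (qchart U)" using U by (simp add:qchart_def)
 ultimately show ?thesis unfolding chart_inv_def by (metis inv_into_f_f)
qed

lemma is_chart_qchart:
 assumes U: "U:sheets" shows "is_chart M (qchart U)"
proof -
 have Up: "open U" "U<=Y" "inj_on q U" using U by (auto simp:sheets_def)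
 have top: "topspace (subtopology M (q ` U)) = q ` U" using Up by auto
 have "homeomorphic_maps (subtopology M (q ` U)) (top_of_set (L ` U)) (snd (qchart U)) (q o L')"
  unfolding homeomorphic_maps_def
 proof (intro conjI)
  show "continuous_map (subtopology M (q ` U)) (top_of_set (L ` U)) (snd (qchart U))"
   unfolding continuous_map top
  proof (intro conjI allI impI)
   show "snd (qchart U) ` q ` U<=topspace (top_of_set (L ` U))"
    using qchart_image[OF U] by (simp add:qchart_def)
   fix W assume "openin (top_of_set (L ` U)) W"
   hence "open W" "W<=L ` U" using open_L[OF Up(1)] by (auto simp:openin_open_eq)
   have "{p:q ` U. snd (qchart U) p:W} = q ` (U Int L -` W)"
    using Up by (auto simp:qchart_def)
   moreover have "openin M (q ` (U Int L -` W))"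
    using open_L_vimage[OF `open W`] Up by (intro open_q) auto
   ultimately show "openin (subtopology M (q ` U)) {p:q ` U. snd (qchart U) p:W}"
    by (auto simp:openin_subtopology)
  qed
  have "continuous_on (L ` U) L'"
   using lin(2) linear_continuous_on linear_conv_bounded_linear by blast
  hence "continuous_map (top_of_set (L ` U)) (top_of_set Y) L'"
   using Up by auto
  hence "continuous_map (top_of_set (L ` U)) M (q o L')"
   using continuous_q continuous_map_compose by blast
  thus "continuous_map (top_of_set (L ` U)) (subtopology M (q ` U)) (q o L')"
   by (auto simp:continuous_map_in_subtopology)
  show "ALL x:topspace (subtopology M (q ` U)). (q o L') (snd (qchart U) x) = x"
   using Up by (auto simp:qchart_def)
  show "ALL y:topspace (top_of_set (L ` U)). snd (qchart U) ((q o L') y) = y"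
   using Up by (auto simp:qchart_def)
 qed
 hence "homeomorphic_map (subtopology M (q ` U)) (top_of_set (L ` U)) (snd (qchart U))"
  by (rule homeomorphic_maps_imp_map)
 thus ?thesis
  unfolding is_chart_def qchart_image[OF U] using open_q open_L Up by (simp add:qchart_def)
qed

lemma smooth_on_L: "open S ==> smooth_on S f ==> smooth_on S (%x. L (f x))"
 using lin(1) smooth_on_bounded_linear linear_conv_bounded_linear by blast

lemma smooth_on_L': "open S ==> smooth_on S f ==> smooth_on S (%x. L' (f x))"
 using lin(2) smooth_on_bounded_linear linear_conv_bounded_linear by blast

text \<open>Locally the inverse of \<open>q\<close> on another sheet, composed with
  \<open>q\<close>, is one of the maps supplied by \<open>pseudo\<close>; this is the source of all
  smoothness statements about charts.\<close>

lemma inv_sheet_smooth: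
 assumes V: "V:sheets" and a: "a:Y" "q a:q ` V"
 shows "EX N th0. open N & a:N & N<=Y & smooth_on N th0 & th0 ` N<=V &
   (ALL u:N. q (th0 u) = q u & inv_into V q (q u) = th0 u)"
proof -
 have Vp: "open V" "V<=Y" "inj_on q V" using V by (auto simp:sheets_def)
 obtain v where v: "v:V" "q v = q a" using a by auto
 obtain N th0 where N: "open N" "a:N" "N<=Y" "smooth_on N th0" "th0 a = v" "ALL w:N. q (th0 w) = q w"
  using pseudo[of a v] v a Vp by force
 let ?N = "N Int th0 -` V"
 have "open ?N" using N Vp smooth_on_continuous continuous_open_preimage by blast
 moreover have "inv_into V q (q u) = th0 u" if "u:?N" for u
  using that N(6) Vp(3) by (metis IntD1 IntD2 inv_into_f_f vimageD)
 ultimately show ?thesis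
  using N v smooth_on_subset[OF N(4)] by (intro exI[of _ ?N] exI[of _ th0]) auto
qed

lemma smooth_chart_q:
 assumes V: "V:sheets"
 shows "smooth_on (Y Int q -` (q ` V)) (%e. snd (qchart V) (q e))"
proof (rule smooth_on_local)
 fix a assume "a:Y Int q -` (q ` V)"
 then obtain N th0 where N: "open N" "a:N" "smooth_on N th0" "ALL u:N. inv_into V q (q u) = th0 u"
  using inv_sheet_smooth[OF V, of a] by blast
 have "smooth_on N (%e. snd (qchart V) (q e))"
  by (subst smooth_on_cong[OF N(1), of _ "%u. L (th0 u)"]) (use N smooth_on_L in "auto simp:qchart_def")
 thus "EX U. open U & a:U & smooth_on U (%e. snd (qchart V) (q e))" using N by blast
qed

lemma smooth_atlas_qatlas: "smooth_atlas M qatlas"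
 unfolding smooth_atlas_def
proof (intro conjI ballI)
 show "is_chart M c" if "c:qatlas" for c using that is_chart_qchart by (auto simp:qatlas_def)
 show "(UN c:qatlas. fst c) = topspace M"
  using sheet_at by (fastforce simp:qatlas_def qchart_def sheets_def)
 fix c d assume "c:qatlas" "d:qatlas"
 then obtain U V where UV: "U:sheets" "V:sheets" "c = qchart U" "d = qchart V" by (auto simp:qatlas_def)
 have Up: "open U" "U<=Y" "inj_on q U" using UV by (auto simp:sheets_def)
 let ?W = "U Int (Y Int q -` (q ` V))"
 have "fst c Int fst d = q ` ?W" using Up UV(3,4) by (auto simp:qchart_def)
 hence "snd c ` (fst c Int fst d) = (%u. snd c (q u)) ` ?W" by auto
 also have "... = L ` ?W" using Up UV(3) by (intro image_cong) (auto simp:qchart_def)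
 finally have W: "snd c ` (fst c Int fst d) = L ` ?W" .
 have "open ?W" using Up sat_open[of V] UV(2) by (auto simp:sheets_def)
 have oW: "open (L ` ?W)" using open_L `open ?W` by blast
 have "smooth_on ?W (%e. snd (qchart V) (q e))"
  by (rule smooth_on_subset[OF smooth_chart_q[OF UV(2)]]) blast
 moreover have "smooth_on (L ` ?W) L'"
  by (rule smooth_on_L'[OF oW smooth_on_id[OF oW]])
 ultimately have 1: "smooth_on (L ` ?W) (%x. snd (qchart V) (q (L' x)))"
  by (rule smooth_on_compose[OF _ _ oW `open ?W`]) (erule imageE, simp only:L'_L)
 have 2: "snd d (chart_inv c x) = snd (qchart V) (q (L' x))" if "x:L ` ?W" for x
  using that qchart_inv[OF UV(1)] UV(3,4) by auto
 show "smooth_on (snd c ` (fst c Int fst d)) (%x. snd d (chart_inv c x))"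
  unfolding W by (rule iffD2[OF smooth_on_cong[OF oW 2] 1])
qed

lemma second_countable_M: "second_countable M"
proof -
 have "second_countable (euclidean :: 'e topology)"
 proof -
  obtain B :: "'e set set" where B: "countable B" "!!C. C:B ==> open C"
   "!!S. open S ==> EX U. U<=B & S = \<Union>U" using univ_second_countable by blast
  thus ?thesis unfolding second_countable_def
  proof (intro exI[of _ B] conjI allI impI ballI)
   fix W x assume "openin (euclidean :: 'e topology) W & x:W"
   then obtain U where "U<=B" "W = \<Union>U" "x:W" using B(3)[of W] by auto
   thus "EX V:B. x:V & V<=W" by blast
  qed (use B in auto)
 qed
 hence "second_countable (top_of_set Y)" by (rule second_countable_subtopology)
 moreover have "open_map (top_of_set Y) M q"
  unfolding open_map_def using Y_open open_q by (auto simp:openin_open_eq)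
 ultimately show ?thesis
  using second_countable_open_map_image[OF continuous_q] by simp
qed

text \<open>Since \<open>q\<close> is open, a failure of separation yields equivalent points in
  shrinking balls around \<open>a\<close> and \<open>b\<close>. So it suffices that the equivalence
  is sequentially closed.\<close>

lemma Hausdorff_M:
 assumes seq: "!!a b A B. a:Y ==> b:Y ==> (!!n. A n:Y) ==> (!!n. B n:Y) ==>
   A ----> a ==> B ----> b ==> (!!n::nat. q (A n) = q (B n)) ==> q a = q b"
 shows "Hausdorff_space M"
 unfolding Hausdorff_space_def topspace_M
proof (intro allI impI, elim conjE imageE)
 fix x y a b assume xy: "x~=y" "x = q a" "y = q b" "a:Y" "b:Y"
 let ?Bn = "%a n. ball a (inverse (real (Suc n))) Int Y"
 have "EX n. disjnt (q ` ?Bn a n) (q ` ?Bn b n)"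
 proof (rule ccontr)
  assume "~ ?thesis"
  hence "ALL n. EX u w. u:?Bn a n & w:?Bn b n & q u = q w" by (force simp:disjnt_def)
  then obtain A B where AB: "!!n. A n:?Bn a n" "!!n. B n:?Bn b n" "!!n. q (A n) = q (B n)" by metis
  have lim: "S ----> c" if "!!n. S n:?Bn c n" for S :: "nat => 'e" and c
  proof (rule LIMSEQ_I)
   fix r :: real assume "0<r"
   obtain N where N: "inverse (real (Suc N))<r" using reals_Archimedean[OF `0<r`] by auto
   have "norm (S n - c)<r" if "n>=N" for n
   proof -
    have "inverse (real (Suc n))<=inverse (real (Suc N))" using `n>=N` by simp
    moreover have "dist c (S n)<inverse (real (Suc n))" using `!!n. S n:?Bn c n`[of n] by simp
    ultimately show ?thesis using N by (metis dist_commute dist_norm less_trans order_less_le_trans)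
   qed
   thus "EX no. ALL n>=no. norm (S n - c)<r" by blast
  qed
  have "q a = q b" by (rule seq[of a b A B]) (use AB xy lim in auto)
  thus False using xy by simp
 qed
 then obtain n where n: "disjnt (q ` ?Bn a n) (q ` ?Bn b n)" by blast
 show "EX U V. openin M U & openin M V & x:U & y:V & disjnt U V"
  using n xy Y_open by (intro exI[of _ "q ` ?Bn a n"] exI[of _ "q ` ?Bn b n"]) (auto intro!:open_q)
qed

lemma compact_M: "compact K ==> K<=Y ==> q ` K = q ` Y ==> compact_space M"
 unfolding compact_space_def using image_compactin[OF _ continuous_q, of K] by (simp add:compactin_subtopology)

end

section \<open>Riemannian metrics\<close>

lemma frechet_derivative_cong_open:
 assumes "open S" "x:S" "!!y. y:S ==> f y = g y" "(g has_derivative g') (at x)"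
 shows "(f has_derivative g') (at x)" "FD f (at x) = g'"
proof -
 show *: "(f has_derivative g') (at x)"
  by (rule has_derivative_transform_within_open[OF assms(4,1,2)]) (simp add:assms(3))
 show "FD f (at x) = g'" using frechet_derivative_at[OF *] by simp
qed

locale smooth_manifold =
 fixes X :: "'a topology" and A :: "'a chart set"
 assumes atlas: "smooth_atlas X A"
begin

lemma chart: "c:A ==> is_chart X c"
 using atlas by (auto simp:smooth_atlas_def)

lemma chart_inj: "c:A ==> inj_on (snd c) (fst c)"
proof -
 assume "c:A"
 hence "openin X (fst c)" "homeomorphic_map (subtopology X (fst c)) (top_of_set (snd c ` fst c)) (snd c)"
  using chart by (auto simp:is_chart_def)
 thus ?thesis
  by (metis homeomorphic_imp_injective_map topspace_subtopology_subset openin_subset)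
qed

lemma chart_inv_left: "c:A ==> p:fst c ==> chart_inv c (snd c p) = p"
 using chart_inj by (simp add:chart_inv_def)

lemma chart_inv_in: "c:A ==> x:snd c ` fst c ==> chart_inv c x:fst c & snd c (chart_inv c x) = x"
 by (simp add:chart_inv_def inv_into_into f_inv_into_f)

lemma chart_open: "c:A ==> openin X (fst c)" "c:A ==> open (snd c ` fst c)"
 using chart by (auto simp:is_chart_def)

lemma chart_image_open:
 assumes "c:A" "openin X W" "W<=fst c" shows "open (snd c ` W)"
proof -
 have "homeomorphic_map (subtopology X (fst c)) (top_of_set (snd c ` fst c)) (snd c)"
  using assms chart by (auto simp:is_chart_def)
 hence "open_map (subtopology X (fst c)) (top_of_set (snd c ` fst c)) (snd c)"
  by (rule homeomorphic_imp_open_map)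
 hence "openin (top_of_set (snd c ` fst c)) (snd c ` W)"
  using assms unfolding open_map_def by (metis openin_open_subtopology chart_open(1))
 thus ?thesis using chart_open(2)[OF assms(1)] by (auto simp:openin_open_eq)
qed

lemma chart_preimage_open:
 assumes "c:A" "open W" shows "openin X {p:fst c. snd c p:W}"
proof -
 have "homeomorphic_map (subtopology X (fst c)) (top_of_set (snd c ` fst c)) (snd c)"
  using assms chart by (auto simp:is_chart_def)
 hence "continuous_map (subtopology X (fst c)) euclidean (snd c)"
  by (metis homeomorphic_imp_continuous_map continuous_map_in_subtopology)
 hence "openin (subtopology X (fst c)) {p:topspace (subtopology X (fst c)). snd c p:W}"
  using assms(2) by (intro openin_continuous_map_preimage) auto
 moreover have "topspace (subtopology X (fst c)) = fst c"
  using openin_subset[OF chart_open(1)[OF assms(1)]] by auto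
 ultimately have "openin (subtopology X (fst c)) {p:fst c. snd c p:W}" by (simp only:)
 thus ?thesis
  by (simp only:openin_open_subtopology[OF chart_open(1)[OF assms(1)]])
qed

definition trans :: "'a chart => 'a chart => real^3 => real^3" where
 "trans c d x = snd d (chart_inv c x)"

lemma overlap_open: "c:A ==> d:A ==> open (snd c ` (fst c Int fst d))"
 by (intro chart_image_open openin_Int chart_open) auto

lemma trans_smooth: "c:A ==> d:A ==> smooth_on (snd c ` (fst c Int fst d)) (trans c d)"
 using atlas by (auto simp:smooth_atlas_def trans_def[abs_def])

lemma deriv_in_id: "deriv_in c d (%q. q) p = FD (trans c d) (at (snd c p))"
 by (simp add:deriv_in_def trans_def[abs_def])

lemma trans_deriv:
 "c:A ==> d:A ==> p:fst c Int fst d ==>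
  (trans c d has_derivative deriv_in c d (%q. q) p) (at (snd c p))"
 unfolding deriv_in_id using smooth_on_has_derivative[OF trans_smooth] by blast

lemma deriv_in_id_linear:
 "c:A ==> d:A ==> p:fst c Int fst d ==> linear (deriv_in c d (%q. q) p)"
 using trans_deriv has_derivative_linear by blast

lemma deriv_in_refl:
 assumes "c:A" "p:fst c" shows "deriv_in c c (%q. q) p = (%v. v)"
 unfolding deriv_in_id by (rule frechet_derivative_cong_open(2)[OF chart_open(2)[OF assms(1)], of _ _ "%x. x"]) (use assms in "auto simp:trans_def chart_inv_left")

lemma deriv_in_comp:
 assumes "c:A" "d:A" "e:A" "p:fst c" "p:fst d" "p:fst e"
 shows "deriv_in c e (%q. q) p v = deriv_in d e (%q. q) p (deriv_in c d (%q. q) p v)"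
proof -
 let ?S = "snd c ` (fst c Int fst d Int fst e)"
 have S: "open ?S" by (intro chart_image_open assms openin_Int chart_open) auto
 have cd: "trans c d (snd c p) = snd d p" using assms by (simp add:trans_def chart_inv_left)
 have "((%x. trans d e (trans c d x)) has_derivative
   (%v. deriv_in d e (%q. q) p (deriv_in c d (%q. q) p v))) (at (snd c p))"
  using diff_chain_at[OF trans_deriv[of c d p], of "trans d e" "deriv_in d e (%q. q) p"] trans_deriv[of d e p] assms by (simp add:cd o_def)
 hence "FD (trans c e) (at (snd c p)) =
   (%v. deriv_in d e (%q. q) p (deriv_in c d (%q. q) p v))"
  by (rule frechet_derivative_cong_open(2)[OF S, rotated 2]) (use assms in "auto simp:trans_def chart_inv_left")
 thus ?thesis by (simp add:deriv_in_id)
qed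

lemma deriv_in_inj:
 assumes "c:A" "d:A" "p:fst c" "p:fst d" "deriv_in c d (%q. q) p v = 0"
 shows "v = 0"
 using deriv_in_comp[of c d c p v] assms deriv_in_refl[of c p] linear_0[OF deriv_in_id_linear[of d c p]] by simp

text \<open>A finite sum of Euclidean metrics pulled back from charts, each multiplied by a cut-off
  function. It is positive definite because at every point some cut-off equals
  \<open>1\<close>.\<close>

lemma riemannian_metric_exists:
 assumes comp: "compact_space X" and haus: "Hausdorff_space X"
 shows "EX g. riemannian_metric A g"
proof -
 have "EX c r. c:A & m:fst c & r>0 & cball (snd c m) r<=snd c ` fst c" if "m:topspace X" for m
 proof -
  have "m:(UN c:A. fst c)" using atlas that by (simp add:smooth_atlas_def)
  then obtain c where c: "c:A" "m:fst c" by blast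
  thus ?thesis using chart_open(2)[OF c(1)] open_contains_cball by blast
 qed
 then obtain ch rd where ch: "!!m. m:topspace X ==> ch m:A" "!!m. m:topspace X ==> m:fst (ch m)"
  "!!m. m:topspace X ==> rd m>0"
  "!!m. m:topspace X ==> cball (snd (ch m) m) (rd m)<=snd (ch m) ` fst (ch m)" by metis
 define W where "W m = {p:fst (ch m). snd (ch m) p:ball (snd (ch m) m) (rd m/2)}" for m
 have Wopen: "openin X (W m)" if "m:topspace X" for m
  unfolding W_def using ch[OF that] by (intro chart_preimage_open) auto
 have "m:W m" if "m:topspace X" for m using ch[OF that] by (simp add:W_def)
 hence "topspace X <= \<Union>(W ` topspace X)" by blast
 hence "EX F. finite F & F<=W ` topspace X & topspace X <= \<Union>F"
  using comp Wopen unfolding compact_space_def compactin_def by auto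
 then obtain F where F: "finite F" "F<=topspace X" "topspace X<=(UN m:F. W m)"
  by (metis finite_subset_image)
 \<comment> \<open>The factor \<open>2\<close> fits \<open>bump\<close>: the value is
   \<open>1\<close> on the ball of half the radius, which defines the cover \<open>W\<close>, and
   \<open>0\<close> outside the ball of radius \<open>rd m\<close>, which lies inside the
   chart.\<close>
 define b where "b m x = bump (2*(norm (x - snd (ch m) m)^2/rd m^2))" for m and x :: "real^3"
 have b0: "b m x = 0" if "m:topspace X" "x~:cball (snd (ch m) m) (rd m)" for m x
 proof -
  have "rd m<norm (x - snd (ch m) m)" using that(2) by (simp add:dist_norm norm_minus_commute)
  hence "rd m^2<=norm (x - snd (ch m) m)^2"
   using ch(3)[OF that(1)] by simp
  thus ?thesis unfolding b_def using ch(3)[OF that(1)] by (intro bump_0) (auto simp:field_simps)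
 qed
 have bsm: "smooth_on UNIV (b m)" for m
 proof -
  have "smooth_on UNIV (%x. bump (2*((x - snd (ch m) m) \<bullet> (x - snd (ch m) m)*(1/rd m^2))))"
   by (rule smooth_on_compose_real[OF smooth_on_bump open_UNIV], rule smooth_on_mult[OF open_UNIV smooth_on_const], rule smooth_on_mult[OF open_UNIV _ smooth_on_const], rule smooth_on_bilinear[OF open_UNIV bounded_bilinear_inner]) (auto intro!:smooth_on_diff smooth_on_id smooth_on_const)
  thus ?thesis by (simp add:b_def[abs_def] power2_norm_eq_inner)
 qed
 define tm where "tm m c p u v =
   (if p:fst (ch m) then b m (snd (ch m) p) *
    (deriv_in c (ch m) (%q. q) p u \<bullet> deriv_in c (ch m) (%q. q) p v) else 0)" for m c p u v
 define g where "g c p u v = (\<Sum>m\<in>F. tm m c p u v)" for c p u v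
 have tm_sm: "smooth_on (snd c ` fst c) (%x. tm m c (chart_inv c x) u v)" if m: "m:F" and c: "c:A" for m c u v
 proof (rule smooth_on_local)
  fix x assume x: "x:snd c ` fst c"
  have m': "m:topspace X" using m F by auto
  note chm = ch[OF m']
  show "EX U. open U & x:U & smooth_on U (%x. tm m c (chart_inv c x) u v)"
  proof (cases "chart_inv c x:fst (ch m)")
   case True
   let ?U = "snd c ` (fst c Int fst (ch m))"
   have U: "open ?U" using overlap_open c chm by blast
   have "x:?U" using True chart_inv_in[OF c x] by force
   have "smooth_on ?U (%x. b m (trans c (ch m) x) *
     (FD (trans c (ch m)) (at x) u \<bullet> FD (trans c (ch m)) (at x) v))"
   proof (rule smooth_on_mult[OF U])
    show "smooth_on ?U (%x. b m (trans c (ch m) x))"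
     by (rule smooth_on_compose[OF bsm trans_smooth[OF c chm(1)] U]) auto
    show "smooth_on ?U (%x. FD (trans c (ch m)) (at x) u \<bullet> FD (trans c (ch m)) (at x) v)"
     by (rule smooth_on_bilinear[OF U bounded_bilinear_inner smooth_on_frechet smooth_on_frechet]; rule trans_smooth[OF c chm(1)])
   qed
   hence "smooth_on ?U (%x. tm m c (chart_inv c x) u v)"
    by (rule iffD2[OF smooth_on_cong[OF U], rotated]) (auto simp:tm_def deriv_in_id trans_def chart_inv_left c)
   thus ?thesis using U `x:?U` by blast
  next
   case False
   let ?K = "chart_inv (ch m) ` cball (snd (ch m) m) (rd m)"
   have "homeomorphic_map (subtopology X (fst (ch m))) (top_of_set (snd (ch m) ` fst (ch m))) (snd (ch m))"
    using chart chm by (auto simp:is_chart_def)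
   then obtain k where k: "homeomorphic_maps (subtopology X (fst (ch m))) (top_of_set (snd (ch m) ` fst (ch m))) (snd (ch m)) k"
    using homeomorphic_map_maps by blast
   have "k y = chart_inv (ch m) y" if y: "y:snd (ch m) ` fst (ch m)" for y
   proof -
    have "k y:fst (ch m)" "snd (ch m) (k y) = y"
     using k y unfolding homeomorphic_maps_def continuous_map_def by auto
    thus ?thesis using chart_inv_left chm(1) by metis
   qed
   hence "k ` cball (snd (ch m) m) (rd m) = ?K" using chm(4) by (intro image_cong) auto
   moreover have "continuous_map (top_of_set (snd (ch m) ` fst (ch m))) X k"
    using k by (auto simp:homeomorphic_maps_def continuous_map_in_subtopology)
   ultimately have "compactin X ?K"
    using image_compactin[of "top_of_set (snd (ch m) ` fst (ch m))" "cball (snd (ch m) m) (rd m)" X k] chm(4) by (simp add:compactin_subtopology)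
   \<comment> \<open>In a Hausdorff space the compact support is closed in all of \<open>X\<close>,
     so the extension by zero is smooth also at points outside the chart of
     \<open>m\<close>.\<close>
   hence cl: "closedin X ?K" using haus compactin_imp_closedin by blast
   let ?N = "fst c - ?K"
   have N: "openin X ?N" using chart_open(1)[OF c] cl by auto
   have "?K<=fst (ch m)" using chm chart_inv_in by blast
   hence xN: "x:snd c ` ?N" using False chart_inv_in[OF c x] by (metis DiffI image_eqI subsetD)
   have "tm m c p u v = 0" if "p:?N" for p
   proof (cases "p:fst (ch m)")
    case True
    hence "snd (ch m) p~:cball (snd (ch m) m) (rd m)"
     using that chart_inv_left[OF chm(1) True] by force
    thus ?thesis using b0[OF m'] by (simp add:tm_def)
   qed (simp add:tm_def)
   hence "smooth_on (snd c ` ?N) (%x. tm m c (chart_inv c x) u v)"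
    by (intro iffD2[OF smooth_on_cong[of _ _ "%x. 0"] smooth_on_const] chart_image_open[OF c N]) (auto simp:chart_inv_left c)
   thus ?thesis using xN chart_image_open[OF c N] by blast
  qed
 qed
 have lin: "linear (deriv_in c (ch m) (%q. q) p)" if "m:F" "c:A" "p:fst c" "p:fst (ch m)" for m c p
  using that F ch deriv_in_id_linear by blast
 have bil: "bilinear (tm m c p)" if "m:F" "c:A" "p:fst c" for m c p
  using lin[OF that] unfolding bilinear_def tm_def by (auto intro!:linearI simp:linear_add linear_scale algebra_simps)
 have "riemannian_metric A g"
  unfolding riemannian_metric_def
 proof (intro conjI ballI allI impI)
  fix c p assume c: "c:A" and p: "p:fst c"
  show "bilinear (g c p)"
   using bil[OF _ c p] unfolding bilinear_def g_def by (auto intro!:linear_compose_sum)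
  show "g c p u v = g c p v u" for u v
   unfolding g_def tm_def by (intro sum.cong) (auto simp:inner_commute)
  fix v :: "real^3" assume v: "v~=0"
  have nn: "tm m c p v v>=0" for m unfolding tm_def b_def using bump_range by auto
  have "p:topspace X" using c p chart_open(1) openin_subset by blast
  then obtain m where m: "m:F" "p:W m" using F by blast
  hence m': "m:topspace X" "p:fst (ch m)" using F by (auto simp:W_def)
  have "norm (snd (ch m) p - snd (ch m) m)<=rd m/2"
   using m(2) by (simp add:W_def dist_norm norm_minus_commute)
  hence "norm (snd (ch m) p - snd (ch m) m)^2<=(rd m/2)^2" by (intro power_mono) auto
  hence "norm (snd (ch m) p - snd (ch m) m)^2<=rd m^2/4"
   by (simp add:power_divide)
  hence "norm (snd (ch m) p - snd (ch m) m)^2*2<=rd m^2"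
   using zero_le_power2[of "norm (snd (ch m) p - snd (ch m) m)"] by linarith
  hence "b m (snd (ch m) p) = 1"
   unfolding b_def using ch(3)[OF m'(1)] by (intro bump_1) simp
  moreover have "deriv_in c (ch m) (%q. q) p v~=0"
   using deriv_in_inj c p m' ch v by blast
  ultimately have "tm m c p v v>0" using m'(2) by (simp add:tm_def)
  thus "0<g c p v v"
   unfolding g_def using m(1) F(1) nn by (meson sum_pos2)
 next
  fix c d p u v assume cd: "c:A" "d:A" "p:fst c Int fst d"
  show "g d p (deriv_in c d (%q. q) p u) (deriv_in c d (%q. q) p v) = g c p u v"
   unfolding g_def
  proof (rule sum.cong)
   fix m assume "m:F"
   hence "ch m:A" using F ch by auto
   thus "tm m d p (deriv_in c d (%q. q) p u) (deriv_in c d (%q. q) p v) = tm m c p u v"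
    using cd deriv_in_comp[of c d "ch m" p] by (simp add:tm_def)
  qed simp
 next
  fix c u v assume "c:A"
  thus "smooth_on (snd c ` fst c) (%x. g c (chart_inv c x) u v)"
   unfolding g_def using tm_sm chart_open(2) by (intro smooth_on_sum)
 qed
 thus ?thesis by blast
qed

end

section \<open>Anosov flows described on a covering\<close>

definition deck :: "'e::euclidean_space set => ('e => 'a) => 'e set => ('e => 'e) => 'e => 'e => bool" where
 "deck Y q U th0 a b <-> open U & a:U & U<=Y & smooth_on U th0 & th0 a = b & th0 ` U<=Y & (ALL u:U. q (th0 u) = q u)"

text \<open>\<open>sect\<close> gives smooth local sections of \<open>q\<close> through any
  prescribed point of a fibre. \<open>K\<close> is a compact set meeting every fibre; uniform
  estimates are made on it.\<close>

locale smooth_cover =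
 fixes X :: "'a topology" and A :: "'a chart set"
  and Y :: "'e::euclidean_space set" and q :: "'e => 'a" and K :: "'e set"
 assumes mfd: "closed_3_manifold X A"
  and Y_open: "open Y" and q_onto: "q ` Y = topspace X"
  and K: "compact K" "K<=Y" "q ` K = q ` Y"
  and cont_q: "continuous_map (top_of_set Y) X q"
  and open_q: "!!U. open U ==> U<=Y ==> openin X (q ` U)"
  and loc_inj: "!!a. a:Y ==> EX U. open U & a:U & U<=Y & inj_on q U"
  and smooth_h: "!!c. c:A ==> smooth_on (Y Int q -` fst c) (%e. snd c (q e))"
  and sect: "!!c a. c:A ==> a:Y ==> q a:fst c ==>
   EX W rh. open W & snd c (q a):W & W<=snd c ` fst c & smooth_on W rh & rh ` W<=Y &
    rh (snd c (q a)) = a & (ALL x:W. q (rh x):fst c & snd c (q (rh x)) = x)"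

sublocale smooth_cover \<subseteq> smooth_manifold X A
 by unfold_locales (use mfd in "simp add:closed_3_manifold_def")

context smooth_cover
begin

definition "dh c a = FD (%e. snd c (q e)) (at a)"

lemma preimage_open: "openin X V ==> open (Y Int q -` V)"
proof -
 assume "openin X V"
 hence "openin (top_of_set Y) {x:topspace (top_of_set Y). q x:V}"
  by (rule openin_continuous_map_preimage[OF cont_q])
 moreover have "{x:topspace (top_of_set Y). q x:V} = Y Int q -` V" by auto
 ultimately show ?thesis using Y_open by (simp add:openin_open_eq)
qed

lemma chart_dom_open: "c:A ==> open (Y Int q -` fst c)"
 by (rule preimage_open[OF chart_open(1)])

lemma dh: "c:A ==> a:Y ==> q a:fst c ==> ((%e. snd c (q e)) has_derivative dh c a) (at a)"
 unfolding dh_def using smooth_on_has_derivative[OF smooth_h] by simp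

lemma dh_linear: "c:A ==> a:Y ==> q a:fst c ==> linear (dh c a)"
 using dh has_derivative_linear by blast

lemma chart_at: "a:Y ==> EX c:A. q a:fst c"
proof -
 assume "a:Y"
 hence "q a:(UN c:A. fst c)" using atlas q_onto by (auto simp:smooth_atlas_def)
 thus ?thesis by blast
qed

lemma dh_inverse:
 assumes "c:A" "a:Y" "q a:fst c"
 obtains k where "linear k" "!!v. k (dh c a v) = v" "!!v. dh c a (k v) = v"
proof -
 obtain W rh where W: "open W" "snd c (q a):W" "W<=snd c ` fst c" "smooth_on W rh" "rh ` W<=Y"
  "rh (snd c (q a)) = a" "!!x. x:W ==> q (rh x):fst c & snd c (q (rh x)) = x"
  using sect[OF assms] by blast
 let ?k = "FD rh (at (snd c (q a)))"
 have k: "(rh has_derivative ?k) (at (snd c (q a)))"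
  by (rule smooth_on_has_derivative[OF W(4,2)])
 have "((%x. snd c (q (rh x))) has_derivative (%v. dh c a (?k v))) (at (snd c (q a)))"
  using diff_chain_at[OF k, of "%e. snd c (q e)" "dh c a"] dh[OF assms] W(6) by (simp add:o_def)
 moreover have "((%x. snd c (q (rh x))) has_derivative (%v. v)) (at (snd c (q a)))"
  by (rule has_derivative_transform_within_open[OF has_derivative_ident W(1,2)]) (simp add:W(7))
 ultimately have 1: "dh c a (?k v) = v" for v
  using has_derivative_unique by metis
 obtain U where U: "open U" "a:U" "U<=Y" "inj_on q U" using loc_inj[OF assms(2)] by blast
 let ?N = "(Y Int q -` fst c) Int (%e. snd c (q e)) -` (W Int rh -` U) Int U"
 have "open (W Int rh -` U)" using W U smooth_on_continuous continuous_open_preimage by blast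
 hence "open ((Y Int q -` fst c) Int (%e. snd c (q e)) -` (W Int rh -` U))"
  by (intro continuous_open_preimage[OF smooth_on_continuous[OF smooth_h[OF assms(1)]] chart_dom_open[OF assms(1)]])
 hence N: "open ?N" using U(1) by auto
 have aN: "a:?N" using assms W U by auto
 have eqN: "rh (snd c (q e)) = e" if "e:?N" for e
 proof -
  have "q (rh (snd c (q e))) = q e"
   using that W(7)[of "snd c (q e)"] inj_onD[OF chart_inj[OF assms(1)]] by auto
  thus ?thesis using that inj_onD[OF U(4)] by auto
 qed
 have "((%e. rh (snd c (q e))) has_derivative (%v. ?k (dh c a v))) (at a)"
  using diff_chain_at[OF dh[OF assms] k] by (simp add:o_def)
 moreover have "((%e. rh (snd c (q e))) has_derivative (%v. v)) (at a)"
  by (rule has_derivative_transform_within_open[OF has_derivative_ident N aN]) (simp add:eqN)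
 ultimately have "?k (dh c a v) = v" for v using has_derivative_unique by metis
 thus ?thesis using that[of ?k] 1 k has_derivative_linear by blast
qed

lemma dh_trans:
 assumes "c:A" "d:A" "a:Y" "q a:fst c" "q a:fst d"
 shows "dh d a v = deriv_in c d (%q. q) (q a) (dh c a v)"
proof -
 have S: "open (Y Int q -` (fst c Int fst d))" by (intro preimage_open openin_Int chart_open assms)
 have "((%e. trans c d (snd c (q e))) has_derivative (%v. deriv_in c d (%q. q) (q a) (dh c a v))) (at a)"
  using diff_chain_at[OF dh[OF assms(1,3,4)] trans_deriv[of c d "q a"]] assms by (simp add:o_def)
 hence "FD (%e. snd d (q e)) (at a) = (%v. deriv_in c d (%q. q) (q a) (dh c a v))"
  by (rule frechet_derivative_cong_open(2)[OF S, rotated 2]) (use assms in "auto simp:trans_def chart_inv_left")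
 thus ?thesis by (simp add:dh_def)
qed

lemma dh_deck:
 assumes "deck Y q U th0 a b" "c:A" "q a:fst c"
 shows "dh c a v = dh c b (FD th0 (at a) v)"
proof -
 have d: "open U" "a:U" "U<=Y" "smooth_on U th0" "th0 a = b" "th0 ` U<=Y" "!!u. u:U ==> q (th0 u) = q u"
  using assms by (auto simp:deck_def)
 have b: "b:Y" "q b:fst c" using d assms(3) by auto
 have "((%e. snd c (q (th0 e))) has_derivative (%v. dh c b (FD th0 (at a) v))) (at a)"
  using diff_chain_at[OF smooth_on_has_derivative[OF d(4,2)], of "%e. snd c (q e)" "dh c b"] dh[OF assms(2) b] d(5) by (simp add:o_def)
 hence "FD (%e. snd c (q e)) (at a) = (%v. dh c b (FD th0 (at a) v))"
  by (rule frechet_derivative_cong_open(2)[OF d(1,2), rotated]) (simp add:d(7))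
 thus ?thesis by (simp add:dh_def)
qed

lemma dh_continuous:
 assumes "c:A" "continuous_on S e" "S<=Y Int q -` fst c"
 shows "continuous_on S (%a. dh c a (e a))"
proof -
 have "dh c a (e a) = (\<Sum>b\<in>Basis. (e a \<bullet> b) *R dh c a b)" if "a:S" for a
 proof -
  have "linear (dh c a)" using dh_linear[OF assms(1), of a] assms(3) that by auto
  hence "dh c a (\<Sum>b\<in>Basis. (e a \<bullet> b) *R b) = (\<Sum>b\<in>Basis. (e a \<bullet> b) *R dh c a b)"
   by (simp add:linear_sum linear_scale)
  thus ?thesis by (simp add:euclidean_representation)
 qed
 moreover have "continuous_on S (%a. \<Sum>b\<in>Basis. (e a \<bullet> b) *R dh c a b)"
 proof (intro continuous_intros assms(2))
  fix b :: 'e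
  have "smooth_on (Y Int q -` fst c) (%a. dh c a b)"
   unfolding dh_def by (rule smooth_on_frechet[OF smooth_h[OF assms(1)]])
  thus "continuous_on S (%a. dh c a b)"
   using smooth_on_continuous continuous_on_subset assms(3) by blast
 qed
 ultimately show ?thesis by simp
qed

text \<open>Only the line spanned by \<open>e\<close> has to descend, so deck maps may rescale it.
  One deck map for each pair of points suffices: its derivative at \<open>a\<close> is determined by
  \<open>dh\<close>, which is injective at \<open>b\<close>.\<close>

definition field_inv :: "('e => 'e) => bool" where
 "field_inv e <-> continuous_on Y e & (ALL y:Y. e y~=0) &
   (ALL a:Y. ALL b:Y. q a = q b --> (EX U th0 k. deck Y q U th0 a b & FD th0 (at a) (e a) = k *R e b))"

definition line_field :: "('e => 'e) => 'a chart => 'a => (real^3) set" where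
 "line_field e c p = (let a = SOME a. a:Y & q a = p in dh c a ` span {e a})"

lemma line_field_eq:
 assumes e: "field_inv e" and c: "c:A" and a: "a:Y" "q a:fst c"
 shows "line_field e c (q a) = dh c a ` span {e a}" "line_field e c (q a) = span {dh c a (e a)}"
proof -
 define b where "b = (SOME b. b:Y & q b = q a)"
 have b: "b:Y" "q b = q a" using someI[of "%b. b:Y & q b = q a" a] a by (auto simp:b_def)
 obtain U th0 k where k: "deck Y q U th0 a b" "FD th0 (at a) (e a) = k *R e b"
  using e a b unfolding field_inv_def by metis
 have lin: "linear (dh c a)" "linear (dh c b)" using dh_linear c a b by auto
 have *: "dh c a (e a) = k *R dh c b (e b)"
  using dh_deck[OF k(1) c a(2)] k(2) lin by (simp add:linear_scale)
 obtain k' where "linear k'" "!!v. k' (dh c a v) = v" using dh_inverse[OF c a] by metis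
 hence "dh c a (e a)~=0" using e a linear_0 unfolding field_inv_def by metis
 hence "k~=0" using * by auto
 have im: "dh c x ` span {e x} = span {dh c x (e x)}" if "linear (dh c x)" for x
  using linear_span_image[OF that, of "{e x}"] by simp
 have "line_field e c (q a) = dh c b ` span {e b}" by (simp add:line_field_def b_def Let_def)
 also have "... = span {dh c b (e b)}" by (rule im[OF lin(2)])
 also have "... = span {dh c a (e a)}"
  unfolding * span_singleton using `k~=0` by (auto simp:image_iff) (metis nonzero_eq_divide_eq)
 finally show "line_field e c (q a) = span {dh c a (e a)}" .
 thus "line_field e c (q a) = dh c a ` span {e a}" using im[OF lin(1)] by simp
qed

lemma dh_nonzero: "field_inv e ==> c:A ==> a:Y ==> q a:fst c ==> dh c a (e a)~=0"
 using dh_inverse linear_0 unfolding field_inv_def by metis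

lemma line_subbundle_LS:
 assumes e: "field_inv e" shows "line_subbundle X A (line_field e)"
 unfolding line_subbundle_def
proof (intro conjI ballI)
 fix c p assume c: "c:A" and p: "p:fst c"
 then obtain a where a: "a:Y" "q a = p" using chart_open(1) openin_subset q_onto by (metis imageE subsetD)
 obtain U0 where U0: "open U0" "a:U0" "U0<=Y" "inj_on q U0" using loc_inj[OF a(1)] by blast
 define U where "U = U0 Int (Y Int q -` fst c)"
 have U: "open U" "a:U" "U<=Y" "inj_on q U" "q ` U<=fst c"
  using U0 chart_dom_open[OF c] a p by (auto simp:U_def intro:inj_on_subset)
 define s where "s m = dh c (inv_into U q m) (e (inv_into U q m))" for m
 have s: "s (q u) = dh c u (e u)" if "u:U" for u using that U by (simp add:s_def)
 have "continuous_on U (%u. dh c u (e u))"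
  using e U unfolding field_inv_def by (intro dh_continuous[OF c]) (auto intro:continuous_on_subset)
 have "continuous_map (subtopology X (q ` U)) euclidean s"
  unfolding continuous_map
 proof (intro conjI allI impI)
  fix O' :: "(real^3) set" assume O: "openin euclidean O'"
  have "topspace (subtopology X (q ` U)) = q ` U" using U q_onto by auto
  hence "{x:topspace (subtopology X (q ` U)). s x:O'} = q ` (U Int (%u. dh c u (e u)) -` O')"
   using s by auto
  moreover have "openin X (q ` (U Int (%u. dh c u (e u)) -` O'))"
   using `continuous_on U _` U O by (intro open_q continuous_open_preimage) auto
  ultimately show "openin (subtopology X (q ` U)) {x:topspace (subtopology X (q ` U)). s x:O'}"
   by (simp add:openin_open_subtopology open_q U) blast
 qed auto
 moreover have "s m~=0 & line_field e c m = span {s m}" if m: "m:q ` U" for m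
 proof -
  obtain u where u: "u:U" "m = q u" using m by blast
  hence "u:Y" "q u:fst c" using U by auto
  thus ?thesis using line_field_eq(2)[OF e c] dh_nonzero[OF e c] s[OF u(1)] u(2) by simp
 qed
 ultimately show "EX W s. openin X W & p:W & W<=fst c &
    continuous_map (subtopology X W) euclidean s & (ALL q:W. s q~=0 & line_field e c q = span {s q})"
  using open_q[of U] U a by auto
next
 fix c d p assume c: "c:A" "d:A" and p: "p:fst c Int fst d"
 then obtain a where a: "a:Y" "q a = p" using chart_open(1) openin_subset q_onto by (metis IntD1 imageE subsetD)
 have "deriv_in c d (%q. q) (q a) ` dh c a ` span {e a} = dh d a ` span {e a}"
  using dh_trans[OF c a(1)] a p by auto
 thus "deriv_in c d (%q. q) p ` line_field e c p = line_field e d p"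
  using line_field_eq(1)[OF e c(1) a(1)] line_field_eq(1)[OF e c(2) a(1)] a p by simp
qed

end

section \<open>Flows lifted to the covering\<close>

locale cover_flow = smooth_cover X A Y q K
 for X :: "'a topology" and A :: "'a chart set" and Y :: "'e::euclidean_space set" and q K +
 fixes ph :: "real => 'a => 'a" and F :: "real => 'e => 'e" and Z :: "'e => 'e"
 assumes F_in: "!!t y. y:Y ==> F t y:Y" and lift: "!!t y. y:Y ==> ph t (q y) = q (F t y)"
  and F0: "!!y. y:Y ==> F 0 y = y" and F_add: "!!s t y. y:Y ==> F (s + t) y = F s (F t y)"
  and F_smooth: "smooth_on (UNIV \<times> Y) (%(t,y). F t y)"
  and F_gen: "!!y. y:Y ==> ((%t. F t y) has_vector_derivative Z y) (at 0)"
begin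

lemma UY_open: "open (UNIV \<times> Y :: (real \<times> 'e) set)" using Y_open by (simp add:open_Times)

lemma F_smooth_t: "smooth_on Y (F t)"
proof -
 have "smooth_on Y (%y. (%(t,y). F t y) (t,y))"
  by (rule smooth_on_compose[OF F_smooth _ Y_open UY_open]) (auto intro:smooth_on_Pair[OF Y_open] smooth_on_const smooth_on_id[OF Y_open])
 thus ?thesis by simp
qed

definition "DF t y = FD (F t) (at y)"

lemma DF: "y:Y ==> (F t has_derivative DF t y) (at y)"
 unfolding DF_def by (rule smooth_on_has_derivative[OF F_smooth_t])

lemma DF_linear: "y:Y ==> linear (DF t y)"
 using DF has_derivative_linear by blast

lemma smooth_flow_phi: "smooth_flow X A ph"
 unfolding smooth_flow_def
proof (intro conjI ballI allI)
 fix p assume "p:topspace X"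
 then obtain y where y: "y:Y" "p = q y" using q_onto by blast
 thus "ph 0 p = p" by (simp add:lift F0)
 show "ph (s + t) p = ph s (ph t p)" for s t using y by (simp add:lift F_add F_in)
next
 show "continuous_map (prod_topology euclideanreal X) X (%(t,p). ph t p)"
  unfolding continuous_map
 proof (intro conjI allI impI)
  show "(%(t,p). ph t p) ` topspace (prod_topology euclideanreal X)<=topspace X"
  proof
   fix r assume "r:(%(t,p). ph t p) ` topspace (prod_topology euclideanreal X)"
   then obtain t p where "r = ph t p" "p:q ` Y" using q_onto by auto
   then obtain y where "y:Y" "r = ph t (q y)" by blast
   thus "r:topspace X" using lift F_in q_onto by auto
  qed
  fix V assume V: "openin X V"
  have "open ((UNIV \<times> Y) Int (%(t,y). F t y) -` (Y Int q -` V))"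
   by (intro continuous_open_preimage[OF smooth_on_continuous[OF F_smooth] UY_open] preimage_open V)
  moreover have "(UNIV \<times> Y) Int (%(t,y). F t y) -` (Y Int q -` V) = {(t,y). y:Y & ph t (q y):V}" (is "_ = ?S")
   using F_in lift by auto
  ultimately have S: "open ?S" by simp
  show "openin (prod_topology euclideanreal X)
    {x:topspace (prod_topology euclideanreal X). (case x of (t,p) => ph t p):V}"
   unfolding openin_prod_topology_alt
  proof (intro allI impI)
   fix t p assume "(t,p):{x:topspace (prod_topology euclideanreal X). (case x of (t,p) => ph t p):V}"
   hence tp: "p:q ` Y" "ph t p:V" using q_onto by auto
   then obtain y where y: "y:Y" "p = q y" by blast
   note y = y tp(2)[unfolded y(2)]
   hence tyS: "(t,y):?S" by simp
   obtain I U where "open I" "open U" "(t,y):I \<times> U" "I \<times> U<=?S"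
    by (rule open_prod_elim[OF S tyS])
   hence IU: "open I" "open U" "t:I" "y:U" "I \<times> U<=?S" by simp_all
   hence "U<=Y" by blast
   have "I \<times> q ` U<={x:topspace (prod_topology euclideanreal X). (case x of (t,p) => ph t p):V}"
   proof
    fix z assume "z:I \<times> q ` U"
    then obtain s u where su: "z = (s,q u)" "s:I" "u:U" by blast
    hence "(s,u):?S" using IU(5) by blast
    hence "ph s (q u):V" "u:Y" by simp_all
    moreover have "q u:topspace X" using `u:Y` q_onto by blast
    ultimately show "z:{x:topspace (prod_topology euclideanreal X). (case x of (t,p) => ph t p):V}"
     by (simp add:su(1))
   qed
   thus "EX U V'. openin euclideanreal U & openin X V' & t:U & p:V' &
     U \<times> V'<={x:topspace (prod_topology euclideanreal X). (case x of (t,p) => ph t p):V}"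
    using IU y open_q[OF IU(2) `U<=Y`] by auto
  qed
 qed
next
 fix c d assume c: "c:A" and d: "d:A"
 let ?S = "{(t,x). x:snd c ` fst c & ph t (chart_inv c x):fst d}"
 show "smooth_on ?S (%(t,x). snd d (ph t (chart_inv c x)))"
 proof (rule smooth_on_local)
  fix z assume "z:?S"
  then obtain t x where z: "z = (t,x)" "x:snd c ` fst c" "ph t (chart_inv c x):fst d" by blast
  have "chart_inv c x:q ` Y"
   using chart_inv_in[OF c z(2)] chart_open(1)[OF c] openin_subset q_onto by blast
  then obtain a where a: "a:Y" "q a = chart_inv c x" by force
  have ax: "q a:fst c" "snd c (q a) = x" using chart_inv_in[OF c z(2)] a by auto
  obtain W rh where W: "open W" "x:W" "W<=snd c ` fst c" "smooth_on W rh" "rh ` W<=Y"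
   "rh x = a" "!!x. x:W ==> q (rh x):fst c & snd c (q (rh x)) = x"
   using sect[OF c a(1) ax(1)] ax(2) by blast
  have inv: "chart_inv c w = q (rh w)" if "w:W" for w
   using W(7)[OF that] chart_inv_left[OF c] by metis
  let ?f = "%(t,y). F t y"
  have sm: "smooth_on (UNIV \<times> W) (%u. ?f (fst u,rh (snd u)))"
  proof (rule smooth_on_compose[OF F_smooth])
   have o: "open (UNIV \<times> W :: (real \<times> (real^3)) set)" using W by (simp add:open_Times)
   show "smooth_on (UNIV \<times> W) (%u::real \<times> (real^3). (fst u,rh (snd u)))"
    by (rule smooth_on_Pair[OF o smooth_on_fst[OF o smooth_on_id[OF o]]], rule smooth_on_compose[OF W(4) smooth_on_snd[OF o smooth_on_id[OF o]] o W(1)]) auto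
   show "open (UNIV \<times> W :: (real \<times> (real^3)) set)" by (rule o)
  qed (use W UY_open in auto)
  let ?N = "(UNIV \<times> W) Int (%u. ?f (fst u,rh (snd u))) -` (Y Int q -` fst d)"
  have N: "open ?N"
   by (rule continuous_open_preimage[OF smooth_on_continuous[OF sm] _ chart_dom_open[OF d]]) (use W in "simp add:open_Times")
  have "smooth_on ?N (%u. snd d (q (?f (fst u,rh (snd u)))))"
   by (rule smooth_on_compose[OF smooth_h[OF d] smooth_on_subset[OF sm] N chart_dom_open[OF d]]) auto
  moreover have "(case u of (t,x) => snd d (ph t (chart_inv c x))) = snd d (q (?f (fst u,rh (snd u))))"
   if "u:?N" for u
  proof -
   have u: "snd u:W" "rh (snd u):Y" using that W(5) by auto
   show ?thesis using inv[OF u(1)] lift[OF u(2)] by (simp add:case_prod_beta)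
  qed
  ultimately have "smooth_on ?N (%(t,x). snd d (ph t (chart_inv c x)))"
   by (rule iffD2[OF smooth_on_cong[OF N], rotated])
  moreover have "z:?N"
  proof -
   have "F t a:Y" "q (F t a):fst d" using z(3) a lift[OF a(1), of t] F_in by simp_all
   thus ?thesis using W(2,6) by (simp add:z(1))
  qed
  ultimately show "EX U. open U & z:U & smooth_on U (%(t,x). snd d (ph t (chart_inv c x)))"
   using N by blast
 qed
qed

lemma generator_phi:
 assumes "c:A" "a:Y" "q a:fst c" shows "generator ph c (q a) = dh c a (Z a)"
proof -
 have 1: "((%t. F t a) has_derivative (%x. x *R Z a)) (at 0)"
  using F_gen[OF assms(2)] by (simp add:has_vector_derivative_def)
 have "((%t. snd c (q (F t a))) has_derivative (%x. dh c a (x *R Z a))) (at 0)"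
  using diff_chain_at[OF 1, of "%e. snd c (q e)" "dh c a"] dh[OF assms] F0[OF assms(2)] by (simp add:o_def)
 hence "((%t. snd c (ph t (q a))) has_vector_derivative dh c a (Z a)) (at 0)"
  unfolding has_vector_derivative_def lift[OF assms(2)] using dh_linear[OF assms] by (simp add:linear_scale)
 thus ?thesis unfolding generator_def by (rule vector_derivative_at)
qed

lemma deriv_in_phi:
 assumes c: "c:A" "a:Y" "q a:fst c" and d: "d:A" "ph t (q a):fst d"
 shows "deriv_in c d (ph t) (q a) (dh c a v) = dh d (F t a) (DF t a v)"
proof -
 obtain W rh where W: "open W" "snd c (q a):W" "smooth_on W rh" "rh ` W<=Y"
  "rh (snd c (q a)) = a" "!!x. x:W ==> q (rh x):fst c & snd c (q (rh x)) = x"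
  using sect[OF c] by blast
 have Fa: "F t a:Y" "q (F t a):fst d" using c d lift F_in by auto
 let ?k = "FD rh (at (snd c (q a)))"
 have k: "(rh has_derivative ?k) (at (snd c (q a)))" by (rule smooth_on_has_derivative[OF W(3,2)])
 have "((%x. snd c (q (rh x))) has_derivative (%v. dh c a (?k v))) (at (snd c (q a)))"
  using diff_chain_at[OF k, of "%e. snd c (q e)" "dh c a"] dh[OF c] W(5) by (simp add:o_def)
 moreover have "((%x. snd c (q (rh x))) has_derivative (%v. v)) (at (snd c (q a)))"
  by (rule has_derivative_transform_within_open[OF has_derivative_ident W(1,2)]) (simp add:W(6))
 ultimately have 1: "dh c a (?k w) = w" for w using has_derivative_unique by metis
 hence kk: "?k (dh c a v) = v" by (metis dh_inverse[OF c])
 have "((%x. F t (rh x)) has_derivative (%w. DF t a (?k w))) (at (snd c (q a)))"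
  using diff_chain_at[OF k, of "F t" "DF t a"] DF[OF c(2)] W(5) by (simp add:o_def)
 hence "((%x. snd d (q (F t (rh x)))) has_derivative (%w. dh d (F t a) (DF t a (?k w)))) (at (snd c (q a)))"
  using diff_chain_at[of "%x. F t (rh x)" _ _ "%e. snd d (q e)" "dh d (F t a)"] dh[OF d(1) Fa] W(5) by (simp add:o_def)
 hence "FD (%x. snd d (ph t (chart_inv c x))) (at (snd c (q a))) =
   (%w. dh d (F t a) (DF t a (?k w)))"
 proof (rule frechet_derivative_cong_open(2)[OF W(1,2), rotated])
  fix x assume x: "x:W"
  hence "chart_inv c x = q (rh x)" using W(6)[OF x] chart_inv_left[OF c(1)] by metis
  thus "snd d (ph t (chart_inv c x)) = snd d (q (F t (rh x)))" using lift x W(4) by auto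
 qed
 thus ?thesis by (simp add:deriv_in_def kk)
qed

text \<open>The lifted flow carries \<open>e\<close> to itself without a factor. The rate of
  contraction is then contained in the length of \<open>e\<close> alone.\<close>

definition pushed :: "('e => 'e) => bool" where
 "pushed e <-> (ALL t. ALL y:Y. DF t y (e y) = e (F t y))"

lemma invariant_line_field:
 assumes e: "field_inv e" "pushed e" shows "invariant_subbundle A ph (line_field e)"
 unfolding invariant_subbundle_def
proof (intro allI ballI impI)
 fix t c p d assume c: "c:A" and p: "p:fst c" and d: "d:A" "ph t p:fst d"
 then obtain a where a: "a:Y" "q a = p" using chart_open(1) openin_subset q_onto by (metis imageE subsetD)
 have ac: "q a:fst c" "ph t (q a):fst d" using a p d by auto
 have "deriv_in c d (ph t) p ` line_field e c p = (%v. dh d (F t a) (DF t a v)) ` span {e a}"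
  using line_field_eq(1)[OF e(1) c a(1) ac(1)] deriv_in_phi[OF c a(1) ac(1) d(1) ac(2)] a by (simp add:image_image)
 also have "... = dh d (F t a) ` (DF t a ` span {e a})" by auto
 also have "DF t a ` span {e a} = span {e (F t a)}"
  using linear_span_image[OF DF_linear[OF a(1)], of t "{e a}"] e(2) a by (simp add:pushed_def)
 also have "dh d (F t a) ` span {e (F t a)} = line_field e d (ph t p)"
  using line_field_eq(1)[OF e(1) d(1), of "F t a"] F_in[OF a(1)] lift[OF a(1)] a ac by simp
 finally show "deriv_in c d (ph t) p ` line_field e c p = line_field e d (ph t p)" .
qed

text \<open>Positive functions transforming like the length of \<open>e\<close>; by
  \<open>adapted_nu\<close> each Riemannian metric gives one. Contraction can thus be checked from
  the transformation law, without an explicit metric.\<close>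

definition adapted :: "('e => 'e) => ('e => real) => bool" where
 "adapted e nu0 <-> continuous_on Y nu0 & (ALL y:Y. nu0 y>0) &
   (ALL a b U th0 k. a:Y --> deck Y q U th0 a b --> FD th0 (at a) (e a) = k *R e b --> nu0 a = abs k*nu0 b)"

definition nu :: "('a chart => 'a => real^3 => real^3 => real) => ('e => 'e) => 'e => real" where
 "nu g e a = (let c = SOME c. c:A & q a:fst c in metric_norm g c (q a) (dh c a (e a)))"

lemma nu_eq:
 assumes g: "riemannian_metric A g" and c: "c:A" "a:Y" "q a:fst c"
 shows "nu g e a = metric_norm g c (q a) (dh c a (e a))"
proof -
 define d where "d = (SOME c. c:A & q a:fst c)"
 have d: "d:A" "q a:fst d" using someI[of "%c. c:A & q a:fst c" c] c by (auto simp:d_def)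
 have "g d (q a) (deriv_in c d (%q. q) (q a) u) (deriv_in c d (%q. q) (q a) v) = g c (q a) u v" for u v
  using g c d unfolding riemannian_metric_def by blast
 thus ?thesis
  using dh_trans[OF c(1) d(1) c(2,3) d(2)] by (simp add:nu_def d_def[symmetric] metric_norm_def)
qed

lemma metric_norm_scale:
 assumes g: "riemannian_metric A g" and "c:A" "p:fst c"
 shows "metric_norm g c p (k *R v) = abs k*metric_norm g c p v"
proof -
 have "bilinear (g c p)" using assms by (auto simp:riemannian_metric_def)
 hence "g c p (k *R v) (k *R v) = k^2*g c p v v"
  by (simp add:bilinear_lmul bilinear_rmul power2_eq_square)
 thus ?thesis by (simp add:metric_norm_def real_sqrt_mult)
qed

lemma adapted_nu:
 assumes g: "riemannian_metric A g" and e: "field_inv e" shows "adapted e (nu g e)"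
 unfolding adapted_def
proof (intro conjI allI impI ballI)
 show "nu g e y>0" if y: "y:Y" for y
 proof -
  obtain c where c: "c:A" "q y:fst c" using chart_at[OF y] by blast
  hence "g c (q y) (dh c y (e y)) (dh c y (e y))>0"
   using g dh_nonzero[OF e c(1) y c(2)] by (auto simp:riemannian_metric_def)
  thus ?thesis using nu_eq[OF g c(1) y c(2)] by (simp add:metric_norm_def)
 qed
 show "nu g e a = abs k*nu g e b"
  if a: "a:Y" and d: "deck Y q U th0 a b" and k: "FD th0 (at a) (e a) = k *R e b" for a b U th0 k
 proof -
  obtain c where c: "c:A" "q a:fst c" using chart_at[OF a] by blast
  have b: "b:Y" "q b = q a" using d unfolding deck_def by auto
  have "dh c a (e a) = k *R dh c b (e b)"
   using dh_deck[OF d c] k dh_linear[OF c(1) b(1)] b c by (simp add:linear_scale)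
  thus ?thesis
   using nu_eq[OF g c(1) a c(2)] nu_eq[OF g c(1) b(1)] metric_norm_scale[OF g c] b c by simp
 qed
 show "continuous_on Y (nu g e)"
 proof (rule continuous_at_imp_continuous_on, rule ballI)
  fix y assume y: "y:Y"
  then obtain c where c: "c:A" "q y:fst c" using chart_at by blast
  let ?N = "Y Int q -` fst c"
  let ?h = "%a. dh c a (e a)"
  have h: "continuous_on ?N ?h"
   using e by (intro dh_continuous[OF c(1)]) (auto simp:field_inv_def intro:continuous_on_subset)
  have "g c (q a) (?h a) (?h a) = (\<Sum>i\<in>Basis. \<Sum>j\<in>Basis. (?h a \<bullet> i)*(?h a \<bullet> j)*g c (chart_inv c (snd c (q a))) i j)"
   if "a:?N" for a
  proof -
   have bl: "bilinear (g c (q a))" using g c that by (auto simp:riemannian_metric_def)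
   have "g c (q a) (\<Sum>i\<in>Basis. (?h a \<bullet> i) *R i) (\<Sum>j\<in>Basis. (?h a \<bullet> j) *R j) =
     (\<Sum>i\<in>Basis. \<Sum>j\<in>Basis. (?h a \<bullet> i)*(?h a \<bullet> j)*g c (q a) i j)"
    using bilinear_sum[OF bl, of "%i. (?h a \<bullet> i) *R i" Basis "%j. (?h a \<bullet> j) *R j" Basis] by (simp add:sum.cartesian_product bilinear_lmul[OF bl] bilinear_rmul[OF bl] mult_ac)
   thus ?thesis using that chart_inv_left[OF c(1)] by (simp add:euclidean_representation)
  qed
  moreover have "continuous_on ?N (%a. \<Sum>i\<in>Basis. \<Sum>j\<in>Basis. (?h a \<bullet> i)*(?h a \<bullet> j)*g c (chart_inv c (snd c (q a))) i j)"
  proof (intro continuous_intros h)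
   fix i j :: "real^3"
   have "smooth_on (snd c ` fst c) (%x. g c (chart_inv c x) i j)"
    using g c by (auto simp:riemannian_metric_def)
   thus "continuous_on ?N (%a. g c (chart_inv c (snd c (q a))) i j)"
    by (intro continuous_on_compose2[OF smooth_on_continuous smooth_on_continuous[OF smooth_h[OF c(1)]]]) auto
  qed
  ultimately have "continuous_on ?N (%a. sqrt (g c (q a) (?h a) (?h a)))"
   by (intro continuous_on_real_sqrt) (rule continuous_on_eq, auto)
  moreover have "nu g e a = sqrt (g c (q a) (?h a) (?h a))" if "a:?N" for a
   using nu_eq[OF g c(1)] that by (simp add:metric_norm_def)
  ultimately have "continuous_on ?N (nu g e)" by (metis (no_types, lifting) continuous_on_eq)
  thus "isCont (nu g e) y"
   using chart_dom_open[OF c(1)] y c by (auto simp:continuous_on_eq_continuous_at)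
 qed
qed

end

text \<open>Pointwise shrinking becomes uniform and exponential: around each point of
  \<open>K\<close> a fixed time shrinks by a fixed factor, finitely many such neighbourhoods cover
  \<open>K\<close>, and a long time is cut into such steps. By \<open>inv\<close> the estimates on
  \<open>K\<close> hold on all of \<open>Y\<close>.\<close>

lemma compact_contraction:
 fixes K Y :: "'e::metric_space set" and r :: "real => 'e => real"
 assumes K: "compact K" "K<=Y"
  and cont: "continuous_on ({0..} \<times> K) (%(t,y). r t y)"
  and G: "!!t y. y:Y ==> t>=0 ==> G t y:Y"
  and cocycle: "!!s t y. y:Y ==> s>=0 ==> t>=0 ==> r (s + t) y = r s (G t y)*r t y"
  and inv: "!!y. y:Y ==> EX k:K. ALL t>=0. r t y = r t k"
  and pos: "!!t y. y:Y ==> t>=0 ==> r t y>0"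
  and con: "!!k. k:K ==> EX t>0. r t k<1"
 shows "EX C>0. EX mu0>0. ALL t>=0. ALL y:Y. r t y<=C*exp (- mu0*t)"
proof (cases "K = {}")
 case True
 hence "Y = {}" using inv by blast
 thus ?thesis by (auto intro!:exI[of _ 1])
next
 case False
 have "EX t th0 e. t>0 & th0<1 & e>0 & (ALL y:K. dist y k<e --> r t y<=th0)" if k: "k:K" for k
 proof -
  obtain t where t: "t>0" "r t k<1" using con[OF k] by blast
  have "continuous_on K (%y. (%(t,y). r t y) (t,y))"
   by (rule continuous_on_compose2[OF cont]) (use t in "auto intro!:continuous_intros")
  hence "continuous_on K (r t)" by simp
  moreover have "(1 - r t k)/2>0" using t by simp
  ultimately have "EX e>0. ALL y:K. dist y k<e --> dist (r t y) (r t k)<(1 - r t k)/2"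
   using k unfolding continuous_on_iff by blast
  then obtain e where e: "e>0" "!!y. y:K ==> dist y k<e ==> dist (r t y) (r t k)<(1 - r t k)/2" by blast
  have "r t y<=(1 + r t k)/2" if "y:K" "dist y k<e" for y
   using e(2)[OF that] unfolding dist_real_def abs_less_iff by simp
  thus ?thesis using t e(1) by (intro exI[of _ t] exI[of _ "(1 + r t k)/2"] exI[of _ e]) auto
 qed
 then obtain T th0 e where Te: "!!k. k:K ==> T k>0" "!!k. k:K ==> th0 k<1" "!!k. k:K ==> e k>0"
  "!!k y. k:K ==> y:K ==> dist y k<e k ==> r (T k) y<=th0 k" by metis
 have "K<=(UN k:K. ball k (e k))" using Te(3) by auto
 then obtain D where D: "D<=K" "finite D" "K<=(UN k:D. ball k (e k))"
  using compactE_image[OF K(1), of K "%k. ball k (e k)"] by auto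
 have Dne: "D~={}" using D False by auto
 define Tm where "Tm = Max (T ` D)"
 define Tn where "Tn = Min (T ` D)"
 define ka where "ka = max (1/2) (Max (th0 ` D))"
 have T: "T k<=Tm" "Tn<=T k" "th0 k<=ka" if "k:D" for k
  using that D by (auto simp:Tm_def Tn_def ka_def le_max_iff_disj)
 have Tn: "Tn>0" using D Dne Te(1) by (auto simp:Tn_def)
 have Tm: "Tm>0" using T(1,2) Tn Dne by force
 have ka: "0<ka" "ka<1" using D Dne Te(2) by (auto simp:ka_def)
 have step: "EX t. Tn<=t & t<=Tm & r t y<=ka" if y: "y:Y" for y
 proof -
  obtain k where k: "k:K" "!!t. t>=0 ==> r t y = r t k" using inv[OF y] by blast
  obtain d where d: "d:D" "dist d k<e d" using D k by auto
  have "r (T d) k<=th0 d" using Te(4)[of d k] d D k by (auto simp:dist_commute)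
  moreover have "r (T d) y = r (T d) k" using k(2)[of "T d"] Te(1)[of d] d D by auto
  ultimately show ?thesis using T[OF d(1)] by auto
 qed
 have "compact ((%(t,y). r t y) ` ({0..Tm} \<times> K))"
  by (intro compact_continuous_image continuous_on_subset[OF cont] compact_Times K) auto
 then obtain C0 where C00: "!!x. x:(%(t,y). r t y) ` ({0..Tm} \<times> K) ==> abs x<=C0"
  using compact_imp_bounded bounded_real by metis
 hence C0: "r t y<=abs C0 + 1" if y: "y:Y" and t: "0<=t" "t<=Tm" for t y
 proof -
  obtain k where k: "k:K" "r t y = r t k" using inv[OF y] t by blast
  have "r t k:(%(t,y). r t y) ` ({0..Tm} \<times> K)" using k t by force
  hence "abs(r t k)<=C0" by (rule C00)
  thus ?thesis using k by linarith
 qed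
 \<comment> \<open>A step lasts at most \<open>Tm\<close> and gains the factor \<open>ka\<close>, so
   the rate is fixed by \<open>exp (- mu0 * Tm) = ka\<close>. The constant \<open>C\<close> pays for
   the last, incomplete step.\<close>
 define mu0 where "mu0 = - ln ka/Tm"
 have mu0: "mu0>0" using ka Tm by (simp add:mu0_def divide_neg_pos)
 have emu0: "exp (mu0*Tm)*ka = 1" using ka Tm by (simp add:mu0_def exp_minus)
 define C where "C = (abs C0 + 1)*exp (mu0*Tm)"
 have Cpos: "C>0" by (simp add:C_def)
 \<comment> \<open>Each step lasts at least \<open>Tn\<close>, so the number of steps below a given
   time is bounded and induction on it works.\<close>
 have main: "ALL y:Y. ALL t. 0<=t --> t<real n*Tn --> r t y<=C*exp (- mu0*t)" for n
 proof (induction n)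
  case (Suc n)
  show ?case
  proof (intro ballI allI impI)
   fix y t assume y: "y:Y" and t: "0<=t" "t<real (Suc n)*Tn"
   show "r t y<=C*exp (- mu0*t)"
   proof (cases "t<=Tm")
    case True
    hence "1<=exp (mu0*Tm)*exp (- mu0*t)"
     using mu0 by (simp add:exp_add[symmetric])
    hence "(abs C0 + 1)*1<=(abs C0 + 1)*(exp (mu0*Tm)*exp (- mu0*t))"
     by (intro mult_left_mono) auto
    thus ?thesis using C0[OF y t(1) True] by (simp add:C_def)
   next
    case False
    obtain s where s: "Tn<=s" "s<=Tm" "r s y<=ka" using step[OF y] by blast
    have ts: "0<=t - s" "t - s<real n*Tn" using s t False by (auto simp:algebra_simps)
    have Gy: "G s y:Y" using G[OF y] s Tn by auto
    have "r t y = r (t - s) (G s y)*r s y"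
     using cocycle[OF y ts(1), of s] s Tn by simp
    also have "... <= (C*exp (- mu0*(t - s)))*ka"
     using Suc ts Gy s(1,3) pos[OF y, of s] Tn Cpos by (intro mult_mono) auto
    also have "exp (- mu0*(t - s)) = exp (- mu0*t)*exp (mu0 * s)"
     by (simp add:exp_add[symmetric] algebra_simps)
    also have "C*(exp (- mu0*t)*exp (mu0 * s))*ka<=C*(exp (- mu0*t)*exp (mu0*Tm))*ka"
     using s mu0 Cpos ka by simp
    also have "... = C*exp (- mu0*t)" using emu0 by simp
    finally show ?thesis .
   qed
  qed
 qed (use Tn in auto)
 have "r t y<=C*exp (- mu0*t)" if "0<=t" "y:Y" for t y
 proof -
  obtain n where "t<real n*Tn" using reals_Archimedean3[OF Tn] by blast
  thus ?thesis using main that by blast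
 qed
 thus ?thesis using Cpos mu0 by blast
qed

context cover_flow
begin

text \<open>The same factor \<open>k\<close> relates the fields over \<open>a\<close> and
  \<open>b\<close> before and after flowing, since the flow preserves \<open>e\<close>; it cancels
  in the ratio.\<close>

lemma nu_ratio:
 assumes g: "riemannian_metric A g" and e: "field_inv e" "pushed e" and ab: "a:Y" "b:Y" "q a = q b"
 shows "nu g e (F t a)/nu g e a = nu g e (F t b)/nu g e b"
proof -
 obtain c where c: "c:A" "q a:fst c" using chart_at[OF ab(1)] by blast
 have Fa: "F t a:Y" "F t b:Y" using F_in ab by auto
 obtain d where d: "d:A" "q (F t a):fst d" using chart_at[OF Fa(1)] by blast
 have qF: "q (F t b) = q (F t a)" using lift ab by metis
 obtain U th0 k where k: "deck Y q U th0 a b" "FD th0 (at a) (e a) = k *R e b"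
  using e(1) ab unfolding field_inv_def by metis
 have 1: "dh c a (e a) = dh c b (k *R e b)" using dh_deck[OF k(1) c] k(2) by simp
 have "dh d (F t a) (DF t a (e a)) = dh d (F t b) (DF t b (k *R e b))"
  using deriv_in_phi[OF c(1) ab(1) c(2) d(1), of t] deriv_in_phi[OF c(1) ab(2) _ d(1), of t] 1 ab c d lift qF by metis
 hence 2: "dh d (F t a) (e (F t a)) = k *R dh d (F t b) (e (F t b))"
  using e(2) ab DF_linear[OF ab(2)] dh_linear[OF d(1) Fa(2)] d qF by (simp add:pushed_def linear_scale)
 have 3: "dh c a (e a) = k *R dh c b (e b)" using 1 dh_linear[OF c(1) ab(2)] c ab by (simp add:linear_scale)
 have "nu g e (F t a) = abs k*nu g e (F t b)"
  using nu_eq[OF g d(1) Fa(1) d(2)] nu_eq[OF g d(1) Fa(2)] 2 metric_norm_scale[OF g d] qF d by simp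
 moreover have "nu g e a = abs k*nu g e b"
  using nu_eq[OF g c(1) ab(1) c(2)] nu_eq[OF g c(1) ab(2)] 3 metric_norm_scale[OF g c] ab c by simp
 moreover have "nu g e a>0" using adapted_nu[OF g e(1)] ab by (auto simp:adapted_def)
 ultimately show ?thesis by auto
qed

text \<open>\<open>sg0\<close> is the direction of time, so that the stable and the unstable field
  share one proof.\<close>

lemma contraction:
 assumes g: "riemannian_metric A g" and e: "field_inv e" "pushed e" and sg: "abs sg0 = (1::real)"
  and con: "!!y. y:Y ==> EX t>0. nu g e (F (sg0*t) y)<nu g e y"
 shows "contracted_by A g (%t. ph (sg0*t)) (line_field e)"
proof -
 have ad: "continuous_on Y (nu g e)" "!!y. y:Y ==> nu g e y>0"
  using adapted_nu[OF g e(1)] by (auto simp:adapted_def)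
 define r where "r t y = nu g e (F (sg0*t) y)/nu g e y" for t y
 have "EX C>0. EX mu0>0. ALL t>=0. ALL y:Y. r t y<=C*exp (- mu0*t)"
 proof (rule compact_contraction[OF K(1,2), where G = "%t. F (sg0*t)"])
  have "continuous_on ({0..} \<times> K) (%z. nu g e ((%(t,y). F t y) (sg0 * fst z,snd z))/nu g e (snd z))"
  proof (intro continuous_on_divide)
   have "continuous_on ({0..} \<times> K) (%z. (%(t,y). F t y) (sg0 * fst z,snd z))"
    by (rule continuous_on_compose2[OF smooth_on_continuous[OF F_smooth]]) (use K in "auto intro!:continuous_intros")
   thus "continuous_on ({0..} \<times> K) (%z. nu g e ((%(t,y). F t y) (sg0 * fst z,snd z)))"
    by (rule continuous_on_compose2[OF ad(1)]) (use K F_in in auto)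
   show "continuous_on ({0..} \<times> K) (%z. nu g e (snd z))"
    by (rule continuous_on_compose2[OF ad(1)]) (use K in "auto intro!:continuous_intros")
   show "ALL z:{0..} \<times> K. nu g e (snd z)~=0" using ad(2) K by force
  qed
  thus "continuous_on ({0..} \<times> K) (%(t,y). r t y)" by (simp add:r_def case_prod_beta)
  show "r (s + t) y = r s (F (sg0*t) y)*r t y" if "y:Y" for s t y
   using ad(2)[OF F_in[OF that, of "sg0*t"]] F_add[OF that, of "sg0 * s" "sg0*t"] by (simp add:r_def distrib_left)
  show "EX k:K. ALL t>=0. r t y = r t k" if y: "y:Y" for y
  proof -
   have "q y:q ` K" using K(3) y by blast
   then obtain k where "k:K" "q y = q k" by blast
   thus ?thesis using nu_ratio[OF g e y] K(2) by (auto simp:r_def)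
  qed
  show "EX t>0. r t k<1" if "k:K" for k
   using con[of k] ad(2)[of k] that K(2) by (auto simp:r_def)
 qed (use F_in ad in "auto simp:r_def")
 then obtain C mu0 where C: "C>0" "mu0>0" "!!t y. t>=0 ==> y:Y ==> r t y<=C*exp (- mu0*t)" by blast
 show ?thesis
  unfolding contracted_by_def
 proof (rule exI[of _ C], rule conjI[OF C(1)], rule exI[of _ mu0], rule conjI[OF C(2)], intro allI impI ballI)
  fix t c p d v
  assume t: "0<=t" and c: "c:A" and p: "p:fst c" and d: "d:A" "ph (sg0*t) p:fst d" and v: "v:line_field e c p"
  obtain a where a: "a:Y" "q a = p" using c p chart_open(1) openin_subset q_onto by (metis imageE subsetD)
  have ac: "q a:fst c" "ph (sg0*t) (q a):fst d" using a p d by auto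
  have Fa: "F (sg0*t) a:Y" "q (F (sg0*t) a) = ph (sg0*t) p" using a F_in lift by auto
  obtain k where k: "v = k *R dh c a (e a)"
   using v line_field_eq(2)[OF e(1) c a(1) ac(1)] a by (auto simp:span_singleton)
  have "v = dh c a (k *R e a)" using k dh_linear[OF c a(1) ac(1)] by (simp add:linear_scale)
  hence "deriv_in c d (ph (sg0*t)) p v = dh d (F (sg0*t) a) (DF (sg0*t) a (k *R e a))"
   using deriv_in_phi[OF c a(1) ac(1) d(1) ac(2)] a by simp
  also have "... = k *R dh d (F (sg0*t) a) (e (F (sg0*t) a))"
   using e(2) a DF_linear[OF a(1)] dh_linear[OF d(1) Fa(1)] Fa d by (simp add:pushed_def linear_scale)
  finally have "metric_norm g d (ph (sg0*t) p) (deriv_in c d (ph (sg0*t)) p v) = abs k*nu g e (F (sg0*t) a)"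
   using nu_eq[OF g d(1) Fa(1)] metric_norm_scale[OF g d] Fa d by simp
  also have "... <= abs k*(C*exp (- mu0*t)*nu g e a)"
   using C(3)[OF t a(1)] ad(2)[OF a(1)] by (intro mult_left_mono) (auto simp:r_def divide_simps)
  also have "... = C*exp (- mu0*t)*metric_norm g c p v"
   using nu_eq[OF g c a(1) ac(1)] metric_norm_scale[OF g c p] k a by simp
  finally show "metric_norm g d (ph (sg0*t) p) (deriv_in c d (ph (sg0*t)) p v)<=C*exp (- mu0*t)*metric_norm g c p v" .
 qed
qed

theorem anosov_flow_phi:
 assumes e1: "field_inv e1" "pushed e1" and e2: "field_inv e2" "pushed e2"
  and span: "!!y v. y:Y ==> EX r s t. v = r *R e1 y + s *R Z y + t *R e2 y"
  and indep: "!!y r s t. y:Y ==> r *R e1 y + s *R Z y + t *R e2 y = 0 ==> r = 0 & s = 0 & t = 0"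
  and con1: "!!nu0 y. adapted e1 nu0 ==> y:Y ==> EX t>0. nu0 (F t y)<nu0 y"
  and con2: "!!nu0 y. adapted e2 nu0 ==> y:Y ==> EX t>0. nu0 (F (- t) y)<nu0 y"
 shows "anosov_flow X A ph"
proof -
 have "compact_space X" "Hausdorff_space X" using mfd by (auto simp:closed_3_manifold_def)
 then obtain g where g: "riemannian_metric A g" using riemannian_metric_exists by blast
 have split:"EX! w. case w of (x,r,b) =>
      x:line_field e1 c p & b:line_field e2 c p & v = x + r *R generator ph c p + b"
  if c: "c:A" and p: "p:fst c" for c p v
 proof -
  obtain a where a: "a:Y" "q a = p" using c p chart_open(1) openin_subset q_onto by (metis imageE subsetD)
  have ac: "q a:fst c" using a p by simp
  obtain k where k: "linear k" "!!v. k (dh c a v) = v" "!!v. dh c a (k v) = v" using dh_inverse[OF c a(1) ac] by metis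
  have lin: "linear (dh c a)" by (rule dh_linear[OF c a(1) ac])
  have gen: "generator ph c p = dh c a (Z a)" using generator_phi[OF c a(1) ac] a by simp
  have E: "line_field e c p = span {dh c a (e a)}" if "field_inv e" for e
   using line_field_eq(2)[OF that c a(1) ac] a by simp
  obtain r s t where rst: "k v = r *R e1 a + s *R Z a + t *R e2 a" using span[OF a(1)] by blast
  hence "dh c a (k v) = r *R dh c a (e1 a) + s *R dh c a (Z a) + t *R dh c a (e2 a)"
   using lin by (simp add:linear_add linear_scale)
  hence v: "v = r *R dh c a (e1 a) + s *R generator ph c p + t *R dh c a (e2 a)" using k gen by simp
  show ?thesis
  proof (rule ex1I[of _ "(r *R dh c a (e1 a),s,t *R dh c a (e2 a))"])
   show "case (r *R dh c a (e1 a),s,t *R dh c a (e2 a)) of (x,r,b) =>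
      x:line_field e1 c p & b:line_field e2 c p & v = x + r *R generator ph c p + b"
    using v E[OF e1(1)] E[OF e2(1)] by (simp add:span_mul span_base)
   fix w assume w: "case w of (x,r,b) =>
      x:line_field e1 c p & b:line_field e2 c p & v = x + r *R generator ph c p + b"
   obtain x s' b where w': "w = (x,s',b)" by (cases w)
   then obtain r' t' where r': "x = r' *R dh c a (e1 a)" "b = t' *R dh c a (e2 a)"
    using w E[OF e1(1)] E[OF e2(1)] by (auto simp:span_singleton)
   have "v = r' *R dh c a (e1 a) + s' *R generator ph c p + t' *R dh c a (e2 a)" using w w' r' by simp
   hence "dh c a ((r - r') *R e1 a + (s - s') *R Z a + (t - t') *R e2 a) = 0"
    using v gen lin by (simp add:linear_add linear_scale linear_diff algebra_simps)
   hence "(r - r') *R e1 a + (s - s') *R Z a + (t - t') *R e2 a = 0"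
    using k(2) linear_0[OF k(1)] by metis
   hence "r - r' = 0 & s - s' = 0 & t - t' = 0" by (rule indep[OF a(1)])
   hence "r = r'" "s = s'" "t = t'" by simp_all
   thus "w = (r *R dh c a (e1 a),s,t *R dh c a (e2 a))" using w' r' by simp
  qed
 qed
 have "contracted_by A g ph (line_field e1)"
  using contraction[OF g e1, of 1] con1[OF adapted_nu[OF g e1(1)]] by simp
 moreover have "contracted_by A g (%t. ph (- t)) (line_field e2)"
  using contraction[OF g e2, of "-1"] con2[OF adapted_nu[OF g e2(1)]] by simp
 ultimately show ?thesis
  unfolding anosov_flow_def by (intro conjI exI[of _ g] exI[of _ "line_field e1"] exI[of _ "line_field e2"] smooth_flow_phi g line_subbundle_LS invariant_line_field e1 e2 ballI allI split)
qed

end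

section \<open>The profile of the derived-from-Anosov map\<close>

definition lam :: real where "lam = (3 + sqrt 5)/2"

lemma lam_bounds: "2<lam" "lam<3"
proof -
 have "1<sqrt (5::real)" "sqrt (5::real)<3" using real_less_lsqrt[of 3 5] by simp_all
 thus "2<lam" "lam<3" by (simp_all add:lam_def)
qed

lemma lam_sq: "lam*lam = 3*lam - 1"
proof -
 have "sqrt 5 * sqrt 5 = (5::real)" by simp
 thus ?thesis unfolding lam_def by (simp add:field_simps)
qed

lemma lam_inverse: "1/lam = 3 - lam"
 using lam_sq lam_bounds by (simp add:field_simps)

lemma lam_pos [simp]: "0<lam" "lam>1" "lam~=0" "0<=lam" "1<=lam"
 using lam_bounds by auto

text \<open>Solves \<open>4 * (lam - 1/lam) = gap * (1 - 1/lam)\<close>: a clamp rises by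
  \<open>4\<close>, and with the factor \<open>lam - 1/lam\<close> this moves the fixed point of a
  line of slope \<open>1/lam\<close> by exactly \<open>gap\<close>.\<close>

definition gap :: real where "gap = 4*lam + 4"

definition src :: "nat => real" where "src j = (real j - 1/2)*gap"

definition sad :: "nat => real" where "sad i = (real i - 1)*gap"

lemma gap_bounds: "12<gap" "gap<16" using lam_bounds by (simp_all add:gap_def)

lemma smooth_on_real_derivative:
 fixes g :: "real => real"
 assumes "smooth_on UNIV g"
 obtains g' where "!!x. (g has_real_derivative g' x) (at x)" "smooth_on UNIV g'"
proof
 show "smooth_on UNIV (%x. FD g (at x) 1)" by (rule smooth_on_frechet[OF assms])
 fix x
 have d: "(g has_derivative FD g (at x)) (at x)"
  by (rule smooth_on_has_derivative[OF assms]) simp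
 have "FD g (at x) = (*) (FD g (at x) 1)"
 proof
  show "FD g (at x) h = FD g (at x) 1*h" for h
   using linear_scale[OF has_derivative_linear[OF d], of h 1] by simp
 qed
 thus "(g has_real_derivative FD g (at x) 1) (at x)"
  using d by (simp add:has_field_derivative_def)
qed

lemma clamp_fn_deriv:
 obtains T' B where "!!x. (clamp_fn has_real_derivative T' x) (at x)" "!!x. T' x>=0"
  "!!x. abs x>2 ==> T' x = 0" "!!x. T' x<=B" "B>0"
proof -
 obtain T' where d: "!!x. (clamp_fn has_real_derivative T' x) (at x)" and sm: "smooth_on UNIV T'"
  using smooth_on_real_derivative[OF smooth_on_clamp_fn] by blast
 have nn: "T' x>=0" for x
  by (rule mono_on_imp_deriv_nonneg[of UNIV clamp_fn, OF _ d]) (auto intro!:mono_onI mono_clamp_fn)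
 have z: "T' x = 0" if x: "abs x>2" for x
 proof -
  have *: "(clamp_fn has_real_derivative 0) (at x)" if "x:S" "open S" "!!y. y:S ==> clamp_fn y = c" for S c
   by (rule has_field_derivative_transform_within_open[OF DERIV_const[of c] that(2,1)]) (simp add:that(3))
  have "(clamp_fn has_real_derivative 0) (at x)"
  proof (cases "x>0")
   case True
   thus ?thesis using *[of "{2<..}" 2] x by (auto simp:clamp_fn_ge)
  next
   case False
   thus ?thesis using *[of "{..< -2}" "-2"] x by (auto simp:clamp_fn_le)
  qed
  thus ?thesis using DERIV_unique d by blast
 qed
 have "compact (T' ` {-2..2})"
  by (intro compact_continuous_image continuous_on_subset[OF smooth_on_continuous[OF sm]]) auto
 then obtain B where B: "!!y. y:T' ` {-2..2} ==> abs y<=B"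
  using compact_imp_bounded bounded_real by metis
 have "T' x<=abs B + 1" for x
 proof (cases "abs x>2")
  case False
  hence "T' x:T' ` {-2..2}" by (intro imageI) auto
  thus ?thesis using B by fastforce
 qed (use z in auto)
 thus ?thesis using that[of T' "abs B + 1"] d nn z by auto
qed

text \<open>To \<open>x / lam\<close> one adds a clamp at every source, which raises the slope there
  to \<open>lam\<close>. Far away the gained height is taken back by wide, flat clamps. The points
  \<open>sad i\<close> lie on the plateaus between the sources.\<close>

lemma profile_exists:
 obtains P P' X0 where "smooth_on UNIV P" "!!x. (P has_real_derivative P' x) (at x)" "!!x. P' x>0"
  "!!j x. j<3 ==> abs(x - src j)<=1 ==> P x = src j + lam*(x - src j)"
  "!!x. (!!j. j<3 ==> lam<=abs(x - src j)) ==> P' x<=1/lam"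
  "!!i. i<=3 ==> P (sad i) = sad i"
  "!!x. X0<=abs x ==> P x = x/lam" "X0>64"
proof -
 obtain T' B where T': "!!x. (clamp_fn has_real_derivative T' x) (at x)" "!!x. T' x>=0"
  "!!x. abs x>2 ==> T' x = 0" "!!x. T' x<=B" "B>0"
  by (rule clamp_fn_deriv) blast
 let ?T = clamp_fn
 define c where "c = lam - 1/lam"
 have c: "c>0" "c<3" using lam_bounds lam_inverse by (auto simp:c_def)
 \<comment> \<open>The width of the compensating clamps, chosen such that
   \<open>c * B / V < 1 / lam\<close> and the slope stays positive.\<close>
 define V where "V = lam*c*B + 1"
 have V: "V>0" "lam*c*B<V" using c T'(5) by (simp_all add:V_def add_pos_pos)
 define m1 where "m1 = src 2 + 2 + 4*V + gap"
 define m2 where "m2 = src 0 - 2 - 2*V - gap"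
 \<comment> \<open>In units of \<open>c\<close> the three clamps rise by \<open>12\<close>. Of this
   \<open>8\<close> is taken back on the right, around \<open>m1\<close>, and \<open>4\<close> on
   the left, around \<open>m2\<close>; this distribution makes \<open>sad 1\<close> the
   origin.\<close>
 define P where "P x = x/lam + c*(?T (x - src 0) + ?T (x - src 1) + ?T (x - src 2)
   - 2*?T ((x - m1)/(2*V)) - ?T ((x - m2)/V))" for x
 define P' where "P' x = 1/lam + c*(T' (x - src 0) + T' (x - src 1) + T' (x - src 2)
   - T' ((x - m1)/(2*V))/V - T' ((x - m2)/V)/V)" for x
 have srcs: "src 0 = - gap/2" "src 1 = gap/2" "src 2 = 3*gap/2" by (simp_all add:src_def)
 note gb = gap_bounds lam_bounds
 have m1T: "?T ((x - m1)/(2*V)) = -2" and m1T': "T' ((x - m1)/(2*V)) = 0" if "x<=src 2 + gap" for x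
 proof -
  have "(x - m1)/(2*V) < -2" using that V by (simp add:m1_def pos_divide_less_eq)
  moreover from this have "abs((x - m1)/(2*V))>2" by linarith
  ultimately show "?T ((x - m1)/(2*V)) = -2" "T' ((x - m1)/(2*V)) = 0" using clamp_fn_le T'(3) by auto
 qed
 have m2T: "?T ((x - m2)/V) = 2" and m2T': "T' ((x - m2)/V) = 0" if "src 0 - gap<=x" for x
 proof -
  have "(x - m2)/V>2" using that V by (simp add:m2_def pos_less_divide_eq)
  moreover from this have "abs((x - m2)/V)>2" by linarith
  ultimately show "?T ((x - m2)/V) = 2" "T' ((x - m2)/V) = 0" using clamp_fn_ge T'(3) by auto
 qed
 have Pd: "(P has_real_derivative P' x) (at x)" for x
 proof -
  have ch: "((%x. ?T ((x - m)/w)) has_real_derivative T' ((x - m)/w)*(1/w)) (at x)" if "w~=0" for m w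
   by (rule DERIV_chain2[OF T'(1)]) (use that in "auto intro!:derivative_eq_intros")
  have "(P has_real_derivative 1/lam + c*(T' ((x - src 0)/1)*(1/1) + T' ((x - src 1)/1)*(1/1) + T' ((x - src 2)/1)*(1/1)
   - 2*(T' ((x - m1)/(2*V))*(1/(2*V))) - T' ((x - m2)/V)*(1/V))) (at x)"
   unfolding P_def[abs_def] using ch[of 1 "src 0"] ch[of 1 "src 1"] ch[of 1 "src 2"] ch[of "2*V" m1] ch[of V m2] V by (intro DERIV_add DERIV_cmult DERIV_diff DERIV_cdivide) auto
  thus ?thesis by (simp add:P'_def)
 qed
 have pos: "P' x>0" for x
 proof -
  have "T' ((x - m1)/(2*V))/V + T' ((x - m2)/V)/V<=B/V"
  proof (cases "x<=src 2 + gap")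
   case True
   thus ?thesis using m1T' T'(4) V by (simp add:divide_right_mono)
  next
   case False
   hence "src 0 - gap<=x" using srcs gb by simp
   thus ?thesis using m2T' T'(4) V by (simp add:divide_right_mono)
  qed
  hence "c*(T' ((x - m1)/(2*V))/V + T' ((x - m2)/V)/V)<=c*(B/V)"
   using c by (intro mult_left_mono) auto
  moreover have "c*(B/V)<1/lam" using V by (simp add:field_simps)
  moreover have "c*(T' (x - src 0) + T' (x - src 1) + T' (x - src 2))>=0" using c T'(2) by simp
  ultimately show ?thesis by (simp add:P'_def algebra_simps)
 qed
 have smT: "smooth_on UNIV (%x. ?T ((x - m)/w))" for m w
  unfolding divide_inverse by (rule smooth_on_compose_real[OF smooth_on_clamp_fn]) (auto intro!:smooth_on_mult smooth_on_diff smooth_on_id smooth_on_const)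
 have Psm: "smooth_on UNIV P"
 proof -
  have "smooth_on UNIV (%x. x*(1/lam) + c*(?T ((x - src 0)/1) + ?T ((x - src 1)/1) + ?T ((x - src 2)/1)
   - 2*?T ((x - m1)/(2*V)) - ?T ((x - m2)/V)))"
   by (intro smooth_on_add smooth_on_mult smooth_on_diff smT smooth_on_id smooth_on_const) auto
  thus ?thesis by (simp add:P_def[abs_def])
 qed
 have gapc: "4*c = gap*(1 - 1/lam)"
  by (simp add:c_def gap_def algebra_simps)
 have lin: "P x = src j + lam*(x - src j)" if j: "j<3" and x: "abs(x - src j)<=1" for j x
 proof -
  have j': "j = 0 | j = 1 | j = 2" using j by auto
  have xr: "x<=src 2 + gap" "src 0 - gap<=x" using j' x srcs gb by auto
  have far: "?T (x - src k) = (if k<j then 2 else -2)" if "k<3" "k~=j" for k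
  proof -
   have "k = 0 | k = 1 | k = 2" using that by auto
   thus ?thesis using j' x srcs gb that(2) by (auto intro!:clamp_fn_ge clamp_fn_le)
  qed
  have "?T (x - src 0) + ?T (x - src 1) + ?T (x - src 2) = (x - src j) + (4*real j - 4)"
   using j' far[of 0] far[of 1] far[of 2] clamp_fn_id[OF x] by auto
  hence "P x = x/lam + c*((x - src j) + (4*real j - 4) - 2*(-2) - 2)"
   unfolding P_def m1T[OF xr(1)] m2T[OF xr(2)] by simp
  hence "P x = x/lam + c*(x - src j) + c*(4*real j - 2)" by (simp add:algebra_simps)
  also have "c*(4*real j - 2) = 4*c*(real j - 1/2)" by simp
  also have "... = src j*(1 - 1/lam)" unfolding gapc by (simp add:src_def)
  finally show ?thesis by (simp add:c_def algebra_simps)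
 qed
 have fixp: "P (sad i) = sad i" if i: "i<=3" for i
 proof -
  have i': "i = 0 | i = 1 | i = 2 | i = 3" using i by auto
  have xr: "sad i<=src 2 + gap" "src 0 - gap<=sad i" using i' srcs gb by (auto simp:sad_def)
  have far: "?T (sad i - src k) = (if k<i then 2 else -2)" if "k<3" for k
  proof -
   have "k = 0 | k = 1 | k = 2" using that by auto
   thus ?thesis using i' srcs gb by (auto intro!:clamp_fn_ge clamp_fn_le simp:sad_def)
  qed
  have "?T (sad i - src 0) + ?T (sad i - src 1) + ?T (sad i - src 2) = 4*real i - 6"
   using i' far[of 0] far[of 1] far[of 2] by auto
  hence "P (sad i) = sad i/lam + c*(4*real i - 6 - 2*(-2) - 2)"
   unfolding P_def m1T[OF xr(1)] m2T[OF xr(2)] by simp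
  also have "c*(4*real i - 6 - 2*(-2) - 2) = 4*c*(real i - 1)" by simp
  also have "... = sad i*(1 - 1/lam)" unfolding gapc by (simp add:sad_def)
  finally show ?thesis by (simp add:algebra_simps)
 qed
 define X0 where "X0 = abs m1 + abs m2 + 4*V + 64"
 have out: "P x = x/lam" if x: "X0<=abs x" for x
 proof (cases "x>0")
  case True
  have b: "x - src 0>=2" "x - src 1>=2" "x - src 2>=2" "(x - m1)/(2*V)>=2" "(x - m2)/V>=2"
   using x True V srcs gb by (auto simp:X0_def pos_le_divide_eq)
  thus ?thesis by (simp add:P_def clamp_fn_ge)
 next
  case False
  have b: "x - src 0 <= -2" "x - src 1 <= -2" "x - src 2 <= -2" "(x - m1)/(2*V) <= -2" "(x - m2)/V <= -2"
   using x False V srcs gb by (auto simp:X0_def pos_divide_le_eq)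
  thus ?thesis by (simp add:P_def clamp_fn_le)
 qed
 have small: "P' x<=1/lam" if x: "!!j. j<3 ==> lam<=abs(x - src j)" for x
 proof -
  have "T' (x - src j) = 0" if "j<3" for j using x[OF that] gb T'(3) by auto
  moreover have "0<=c*(T' ((x - m1)/(2*V))/V + T' ((x - m2)/V)/V)"
   using c V T'(2) by simp
  ultimately show ?thesis by (simp add:P'_def algebra_simps)
 qed
 show ?thesis
  by (rule that[OF Psm Pd pos lin small fixp out]) (use V in "auto simp:X0_def")
qed

section \<open>The derived-from-Anosov map on the plane\<close>

locale da_map =
 fixes P P' :: "real => real" and X0 :: real
 assumes P_smooth: "smooth_on UNIV P" and P_deriv: "!!x. (P has_real_derivative P' x) (at x)" and P'_pos: "!!x. P' x>0"
  and P_src: "!!j x. j<3 ==> abs(x - src j)<=1 ==> P x = src j + lam*(x - src j)"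
  and P'_small: "!!x. (!!j. j<3 ==> lam<=abs(x - src j)) ==> P' x<=1/lam"
  and P_sad: "!!i. i<=3 ==> P (sad i) = sad i"
  and P_out: "!!x. X0<=abs x ==> P x = x/lam" and X0: "X0>64"
begin

text \<open>Makes the lattice translates of \<open>Box\<close> disjoint: a nonzero difference would
  violate \<open>Lat_big\<close>, as \<open>2 * (X0 + 1) * 6 = Kl < Kl^2\<close>.\<close>

definition "Kl = 12*(X0 + 1)"

text \<open>The ring \<open>Z[lam]\<close> under its two real embeddings, scaled by
  \<open>Kl\<close>; the conjugate of \<open>lam\<close> is \<open>1/lam\<close>. So
  \<open>Alin\<close> is multiplication by the unit \<open>lam\<close> and preserves the
  lattice.\<close>

definition Lat :: "(real*real) set" where
 "Lat = {(Kl*(of_int a + of_int b/lam),Kl*(of_int a + of_int b*lam)) | a b. True}"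

definition Alin :: "real*real => real*real" where "Alin v = (fst v/lam,lam * snd v)"
definition Ainv :: "real*real => real*real" where "Ainv v = (lam * fst v,snd v/lam)"

lemma Alin_inv [simp]: "Alin (Ainv v) = v" "Ainv (Alin v) = v" by (simp_all add:Alin_def Ainv_def)
lemma Alin_add: "Alin (v + w) = Alin v + Alin w" "Ainv (v + w) = Ainv v + Ainv w"
 "Alin (v - w) = Alin v - Alin w" "Ainv (v - w) = Ainv v - Ainv w" "Alin 0 = 0" "Ainv 0 = 0"
 by (simp_all add:Alin_def Ainv_def add_divide_distrib diff_divide_distrib algebra_simps zero_prod_def)

lemma Kl_pos: "Kl>0" using X0 by (simp add:Kl_def)

lemma Lat_0 [simp]: "0:Lat" by (auto simp:Lat_def zero_prod_def intro!:exI[of _ 0])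

lemma Lat_add: "v:Lat ==> w:Lat ==> v + w:Lat"
proof -
 assume "v:Lat" "w:Lat"
 then obtain a b c d where "v = (Kl*(of_int a + of_int b/lam),Kl*(of_int a + of_int b*lam))"
  "w = (Kl*(of_int c + of_int d/lam),Kl*(of_int c + of_int d*lam))" by (auto simp:Lat_def)
 hence "v + w = (Kl*(of_int (a + c) + of_int (b + d)/lam),Kl*(of_int (a + c) + of_int (b + d)*lam))"
  by (simp add:algebra_simps add_divide_distrib)
 thus ?thesis unfolding Lat_def by blast
qed

lemma Lat_uminus: "v:Lat ==> - v:Lat"
proof -
 assume "v:Lat"
 then obtain a b where "v = (Kl*(of_int a + of_int b/lam),Kl*(of_int a + of_int b*lam))" by (auto simp:Lat_def)
 hence "- v = (Kl*(of_int (- a) + of_int (- b)/lam),Kl*(of_int (- a) + of_int (- b)*lam))"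
  by (simp add:algebra_simps)
 thus ?thesis unfolding Lat_def by blast
qed

lemma Lat_diff: "v:Lat ==> w:Lat ==> v - w:Lat"
 using Lat_add[OF _ Lat_uminus] by simp

lemma Lat_lin: assumes "v:Lat" shows "Alin v:Lat" "Ainv v:Lat"
proof -
 obtain a b where v: "v = (Kl*(of_int a + of_int b/lam),Kl*(of_int a + of_int b*lam))"
  using assms by (auto simp:Lat_def)
 have il: "1/lam*(1/lam) = 3/lam - 1" using lam_sq by (simp add:field_simps)
 have "Alin v = (Kl*(of_int (- b) + of_int (a + 3*b)/lam),Kl*(of_int (- b) + of_int (a + 3*b)*lam))"
 proof -
  have "(of_int a + of_int b/lam)/lam = of_int a/lam + of_int b*(1/lam*(1/lam))" by (simp add:add_divide_distrib)
  also have "... = of_int (- b) + of_int (a + 3*b)/lam" unfolding il by (simp add:algebra_simps add_divide_distrib)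
  finally have x: "(of_int a + of_int b/lam)/lam = of_int (- b) + of_int (a + 3*b)/lam" .
  have "lam*(of_int a + of_int b*lam) = of_int a*lam + of_int b*(lam*lam)" by (simp add:algebra_simps)
  also have "... = of_int (- b) + of_int (a + 3*b)*lam" unfolding lam_sq by (simp add:algebra_simps)
  finally have y: "lam*(of_int a + of_int b*lam) = of_int (- b) + of_int (a + 3*b)*lam" .
  have "Alin v = (Kl*((of_int a + of_int b/lam)/lam),Kl*(lam*(of_int a + of_int b*lam)))"
   by (simp add:v Alin_def)
  thus ?thesis by (simp only:x y)
 qed
 thus "Alin v:Lat" unfolding Lat_def by blast
 have "Ainv v = (Kl*(of_int (3*a + b) + of_int (- a)/lam),Kl*(of_int (3*a + b) + of_int (- a)*lam))"
 proof -
  have 1: "lam = 3 - 1/lam" "1/lam = 3 - lam" using lam_inverse by auto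
  have "lam*(of_int a + of_int b/lam) = of_int a*lam + of_int b" by (simp add:distrib_left)
  also have "... = of_int (3*a + b) + of_int (- a)*(1/lam)" by (subst 1(1)) (simp add:algebra_simps)
  finally have x: "lam*(of_int a + of_int b/lam) = of_int (3*a + b) + of_int (- a)/lam" by simp
  have "(of_int a + of_int b*lam)/lam = of_int a*(1/lam) + of_int b" by (simp add:add_divide_distrib)
  also have "... = of_int (3*a + b) + of_int (- a)*lam" unfolding 1(2) by (simp add:algebra_simps)
  finally have y: "(of_int a + of_int b*lam)/lam = of_int (3*a + b) + of_int (- a)*lam" .
  have "Ainv v = (Kl*(lam*(of_int a + of_int b/lam)),Kl*((of_int a + of_int b*lam)/lam))"
   by (simp add:v Ainv_def)
  thus ?thesis by (simp only:x y)
 qed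
 thus "Ainv v:Lat" unfolding Lat_def by blast
qed

lemma five_not_square:
 fixes m n :: int assumes "m^2 = 5*n^2" shows "n = 0"
proof (rule ccontr)
 assume n: "n~=0"
 hence m: "m~=0" using assms by auto
 have "multiplicity 5 (m^2) = 2*multiplicity 5 m"
  using m by (simp add:prime_elem_multiplicity_power_distrib)
 moreover have "multiplicity 5 (5*n^2) = Suc (2*multiplicity 5 n)"
  using n by (simp add:multiplicity_times_same prime_elem_multiplicity_power_distrib)
 ultimately have "2*multiplicity 5 m = Suc (2*multiplicity 5 n)" using assms by simp
 thus False by presburger
qed

text \<open>The product of the coordinates is \<open>Kl^2\<close> times the norm
  \<open>a^2 + 3*a*b + b^2\<close>, an integer which vanishes only at zero because its discriminant
  \<open>5\<close> is not a square.\<close>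

lemma Lat_big:
 assumes "v:Lat" "v~=0" shows "abs(fst v)*abs(snd v)>=Kl^2"
proof -
 obtain a b where v: "v = (Kl*(of_int a + of_int b/lam),Kl*(of_int a + of_int b*lam))"
  using assms by (auto simp:Lat_def)
 have "(of_int a + of_int b/lam)*(of_int a + of_int b*lam) = of_int a^2 + of_int a * of_int b*(lam + 1/lam) + of_int b^2"
  by (simp add:field_simps power2_eq_square)
 also have "lam + 1/lam = 3" using lam_inverse by simp
 finally have e: "(of_int a + of_int b/lam)*(of_int a + of_int b*lam) = of_int (a^2 + 3*a*b + b^2)" by simp
 have "a^2 + 3*a*b + b^2~=0"
 proof
  assume 0: "a^2 + 3*a*b + b^2 = 0"
  have "(2*a + 3*b)^2 = 4*(a^2 + 3*a*b + b^2) + 5*b^2" by (simp add:power2_eq_square algebra_simps)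
  hence "b = 0" using 0 five_not_square by simp
  hence "a = 0" using 0 by simp
  thus False using v `b = 0` assms(2) by (simp add:zero_prod_def)
 qed
 hence "1<=abs(real_of_int (a^2 + 3*a*b + b^2))" by linarith
 hence "Kl^2*1<=Kl^2*abs(real_of_int (a^2 + 3*a*b + b^2))" by (intro mult_left_mono) auto
 also have "... = abs(fst v)*abs(snd v)"
  unfolding e[symmetric] v by (simp add:abs_mult power2_eq_square)
 finally show ?thesis by simp
qed

definition Box :: "(real*real) set" where "Box = {p. abs(fst p)<X0 + 1 & abs(snd p)<3}"

lemma Lat_small:
 assumes "v:Lat" "abs(fst v)<=2*(X0 + 1)" "abs(snd v)<=6" shows "v = 0"
proof (rule ccontr)
 assume "v~=0"
 hence "Kl^2<=abs(fst v)*abs(snd v)" using Lat_big assms by blast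
 also have "... <= 2*(X0 + 1)*6" using assms by (intro mult_mono) auto
 also have "... = Kl*1" by (simp add:Kl_def)
 also have "... < Kl*Kl" using X0 by (intro mult_strict_left_mono) (auto simp:Kl_def)
 finally show False by (simp add:power2_eq_square)
qed

lemma Box_unique: "v:Lat ==> w:Lat ==> p - v:Box ==> p - w:Box ==> v = w"
 using Lat_small[OF Lat_diff[of v w]] by (auto simp:Box_def)

text \<open>Replaces \<open>x / lam\<close> by \<open>P x\<close> where \<open>bump\<close> is
  \<open>1\<close>. Its support keeps distance \<open>1\<close> from the complement of
  \<open>Box\<close>, so the periodic extension \<open>bb\<close> is smooth.\<close>

definition pert :: "real*real => real" where "pert u = bump (snd u)*(P (fst u) - fst u/lam)"

definition bb :: "real*real => real" where
 "bb p = (if EX v:Lat. p - v:Box then pert (p - (SOME v. v:Lat & p - v:Box)) else 0)"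

lemma bb_Box: "v:Lat ==> p - v:Box ==> bb p = pert (p - v)"
proof -
 assume v: "v:Lat" "p - v:Box"
 have "(SOME v. v:Lat & p - v:Box) = v"
  by (rule some_equality) (use v Box_unique in blast)+
 thus ?thesis using v unfolding bb_def by auto
qed

lemma bb_add: "v:Lat ==> bb (p + v) = bb p"
proof (cases "EX w:Lat. p - w:Box")
 case True
 assume v: "v:Lat"
 obtain w where w: "w:Lat" "p - w:Box" using True by blast
 hence "bb p = pert (p - w)" "bb (p + v) = pert (p + v - (w + v))"
  using bb_Box[of "w + v" "p + v"] bb_Box Lat_add v by auto
 thus ?thesis by simp
next
 case False
 assume v: "v:Lat"
 have "~ (EX w:Lat. p + v - w:Box)"
 proof
  assume "EX w:Lat. p + v - w:Box"
  then obtain w where "w:Lat" "p - (w - v):Box" by (auto simp:algebra_simps)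
  thus False using False Lat_diff v by blast
 qed
 thus ?thesis using False by (simp add:bb_def)
qed

lemma pert_out: "X0<=abs(fst u) | 2<=abs(snd u) ==> pert u = 0"
 by (auto simp:pert_def P_out bump_0)

lemma open_Box: "open Box"
proof -
 have "Box = {-(X0 + 1)<..<X0 + 1} \<times> {-3<..<3}" by (auto simp:Box_def)
 thus ?thesis by (simp add:open_Times)
qed

lemma smooth_pert: "smooth_on UNIV pert"
proof -
 have "smooth_on UNIV (%u::real\<times>real. bump (snd u)*(P (fst u) - fst u*(1/lam)))"
  by (intro smooth_on_mult smooth_on_diff smooth_on_compose_real[OF smooth_on_bump] smooth_on_compose_real[OF P_smooth] smooth_on_fst smooth_on_snd smooth_on_id smooth_on_const) auto
 thus ?thesis by (simp add:pert_def[abs_def])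
qed

lemma local_form:
 "EX U v. open U & p:U & v:Lat & ((p - v:Box & (ALL u:U. u - v:Box & bb u = pert (u - v))) |
   ((ALL w:Lat. p - w~:Box) & (ALL u:U. bb u = 0)))"
proof (cases "EX v:Lat. p - v:Box")
 case True
 then obtain v where v: "v:Lat" "p - v:Box" by blast
 have "open ((%u. u - v) -` Box)" by (intro open_Box continuous_intros)
 thus ?thesis using v bb_Box by blast
next
 case False
 have z: "bb u = 0" if "u:ball p 1" for u
 proof (rule ccontr)
  assume "bb u~=0"
  hence "EX v:Lat. u - v:Box" unfolding bb_def by presburger
  then obtain v where v: "v:Lat" "u - v:Box" by blast
  hence "pert (u - v)~=0" using bb_Box `bb u~=0` by metis
  hence "~ (X0<=abs(fst (u - v)) | 2<=abs(snd (u - v)))" using pert_out by blast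
  hence "abs(fst (u - v))<X0" "abs(snd (u - v))<2" by auto
  moreover have "abs(fst (p - u))<=norm (p - u)" "abs(snd (p - u))<=norm (p - u)"
   using norm_fst_le[of "fst (p - u)" "snd (p - u)"] norm_snd_le[of "snd (p - u)" "fst (p - u)"] unfolding prod.collapse by auto
  moreover have "norm (p - u)<1" using that by (simp add:dist_norm)
  ultimately have "p - v:Box" by (auto simp:Box_def)
  thus False using False v by blast
 qed
 show ?thesis
  by (rule exI[of _ "ball p 1"], rule exI[of _ 0]) (use z False in auto)
qed

lemma smooth_bb: "smooth_on UNIV bb"
proof (rule smooth_on_local)
 fix p :: "real*real"
 obtain U v where U: "open U" "p:U" "(ALL u:U. bb u = pert (u - v)) | (ALL u:U. bb u = 0)"
  using local_form[of p] by blast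
 have "smooth_on U (%u. pert (u - v))"
  by (rule smooth_on_compose[OF smooth_pert smooth_on_diff[OF U(1) smooth_on_id[OF U(1)] smooth_on_const] U(1)]) auto
 hence "smooth_on U bb"
  using U(3) smooth_on_cong[OF U(1), of bb "%u. pert (u - v)"] smooth_on_cong[OF U(1), of bb "%u. 0"] smooth_on_const[of U 0] by auto
 thus "EX U. open U & p:U & smooth_on U bb" using U by blast
qed

text \<open>\<open>Fx\<close> and \<open>Fy\<close> are the partial derivatives of the first
  coordinate of the map \<open>fm\<close> introduced below.\<close>

definition Fx :: "real*real => real" where "Fx p = 1/lam + FD bb (at p) (1,0)"
definition Fy :: "real*real => real" where "Fy p = FD bb (at p) (0,1)"

lemma smooth_Fx: "smooth_on UNIV Fx" and smooth_Fy: "smooth_on UNIV Fy"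
 unfolding Fx_def[abs_def] Fy_def[abs_def] by (intro smooth_on_add smooth_on_const smooth_on_frechet[OF smooth_bb]; simp)+

lemma bb_deriv: "(bb has_derivative (%h. (Fx p - 1/lam) * fst h + Fy p * snd h)) (at p)"
proof -
 have d: "(bb has_derivative FD bb (at p)) (at p)"
  by (rule smooth_on_has_derivative[OF smooth_bb]) simp
 have lin: "linear (FD bb (at p))" using has_derivative_linear[OF d] .
 have "FD bb (at p) h = (Fx p - 1/lam) * fst h + Fy p * snd h" for h
 proof -
  have "h = fst h *R (1,0) + snd h *R (0,1)" by simp
  hence "FD bb (at p) h = fst h *R FD bb (at p) (1,0) + snd h *R FD bb (at p) (0,1)"
   using linear_add[OF lin] linear_scale[OF lin] by metis
  thus ?thesis by (simp add:Fx_def Fy_def)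
 qed
 hence "FD bb (at p) = (%h. (Fx p - 1/lam) * fst h + Fy p * snd h)" by auto
 thus ?thesis using d by simp
qed

lemma derivs_Box:
 assumes "v:Lat" "p - v:Box"
 shows "Fx p = 1/lam + bump (snd (p - v))*(P' (fst (p - v)) - 1/lam)" and "abs(snd (p - v))<1 ==> Fy p = 0"
proof -
 let ?u = "p - v"
 have opn: "open ((%u. u - v) -` Box)" by (intro open_Box continuous_intros)
 have "(pert has_derivative FD pert (at ?u)) (at ?u)"
  by (rule smooth_on_has_derivative[OF smooth_pert]) simp
 hence pd: "((%u. pert (u - v)) has_derivative FD pert (at ?u)) (at p)"
 proof -
  have "((%u. u - v) has_derivative (%h. h)) (at p)" by (auto intro!:derivative_eq_intros)
  from diff_chain_at[OF this, of pert] `(pert has_derivative _) _` show ?thesis by (simp add:o_def)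
 qed
 have fd: "FD bb (at p) = FD pert (at ?u)"
  by (rule frechet_derivative_cong_open(2)[OF opn, of p bb "%u. pert (u - v)"]) (use assms bb_Box pd in auto)
 have along: "((%t. pert (?u + t *R h)) has_real_derivative FD pert (at ?u) h) (at 0)" for h
 proof -
  have l: "((%t. ?u + t *R h) has_derivative (%t. t *R h)) (at 0)" by (auto intro!:derivative_eq_intros)
  have p: "(pert has_derivative FD pert (at ?u)) (at (?u + 0 *R h))"
   using smooth_on_has_derivative[OF smooth_pert, of ?u] by simp
  have "((%t. pert (?u + t *R h)) has_derivative (%t. FD pert (at ?u) (t *R h))) (at 0)"
   using diff_chain_at[OF l p] by (simp add:o_def)
  moreover have "(%t. FD pert (at ?u) (t *R h)) = (*) (FD pert (at ?u) h)"
   using linear_scale[OF has_derivative_linear[OF p]] by auto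
  ultimately show ?thesis by (simp add:has_field_derivative_def)
 qed
 have "((%t. pert (?u + t *R (1,0))) has_real_derivative bump (snd ?u)*(P' (fst ?u) - 1/lam)) (at 0)"
 proof -
  have "((%t. P (fst ?u + t)) has_real_derivative P' (fst ?u)) (at 0)"
   using DERIV_shift[of P "P' (fst ?u)" 0 "fst ?u"] P_deriv[of "fst ?u"] by (simp add:add.commute)
  thus ?thesis by (auto simp:pert_def intro!:derivative_eq_intros)
 qed
 hence "FD pert (at ?u) (1,0) = bump (snd ?u)*(P' (fst ?u) - 1/lam)"
  using along DERIV_unique by blast
 thus "Fx p = 1/lam + bump (snd (p - v))*(P' (fst (p - v)) - 1/lam)" by (simp add:Fx_def fd)
 assume y: "abs(snd (p - v))<1"
 have "((%t. pert (?u + t *R (0,1))) has_real_derivative 0) (at 0)"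
  by (rule has_field_derivative_transform_within_open[OF DERIV_const[of "P (fst ?u) - fst ?u/lam"], of "{t. abs(snd ?u + t)<1}"]) (use y in "auto simp:pert_def bump_1 intro!:open_Collect_less continuous_intros")
 hence "FD pert (at ?u) (0,1) = 0" using along DERIV_unique by blast
 thus "Fy p = 0" by (simp add:Fy_def fd)
qed

lemma derivs_out: "ALL w:Lat. p - w~:Box ==> Fx p = 1/lam & Fy p = 0"
proof -
 assume out: "ALL w:Lat. p - w~:Box"
 then obtain U where U: "open U" "p:U" "ALL u:U. bb u = 0" using local_form[of p] by blast
 have "FD bb (at p) = (%h. 0)"
  by (rule frechet_derivative_cong_open(2)[OF U(1,2), of _ "%u. 0"]) (use U in auto)
 thus ?thesis by (simp add:Fx_def Fy_def)
qed

text \<open>Inside a box this is a convex combination of \<open>1/lam\<close> and a value of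
  \<open>P'\<close>.\<close>

lemma Fx_pos: "Fx p>0"
proof (cases "EX v:Lat. p - v:Box")
 case True
 then obtain v where v: "v:Lat" "p - v:Box" by blast
 let ?b = "bump (snd (p - v))"
 have "Fx p = (1 - ?b)*(1/lam) + ?b*P' (fst (p - v))" using derivs_Box(1)[OF v] by (simp add:algebra_simps)
 moreover have "0<=?b" "?b<=1" using bump_range by auto
 ultimately show ?thesis using P'_pos[of "fst (p - v)"] by (cases "?b = 0") (auto intro!:add_nonneg_pos)
next
 case False
 thus ?thesis using derivs_out by auto
qed

end

text \<open>The derivative of \<open>g\<close> at \<open>y\<close> is \<open>k (g y)\<close>, so the
  regularity of \<open>g\<close> improves by one order at a time through composition with the smooth
  \<open>k\<close>.\<close>

lemma smooth_on_inverse_map: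
 fixes f g :: "'e::euclidean_space => 'e"
 assumes S: "open S" "open T" and g: "!!x. x:S ==> g (f x) = x" "!!y. y:T ==> g y:S & f (g y) = y"
  and f: "!!x. x:S ==> (f has_derivative f' x) (at x)" and k: "!!x v. x:S ==> f' x (k x v) = v"
  and ksm: "!!v. smooth_on S (%x. k x v)" and klin: "!!x. x:S ==> linear (k x)"
 shows "smooth_on T g" "!!y. y:T ==> (g has_derivative k (g y)) (at y)"
proof -
 show d: "(g has_derivative k (g y)) (at y)" if y: "y:T" for y
 proof -
  have x: "g y:S" "f (g y) = y" using g y by auto
  have "continuous_on S f" using f has_derivative_continuous continuous_at_imp_continuous_on by blast
  hence "(g has_derivative k (g y)) (at (f (g y)))"
   by (rule has_derivative_inverse_strong[OF S(1) x(1)]) (use g f x k in "auto simp:o_def id_def")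
  thus ?thesis by (simp add:x)
 qed
 have "Ck_on n T g" for n
 proof (induction n)
  case 0
  have "isCont g y" if "y:T" for y using has_derivative_continuous[OF d[OF that]] .
  thus ?case by (simp add:continuous_at_imp_continuous_on)
 next
  case (Suc n)
  have "Ck_on n T (%y. k (g y) v)" for v
   by (rule Ck_on_compose[OF S(2,1) _ Suc.IH]) (use g ksm in "auto simp:smooth_on_def")
  thus ?case by (intro Ck_on_SucI[OF S(2) d])
 qed
 thus "smooth_on T g" by (simp add:smooth_on_def)
qed

section \<open>The planar map \<open>fm\<close>, its sources and the punctured plane
  \<open>U\<close>\<close>

definition nrm :: "real*real => real" where "nrm u = max (abs(fst u)) (abs(snd u))"

definition cs :: "nat => real*real" where "cs j = (src j,0)"

lemma nrm_scale: "nrm (c *R u) = abs c*nrm u"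
 by (simp add:nrm_def abs_mult max_mult_distrib_left)

lemma nrm_0 [simp]: "nrm u = 0 <-> u = 0" "nrm u>=0"
 by (auto simp:nrm_def prod_eq_iff max_def)

lemma nrm_zero [simp]: "nrm 0 = 0" by simp

lemma nrm_minus: "nrm (u - w) = nrm (w - u)" by (simp add:nrm_def abs_minus_commute)

lemma nrm_pos: "u~=0 ==> nrm u>0" using nrm_0[of u] by linarith

lemma continuous_on_nrm [continuous_intros]: "continuous_on S f ==> continuous_on S (%x. nrm (f x))"
 unfolding nrm_def by (intro continuous_intros)

lemma src_bounds: "j<3 ==> abs(src j)<24" "sad j + 6<src j" "src j + 6<sad (Suc j)"
 "j<3 ==> sad 0 + 6<src j" "j<3 ==> src j + 6<sad 3"
proof -
 note gb = gap_bounds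
 show "sad j + 6<src j" "src j + 6<sad (Suc j)" using gb by (auto simp:src_def sad_def algebra_simps)
 assume "j<3"
 hence "j = 0 | j = 1 | j = 2" by auto
 thus "abs(src j)<24" "sad 0 + 6<src j" "src j + 6<sad 3" using gb by (auto simp:src_def sad_def)
qed

lemma src_sep: "j<3 ==> k<3 ==> j~=k ==> abs(src j - src k)>12"
proof -
 assume "j<3" "k<3" "j~=k"
 hence "abs(real j - real k)>=1" by linarith
 hence "gap*1<=gap*abs(real j - real k)" using gap_bounds by simp
 also have "... = abs(src j - src k)" 
 proof -
  have "src j - src k = gap*(real j - real k)" by (simp add:src_def algebra_simps)
  thus ?thesis using gap_bounds by (simp add:abs_mult)
 qed
 finally show ?thesis using gap_bounds by linarith
qed

context da_map
begin

definition fm :: "real*real => real*real" where "fm p = (fst p/lam + bb p,lam * snd p)"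

lemma fm_add: "v:Lat ==> fm (p + v) = fm p + Alin v"
 by (simp add:fm_def bb_add Alin_def add_divide_distrib algebra_simps)

lemma fm_deriv: "(fm has_derivative (%h. (Fx p * fst h + Fy p * snd h,lam * snd h))) (at p)"
proof -
 have "(fm has_derivative (%h. (fst h/lam + ((Fx p - 1/lam) * fst h + Fy p * snd h),lam * snd h))) (at p)"
  unfolding fm_def[abs_def] by (intro has_derivative_Pair has_derivative_add bb_deriv) (auto intro!:derivative_eq_intros)
 thus ?thesis by (rule has_derivative_eq_rhs) (auto simp:algebra_simps)
qed

lemma smooth_fm: "smooth_on UNIV fm"
proof -
 have "smooth_on UNIV (%p::real\<times>real. (fst p*(1/lam) + bb p,lam * snd p))"
  by (intro smooth_on_Pair smooth_on_add smooth_on_mult smooth_on_fst smooth_on_snd smooth_on_id smooth_on_const smooth_bb) auto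
 thus ?thesis by (simp add:fm_def[abs_def])
qed

lemma pert_bounded: "EX C. ALL p. abs(bb p)<=C"
proof -
 have "compact (pert ` ({-(X0+1)..X0+1} \<times> {-3..3}))"
  by (intro compact_continuous_image continuous_on_subset[OF smooth_on_continuous[OF smooth_pert]] compact_Times) auto
 then obtain C where C: "!!y. y:pert ` ({-(X0+1)..X0+1} \<times> {-3..3}) ==> abs y<=C"
  using compact_imp_bounded bounded_real by metis
 have "abs(bb p)<=abs C" for p
 proof (cases "EX v:Lat. p - v:Box")
  case True
  then obtain v where v: "v:Lat" "p - v:Box" by blast
  hence "pert (p - v):pert ` ({-(X0+1)..X0+1} \<times> {-3..3})"
   by (intro imageI) (auto simp:Box_def mem_Times_iff)
  thus ?thesis using C bb_Box[OF v] by fastforce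
 qed (simp add:bb_def)
 thus ?thesis by blast
qed

lemma fst_fm_deriv: "((%x. fst (fm (x,y))) has_real_derivative Fx (x,y)) (at x)"
proof -
 have "((%x. (x,y)) has_derivative (%h. (h,0))) (at x)" by (auto intro!:derivative_eq_intros)
 from diff_chain_at[OF this fm_deriv[of "(x,y)"]]
 have "((%x. fm (x,y)) has_derivative (%h. (Fx (x,y)*h,0))) (at x)" by (simp add:o_def)
 from has_derivative_fst[OF this] show ?thesis by (simp add:has_field_derivative_def)
qed

lemma fst_fm_mono: "x<x' ==> fst (fm (x,y))<fst (fm (x',y))"
 by (rule DERIV_pos_imp_increasing) (use fst_fm_deriv Fx_pos in blast)+

text \<open>Horizontal lines go to horizontal lines, increasingly by \<open>Fx_pos\<close>.
  Surjectivity is the intermediate value theorem, as \<open>bb\<close> is bounded.\<close>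

lemma bij_fm: "bij fm"
proof (rule bijI)
 show "inj fm"
 proof (rule injI)
  fix p p' assume eq: "fm p = fm p'"
  hence y: "snd p = snd p'" by (simp add:fm_def)
  have "fst p = fst p'"
  proof (rule ccontr)
   assume "fst p~=fst p'"
   hence "fst p<fst p' | fst p'<fst p" by linarith
   moreover have "fst (fm (fst p,snd p)) = fst (fm (fst p',snd p))" using eq y by (metis prod.collapse)
   ultimately show False using fst_fm_mono[of "fst p" "fst p'" "snd p"] fst_fm_mono[of "fst p'" "fst p" "snd p"] by auto
  qed
  thus "p = p'" using y by (simp add:prod_eq_iff)
 qed
 show "surj fm"
 proof (rule surjI)
  fix w :: "real*real"
  obtain C where C: "!!p. abs(bb p)<=C" using pert_bounded by blast
  have C0: "0<=C" using C[of 0] by linarith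
  let ?g = "%x. fst (fm (x,snd w/lam))"
  have "continuous_on UNIV ?g"
   by (intro continuous_at_imp_continuous_on ballI DERIV_isCont[OF fst_fm_deriv])
  moreover have "?g (lam*(fst w - C))<=fst w" "fst w<=?g (lam*(fst w + C))"
   using C[of "(lam*(fst w - C),snd w/lam)"] C[of "(lam*(fst w + C),snd w/lam)"] by (auto simp:fm_def)
  moreover have "lam*(fst w - C)<=lam*(fst w + C)" using C0 by simp
  ultimately obtain x where "?g x = fst w"
   using IVT'[of ?g "lam*(fst w - C)" "fst w" "lam*(fst w + C)"] continuous_on_subset by blast
  hence "EX p. fm p = w" by (intro exI[of _ "(x,snd w/lam)"]) (simp add:fm_def)
  thus "fm (SOME p. fm p = w) = w" by (rule someI_ex)
 qed
qed

definition fi :: "real*real => real*real" where "fi = inv_into UNIV fm"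

lemma fi_fm [simp]: "fi (fm p) = p" and fm_fi [simp]: "fm (fi p) = p"
 using bij_fm by (simp_all add:fi_def bij_is_inj bij_is_surj surj_f_inv_f)

lemma snd_fm [simp]: "snd (fm p) = lam * snd p" by (simp add:fm_def)

lemma snd_fi [simp]: "snd (fi p) = snd p/lam"
 using snd_fm[of "fi p"] by simp

lemma fi_eqI: "fm p = w ==> fi w = p" by auto

lemma fi_add: "v:Lat ==> fi (p + v) = fi p + Ainv v"
 by (rule fi_eqI) (use fm_add[OF Lat_lin(2)] in simp)

lemma fi_deriv_smooth: "smooth_on UNIV fi"
  "(fi has_derivative (%h. ((fst h - Fy (fi p)*(snd h/lam))/Fx (fi p),snd h/lam))) (at p)"
proof -
 let ?k = "%x h. ((fst h - Fy x*(snd h/lam))/Fx x,snd h/lam)"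
 have k: "smooth_on UNIV (%x. ?k x v)" for v
  by (intro smooth_on_Pair smooth_on_divide smooth_on_diff smooth_on_mult smooth_on_const smooth_Fx smooth_Fy) (use Fx_pos in "auto simp:less_imp_neq[symmetric]")
 have lin: "linear (?k x)" for x
  by (rule linearI) (auto simp:add_divide_distrib diff_divide_distrib algebra_simps)
 have inv: "(Fx x * fst (?k x v) + Fy x * snd (?k x v),lam * snd (?k x v)) = v" for x v
  using Fx_pos[of x] by simp
 show "smooth_on UNIV fi"
  by (rule smooth_on_inverse_map(1)[OF open_UNIV open_UNIV, of fi fm "%p h. (Fx p * fst h + Fy p * snd h,lam * snd h)" ?k]) (use k lin inv fm_deriv in auto)
 show "(fi has_derivative ?k (fi p)) (at p)"
  by (rule smooth_on_inverse_map(2)[OF open_UNIV open_UNIV, of fi fm "%p h. (Fx p * fst h + Fy p * snd h,lam * snd h)" ?k]) (use k lin inv fm_deriv in auto)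
qed

lemma P_mono: "x<x' ==> P x<P x'"
 by (rule DERIV_pos_imp_increasing) (use P_deriv P'_pos in blast)+

lemma P_mono_le: "x<=x' ==> P x<=P x'" using P_mono by (cases "x = x'") (auto simp:less_imp_le)

lemma P_inj: "P x = P x' ==> x = x'" using P_mono by (metis less_irrefl linorder_neqE)

lemma sad_bounds: "- X0<sad 0" "sad 3<X0" "i<=3 ==> sad 0<=sad i" "i<=3 ==> sad i<=sad 3"
proof -
 show "- X0<sad 0" "sad 3<X0" using gap_bounds X0 by (auto simp:sad_def)
 assume "i<=3"
 moreover have "sad i<=sad k" if "i<=k" for i k using that gap_bounds by (simp add:sad_def)
 ultimately show "sad 0<=sad i" "sad i<=sad 3" by auto
qed

lemma P_surj: "sad 0<=x ==> x<=sad 3 ==> EX w. sad 0<=w & w<=sad 3 & P w = x"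
 using IVT'[of P "sad 0" x "sad 3"] P_sad[of 0] P_sad[of 3] continuous_on_subset[OF smooth_on_continuous[OF P_smooth]] by auto

definition "Pi' x = inv_into {sad 0..sad 3} P x"

lemma Pi'_in: "sad 0<=x ==> x<=sad 3 ==> sad 0<=Pi' x & Pi' x<=sad 3 & P (Pi' x) = x"
proof -
 assume "sad 0<=x" "x<=sad 3"
 hence "x:P ` {sad 0..sad 3}" using P_surj by force
 thus ?thesis using inv_into_into[of x P "{sad 0..sad 3}"] f_inv_into_f[of x P "{sad 0..sad 3}"] by (auto simp:Pi'_def)
qed

lemma fm_Box: "v:Lat ==> abs(fst u)<X0 + 1 ==> abs(snd u)<=1 ==> fm (v + u) = Alin v + (P (fst u),lam * snd u)"
proof -
 assume a: "v:Lat" "abs(fst u)<X0 + 1" "abs(snd u)<=1"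
 have "bb u = pert u" using bb_Box[of 0 u] a by (simp add:Box_def)
 hence "fm u = (P (fst u),lam * snd u)" using a by (simp add:fm_def pert_def bump_1)
 thus ?thesis using fm_add[OF a(1), of u] by (simp add:add.commute)
qed

lemma fi_Box: "v:Lat ==> sad 0<=fst u ==> fst u<=sad 3 ==> abs(snd u)<=lam ==>
  fi (v + u) = Ainv v + (Pi' (fst u),snd u/lam)"
 by (rule fi_eqI, subst fm_Box) (use Pi'_in[of "fst u"] sad_bounds Lat_lin X0 in "auto simp:prod_eq_iff field_simps abs_less_iff")

lemma fm_lin: "v:Lat ==> j<3 ==> nrm u<=1 ==> fm (v + cs j + u) = Alin v + cs j + lam *R u"
 using fm_Box[of v "cs j + u"] src_bounds(1)[of j] P_src[of j "src j + fst u"] X0 by (auto simp:cs_def nrm_def add.assoc prod_eq_iff)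

lemma fi_lin: "v:Lat ==> j<3 ==> nrm u<=lam ==> fi (v + cs j + u) = Ainv v + cs j + (1/lam) *R u"
 by (rule fi_eqI, subst fm_lin) (auto simp:Lat_lin nrm_scale)

definition Zn :: "real => (real*real) set" where
 "Zn r = {p. EX v:Lat. EX j<3. nrm (p - v - cs j)<r}"

definition cen :: "(real*real) set" where "cen = {v + cs j | v j. v:Lat & j<3}"

lemma cenI: "v:Lat ==> j<3 ==> v + cs j:cen" unfolding cen_def by blast

lemma cenE: assumes "p:cen" obtains v j where "v:Lat" "j<3" "p = v + cs j"
 using assms unfolding cen_def by blast

lemma ZnE: assumes "p:Zn r" obtains v j u where "v:Lat" "j<3" "nrm u<r" "p = v + cs j + u"
proof -
 obtain v j where "v:Lat" "j<3" "nrm (p - v - cs j)<r" using assms by (auto simp:Zn_def)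
 thus ?thesis using that[of v j "p - v - cs j"] by simp
qed

lemma ZnI: "v:Lat ==> j<3 ==> nrm u<r ==> v + cs j + u:Zn r"
 unfolding Zn_def by force

lemma Zn_mono: "r<=r' ==> Zn r<=Zn r'" unfolding Zn_def by force

lemma open_Zn: "open (Zn r)"
proof -
 have "Zn r = (UN v:Lat. UN j:{..<3}. {p. nrm (p - v - cs j)<r})" by (auto simp:Zn_def)
 thus ?thesis by (auto intro!:open_Collect_less continuous_intros)
qed

text \<open>Lattice vectors are long and the sources of one translate are more than
  \<open>12\<close> apart, so squares of half side \<open>3\<close> around different sources are
  disjoint.\<close>

lemma cs_unique:
 assumes "v:Lat" "w:Lat" "j<3" "k<3" "v + cs j + u = w + cs k + u'" "nrm u<=3" "nrm u'<=3"
 shows "v = w & j = k & u = u'"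
proof -
 have e: "v - w = cs k - cs j + (u' - u)" using assms(5) by (simp add:algebra_simps)
 have b: "abs(fst u)<=3" "abs(snd u)<=3" "abs(fst u')<=3" "abs(snd u')<=3" using assms(6,7) by (auto simp:nrm_def)
 have "v - w = 0"
  by (rule Lat_small[OF Lat_diff]) (use e b assms src_bounds(1)[of j] src_bounds(1)[of k] X0 in "auto simp:cs_def")
 hence vw: "v = w" by simp
 hence "cs k - cs j + (u' - u) = 0" using e by simp
 hence "src k - src j = fst u - fst u'" by (simp add:cs_def prod_eq_iff)
 hence "j = k" using src_sep[of j k] assms b by force
 thus ?thesis using vw assms(5) by simp
qed

lemma Zn_fi: "p:Zn lam ==> fi p:Zn 1"
 by (erule ZnE) (simp add:fi_lin nrm_scale ZnI Lat_lin)

lemma Zn_fm: "p:Zn 1 ==> fm p:Zn lam"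
 by (erule ZnE) (simp add:fm_lin nrm_scale ZnI Lat_lin)

lemma Zn_Box: "v:Lat ==> j<3 ==> nrm u<lam ==> v + cs j + u - v:Box"
 using src_bounds(1)[of j] X0 lam_bounds by (auto simp:Box_def cs_def nrm_def)

lemma Fy_Zn: "p:Zn 1 ==> Fy p = 0"
proof (erule ZnE)
 fix v j u assume *: "v:Lat" "j<3" "nrm u<1" "p = v + cs j + u"
 hence "nrm u<lam" using lam_bounds by linarith
 from derivs_Box(2)[OF *(1), of p] Zn_Box[OF *(1,2) this] * show "Fy p = 0" by (simp add:cs_def nrm_def)
qed

text \<open>This fixes the half side \<open>lam\<close> of the squares: at heights above
  \<open>lam > 2\<close> the perturbation is switched off, and below it the distance to every source
  is at least \<open>lam\<close> in the horizontal direction, so \<open>P'_small\<close>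
  applies.\<close>

lemma Fx_off: "p~:Zn lam ==> Fx p<=1/lam"
proof (cases "EX v:Lat. p - v:Box")
 case True
 assume off: "p~:Zn lam"
 obtain v where v: "v:Lat" "p - v:Box" using True by blast
 let ?b = "bump (snd (p - v))"
 show ?thesis
 proof (cases "lam<=abs(snd (p - v))")
  case True
  hence "?b = 0" using lam_bounds by (intro bump_0) auto
  thus ?thesis using derivs_Box(1)[OF v] by simp
 next
  case False
  have "lam<=abs(fst (p - v) - src j)" if "j<3" for j
  proof (rule ccontr)
   assume "~ ?thesis"
   hence "nrm (p - v - cs j)<lam" using False by (simp add:nrm_def cs_def)
   thus False using off v(1) that by (auto simp:Zn_def)
  qed
  hence "P' (fst (p - v))<=1/lam" by (rule P'_small)
  hence "?b*(P' (fst (p - v)) - 1/lam)<=0" using bump_range by (simp add:mult_nonneg_nonpos)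
  thus ?thesis using derivs_Box(1)[OF v] by simp
 qed
next
 case False
 thus ?thesis using derivs_out by auto
qed

lemma derivs_periodic: "v:Lat ==> Fx (p + v) = Fx p" "v:Lat ==> Fy (p + v) = Fy p"
proof -
 assume v: "v:Lat"
 have "((%u. u + v) has_derivative (%h. h)) (at p)" by (auto intro!:derivative_eq_intros)
 from diff_chain_at[OF this bb_deriv[of "p + v"]]
 have "(bb has_derivative (%h. (Fx (p + v) - 1/lam) * fst h + Fy (p + v) * snd h)) (at p)"
  by (simp add:o_def bb_add[OF v])
 from has_derivative_unique[OF this bb_deriv[of p]]
 have "(%h. (Fx (p + v) - 1/lam) * fst h + Fy (p + v) * snd h) = (%h. (Fx p - 1/lam) * fst h + Fy p * snd h)" .
 from fun_cong[OF this, of "(1,0)"] fun_cong[OF this, of "(0,1)"] show "Fx (p + v) = Fx p" "Fy (p + v) = Fy p" by simp_all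
qed

lemma Fy_bounded: "EX C. ALL p. abs(Fy p)<=C"
proof -
 have "compact (Fy ` ({-(X0+1)..X0+1} \<times> {-3..3}))"
  by (intro compact_continuous_image continuous_on_subset[OF smooth_on_continuous[OF smooth_Fy]] compact_Times) auto
 then obtain C where C: "!!y. y:Fy ` ({-(X0+1)..X0+1} \<times> {-3..3}) ==> abs y<=C"
  using compact_imp_bounded bounded_real by metis
 have "abs(Fy p)<=abs C" for p
 proof (cases "EX v:Lat. p - v:Box")
  case True
  then obtain v where v: "v:Lat" "p - v:Box" by blast
  hence "Fy (p - v):Fy ` ({-(X0+1)..X0+1} \<times> {-3..3})"
   by (intro imageI) (auto simp:Box_def mem_Times_iff)
  thus ?thesis using C derivs_periodic(2)[OF v(1), of "p - v"] by fastforce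
 qed (use derivs_out in auto)
 thus ?thesis by blast
qed

definition U :: "(real*real) set" where "U = - cen"

lemma cen_Zn: "r>0 ==> cen<=Zn r"
proof
 fix p assume "r>0" "p:cen"
 thus "p:Zn r" using ZnI[of _ _ 0 r] by (elim cenE) simp
qed

lemma fm_cen: "fm p:cen <-> p:cen"
proof
 assume "p:cen"
 then obtain v j where vj: "v:Lat" "j<3" "p = v + cs j" by (rule cenE)
 hence "fm p = Alin v + cs j" using fm_lin[of v j 0] by simp
 thus "fm p:cen" using cenI[OF Lat_lin(1)] vj by simp
next
 assume "fm p:cen"
 then obtain v j where vj: "v:Lat" "j<3" "fm p = v + cs j" by (rule cenE)
 have "fi (fm p) = Ainv v + cs j" using fi_lin[of v j 0] vj by simp
 thus "p:cen" using cenI[OF Lat_lin(2)[OF vj(1)] vj(2)] by simp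
qed

lemma fm_U: "fm p:U <-> p:U" and fi_U: "fi p:U <-> p:U"
 using fm_cen[of p] fm_cen[of "fi p"] by (auto simp:U_def)

lemma U_add: "v:Lat ==> p + v:U <-> p:U"
proof -
 have *: "p + v:cen" if "p:cen" "v:Lat" for p v
 proof -
  obtain w j where wj: "w:Lat" "j<3" "p = w + cs j" using cenE[OF `p:cen`] by blast
  hence "p + v = (w + v) + cs j" by simp
  thus ?thesis using cenI[OF Lat_add[OF wj(1) that(2)] wj(2)] by (simp only:)
 qed
 assume "v:Lat"
 thus ?thesis using *[of p v] *[of "p + v" "- v"] Lat_uminus by (auto simp:U_def)
qed

lemma U_iff: "v:Lat ==> j<3 ==> nrm u<=lam ==> v + cs j + u:U <-> u~=0"
proof -
 assume a: "v:Lat" "j<3" "nrm u<=lam"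
 have "u = 0" if "v + cs j + u:cen"
 proof -
  obtain w k where "w:Lat" "k<3" "v + cs j + u = w + cs k" using cenE[OF `v + cs j + u:cen`] by blast
  thus ?thesis using cs_unique[of v w j k u 0] a lam_bounds by simp
 qed
 moreover have "v + cs j:cen" by (rule cenI[OF a(1,2)])
 ultimately show ?thesis unfolding U_def by auto
qed

lemma open_U: "open U"
proof (subst open_subopen, rule ballI)
 fix p assume p: "p:U"
 show "EX T. open T & p:T & T<=U"
 proof (cases "p:Zn lam")
  case True
  then obtain v j u where vju: "v:Lat" "j<3" "nrm u<lam" "p = v + cs j + u" by (rule ZnE)
  let ?T = "{p'. nrm (p' - v - cs j)<lam} Int - {v + cs j}"
  have "open ?T" by (intro open_Int open_Collect_less continuous_intros)
  moreover have "p:?T" using vju p U_iff[of v j u] by auto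
  moreover have "?T<=U"
  proof
   fix p' assume "p':?T"
   hence "nrm (p' - v - cs j)<=lam" "p' - v - cs j~=0" by (auto simp:diff_diff_eq)
   thus "p':U" using U_iff[OF vju(1,2), of "p' - v - cs j"] by simp
  qed
  ultimately show ?thesis by blast
 next
  case False
  let ?T = "{p'. nrm (p' - p)<1}"
  have "open ?T" by (intro open_Collect_less continuous_intros)
  moreover have "p:?T" by simp
  moreover have "?T<=U"
  proof
   fix p' assume p': "p':?T"
   show "p':U"
   proof (rule ccontr)
    assume "p'~:U"
    then obtain v j where vj: "v:Lat" "j<3" "p' = v + cs j" unfolding U_def by (metis ComplI cenE)
    have "nrm (p - v - cs j) = nrm (p' - p)" using nrm_minus[of p p'] by (simp add:vj(3) diff_diff_eq)
    hence "nrm (p - v - cs j)<lam" using p' lam_bounds by simp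
    thus False using False vj unfolding Zn_def by blast
   qed
  qed
  ultimately show ?thesis by blast
 qed
qed

end

section \<open>Escape from the sources, and invariant sections over \<open>U\<close>\<close>

context da_map
begin

lemma nrm_Zn_iff: "v:Lat ==> j<3 ==> nrm u<=3 ==> r<=3 ==> v + cs j + u:Zn r <-> nrm u<r"
proof -
 assume a: "v:Lat" "j<3" "nrm u<=3" "r<=3"
 have "nrm u<r" if "v + cs j + u:Zn r"
 proof -
  obtain w k u' where w: "w:Lat" "k<3" "nrm u'<r" "v + cs j + u = w + cs k + u'" using ZnE[OF `v + cs j + u:Zn r`] by blast
  thus ?thesis using cs_unique[of v w j k u u'] a by simp
 qed
 thus ?thesis using a ZnI by blast
qed

lemma fi_Zn_scale: "r<=lam ==> p:Zn r ==> fi p:Zn (r/lam)"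
 by (erule ZnE) (simp add:fi_lin nrm_scale ZnI Lat_lin divide_strict_right_mono)

lemma fi_pow_Zn: "p:Zn lam ==> (fi^^n) p:Zn (lam/lam^n)"
proof (induction n)
 case (Suc n)
 have "lam/lam^n<=lam" by (simp add:field_simps)
 thus ?case using fi_Zn_scale[OF _ Suc.IH[OF Suc.prems]] by simp
qed simp

lemma fi_pow_fm_pow [simp]: "(fi^^n) ((fm^^n) p) = p" "(fm^^n) ((fi^^n) p) = p"
proof -
 show "(fi^^n) ((fm^^n) p) = p" by (induction n arbitrary: p) (simp_all add:funpow_swap1)
 show "(fm^^n) ((fi^^n) p) = p" by (induction n arbitrary: p) (simp_all add:funpow_swap1)
qed

lemma fm_pow_U: "(fm^^n) p:U <-> p:U" "(fi^^n) p:U <-> p:U"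
 by (induction n) (auto simp:fm_U fi_U)

lemma fm_off: "p~:Zn lam ==> fm p~:Zn lam"
 using Zn_fi[of "fm p"] Zn_mono[of 1 lam] by auto

lemma fm_pow_off: "p~:Zn lam ==> (fm^^n) p~:Zn lam"
 by (induction n) (auto simp:fm_off)

text \<open>A point staying forever would have a displacement below \<open>lam / lam^n\<close> for
  every \<open>n\<close>, that is, it would be a source. After leaving, an orbit never returns, by
  \<open>fm_off\<close>.\<close>

lemma exit_Zn:
 assumes "p:U" shows "EX N. ALL n>=N. (fm^^n) p~:Zn lam"
proof -
 have "EX N. (fm^^N) p~:Zn lam"
 proof (rule ccontr)
  assume "~ ?thesis"
  hence all: "(fm^^n) p:Zn lam" for n by blast
  have "p:Zn lam" using all[of 0] by simp
  then obtain v j u where vju: "v:Lat" "j<3" "nrm u<lam" "p = v + cs j + u" by (rule ZnE)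
  hence "u~=0" using U_iff[of v j u] assms by simp
  then obtain n where n: "lam/nrm u<lam^n" using real_arch_pow[of lam "lam/nrm u"] by auto
  have "p:Zn (lam/lam^n)" using fi_pow_Zn[OF all[of n], of n] by simp
  moreover have "lam/lam^n<=3" 
  proof -
   have "lam/lam^n<=lam/1" by (intro divide_left_mono) auto
   thus ?thesis using lam_bounds by simp
  qed
  ultimately have "nrm u<lam/lam^n"
   using nrm_Zn_iff[of v j u "lam/lam^n"] vju lam_bounds by simp
  thus False using n nrm_pos[OF `u~=0`] by (simp add:field_simps)
 qed
 then obtain N where N: "(fm^^N) p~:Zn lam" by blast
 have "(fm^^n) p~:Zn lam" if "n>=N" for n
  using fm_pow_off[OF N, of "n - N"] that by (metis comp_apply funpow_add le_add_diff_inverse2)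
 thus ?thesis by blast
qed

text \<open>Iterate \<open>h |-> (A * h + B) o fi\<close> from the approximate solution
  \<open>h0\<close>. The increments vanish on \<open>Zn lam\<close>, where \<open>h0\<close> is
  exact, and elsewhere each step multiplies them by at most \<open>ka\<close>; so they form a
  uniformly convergent series. This is how the missing contraction near the sources is
  overcome.\<close>

lemma cocycle_section:
 assumes A: "continuous_on U A" "continuous_on U B" and h0: "continuous_on U h0"
  and ka: "0<=ka" "ka<1" and off: "!!p. p:U ==> p~:Zn lam ==> abs(A p)<=ka"
  and err: "!!p. p:U ==> abs(A (fi p)*h0 (fi p) + B (fi p) - h0 p)<=C"
  and exact: "!!p. p:U ==> p:Zn lam ==> A (fi p)*h0 (fi p) + B (fi p) = h0 p"
  and per: "!!v p. v:Lat ==> p:U ==> A (p + v) = A p & B (p + v) = B p & h0 (p + v) = h0 p"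
 shows "EX h :: real*real => real. continuous_on U h & (ALL p:U. h (fm p) = A p*h p + B p) & (ALL p:U Int Zn lam. h p = h0 p) &
   (ALL v:Lat. ALL p:U. h (p + v) = h p)"
proof -
 define hs where "hs = rec_nat h0 (%n g p. A (fi p)*g (fi p) + B (fi p))"
 have hs0: "hs 0 = h0" and hsS: "hs (Suc n) p = A (fi p)*hs n (fi p) + B (fi p)" for n p
  by (simp_all add:hs_def)
 define d where "d n p = hs (Suc n) p - hs n p" for n p
 have dS: "d (Suc n) p = A (fi p)*d n (fi p)" for n p by (simp add:d_def hsS algebra_simps)
 have d0: "d 0 p = A (fi p)*h0 (fi p) + B (fi p) - h0 p" for p by (simp add:d_def hsS hs0)
 have dZ: "d n p = 0" if "p:U" "p:Zn lam" for n p
  using that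
 proof (induction n arbitrary: p)
  case (Suc n)
  have "fi p:Zn lam" using Zn_fi[OF Suc.prems(2)] Zn_mono[of 1 lam] by auto
  thus ?case using Suc by (simp add:dS fi_U)
 qed (simp add:d0 exact)
 have db: "abs(d n p)<=C*ka^n" if "p:U" for n p
  using that
 proof (induction n arbitrary: p)
  case 0
  thus ?case using err by (simp add:d0)
 next
  case (Suc n)
  have fu: "fi p:U" using Suc by (simp add:fi_U)
  have C: "0<=C*ka^n" using Suc.IH[OF fu] by linarith
  show ?case
  proof (cases "fi p:Zn lam")
   case True
   thus ?thesis using dZ[OF fu True] mult_nonneg_nonneg[OF ka(1) C] by (simp add:dS mult.left_commute)
  next
   case False
   have "abs(d (Suc n) p)<=ka*(C*ka^n)"
    unfolding dS abs_mult using off[OF fu False] Suc.IH[OF fu] by (intro mult_mono) auto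
   thus ?thesis by (simp add:mult_ac)
  qed
 qed
 have hsum: "hs n p = h0 p + (\<Sum>i<n. d i p)" for n p by (induction n) (auto simp:hs0 d_def)
 have hc: "continuous_on U (hs n)" for n
 proof (induction n)
  case (Suc n)
  have fic: "continuous_on U fi" "fi ` U<=U"
   using smooth_on_continuous[OF fi_deriv_smooth(1)] continuous_on_subset fi_U by auto
  have "continuous_on U (%p. A (fi p)*hs n (fi p) + B (fi p))"
   by (intro continuous_intros continuous_on_compose2[OF A(1) fic] continuous_on_compose2[OF A(2) fic] continuous_on_compose2[OF Suc fic])
  thus ?case by (simp add:hsS[abs_def])
 qed (simp add:hs0 h0)
 define h where "h p = h0 p + (\<Sum>i. d i p)" for p
 have summ: "summable (%n. C*ka^n)" using ka by simp
 have ul: "uniform_limit U (%n p. \<Sum>i<n. d i p) (%p. \<Sum>i. d i p) sequentially"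
  by (rule Weierstrass_m_test[OF _ summ]) (use db in auto)
 have ul': "uniform_limit U hs h sequentially"
  unfolding hsum[abs_def] h_def[abs_def] by (intro uniform_limit_add uniform_limit_const ul)
 have lim: "(%n. hs n p) ----> h p" if "p:U" for p
  by (rule tendsto_uniform_limitI[OF ul' that])
 have "continuous_on U h" by (rule uniform_limit_theorem[OF _ ul']) (auto simp:hc)
 moreover have "h (fm p) = A p*h p + B p" if p: "p:U" for p
 proof -
  have "(%n. hs (Suc n) (fm p)) ----> h (fm p)" by (rule LIMSEQ_Suc[OF lim]) (simp add:fm_U p)
  moreover have "(%n. hs (Suc n) (fm p)) ----> A p*h p + B p"
   unfolding hsS fi_fm by (intro tendsto_intros lim p)
  ultimately show ?thesis by (rule LIMSEQ_unique)
 qed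
 moreover have "h p = h0 p" if "p:U Int Zn lam" for p using dZ that by (simp add:h_def)
 moreover have "h (p + v) = h p" if "v:Lat" "p:U" for v p
 proof -
  have "hs n (p + v) = hs n p" if "p:U" "v:Lat" for n p v
   using that
  proof (induction n arbitrary: p v)
   case (Suc n)
   thus ?case using per[OF Lat_lin(2), of v "fi p"] by (simp add:hsS fi_add fi_U Lat_lin)
  qed (use per hs0 in auto)
  hence "(%n. hs n p) ----> h (p + v)" using lim[of "p + v"] that U_add by simp
  thus ?thesis using lim[OF that(2)] LIMSEQ_unique by blast
 qed
 ultimately show ?thesis by blast
qed

lemma continuous_on_UNIV_sub: "smooth_on UNIV g ==> continuous_on S g"
 using smooth_on_continuous continuous_on_subset by blast

text \<open>The vector \<open>(sg0, 1)\<close> spans the unstable direction: the derivative of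
  \<open>fm\<close> sends it to \<open>(Fx * sg0 + Fy, lam)\<close>. Near the sources the direction
  is exactly vertical, as the quarter turn of the glueing requires.\<close>

lemma sigma_exists:
 "EX sg0. continuous_on U sg0 & (ALL p:U. sg0 (fm p) = (Fx p * sg0 p + Fy p)/lam) & (ALL p:U Int Zn lam. sg0 p = 0) &
   (ALL v:Lat. ALL p:U. sg0 (p + v) = sg0 p)"
proof -
 obtain C where C: "!!p. abs(Fy p)<=C" using Fy_bounded by blast
 have "EX sg0. continuous_on U sg0 & (ALL p:U. sg0 (fm p) = (Fx p/lam) * sg0 p + Fy p/lam) & (ALL p:U Int Zn lam. sg0 p = 0) &
   (ALL v:Lat. ALL p:U. sg0 (p + v) = sg0 p)"
 proof (rule cocycle_section[where ka = "1/lam" and C = C])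
  show "continuous_on U (%p. Fx p/lam)" "continuous_on U (%p. Fy p/lam)"
   by (intro continuous_intros continuous_on_UNIV_sub smooth_Fx smooth_Fy; simp)+
  show "abs(Fx p/lam)<=1/lam" if "p~:Zn lam" for p
  proof -
   have "Fx p<=1" by (rule order.trans[OF Fx_off[OF that]]) simp
   thus ?thesis using Fx_pos[of p] by (simp add:divide_right_mono)
  qed
  show "abs(Fx (fi p)/lam*0 + Fy (fi p)/lam - 0)<=C" for p
  proof -
   have "abs(Fy (fi p))/lam<=abs(Fy (fi p))/1" by (intro divide_left_mono) auto
   thus ?thesis using C[of "fi p"] by simp
  qed
  show "Fx (fi p)/lam*0 + Fy (fi p)/lam = 0" if "p:Zn lam" for p using Fy_Zn[OF Zn_fi[OF that]] by simp
 qed (auto simp:derivs_periodic lam_bounds)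
 thus ?thesis by (simp add:add_divide_distrib)
qed

text \<open>The vertical derivative of \<open>- ln (fst u^2 + snd u^2)\<close>: the logarithmic
  slope that the factor \<open>1 / sq u\<close> of the glueing imposes on a surface of constant
  height.\<close>

definition c0 :: "real*real => real" where "c0 u = - 2 * snd u/(fst u^2 + snd u^2)"

lemma c0_scale: "a~=0 ==> c0 (a *R u) = c0 u/a"
proof -
 assume a: "a~=0"
 have "c0 (a *R u) = (a*(- 2 * snd u))/(a*(a*(fst u^2 + snd u^2)))"
  by (simp add:c0_def power2_eq_square algebra_simps)
 also have "... = (- 2 * snd u)/(a*(fst u^2 + snd u^2))" by simp
 finally show ?thesis by (simp add:c0_def)
qed

lemma c0_bound: "1<=nrm u ==> abs(c0 u)<=2"
proof -
 assume a: "1<=nrm u"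
 have "abs(snd u)<=nrm u" by (simp add:nrm_def)
 also have "... <= nrm u*nrm u" using a by simp
 also have "... <= fst u^2 + snd u^2" by (auto simp:nrm_def max_def power2_eq_square)
 finally have *: "abs(snd u)<=fst u^2 + snd u^2" .
 have "fst u~=0 | snd u~=0" using a by (auto simp:nrm_def)
 hence "0<fst u^2 + snd u^2" by (simp add:sum_power2_gt_zero_iff)
 thus ?thesis using * by (simp add:c0_def divide_le_eq)
qed

definition cut :: "real*real => real" where "cut u = max 0 (min 1 ((3 - nrm u)/(3 - lam)))"

definition c1 :: "real*real => real" where
 "c1 p = (if p:Zn 3 then (let u = (SOME u. EX v:Lat. EX j<3. nrm u<3 & p = v + cs j + u) in cut u*c0 u) else 0)"

lemma c1_eq: "v:Lat ==> j<3 ==> nrm u<3 ==> c1 (v + cs j + u) = cut u*c0 u"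
proof -
 assume a: "v:Lat" "j<3" "nrm u<3"
 have "(SOME u'. EX w:Lat. EX k<3. nrm u'<3 & v + cs j + u = w + cs k + u') = u"
 proof (rule some_equality)
  show "EX w:Lat. EX k<3. nrm u<3 & v + cs j + u = w + cs k + u" using a by blast
  fix u' assume "EX w:Lat. EX k<3. nrm u'<3 & v + cs j + u = w + cs k + u'"
  then obtain w k where "w:Lat" "k<3" "nrm u'<3" "v + cs j + u = w + cs k + u'" by blast
  thus "u' = u" using cs_unique[of v w j k u u'] a by simp
 qed
 thus ?thesis using ZnI[OF a] by (simp add:c1_def)
qed

lemma cut_1: "nrm u<=lam ==> cut u = 1" using lam_bounds by (simp add:cut_def)
lemma cut_range: "0<=cut u" "cut u<=1" by (auto simp:cut_def)

lemma c1_bound: "p~:Zn 1 ==> abs(c1 p)<=2"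
proof (cases "p:Zn 3")
 case True
 assume p: "p~:Zn 1"
 obtain v j u where vju: "v:Lat" "j<3" "nrm u<3" "p = v + cs j + u" using ZnE[OF True] by blast
 have "1<=nrm u" using p nrm_Zn_iff[of v j u 1] vju by auto
 hence "cut u*abs(c0 u)<=1*2" using cut_range[of u] c0_bound[of u] by (intro mult_mono) auto
 thus ?thesis using c1_eq[OF vju(1-3)] vju(4) cut_range[of u] by (simp add:abs_mult)
qed (simp add:c1_def)

text \<open>Outside the squares of half side \<open>3\<close>, where \<open>c1\<close> is zero,
  continuity comes from a bound by the distance: \<open>cut\<close> decreases linearly to
  \<open>0\<close> at their boundary.\<close>

lemma c1_continuous: "continuous_on U c1"
proof (rule continuous_at_imp_continuous_on, rule ballI)
 fix p assume p: "p:U"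
 show "isCont c1 p"
 proof (cases "p:Zn 3")
  case True
  then obtain v j u where vju: "v:Lat" "j<3" "nrm u<3" "p = v + cs j + u" by (rule ZnE)
  let ?T = "{p'. nrm (p' - v - cs j)<3} Int U"
  have T: "open ?T" by (intro open_Int open_U open_Collect_less continuous_intros)
  have nz: "fst (p' - v - cs j)^2 + snd (p' - v - cs j)^2~=0" if "p':U" for p'
  proof
   assume "fst (p' - v - cs j)^2 + snd (p' - v - cs j)^2 = 0"
   hence "p' - v - cs j = 0" by (simp add:prod_eq_iff)
   thus False using that U_iff[OF vju(1,2), of 0] by (simp add:diff_diff_eq)
  qed
  have "continuous_on ?T (%p'. cut (p' - v - cs j)*c0 (p' - v - cs j))"
   unfolding cut_def c0_def by (intro continuous_intros) (use lam_bounds nz in auto)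
  moreover have "c1 p' = cut (p' - v - cs j)*c0 (p' - v - cs j)" if "p':?T" for p'
   using c1_eq[OF vju(1,2), of "p' - v - cs j"] that by simp
  ultimately have "continuous_on ?T c1" by (metis (no_types, lifting) continuous_on_eq)
  thus ?thesis using T p vju by (simp add:continuous_on_eq_continuous_at)
 next
  case False
  have z: "c1 p' = 0 | (EX v j. v:Lat & j<3 & nrm (p' - v - cs j)<3 & c1 p' = cut (p' - v - cs j)*c0 (p' - v - cs j))" for p'
  proof (cases "p':Zn 3")
   case True
   then obtain v j u where vju: "v:Lat" "j<3" "nrm u<3" "p' = v + cs j + u" by (rule ZnE)
   thus ?thesis using c1_eq[OF vju(1-3)] by (intro disjI2 exI[of _ v]) auto
  qed (simp add:c1_def)
  have bound: "abs(c1 p')<=2*(norm (p' - p)/(3 - lam))" if near: "norm (p' - p)<1" for p'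
  proof -
   have "c1 p' = 0 | ?thesis"
   proof -
    have "?thesis" if vj: "v:Lat" "j<3" "nrm (p' - v - cs j)<3" "c1 p' = cut (p' - v - cs j)*c0 (p' - v - cs j)" for v j
    proof -
     let ?u = "p' - v - cs j"
     have "nrm (p - v - cs j)>=3" using False vj by (fastforce simp:Zn_def)
     moreover have "nrm (p - v - cs j)<=nrm ?u + norm (p' - p)"
      using norm_fst_le[of "fst (p' - p)" "snd (p' - p)"] norm_snd_le[of "snd (p' - p)" "fst (p' - p)"] unfolding prod.collapse by (auto simp:nrm_def)
     ultimately have n: "3 - nrm ?u<=norm (p' - p)" "nrm ?u>=1" using near by auto
     have "cut ?u<=norm (p' - p)/(3 - lam)"
      using n(1) lam_bounds by (auto simp:cut_def intro!:min.coboundedI2 divide_right_mono)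
     hence "cut ?u*abs(c0 ?u)<=norm (p' - p)/(3 - lam)*2"
      using c0_bound[OF n(2)] lam_bounds by (intro mult_mono) auto
     thus ?thesis using vj(4) cut_range[of ?u] by (simp add:abs_mult mult.commute)
    qed
    thus ?thesis using z[of p'] by blast
   qed
   thus ?thesis using lam_bounds by auto
  qed
  have "c1 p = 0" using False by (simp add:c1_def)
  moreover have "(c1 \<longlongrightarrow> 0) (at p)"
  proof (rule Lim_null_comparison)
   show "\<forall>\<^sub>F x in at p. norm (c1 x)<=2*(norm (x - p)/(3 - lam))"
    unfolding eventually_at using bound by (auto simp:dist_norm intro!:exI[of _ 1])
   show "((%x. 2*(norm (x - p)/(3 - lam))) \<longlongrightarrow> 0) (at p)"
    using lam_bounds by (auto intro!:tendsto_eq_intros)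
  qed
  ultimately show ?thesis by (simp add:isCont_def)
 qed
qed

text \<open>The unstable direction is lifted to the suspension with third component
  \<open>z * c\<close>. Invariance under \<open>(p, z) |-> (fm p, z / lam)\<close> means
  \<open>c (fm p) = c p / lam\<close>, and \<open>c0\<close>, being homogeneous of degree
  \<open>-1\<close>, solves this exactly around the sources.\<close>

lemma c_exists:
 "EX c. continuous_on U c & (ALL p:U. c (fm p) = c p/lam) &
   (ALL v:Lat. ALL j<3. ALL u. u~=0 --> nrm u<lam --> c (v + cs j + u) = c0 u) &
   (ALL v:Lat. ALL p:U. c (p + v) = c p)"
proof -
 have per: "c1 (p + v) = c1 p" if v: "v:Lat" for p v
 proof (cases "p:Zn 3")
  case True
  then obtain w j u where w: "w:Lat" "j<3" "nrm u<3" "p = w + cs j + u" by (rule ZnE)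
  have e: "p + v = (w + v) + cs j + u" using w by simp
  show ?thesis unfolding e using c1_eq[OF Lat_add[OF w(1) v] w(2,3)] c1_eq[OF w(1-3)] w(4) by simp
 next
  case False
  have "p + v~:Zn 3"
  proof
   assume "p + v:Zn 3"
   then obtain w j u where w: "w:Lat" "j<3" "nrm u<3" "p + v = w + cs j + u" by (rule ZnE)
   hence "p = (w - v) + cs j + u" by (simp add:algebra_simps)
   thus False using False ZnI[OF Lat_diff[OF w(1) v] w(2,3)] by simp
  qed
  thus ?thesis using False by (simp add:c1_def)
 qed
 have exact: "1/lam*c1 (fi p) + 0 = c1 p" if "p:Zn lam" for p
 proof -
  obtain v j u where vju: "v:Lat" "j<3" "nrm u<lam" "p = v + cs j + u" using ZnE[OF `p:Zn lam`] by blast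
  have n: "nrm u<3" "nrm ((1/lam) *R u)<=lam" "nrm ((1/lam) *R u)<3"
  proof -
   show "nrm u<3" using vju lam_bounds by simp
   have "nrm ((1/lam) *R u)<=nrm u" using mult_right_mono[of "1/lam" 1 "nrm u"] by (simp add:nrm_scale)
   thus "nrm ((1/lam) *R u)<=lam" "nrm ((1/lam) *R u)<3" using vju lam_bounds by auto
  qed
  have "c1 (fi p) = c0 ((1/lam) *R u)"
   using c1_eq[OF Lat_lin(2)[OF vju(1)] vju(2) n(3)] fi_lin[OF vju(1,2), of u] vju cut_1[OF n(2)] by simp
  also have "... = lam*c0 u" using c0_scale[of "1/lam" u] by simp
  finally show ?thesis using c1_eq[OF vju(1,2) n(1)] vju cut_1[of u] by simp
 qed
 have "EX c. continuous_on U c & (ALL p:U. c (fm p) = 1/lam*c p + 0) & (ALL p:U Int Zn lam. c p = c1 p) &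
   (ALL v:Lat. ALL p:U. c (p + v) = c p)"
 proof (rule cocycle_section[where ka = "1/lam" and C = 4])
  show "abs(1/lam*c1 (fi p) + 0 - c1 p)<=4" for p
  proof (cases "p:Zn lam")
   case True
   thus ?thesis using exact[OF True] by simp
  next
   case False
   have "p~:Zn 1" "fi p~:Zn 1" using False Zn_mono[of 1 lam] Zn_fm[of "fi p"] by auto
   hence b: "abs(c1 p)<=2" "abs(c1 (fi p))<=2" using c1_bound by auto
   have "abs(1/lam*c1 (fi p))<=1*2" unfolding abs_mult using b by (intro mult_mono) auto
   thus ?thesis using b by linarith
  qed
  show "1/lam*c1 (fi p) + 0 = c1 p" if "p:Zn lam" for p using exact[OF that] .
 qed (auto simp:c1_continuous per)
 then obtain c where c: "continuous_on U c" "!!p. p:U ==> c (fm p) = 1/lam*c p + 0"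
  "!!p. p:U ==> p:Zn lam ==> c p = c1 p" "!!v p. v:Lat ==> p:U ==> c (p + v) = c p" by blast
 have "c (v + cs j + u) = c0 u" if "v:Lat" "j<3" "u~=0" "nrm u<lam" for v j u
  using c(3)[of "v + cs j + u"] U_iff[of v j u] ZnI[of v j u lam] c1_eq[of v j u] cut_1[of u] that lam_bounds by simp
 thus ?thesis using c by auto
qed

end

section \<open>The glued manifold\<close>

type_synonym pt = "(real*real) \<times> real"

text \<open>Real numbers correspond to sets of naturals, and three such sets are combined into one
  by tagging and pairing.\<close>

lemma enc_exists: "EX e :: pt => real. inj e"
proof -
 have "(UNIV :: nat set set) \<approx> (UNIV :: real set)" by (rule nat_sets_eqpoll_reals)
 then obtain g :: "nat set => real" where g: "bij_betw g UNIV UNIV" unfolding eqpoll_def by blast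
 have gi: "inj g" "surj g" using g by (auto simp:bij_betw_def)
 define h where "h = inv_into UNIV g"
 have h: "inj h" unfolding h_def using gi(2) by (rule surj_imp_inj_inv)
 define S where "S p = {0::nat} \<times> h (fst (fst p)) Un {1} \<times> h (snd (fst p)) Un {2} \<times> h (snd p)" for p :: pt
 have "inj (%p. g (prod_encode ` S p))"
 proof (rule injI)
  fix p q assume "g (prod_encode ` S p) = g (prod_encode ` S q)"
  hence "S p = S q" using gi(1) by (simp add:inj_eq inj_image_eq_iff inj_prod_encode)
  moreover have "h (fst (fst p)) = {n. (0,n):S p}" "h (snd (fst p)) = {n. (1,n):S p}" "h (snd p) = {n. (2,n):S p}" for p
   by (auto simp:S_def)
  ultimately have "h (fst (fst p)) = h (fst (fst q))" "h (snd (fst p)) = h (snd (fst q))" "h (snd p) = h (snd q)" by metis+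
  thus "p = q" using h by (simp add:inj_eq prod_eq_iff)
 qed
 thus ?thesis by blast
qed

text \<open>The theorem asks for manifolds whose points are real numbers.\<close>

definition enc :: "pt => real" where "enc = (SOME e. inj e)"

lemma inj_enc: "inj enc" unfolding enc_def by (rule someI_ex[OF enc_exists])

definition pj :: "nat => nat" where "pj j = (if j = 0 then 1 else if j = 1 then 0 else j)"

lemma pj_pj [simp]: "pj (pj j) = j" and pj_less [simp]: "pj j<3 <-> j<3" by (auto simp:pj_def)

definition rot :: "real*real => real*real" where "rot u = (- snd u,fst u)"

lemma lam_not_neg [simp]: "~ lam<0" "~ lam<=0" using lam_bounds by auto

lemma rot_rot: "rot (rot u) = - u" by (simp add:rot_def prod_eq_iff)
lemma rot_scale: "rot (c *R u) = c *R rot u" by (simp add:rot_def)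
lemma nrm_rot [simp]: "nrm (rot u) = nrm u" by (simp add:rot_def nrm_def)

definition sq :: "real*real => real" where "sq u = fst u^2 + snd u^2"

lemma sq_rot [simp]: "sq (rot u) = sq u" by (simp add:rot_def sq_def)
lemma sq_scale [simp]: "sq (c *R u) = c^2 * sq u" by (simp add:sq_def power_mult_distrib distrib_left)
lemma sq_pos: "u~=0 ==> sq u>0" by (auto simp:sq_def sum_power2_gt_zero_iff prod_eq_iff)

locale glued = da_map +
 fixes ep :: "nat => real" assumes eps: "ep j = 1 | ep j = -1"
begin

definition Y :: "pt set" where "Y = {a. fst a:U & snd a~=0}"

definition FF :: "pt => pt" where "FF a = (fm (fst a),snd a/lam)"
definition FI :: "pt => pt" where "FI a = (fi (fst a),lam * snd a)"
definition TT :: "real*real => pt => pt" where "TT v a = (fst a + v,snd a)"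

text \<open>Read from the piece \<open>z < 0\<close> the glueing has to be the inverse map. As the
  inverse of \<open>rot\<close> is \<open>- rot\<close>, the sign there is
  \<open>- ep (pj j)\<close>, and \<open>gl\<close> becomes an involution
  (\<open>gl_form\<close>).\<close>

definition ee :: "nat => real => real" where "ee j z = (if z>0 then ep j else - ep (pj j))"

definition gl :: "nat => real*real => real => pt" where
 "gl j u z = (cs (pj j) + ee j z *R rot u,- (1/(z * sq u)))"

text \<open>Equivalence under the group generated by \<open>FF\<close> and the lattice translations.
  Comparing images under powers of \<open>FI\<close> suffices because \<open>FI\<close> normalises
  the translations.\<close>

definition rel0 :: "pt => pt => bool" where
 "rel0 a b <-> (EX n m. EX v:Lat. (FI^^n) a = TT v ((FI^^m) b))"

definition relG :: "pt => pt => bool" where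
 "relG a b <-> (EX j<3. EX u z. u~=0 & nrm u<lam & z~=0 & rel0 a (cs j + u,z) & rel0 b (gl j u z))"

definition rel :: "pt => pt => bool" where "rel a b <-> rel0 a b | relG a b"

lemma FF_FI [simp]: "FF (FI a) = a" "FI (FF a) = a" by (simp_all add:FF_def FI_def)

lemma FI_pow: "(FI^^n) a = ((fi^^n) (fst a),lam^n * snd a)"
 by (induction n) (auto simp:FI_def)

lemma FF_pow: "(FF^^n) a = ((fm^^n) (fst a),snd a/lam^n)"
 by (induction n) (auto simp:FF_def)

lemma FF_FI_pow [simp]: "(FF^^n) ((FI^^n) a) = a" "(FI^^n) ((FF^^n) a) = a"
 by (simp_all add:FF_pow FI_pow)

lemma FI_TT: "v:Lat ==> FI (TT v a) = TT (Ainv v) (FI a)" by (simp add:FI_def TT_def fi_add)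
lemma FF_TT: "v:Lat ==> FF (TT v a) = TT (Alin v) (FF a)" by (simp add:FF_def TT_def fm_add)

lemma FI_pow_TT: "v:Lat ==> EX w:Lat. (FI^^n) (TT v a) = TT w ((FI^^n) a)"
 by (induction n) (auto simp:FI_TT intro:Lat_lin)

lemma FF_pow_TT: "v:Lat ==> EX w:Lat. (FF^^n) (TT v a) = TT w ((FF^^n) a)"
 by (induction n) (auto simp:FF_TT intro:Lat_lin)

lemma TT_TT [simp]: "TT v (TT w a) = TT (w + v) a" "TT 0 a = a" by (simp_all add:TT_def)

lemma rel0_refl [simp]: "rel0 a a"
 unfolding rel0_def by (intro exI[of _ 0] bexI[of _ 0]) auto

lemma rel0_sym: "rel0 a b ==> rel0 b a"
proof -
 assume "rel0 a b"
 then obtain n m v where *: "v:Lat" "(FI^^n) a = TT v ((FI^^m) b)" by (auto simp:rel0_def)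
 have "(FI^^m) b = TT (- v) ((FI^^n) a)" using * by simp
 thus ?thesis using Lat_uminus[OF *(1)] unfolding rel0_def by blast
qed

lemma rel0_trans: "rel0 a b ==> rel0 b c ==> rel0 a c"
proof -
 assume "rel0 a b" "rel0 b c"
 then obtain n m v n' m' v' where *: "v:Lat" "(FI^^n) a = TT v ((FI^^m) b)"
  "v':Lat" "(FI^^n') b = TT v' ((FI^^m') c)" by (auto simp:rel0_def)
 obtain w where w: "w:Lat" "(FI^^n') (TT v ((FI^^m) b)) = TT w ((FI^^n') ((FI^^m) b))"
  using FI_pow_TT[OF *(1)] by blast
 obtain w' where w': "w':Lat" "(FI^^m) (TT v' ((FI^^m') c)) = TT w' ((FI^^m) ((FI^^m') c))"
  using FI_pow_TT[OF *(3)] by blast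
 have comm: "(FI^^n') ((FI^^m) b) = (FI^^m) ((FI^^n') b)"
  by (metis comp_apply funpow_add add.commute)
 have "(FI^^(n' + n)) a = TT w (TT w' ((FI^^(m + m')) c))"
  using * w w' comm by (simp add:funpow_add)
 hence "(FI^^(n' + n)) a = TT (w' + w) ((FI^^(m + m')) c)" by simp
 thus ?thesis using Lat_add[OF w'(1) w(1)] unfolding rel0_def by blast
qed

lemma rel0_FI: "rel0 a ((FI^^n) a)" "rel0 a ((FF^^n) a)" "rel0 a (FF a)" "v:Lat ==> rel0 a (TT v a)"
proof -
 show "rel0 a ((FI^^n) a)" unfolding rel0_def by (intro exI[of _ n] exI[of _ 0] bexI[of _ 0]) auto
 show *: "rel0 a ((FF^^n) a)" for n unfolding rel0_def by (intro exI[of _ 0] exI[of _ n] bexI[of _ 0]) auto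
 show "rel0 a (FF a)" using *[of 1] by simp
 show "rel0 a (TT v a)" if "v:Lat"
  unfolding rel0_def using Lat_uminus[OF that] by (intro exI[of _ 0] bexI[of _ "- v"]) auto
qed

lemma rel0_cases:
 assumes "rel0 a b"
 obtains k v where "v:Lat" "b = TT v ((FF^^k) a)" | k v where "v:Lat" "b = TT v ((FI^^k) a)"
proof -
 obtain n m v where *: "v:Lat" "(FI^^n) b = TT v ((FI^^m) a)" using rel0_sym[OF assms] by (auto simp:rel0_def)
 obtain w where w: "w:Lat" "(FF^^n) (TT v ((FI^^m) a)) = TT w ((FF^^n) ((FI^^m) a))"
  using FF_pow_TT[OF *(1)] by blast
 have b: "b = TT w ((FF^^n) ((FI^^m) a))" using * w by (metis FF_FI_pow(1))
 show ?thesis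
 proof (cases "n<=m")
  case True
  hence "(FI^^m) a = (FI^^n) ((FI^^(m - n)) a)" by (metis comp_apply funpow_add le_add_diff_inverse)
  thus ?thesis using that(2) b w by simp
 next
  case False
  hence "(FF^^n) ((FI^^m) a) = (FF^^(n - m)) ((FF^^m) ((FI^^m) a))"
   by (metis comp_apply funpow_add le_add_diff_inverse2 nat_le_linear)
  thus ?thesis using that(1) b w by simp
 qed
qed

lemma fi_pow_lin0: "j<3 ==> nrm u<=lam ==> (fi^^m) (cs j + u) = cs j + (1/lam^m) *R u"
proof (induction m)
 case (Suc m)
 have "1/lam^m*nrm u<=1*lam" using Suc.prems by (intro mult_mono) auto
 thus ?case using Suc fi_lin[of 0 j "(1/lam^m) *R u"] Alin_add(6) by (simp add:nrm_scale)
qed simp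

lemma FI_pow_lin: "j<3 ==> nrm u<=lam ==> (FI^^m) (cs j + u,z) = (cs j + (1/lam^m) *R u,lam^m*z)"
 by (simp add:FI_pow fi_pow_lin0)

lemma ee_sq [simp]: "ee j z*ee j z = 1" "abs(ee j z) = 1" "ee j z~=0"
 using eps[of j] eps[of "pj j"] by (auto simp:ee_def)

lemma FI_pow_gl: "j<3 ==> nrm u<=lam ==> (FI^^m) (gl j u z) = gl j ((1/lam^m) *R u) (lam^m*z)"
proof -
 assume a: "j<3" "nrm u<=lam"
 have "(FI^^m) (gl j u z) = (cs (pj j) + (1/lam^m) *R ee j z *R rot u,lam^m*(- (1/(z * sq u))))"
  unfolding gl_def by (rule FI_pow_lin) (use a in "auto simp:nrm_scale")
 moreover have "ee j (lam^m*z) = ee j z" by (simp add:ee_def zero_less_mult_iff)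
 moreover have "lam^m*(- (1/(z * sq u))) = - (1/(lam^m*z * sq ((1/lam^m) *R u)))"
  by (cases "z * sq u = 0") (auto simp:power2_eq_square)
 ultimately show ?thesis by (simp add:gl_def rot_scale)
qed

lemma gl_form: "u~=0 ==> z~=0 ==>
  gl j u z = (cs (pj j) + ee j z *R rot u,- (1/(z * sq u))) & ee j z *R rot u~=0 & nrm (ee j z *R rot u) = nrm u &
  - (1/(z * sq u))~=0 & gl (pj j) (ee j z *R rot u) (- (1/(z * sq u))) = (cs j + u,z)"
proof -
 assume a: "u~=0" "z~=0"
 have s: "sq u>0" using sq_pos a by blast
 have "ee (pj j) (- (1/(z * sq u))) = - ee j z"
  using a s by (simp add:ee_def mult_less_0_iff)
 moreover have "rot u~=0" using a nrm_rot[of u] by force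
 ultimately show ?thesis using a s by (auto simp:gl_def nrm_scale rot_scale rot_rot power2_eq_square)
qed

text \<open>The glueing is compatible with the equivalence: by \<open>cs_unique\<close> equivalent
  points around sources differ by scaling at the same source, and the glueing commutes with
  scaling.\<close>

lemma rel0_gl:
 assumes "j<3" "k<3" "u~=0" "u'~=0" "nrm u<lam" "nrm u'<lam" "rel0 (cs j + u,z) (cs k + u',z')"
 shows "j = k & rel0 (gl j u z) (gl k u' z')"
proof -
 obtain n m v where *: "v:Lat" "(FI^^n) (cs j + u,z) = TT v ((FI^^m) (cs k + u',z'))"
  using assms(7) by (auto simp:rel0_def)
 hence e: "cs j + (1/lam^n) *R u = cs k + (1/lam^m) *R u' + v" "lam^n*z = lam^m*z'"
  using assms by (simp_all add:FI_pow_lin TT_def)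
 have small: "nrm ((1/lam^n) *R u)<=3" if "nrm u<lam" for n u
 proof -
  have "1/lam^n*nrm u<=1*lam" using that by (intro mult_mono) auto
  thus ?thesis using lam_bounds by (simp add:nrm_scale)
 qed
 have "0 = v & j = k & (1/lam^n) *R u = (1/lam^m) *R u'"
  by (rule cs_unique[OF Lat_0 *(1)]) (use assms small e(1) in "auto simp:algebra_simps")
 hence jk: "j = k" and uu: "(1/lam^n) *R u = (1/lam^m) *R u'" by auto
 have "(FI^^n) (gl j u z) = TT 0 ((FI^^m) (gl k u' z'))"
  using FI_pow_gl[of j u n z] FI_pow_gl[of k u' m z'] assms jk uu e(2) by simp
 thus ?thesis using jk Lat_0 unfolding rel0_def by blast
qed

lemma relG_sym: "relG a b ==> relG b a"
proof -
 assume "relG a b"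
 then obtain j u z where *: "j<3" "u~=0" "nrm u<lam" "z~=0" "rel0 a (cs j + u,z)" "rel0 b (gl j u z)"
  by (auto simp:relG_def)
 note g = gl_form[OF *(2,4), of j]
 show ?thesis unfolding relG_def using * g by (intro exI[of _ "pj j"] conjI exI[of _ "ee j z *R rot u"] exI[of _ "- (1/(z * sq u))"]) auto
qed

lemma relG_rel0: "relG a b ==> rel0 b c ==> relG a c" "rel0 a b ==> relG b c ==> relG a c"
 unfolding relG_def using rel0_trans rel0_sym by blast+

text \<open>Two crossings cancel because \<open>gl\<close> is an involution. This is the critical
  case of transitivity.\<close>

lemma relG_relG: "relG a b ==> relG b c ==> rel0 a c"
proof -
 assume "relG a b" "relG b c"
 then obtain j u z k u' z' where *: "j<3" "u~=0" "nrm u<lam" "z~=0" "rel0 a (cs j + u,z)" "rel0 b (gl j u z)"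
  "k<3" "u'~=0" "nrm u'<lam" "z'~=0" "rel0 b (cs k + u',z')" "rel0 c (gl k u' z')"
  by (auto simp:relG_def)
 note g = gl_form[OF *(2,4), of j]
 have "rel0 (cs (pj j) + ee j z *R rot u,- (1/(z * sq u))) (cs k + u',z')"
  using rel0_trans[OF rel0_sym[OF *(6)] *(11)] g by simp
 hence "rel0 (gl (pj j) (ee j z *R rot u) (- (1/(z * sq u)))) (gl k u' z')"
  using rel0_gl[of "pj j" k "ee j z *R rot u" u' "- (1/(z * sq u))" z'] * g by simp
 hence "rel0 (cs j + u,z) (gl k u' z')" using g by simp
 thus ?thesis using rel0_trans[OF rel0_trans[OF *(5)] rel0_sym[OF *(12)]] by blast
qed

lemma rel_equiv: "rel a a" "rel a b ==> rel b a" "rel a b ==> rel b c ==> rel a c"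
 proof -
 show "rel a a" by (simp add:rel_def)
 show "rel b a" if "rel a b" using that unfolding rel_def by (elim disjE) (metis rel0_sym, metis relG_sym)
 show "rel a c" if "rel a b" "rel b c"
  using that unfolding rel_def by (elim disjE) (metis rel0_trans, metis relG_rel0(2), metis relG_rel0(1), metis relG_relG)
qed

definition q :: "pt => real" where "q a = enc (SOME b. rel a b)"

lemma q_eq: "q a = q b <-> rel a b"
proof
 assume "q a = q b"
 hence "(SOME c. rel a c) = (SOME c. rel b c)" using inj_enc by (simp add:q_def inj_eq)
 thus "rel a b" using someI[of "rel a", OF rel_equiv(1)] someI[of "rel b", OF rel_equiv(1)] rel_equiv by metis
next
 assume "rel a b"
 hence "rel a = rel b" using rel_equiv by blast
 thus "q a = q b" by (simp add:q_def)
qed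

lemma Y_FF: "FF a:Y <-> a:Y" "FI a:Y <-> a:Y" "v:Lat ==> TT v a:Y <-> a:Y"
 by (auto simp:Y_def FF_def FI_def TT_def fm_U fi_U U_add)

lemma Y_pow: "(FF^^n) a:Y <-> a:Y" "(FI^^n) a:Y <-> a:Y"
 by (induction n) (auto simp:Y_FF)

lemma Y_center: "j<3 ==> nrm u<lam ==> (cs j + u,z):Y <-> u~=0 & z~=0"
 using U_iff[of 0 j u] by (simp add:Y_def)

lemma Y_gl: "j<3 ==> nrm u<lam ==> u~=0 ==> z~=0 ==> gl j u z:Y"
 using gl_form[of u z j] Y_center[of "pj j" "ee j z *R rot u"] by simp

lemma open_Y: "open Y"
proof -
 have "Y = U \<times> - {0}" by (auto simp:Y_def)
 thus ?thesis by (simp add:open_Times open_U open_Compl)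
qed

lemma rel0_sign: "rel0 a b ==> snd a>0 <-> snd b>0"
 by (erule rel0_cases) (auto simp:FF_pow FI_pow TT_def zero_less_mult_iff zero_less_divide_iff)

lemma relG_sign: "relG a b ==> snd a>0 <-> snd b<0"
proof -
 assume "relG a b"
 then obtain j u z where *: "u~=0" "z~=0" "rel0 a (cs j + u,z)" "rel0 b (gl j u z)" by (auto simp:relG_def)
 have nz: "snd b = 0 <-> snd c = 0" if "rel0 b c" for b c
  using that by (rule rel0_cases) (auto simp:FF_pow FI_pow TT_def)
 show ?thesis using rel0_sign[OF *(3)] rel0_sign[OF *(4)] nz[OF *(4)] sq_pos[OF *(1)] by (auto simp:gl_def mult_less_0_iff)
qed

end

context glued
begin

lemma FF_deriv: "(FF has_derivative (%h. ((Fx (fst a) * fst (fst h) + Fy (fst a) * snd (fst h),lam * snd (fst h)),snd h/lam))) (at a)"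
proof -
 have "((%b. fm (fst b)) has_derivative (%h. (Fx (fst a) * fst (fst h) + Fy (fst a) * snd (fst h),lam * snd (fst h)))) (at a)"
  using diff_chain_at[OF bounded_linear_imp_has_derivative[OF bounded_linear_fst] fm_deriv[of "fst a"]] by (simp add:o_def)
 thus ?thesis unfolding FF_def[abs_def] by (rule has_derivative_Pair) (auto intro!:derivative_eq_intros)
qed

lemma FI_deriv: "(FI has_derivative (%h. (((fst (fst h) - Fy (fi (fst a))*(snd (fst h)/lam))/Fx (fi (fst a)),snd (fst h)/lam),lam * snd h))) (at a)"
proof -
 have "((%b. fi (fst b)) has_derivative (%h. ((fst (fst h) - Fy (fi (fst a))*(snd (fst h)/lam))/Fx (fi (fst a)),snd (fst h)/lam))) (at a)"
  using diff_chain_at[OF bounded_linear_imp_has_derivative[OF bounded_linear_fst] fi_deriv_smooth(2)[of "fst a"]] by (simp add:o_def)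
 thus ?thesis unfolding FI_def[abs_def] by (rule has_derivative_Pair) (auto intro!:derivative_eq_intros)
qed

lemma smooth_FF: "open S ==> smooth_on S FF" and smooth_FI: "open S ==> smooth_on S FI" and smooth_TT: "open S ==> smooth_on S (TT v)"
proof -
 assume S: "open S"
 have "smooth_on S (%a. (fm (fst a),(1/lam) * snd a))" "smooth_on S (%a. (fi (fst a),lam * snd a))"
  by (rule smooth_on_Pair[OF S smooth_on_compose[OF _ smooth_on_fst[OF S smooth_on_id[OF S]] S open_UNIV] smooth_on_mult[OF S smooth_on_const smooth_on_snd[OF S smooth_on_id[OF S]]]], simp_all add:smooth_fm fi_deriv_smooth)+
 thus "smooth_on S FF" "smooth_on S FI" by (simp_all add:FF_def[abs_def] FI_def[abs_def])
 show "smooth_on S (TT v)" unfolding TT_def[abs_def] by (intro smooth_on_Pair smooth_on_add smooth_on_fst smooth_on_snd smooth_on_id smooth_on_const S)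
qed

definition Dj :: "nat => pt set" where "Dj j = {a. fst a - cs j~=0 & nrm (fst a - cs j)<lam & snd a~=0}"

definition Gm :: "nat => pt => pt" where "Gm j a = gl j (fst a - cs j) (snd a)"

lemma Dj_iff: "(cs j + u,z):Dj j <-> u~=0 & nrm u<lam & z~=0" by (simp add:Dj_def)

lemma open_Dj: "open (Dj j)"
 unfolding Dj_def by (intro open_Collect_conj open_Collect_neq open_Collect_less continuous_intros)

lemma Dj_Y: "j<3 ==> Dj j<=Y" "j<3 ==> Gm j ` Dj j<=Y"
proof -
 assume j: "j<3"
 show "Dj j<=Y"
 proof
  fix a assume "a:Dj j"
  thus "a:Y" using Y_center[OF j, of "fst a - cs j" "snd a"] by (simp add:Dj_def)
 qed
 show "Gm j ` Dj j<=Y"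
 proof
  fix b assume "b:Gm j ` Dj j"
  then obtain a where "a:Dj j" "b = Gm j a" by blast
  thus "b:Y" using Y_gl[OF j, of "fst a - cs j" "snd a"] unfolding Gm_def Dj_def by blast
 qed
qed

lemma Gm_local:
 assumes "a:Dj j"
 defines "s == ee j (snd a)"
 shows "EX V. open V & a:V & V<=Dj j & (ALL b:V. Gm j b = (cs (pj j) + s *R rot (fst b - cs j),- inverse (snd b * sq (fst b - cs j))))"
proof -
 let ?V = "Dj j Int {b. snd b * snd a>0}"
 have "open ?V" by (intro open_Int open_Dj open_Collect_less continuous_intros)
 moreover have "a:?V" using assms by (auto simp:Dj_def zero_less_mult_iff)
 moreover have "Gm j b = (cs (pj j) + s *R rot (fst b - cs j),- inverse (snd b * sq (fst b - cs j)))" if "b:?V" for b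
 proof -
  have "ee j (snd b) = s" using that by (auto simp:s_def ee_def zero_less_mult_iff)
  thus ?thesis by (simp only:Gm_def gl_def inverse_eq_divide)
 qed
 ultimately show ?thesis by blast
qed

lemma smooth_Gm: "smooth_on (Dj j) (Gm j)"
proof (rule smooth_on_local)
 fix a assume "a:Dj j"
 obtain V where V: "open V" "a:V" "V<=Dj j"
  "ALL b:V. Gm j b = (cs (pj j) + ee j (snd a) *R rot (fst b - cs j),- inverse (snd b * sq (fst b - cs j)))"
  using Gm_local[OF `a:Dj j`] by auto
 have nz: "snd b*(fst (fst b - cs j)^2 + snd (fst b - cs j)^2)~=0" if "b:V" for b
  using that V(3) sq_pos[of "fst b - cs j"] by (auto simp:Dj_def sq_def)
 have d: "smooth_on V (%b. fst (fst b - cs j))" "smooth_on V (%b. snd (fst b - cs j))"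
  by (intro smooth_on_diff smooth_on_fst smooth_on_snd smooth_on_id smooth_on_const V(1))+
 have "smooth_on V (%b. (cs (pj j) + ee j (snd a) *R (- snd (fst b - cs j),fst (fst b - cs j)),
   - inverse (snd b*(fst (fst b - cs j)^2 + snd (fst b - cs j)^2))))"
  by (intro smooth_on_Pair smooth_on_add smooth_on_scaleR smooth_on_minus smooth_on_inverse smooth_on_mult smooth_on_power smooth_on_snd[OF V(1) smooth_on_id[OF V(1)]] smooth_on_const d V(1)) (use nz in auto)
 moreover have "Gm j b = (cs (pj j) + ee j (snd a) *R (- snd (fst b - cs j),fst (fst b - cs j)),
   - inverse (snd b*(fst (fst b - cs j)^2 + snd (fst b - cs j)^2)))" if "b:V" for b
  using V(4) that unfolding rot_def sq_def by blast
 ultimately have "smooth_on V (Gm j)" by (simp only:smooth_on_cong[OF V(1), of "Gm j"])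
 thus "EX V. open V & a:V & smooth_on V (Gm j)" using V by blast
qed

lemma Gm_deriv:
 assumes "a:Dj j"
 defines "u == fst a - cs j"
 shows "FD (Gm j) (at a) h = (ee j (snd a) *R rot (fst h),
   snd h/(snd a^2 * sq u) + 2*(fst u * fst (fst h) + snd u * snd (fst h))/(snd a * sq u^2))"
proof -
 obtain V where V: "open V" "a:V" "V<=Dj j"
  "ALL b:V. Gm j b = (cs (pj j) + ee j (snd a) *R rot (fst b - cs j),- inverse (snd b * sq (fst b - cs j)))"
  using Gm_local[OF assms(1)] by auto
 have s: "sq u>0" "snd a~=0" using assms sq_pos by (auto simp:Dj_def)
 have 1: "((%b. cs (pj j) + ee j (snd a) *R (- snd (fst b - cs j),fst (fst b - cs j))) has_derivative
   (%h. ee j (snd a) *R (- snd (fst h),fst (fst h)))) (at a)"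
  by (auto intro!:derivative_eq_intros)
 have "((%b. snd b*(fst (fst b - cs j)^2 + snd (fst b - cs j)^2)) has_derivative
   (%h. snd a*(2 * fst u * fst (fst h) + 2 * snd u * snd (fst h)) + snd h * sq u)) (at a)"
  by (auto intro!:derivative_eq_intros simp:u_def sq_def algebra_simps)
 hence "((%b. - inverse (snd b*(fst (fst b - cs j)^2 + snd (fst b - cs j)^2))) has_derivative
   (%h. inverse (snd a * sq u)*(snd a*(2 * fst u * fst (fst h) + 2 * snd u * snd (fst h)) + snd h * sq u)*inverse (snd a * sq u))) (at a)"
  by (rule has_derivative_eq_rhs[OF has_derivative_minus[OF Deriv.has_derivative_inverse[rotated]]]) (use s in "auto simp:u_def sq_def")
 note 2 = has_derivative_Pair[OF 1 this]
 have "Gm j b = (cs (pj j) + ee j (snd a) *R (- snd (fst b - cs j),fst (fst b - cs j)),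
   - inverse (snd b*(fst (fst b - cs j)^2 + snd (fst b - cs j)^2)))" if "b:V" for b
  using V(4) that unfolding rot_def sq_def by blast
 from frechet_derivative_cong_open(2)[OF V(1,2) this 2]
 have "FD (Gm j) (at a) = (%h. (ee j (snd a) *R (- snd (fst h),fst (fst h)),
   inverse (snd a * sq u)*(snd a*(2 * fst u * fst (fst h) + 2 * snd u * snd (fst h)) + snd h * sq u)*inverse (snd a * sq u)))"
  by blast
 moreover have "inverse (snd a * sq u)*(snd a*(2 * fst u * fst (fst h) + 2 * snd u * snd (fst h)) + snd h * sq u)*inverse (snd a * sq u)
   = snd h/(snd a^2 * sq u) + 2*(fst u * fst (fst h) + snd u * snd (fst h))/(snd a * sq u^2)"
  using s by (simp add:field_simps power2_eq_square)
 ultimately show ?thesis by (simp add:rot_def)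
qed

text \<open>A deck map that respects all line fields in \<open>E\<close>. The empty set yields the
  pseudogroup property of the quotient, a single field yields \<open>field_inv\<close>.\<close>

definition link :: "(pt => pt) set => pt => pt => bool" where
 "link E a b <-> (EX V th0. deck Y q V th0 a b & (ALL e:E. EX k. FD th0 (at a) (e a) = k *R e b))"

lemma link_trans: "link E a b ==> link E b c ==> link E a c"
proof -
 assume "link E a b" "link E b c"
 then obtain V th0 V' th0' where d: "deck Y q V th0 a b" "ALL e:E. EX k. FD th0 (at a) (e a) = k *R e b"
  "deck Y q V' th0' b c" "ALL e:E. EX k. FD th0' (at b) (e b) = k *R e c" by (auto simp:link_def)
 let ?V = "V Int th0 -` V'"
 have dd: "open V" "a:V" "V<=Y" "smooth_on V th0" "th0 a = b" "th0 ` V<=Y" "!!u. u:V ==> q (th0 u) = q u"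
  "open V'" "b:V'" "V'<=Y" "smooth_on V' th0'" "th0' b = c" "th0' ` V'<=Y" "!!u. u:V' ==> q (th0' u) = q u"
  using d(1,3) unfolding deck_def by blast+
 have V: "open ?V" by (rule continuous_open_preimage[OF smooth_on_continuous[OF dd(4)] dd(1,8)])
 have "smooth_on ?V (%x. th0' (th0 x))"
  by (rule smooth_on_compose[OF dd(11) smooth_on_subset[OF dd(4)] V dd(8)]) auto
 moreover have "q (th0' (th0 u)) = q u" "th0' (th0 u):Y" if "u:?V" for u
 proof -
  have "u:V" "th0 u:V'" using that by simp_all
  thus "q (th0' (th0 u)) = q u" using dd(7)[of u] dd(14)[of "th0 u"] by simp
  show "th0' (th0 u):Y" using dd(13) `th0 u:V'` by auto
 qed
 ultimately have "deck Y q ?V (%x. th0' (th0 x)) a c"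
  using dd(2,3,5,9,12) V unfolding deck_def by blast
 moreover have "EX k. FD (%x. th0' (th0 x)) (at a) (e a) = k *R e c" if eE: "e:E" for e
 proof -
  obtain k k' where k: "FD th0 (at a) (e a) = k *R e b" "FD th0' (at b) (e b) = k' *R e c"
   using bspec[OF d(2) eE] bspec[OF d(4) eE] by auto
  have t: "(th0 has_derivative FD th0 (at a)) (at a)" "(th0' has_derivative FD th0' (at b)) (at b)"
   using d(1,3) smooth_on_has_derivative by (auto simp:deck_def)
  hence "((%x. th0' (th0 x)) has_derivative (%h. FD th0' (at b) (FD th0 (at a) h))) (at a)"
   using diff_chain_at[OF t(1), of th0'] d(1) by (simp add:deck_def o_def)
  hence "FD (%x. th0' (th0 x)) (at a) (e a) = FD th0' (at b) (k *R e b)"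
   using frechet_derivative_at k(1) by metis
  also have "... = (k*k') *R e c" using linear_scale[OF has_derivative_linear[OF t(2)]] k(2) by simp
  finally show ?thesis by blast
 qed
 ultimately show ?thesis unfolding link_def by blast
qed

definition invfield :: "(pt => pt) => bool" where
 "invfield e <-> (ALL a:Y. (EX k. FD FF (at a) (e a) = k *R e (FF a)) & (EX k. FD FI (at a) (e a) = k *R e (FI a))) &
   (ALL v:Lat. ALL a:Y. e (TT v a) = e a) & (ALL j<3. ALL a:Dj j. EX k. FD (Gm j) (at a) (e a) = k *R e (Gm j a))"

lemma TT_deriv: "FD (TT v) (at a) = (%h. h)"
proof -
 have "(TT v has_derivative (%h. (fst h,snd h))) (at a)" unfolding TT_def[abs_def] by (auto intro!:derivative_eq_intros)
 thus ?thesis using frechet_derivative_at by fastforce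
qed

lemma link_gen:
 assumes E: "!!e. e:E ==> invfield e"
 shows "a:Y ==> link E a (FF a)" "a:Y ==> link E a (FI a)" "a:Y ==> v:Lat ==> link E a (TT v a)"
  "j<3 ==> a:Dj j ==> link E a (Gm j a)"
proof -
 have r: "rel (FF b) b" "rel (FI b) b" for b
  using rel0_FI(3)[of b] rel0_FI(1)[of b 1] rel0_sym unfolding rel_def by auto
 have rT: "rel (TT v b) b" if "v:Lat" for v b using rel0_sym[OF rel0_FI(4)[OF that]] by (simp add:rel_def)
 have rG: "rel (Gm j b) b" if "j<3" "b:Dj j" for j b
 proof -
  have "relG b (Gm j b)" unfolding relG_def Gm_def by (rule exI[of _ j], rule conjI[OF that(1)], rule exI[of _ "fst b - cs j"], rule exI[of _ "snd b"]) (use that(2) in "simp add:Dj_def")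
  thus ?thesis using relG_sym rel_def by blast
 qed
 show "link E a (FF a)" if "a:Y"
  unfolding link_def deck_def using E that r q_eq open_Y Y_FF smooth_FF[OF open_Y] by (intro exI[of _ Y] exI[of _ FF]) (auto simp:invfield_def)
 show "link E a (FI a)" if "a:Y"
  unfolding link_def deck_def using E that r q_eq open_Y Y_FF smooth_FI[OF open_Y] by (intro exI[of _ Y] exI[of _ FI]) (auto simp:invfield_def)
 show "link E a (TT v a)" if "a:Y" "v:Lat"
 proof -
  have "deck Y q Y (TT v) a (TT v a)"
   unfolding deck_def using that rT[OF that(2)] q_eq open_Y Y_FF(3)[OF that(2)] smooth_TT[OF open_Y] by blast
  moreover have "FD (TT v) (at a) (e a) = 1 *R e (TT v a)" if "e:E" for e
   using E[OF that] `v:Lat` `a:Y` by (simp add:TT_deriv invfield_def)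
  ultimately show ?thesis unfolding link_def by blast
 qed
 show "link E a (Gm j a)" if "j<3" "a:Dj j"
  unfolding link_def deck_def using E that rG q_eq open_Dj Dj_Y[OF that(1)] smooth_Gm by (intro exI[of _ "Dj j"] exI[of _ "Gm j"]) (auto simp:invfield_def)
qed

lemma link_rel0:
 assumes E: "!!e. e:E ==> invfield e" and a: "a:Y" and ab: "rel0 a b"
 shows "link E a b"
proof -
 have "link E a a" using link_gen(3)[OF E a Lat_0] by simp
 hence 1: "link E a ((FF^^n) a) & link E a ((FI^^n) a)" for n
 proof (induction n)
  case (Suc n)
  show ?case using link_trans[OF _ link_gen(1)[OF E, where a="(FF^^n) a"]] link_trans[OF _ link_gen(2)[OF E, where a="(FI^^n) a"]] Suc Y_pow a by simp
 qed auto
 from ab show ?thesis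
 proof (rule rel0_cases)
  fix k v assume "v:Lat" "b = TT v ((FF^^k) a)"
  thus ?thesis using link_trans[OF conjunct1[OF 1] link_gen(3)[OF E]] Y_pow a by blast
 next
  fix k v assume "v:Lat" "b = TT v ((FI^^k) a)"
  thus ?thesis using link_trans[OF conjunct2[OF 1] link_gen(3)[OF E]] Y_pow a by blast
 qed
qed

lemma link_rel:
 assumes E: "!!e. e:E ==> invfield e" and a: "a:Y" and ab: "rel a b"
 shows "link E a b"
proof (cases "rel0 a b")
 case False
 then obtain j u z where *: "j<3" "u~=0" "nrm u<lam" "z~=0" "rel0 a (cs j + u,z)" "rel0 b (gl j u z)"
  using ab unfolding rel_def relG_def by blast
 have c: "(cs j + u,z):Dj j" "Gm j (cs j + u,z) = gl j u z" "gl j u z:Y"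
  using * by (simp_all add:Dj_iff Gm_def Y_gl)
 have "link E (cs j + u,z) (gl j u z)" using link_gen(4)[OF E *(1) c(1)] c(2) by simp
 thus ?thesis
  using link_trans[OF link_trans[OF link_rel0[OF E a *(5)]] link_rel0[OF E c(3) rel0_sym[OF *(6)]]] by blast
qed (use link_rel0 E a in blast)

text \<open>Equivalent points at nearby heights have the same sign, so no glueing is involved. Their
  heights differ by a factor less than \<open>2 < lam\<close>, which excludes powers of
  \<open>FF\<close>; the remaining lattice vector is short, hence zero.\<close>

lemma q_loc_inj: "a:Y ==> EX V. open V & a:V & V<=Y & inj_on q V"
proof -
 assume a: "a:Y"
 let ?V = "Y Int {b. norm (fst b - fst a)<1} Int {b. abs(snd b - snd a)<abs(snd a)/8}"
 have V: "open ?V" by (intro open_Int open_Y open_Collect_less continuous_intros)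
 have "b = c" if b: "b:?V" and c: "c:?V" and bc: "rel b c" for b c
 proof -
  have "snd a~=0" using a by (simp add:Y_def)
  have *: "abs(snd b - snd a)<abs(snd a)/8" "abs(snd c - snd a)<abs(snd a)/8" using b c by auto
  have s: "snd b>0 <-> snd c>0" "snd b~=0" "snd c~=0"
   and z: "abs(snd b)<2*abs(snd c)" "abs(snd c)<2*abs(snd b)" using * by linarith+
  have "rel0 b c" using bc relG_sign s unfolding rel_def by (metis less_asym neqE)
  have pl: "lam^k = 1 | lam^k>=2" "k = 0 | lam^k>=2" for k
  proof -
   have "lam^1<=lam^k" if "k>0" using that by (intro power_increasing) auto
   thus "lam^k = 1 | lam^k>=2" "k = 0 | lam^k>=2" using lam_bounds by (cases "k = 0"; simp)+
  qed
  have "EX v:Lat. c = TT v b"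
   using `rel0 b c`
  proof (rule rel0_cases)
   fix k v assume v: "v:Lat" "c = TT v ((FF^^k) b)"
   hence "abs(snd c)*lam^k = abs(snd b)" by (simp add:TT_def FF_pow)
   hence "abs(snd c)*lam^k<abs(snd c)*2" using z by linarith
   hence "k = 0" using pl(2)[of k] s by auto
   thus ?thesis using v by auto
  next
   fix k v assume v: "v:Lat" "c = TT v ((FI^^k) b)"
   hence "abs(snd c) = abs(snd b)*lam^k" by (simp add:TT_def FI_pow abs_mult)
   hence "abs(snd b)*lam^k<abs(snd b)*2" using z by linarith
   hence "k = 0" using pl(2)[of k] s by auto
   thus ?thesis using v by auto
  qed
  then obtain v where v: "v:Lat" "c = TT v b" by blast
  have "norm v<2"
  proof -
   have "v = (fst c - fst a) - (fst b - fst a)" using v by (simp add:TT_def)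
   hence "norm v<=norm (fst c - fst a) + norm (fst b - fst a)" by (metis norm_triangle_ineq4)
   thus ?thesis using b c by auto
  qed
  hence "v = 0"
   using Lat_small[OF v(1)] norm_fst_le[of "fst v" "snd v"] norm_snd_le[of "snd v" "fst v"] X0 by auto
  thus ?thesis using v by simp
 qed
 hence "inj_on q ?V" by (intro inj_onI) (simp only:q_eq)
 moreover have "a:?V" using a by (auto simp:Y_def)
 ultimately show ?thesis using V by blast
qed

end

section \<open>The quotient is a closed 3-manifold\<close>

definition L3 :: "pt => real^3" where "L3 a = vector [fst (fst a),snd (fst a),snd a]"
definition L3' :: "real^3 => pt" where "L3' x = ((x $ 1,x $ 2),x $ 3)"

lemma L3_linear: "linear L3" "linear L3'" "L3' (L3 e) = e" "L3 (L3' x) = x"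
proof -
 show "linear L3" by (rule linearI) (simp_all add:L3_def vec_eq_iff forall_3)
 show "linear L3'" by (rule linearI) (simp_all add:L3'_def)
 show "L3' (L3 e) = e" by (simp add:L3_def L3'_def)
 show "L3 (L3' x) = x" by (simp add:L3_def L3'_def vec_eq_iff forall_3)
qed

sublocale glued \<subseteq> lq: local_quotient Y q L3 L3'
proof
 show "open Y" by (rule open_Y)
 fix a b assume "a:Y" "b:Y" "q a = q b"
 hence "link {} a b" using link_rel[of "{}" a b] q_eq by simp
 thus "EX V th0. open V & a:V & V<=Y & smooth_on V th0 & th0 a = b & th0 ` V<=Y & (ALL u:V. q (th0 u) = q u)"
  unfolding link_def deck_def by blast
qed (use L3_linear q_loc_inj in "simp_all only:simp_thms linear_add linear_scale")

lemma subseq_choice: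
 assumes "finite S" "!!n::nat. EX k:S. Q n k"
 shows "EX k:S. EX r :: nat => nat. strict_mono r & (ALL n. Q (r n) k)"
proof -
 obtain f where f: "!!n. f n:S & Q n (f n)" using assms(2) by metis
 obtain k where k: "k:S" "infinite (f -` {k} Int UNIV)"
  by (rule inf_img_fin_domE'[of f UNIV]) (use f assms(1) in "auto intro:finite_subset[of _ S]")
 obtain r :: "nat => nat" where "strict_mono r" "!!n. r n:f -` {k} Int UNIV" using infinite_enumerate[OF k(2)] by blast
 moreover from this have "Q (r n) k" for n using f[of "r n"] by simp
 ultimately show ?thesis using k(1) by blast
qed

lemma lam_bracket: "x>=1 ==> EX n. 1<=x/lam^n & x/lam^n<=lam"
proof -
 assume x: "x>=1"
 obtain n where "x<lam^n" using real_arch_pow[of lam x] by auto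
 define m where "m = (LEAST n. x<lam^n)"
 have m: "x<lam^m" unfolding m_def by (rule LeastI) fact
 hence "m~=0" using x by (cases m) auto
 hence "~ x<lam^(m - 1)" unfolding m_def by (intro not_less_Least) auto
 moreover have "lam^m = lam*lam^(m - 1)" using `m~=0` by (metis power_eq_if)
 ultimately show ?thesis using m by (intro exI[of _ "m - 1"]) (auto simp:field_simps)
qed

lemma lam_bracket_small: "0<x ==> x<=1 ==> EX n. 1<=lam^n*x & lam^n*x<=lam"
proof -
 assume x: "0<x" "x<=1"
 obtain n where n: "1<=(1/x)/lam^n" "(1/x)/lam^n<=lam" using lam_bracket[of "1/x"] x by auto
 have "lam^n*x<=1" "1<=lam*(lam^n*x)" using n x by (auto simp:field_simps)
 hence "1<=lam^Suc n*x" "lam^Suc n*x<=lam" by auto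
 thus ?thesis by blast
qed

lemma norm_le_nrm: "norm u<=2*nrm u"
 using norm_Pair_le[of "fst u" "snd u"] by (auto simp:nrm_def)

lemma sq_nrm: "nrm u^2<=sq u" "sq u<=2*nrm u^2"
proof -
 have "fst u^2<=nrm u^2" "snd u^2<=nrm u^2" by (auto simp:nrm_def abs_le_square_iff[symmetric])
 thus "sq u<=2*nrm u^2" by (simp add:sq_def)
 show "nrm u^2<=sq u" by (auto simp:nrm_def sq_def max_def)
qed

context da_map
begin

lemma Lat_closed:
 assumes "!!n. v n:Lat" "v ----> w" shows "w:Lat"
proof -
 obtain N where N: "!!n. n>=N ==> dist (v n) w<1" using assms(2) unfolding lim_sequentially by force
 have "v n = v N" if "n>=N" for n
 proof -
  have "dist (v n) (v N)<2" using dist_triangle2[of "v n" "v N" w] N[OF that] N[of N] by linarith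
  hence "norm (v n - v N)<2" by (simp add:dist_norm)
  hence "v n - v N = 0"
   using norm_fst_le[of "fst (v n - v N)" "snd (v n - v N)"] norm_snd_le[of "snd (v n - v N)" "fst (v n - v N)"] X0 unfolding prod.collapse by (intro Lat_small Lat_diff assms) auto
  thus ?thesis by simp
 qed
 hence "v ----> v N" by (intro tendsto_eventually eventually_sequentiallyI)
 thus ?thesis using LIMSEQ_unique[OF assms(2)] assms(1) by metis
qed

text \<open>Write \<open>p\<close> in the basis \<open>(Kl, Kl)\<close>,
  \<open>(Kl / lam, Kl * lam)\<close> and round the coefficients down.\<close>

lemma Lat_cover: "EX v:Lat. p - v:cbox (0,0) (2*Kl,4*Kl)"
proof -
 define d where "d = Kl*(lam - 1/lam)"
 have d: "d>0" using Kl_pos lam_bounds lam_inverse by (simp add:d_def)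
 define be where "be = (snd p - fst p)/d"
 define al where "al = fst p/Kl - be/lam"
 have "Kl~=0" using Kl_pos by auto
 hence f: "fst p = Kl*(al + be/lam)" by (simp add:al_def)
 have "snd p = fst p + be*d" using d by (simp add:be_def)
 hence s: "snd p = Kl*(al + be*lam)" using f by (simp add:d_def algebra_simps)
 define v where "v = (Kl*(of_int \<lfloor>al\<rfloor> + of_int \<lfloor>be\<rfloor> / lam),Kl*(of_int \<lfloor>al\<rfloor> + of_int \<lfloor>be\<rfloor> * lam))"
 have v: "v:Lat" unfolding Lat_def v_def by blast
 have e: "fst (p - v) = Kl*(frac al + frac be/lam)" "snd (p - v) = Kl*(frac al + frac be*lam)"
  using f s by (simp_all add:v_def frac_def algebra_simps diff_divide_distrib)
 have fr: "0<=frac al" "frac al<=1" "0<=frac be" "frac be<=1" using frac_lt_1 less_imp_le by auto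
 have b: "0<=frac be/lam" "frac be/lam<=1" "0<=frac be*lam" "frac be*lam<=1*3"
  using fr lam_bounds by auto (use mult_mono[of "frac be" 1 lam 3] fr in linarith)
 have "0<=fst (p - v)" "fst (p - v)<=Kl*2" "0<=snd (p - v)" "snd (p - v)<=Kl*4"
  unfolding e using fr b Kl_pos by (intro mult_left_mono mult_nonneg_nonneg; linarith)+
 hence "p - v:cbox (0,0) (2*Kl,4*Kl)" unfolding cbox_Pair_eq by (auto simp:mem_Times_iff)
 thus ?thesis using v by blast
qed

lemma off_forward: "r<=lam ==> p~:Zn r ==> (fm^^n) p~:Zn r"
proof (induction n)
 case (Suc n)
 have "(fm^^n) p:Zn r" if "fm ((fm^^n) p):Zn r"
 proof -
  have "(fm^^n) p:Zn (r/lam)" using fi_Zn_scale[OF Suc.prems(1) that] by simp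
  then obtain v j u where u: "v:Lat" "j<3" "nrm u<r/lam" "(fm^^n) p = v + cs j + u" by (rule ZnE)
  have "0<r/lam" using u(3) nrm_0(2)[of u] by linarith
  hence "r>0" by (simp add:zero_less_divide_iff)
  hence "r/lam<=r" by (simp add:field_simps)
  thus ?thesis using u ZnI[of v j u r] by simp
 qed
 thus ?case using Suc by auto
qed simp

lemma countable_cen: "countable cen"
proof -
 have "Lat = (%(a,b). (Kl*(of_int a + of_int b/lam),Kl*(of_int a + of_int b*lam))) ` (UNIV :: (int \<times> int) set)"
  unfolding Lat_def by auto
 hence "countable Lat" by simp
 moreover have "cen = (%(v,j). v + cs j) ` (Lat \<times> {..<3})" unfolding cen_def by auto
 ultimately show ?thesis by simp
qed

lemma connected_U: "connected U"
 unfolding U_def by (intro path_connected_imp_connected path_connected_complement_countable countable_cen) simp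

end

context glued
begin

text \<open>The heights converge to nonzero limits, so the powers of \<open>FF\<close> are bounded
  and constant on a subsequence; then the lattice vectors converge, and the lattice is
  closed.\<close>

lemma rel0_limit:
 assumes ab: "a:Y" "b:Y" and lim: "A ----> a" "B ----> b" and r: "!!n::nat. rel0 (A n) (B n)"
 shows "rel0 a b"
proof -
 have main: "rel0 a b" if a: "a:Y" and b: "b:Y" and lim: "A ----> a" "B ----> b" and r: "!!n::nat. EX k. EX v:Lat. B n = TT v ((FF^^k) (A n))"
  for a b A B
 proof -
  have nz: "snd a~=0" "snd b~=0" using a b by (auto simp:Y_def)
  have "(%n. abs(snd (A n))) ----> abs(snd a)" "(%n. abs(snd (B n))) ----> abs(snd b)" by (intro tendsto_intros lim)+
  hence ev: "\<forall>\<^sub>F n in sequentially. abs(snd (A n))<2*abs(snd a)" "\<forall>\<^sub>F n in sequentially. abs(snd b)/2<abs(snd (B n))"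
   using nz order_tendstoD(2)[of _ "abs(snd a)" _ "2*abs(snd a)"] order_tendstoD(1)[of _ "abs(snd b)" _ "abs(snd b)/2"] by simp_all
  obtain N where N: "!!n. n>=N ==> abs(snd (A n))<2*abs(snd a) & abs(snd b)/2<abs(snd (B n))"
   using eventually_conj[OF ev] unfolding eventually_sequentially by blast
  obtain k0 where k0: "4*abs(snd a)/abs(snd b)<lam^k0" using real_arch_pow[of lam] by auto
  let ?Q = "%n k. EX v:Lat. B (n + N) = TT v ((FF^^k) (A (n + N)))"
  have "EX k:{..k0}. ?Q n k" for n
  proof -
   obtain k v where k: "v:Lat" "B (n + N) = TT v ((FF^^k) (A (n + N)))" using r by blast
   hence "abs(snd (B (n + N)))*lam^k = abs(snd (A (n + N)))" by (simp add:TT_def FF_pow)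
   moreover have "abs(snd b)/2*lam^k<=abs(snd (B (n + N)))*lam^k" using N[of "n + N"] by simp
   ultimately have "abs(snd b)/2*lam^k<=2*abs(snd a)" using N[of "n + N"] by auto
   hence "lam^k<=4*abs(snd a)/abs(snd b)" using nz by (simp add:field_simps)
   hence "lam^k<lam^k0" using k0 by linarith
   hence "k<k0" by simp
   thus ?thesis using k by auto
  qed
  from subseq_choice[where Q="?Q", OF finite_atMost this] obtain k and r :: "nat => nat"
   where r: "strict_mono r" "ALL n. EX v:Lat. B (r n + N) = TT v ((FF^^k) (A (r n + N)))" by auto
  then obtain v where v: "!!n. v n:Lat" "!!n. B (r n + N) = TT (v n) ((FF^^k) (A (r n + N)))" by metis
  have lim': "(%n. A (r n + N)) ----> a" "(%n. B (r n + N)) ----> b"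
   using LIMSEQ_subseq_LIMSEQ[OF LIMSEQ_ignore_initial_segment[OF lim(1), of N] r(1)] LIMSEQ_subseq_LIMSEQ[OF LIMSEQ_ignore_initial_segment[OF lim(2), of N] r(1)] by (simp_all add:o_def)
  have cf: "continuous_on UNIV fm" by (rule smooth_on_continuous[OF smooth_fm])
  have c: "continuous_on UNIV (%p. (fm^^k) p)" for k
  proof (induction k)
   case (Suc k) thus ?case using continuous_on_compose[OF Suc continuous_on_subset[OF cf]] by simp
  qed auto
  have "(%n. (fm^^k) (fst (A (r n + N)))) ----> (fm^^k) (fst a)"
   by (rule continuous_on_tendsto_compose[OF c tendsto_fst[OF lim'(1)]]) auto
  hence "(%n. fst (B (r n + N)) - (fm^^k) (fst (A (r n + N)))) ----> fst b - (fm^^k) (fst a)"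
   by (intro tendsto_diff tendsto_fst lim')
  hence "v ----> fst b - (fm^^k) (fst a)" using v(2) by (simp add:TT_def FF_pow)
  hence L: "fst b - (fm^^k) (fst a):Lat" using Lat_closed v(1) by blast
  have "(%n. snd (A (r n + N))/lam^k) ----> snd a/lam^k" by (intro tendsto_intros lim') auto
  hence "(%n. snd (B (r n + N))) ----> snd a/lam^k" using v(2) by (simp add:TT_def FF_pow)
  hence "snd b = snd a/lam^k" using LIMSEQ_unique tendsto_snd[OF lim'(2)] by blast
  hence "b = TT (fst b - (fm^^k) (fst a)) ((FF^^k) a)" by (simp add:TT_def FF_pow prod_eq_iff)
  thus ?thesis using rel0_trans[OF rel0_FI(2) rel0_FI(4)[OF L]] by metis
 qed
 let ?Q = "%n s. if s then EX k. EX v:Lat. B n = TT v ((FF^^k) (A n)) else EX k. EX v:Lat. A n = TT v ((FF^^k) (B n))"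
 have "EX s:{True,False}. ?Q n s" for n
  using r[of n]
 proof (rule rel0_cases)
  fix k v assume v: "v:Lat" "B n = TT v ((FI^^k) (A n))"
  hence "A n = (FF^^k) (TT (- v) (B n))" by simp
  thus ?thesis using FF_pow_TT[OF Lat_uminus[OF v(1)], of k "B n"] by auto
 qed auto
 from subseq_choice[where Q="?Q", OF finite_insert[THEN iffD2, OF finite_insert[THEN iffD2, OF finite.emptyI]] this]
 obtain s and r :: "nat => nat" where s: "strict_mono r"
  "ALL n. if s then EX k. EX v:Lat. B (r n) = TT v ((FF^^k) (A (r n))) else EX k. EX v:Lat. A (r n) = TT v ((FF^^k) (B (r n)))"
  by blast
 have l: "(A o r) ----> a" "(B o r) ----> b" using LIMSEQ_subseq_LIMSEQ lim s(1) by blast+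
 show ?thesis
 proof (cases s)
  case True thus ?thesis using main[OF ab l] s(2) by simp
 next
  case False thus ?thesis using rel0_sym[OF main[OF ab(2,1) l(2,1)]] s(2) by simp
 qed
qed

text \<open>A very small \<open>z n\<close> would need many steps of \<open>FI\<close> to reach the
  height of \<open>A n\<close>, and these carry the point into a source, whereas \<open>a\<close>
  has a positive distance from all sources.\<close>

lemma center_lower:
 assumes a: "a:Y" "A ----> a" and j: "j<3" and r: "!!n::nat. nrm (u n)<=1 & rel0 (cs j + u n,z n) (A n)"
 shows "EX de>0. \<forall>\<^sub>F n in sequentially. de<=abs(z n)"
proof -
 have aU: "fst a:U" "snd a~=0" using a by (auto simp:Y_def)
 obtain rh where rh: "rh>0" "ball (fst a) (2*rh)<=U"
  using open_contains_ball_eq[OF open_U] aU by (metis field_sum_of_halves half_gt_zero mult_2)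
 have "\<forall>\<^sub>F n in sequentially. dist (fst (A n)) (fst a)<rh" using tendsto_fst[OF a(2)] rh(1) by (rule tendstoD)
 moreover have "\<forall>\<^sub>F n in sequentially. abs(snd a)/2<abs(snd (A n))"
  using order_tendstoD(1)[OF tendsto_rabs[OF tendsto_snd[OF a(2)]], of "abs(snd a)/2"] aU by auto
 ultimately have "\<forall>\<^sub>F n in sequentially. abs(snd a)/2*min 1 (rh/2)<=abs(z n)"
 proof eventually_elim
  case (elim n)
  from conjunct2[OF r[of n]] have "abs(snd (A n))*min 1 (rh/2)<=abs(z n)"
  proof (rule rel0_cases)
   fix k v assume "v:Lat" "A n = TT v ((FF^^k) (cs j + u n,z n))"
   hence "abs(snd (A n)) = abs(z n)/lam^k" by (simp add:TT_def FF_pow)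
   also have "... <= abs(z n)/1" by (intro divide_left_mono) auto
   finally have "abs(snd (A n))*min 1 (rh/2)<=abs(z n)*1" using rh(1) by (intro mult_mono) auto
   thus ?thesis by simp
  next
   fix k v assume v: "v:Lat" "A n = TT v ((FI^^k) (cs j + u n,z n))"
   hence A: "fst (A n) = v + cs j + (1/lam^k) *R u n" "snd (A n) = lam^k*z n"
    using FI_pow_lin[OF j, of "u n" k "z n"] r[of n] lam_bounds by (simp_all add:TT_def)
   have "v + cs j~:U" using cenI[OF v(1) j] by (simp add:U_def)
   hence "2*rh<=dist (fst a) (v + cs j)" using rh(2) by force
   also have "... <= dist (fst (A n)) (fst a) + dist (fst (A n)) (v + cs j)" by (metis dist_commute dist_triangle)
   finally have "rh<=dist (fst (A n)) (v + cs j)" using elim by linarith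
   also have "... = (1/lam^k)*norm (u n)" by (simp add:A dist_norm)
   also have "... <= (1/lam^k)*2" using norm_le_nrm[of "u n"] r[of n] by (intro mult_left_mono) auto
   finally have "lam^k*(rh/2)<=1" by (simp add:field_simps)
   hence "lam^k*min 1 (rh/2)<=1" by (meson lam_pos min.cobounded2 mult_left_mono order_trans zero_less_power less_imp_le)
   hence "abs(z n)*(lam^k*min 1 (rh/2))<=abs(z n)*1" by (intro mult_left_mono) auto
   thus ?thesis by (simp add:A abs_mult mult_ac)
  qed
  moreover have "abs(snd a)/2*min 1 (rh/2)<=abs(snd (A n))*min 1 (rh/2)" using elim rh by simp
  ultimately show ?case by linarith
 qed
 thus ?thesis using aU rh by (intro exI[of _ "abs(snd a)/2*min 1 (rh/2)"]) auto
qed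

text \<open>Scaling moves the displacement into a fundamental annulus, on both sides of the glueing
  simultaneously.\<close>

lemma annulus:
 assumes j: "j<3" and u: "u~=0" "nrm u<lam" and z: "z~=0"
 shows "EX u' z'. 1/lam<=nrm u' & nrm u'<=1 & z'~=0 & rel0 (cs j + u,z) (cs j + u',z') & rel0 (gl j u z) (gl j u' z')"
proof (cases "nrm u<=1")
 case False
 have g: "FI (cs j + u,z) = (cs j + (1/lam) *R u,lam*z)" "FI (gl j u z) = gl j ((1/lam) *R u) (lam*z)"
  using FI_pow_lin[OF j, of u 1] FI_pow_gl[OF j, of u 1] u by auto
 have "1/lam<=1/lam*nrm u" "1/lam*nrm u<=1" using False u by (auto simp:field_simps)
 thus ?thesis using g rel0_FI(1)[of "(cs j + u,z)" 1] rel0_FI(1)[of "gl j u z" 1] z by (intro exI[of _ "(1/lam) *R u"] exI[of _ "lam*z"]) (auto simp:nrm_scale)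
next
 case True
 obtain n where n: "1<=lam^n*(nrm u)" "lam^n*(nrm u)<=lam" using lam_bracket_small[OF nrm_pos[OF u(1)] True] by blast
 define u' where "u' = (lam^n/lam) *R u"
 have u': "nrm u' = lam^n*nrm u/lam" by (simp add:u'_def nrm_scale)
 have b: "1/lam<=nrm u'" "nrm u'<=1" using n unfolding u' by (auto simp:field_simps)
 show ?thesis
 proof (cases n)
  case 0
  hence "nrm u = 1" using n True by simp
  thus ?thesis using z by (intro exI[of _ u]) auto
 next
  case (Suc m)
  hence uu: "u = (1/lam^m) *R u'" by (simp add:u'_def)
  have l: "nrm u'<=lam" using b lam_bounds by linarith
  have "(FI^^m) (cs j + u',z/lam^m) = (cs j + u,z)" "(FI^^m) (gl j u' (z/lam^m)) = gl j u z"
   using FI_pow_lin[OF j l, of m] FI_pow_gl[OF j l, of m] uu by auto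
  thus ?thesis using rel0_sym[OF rel0_FI(1)[of "(cs j + u',z/lam^m)" m]] rel0_sym[OF rel0_FI(1)[of "gl j u' (z/lam^m)" m]] z b by (intro exI[of _ u'] exI[of _ "z/lam^m"]) auto
 qed
qed

text \<open>Applied on both sides, \<open>center_lower\<close> bounds \<open>z n\<close> and
  \<open>1 / (z n * sq (u n))\<close> away from zero. With \<open>u n\<close> in an annulus the
  glueing parameters stay in a compact set, and a subsequence converges.\<close>

lemma relG_limit:
 assumes ab: "a:Y" "b:Y" and lim: "A ----> a" "B ----> b" and r: "!!n::nat. relG (A n) (B n)"
 shows "relG a b"
proof -
 let ?Q = "%n j. EX u z. 1/lam<=nrm u & nrm u<=1 & z~=0 & rel0 (cs j + u,z) (A n) & rel0 (gl j u z) (B n)"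
 have "EX j:{..<3}. ?Q n j" for n
 proof -
  obtain j u z where *: "j<3" "u~=0" "nrm u<lam" "z~=0" "rel0 (A n) (cs j + u,z)" "rel0 (B n) (gl j u z)"
   using r[of n] by (auto simp:relG_def)
  obtain u' z' where "1/lam<=nrm u'" "nrm u'<=1" "z'~=0" "rel0 (cs j + u,z) (cs j + u',z')" "rel0 (gl j u z) (gl j u' z')"
   using annulus[OF *(1-4)] by blast
  hence "?Q n j" using rel0_sym[OF rel0_trans[OF *(5)]] rel0_sym[OF rel0_trans[OF *(6)]] by blast
  thus ?thesis using *(1) by blast
 qed
 from subseq_choice[where Q="?Q", OF finite_lessThan this] obtain j and s :: "nat => nat" where js: "j:{..<3}" and s: "strict_mono s" "ALL n. ?Q (s n) j"
  by auto
 have j: "j<3" using js by simp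
 have lim: "(A o s) ----> a" "(B o s) ----> b" using LIMSEQ_subseq_LIMSEQ lim s(1) by blast+
 obtain u z where uz: "!!n. 1/lam<=nrm (u n) & nrm (u n)<=1 & z n~=0 & rel0 (cs j + u n,z n) ((A o s) n) & rel0 (gl j (u n) (z n)) ((B o s) n)"
  using s(2) unfolding o_def by metis
 have un: "u n~=0" for n
 proof
  assume "u n = 0" hence "1/lam<=0" using uz[of n] by simp
  thus False by simp
 qed
 define w where "w n = ee j (z n) *R rot (u n)" for n
 define y where "y n = - (1/(z n * sq (u n)))" for n
 have gw: "gl j (u n) (z n) = (cs (pj j) + w n,y n)" "nrm (w n) = nrm (u n)" for n
  using gl_form[OF un[of n], of "z n" j] uz[of n] by (simp_all add:w_def y_def)
 obtain d1 where d1: "d1>0" "\<forall>\<^sub>F n in sequentially. d1<=abs(z n)"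
  using center_lower[OF ab(1) lim(1) j, of u z] uz by blast
 have jj: "pj j<3" using j by simp
 obtain d2 where d2: "d2>0" "\<forall>\<^sub>F n in sequentially. d2<=abs(y n)"
  using center_lower[OF ab(2) lim(2) jj, of w y] uz gw by metis
 have low: "1/lam^2<=sq (u n)" for n
 proof -
  have "(1/lam)^2<=nrm (u n)^2" using uz[of n] by simp
  thus ?thesis using sq_nrm(1)[of "u n"] by (simp add:power_divide)
 qed
 define C where "C = lam^2/d2"
 have "\<forall>\<^sub>F n in sequentially. d1<=abs(z n) & abs(z n)<=C"
  using d1(2) d2(2)
 proof eventually_elim
  case (elim n)
  have s0: "sq (u n)>0" using sq_pos un by blast
  have "abs(y n) = 1/(abs(z n) * sq (u n))" using s0 by (simp add:y_def abs_mult)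
  hence "abs(z n) * sq (u n)*abs(y n) = 1" using s0 uz[of n] by simp
  moreover have "abs(z n) * sq (u n)*d2<=abs(z n) * sq (u n)*abs(y n)" using elim s0 by (intro mult_left_mono) auto
  moreover have "abs(z n)*(1/lam^2)*d2<=abs(z n) * sq (u n)*d2" using low[of n] d2(1) by (intro mult_right_mono mult_left_mono) auto
  ultimately have "abs(z n)*(1/lam^2)*d2<=1" by linarith
  thus ?case using elim d2(1) by (simp add:C_def field_simps)
 qed
 then obtain N where N: "!!n. n>=N ==> d1<=abs(z n) & abs(z n)<=C" unfolding eventually_sequentially by blast
 let ?S = "{p :: real*real. 1/lam<=nrm p & nrm p<=1} \<times> {x :: real. d1<=abs x & abs x<=C}"
 have "compact ?S"
 proof (intro compact_Times)
  have "closed {p. 1/lam<=nrm p & nrm p<=1}" by (intro closed_Collect_conj closed_Collect_le continuous_intros)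
  moreover have "bounded {p. 1/lam<=nrm p & nrm p<=1}" unfolding bounded_iff by (intro exI[of _ 2] ballI order_trans[OF norm_le_nrm]) auto
  ultimately show "compact {p. 1/lam<=nrm p & nrm p<=1}" by (simp add:compact_eq_bounded_closed)
  have "closed {x :: real. d1<=abs x & abs x<=C}" by (intro closed_Collect_conj closed_Collect_le continuous_intros)
  moreover have "bounded {x :: real. d1<=abs x & abs x<=C}" unfolding bounded_iff by auto
  ultimately show "compact {x :: real. d1<=abs x & abs x<=C}" by (simp add:compact_eq_bounded_closed)
 qed
 hence cS: "seq_compact ?S" by (rule compact_imp_seq_compact)
 have "ALL n. (u (n + N),z (n + N)):?S" using uz N by auto
 with cS obtain l and t :: "nat => nat" where l: "l:?S" and t: "strict_mono t" "((%n. (u (n + N),z (n + N))) o t) ----> l"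
  by (rule seq_compactE)
 have lt: "(%n. u (t n + N)) ----> fst l" "(%n. z (t n + N)) ----> snd l"
  using tendsto_fst[OF t(2)] tendsto_snd[OF t(2)] by auto
 have l': "fst l~=0" "nrm (fst l)<lam" "snd l~=0" using l lam_bounds d1(1) by auto
 define cc where "cc = (cs j + fst l,snd l)"
 have cD: "cc:Dj j" using l' by (simp add:cc_def Dj_iff)
 have lc: "(%n. (cs j + u (t n + N),z (t n + N))) ----> cc" unfolding cc_def by (intro tendsto_intros lt)
 have "continuous_on (Dj j) (Gm j)" by (rule smooth_on_continuous[OF smooth_Gm])
 hence "(%n. Gm j (cs j + u (t n + N),z (t n + N))) ----> Gm j cc"
  by (rule continuous_on_tendsto_compose[OF _ lc cD]) (intro always_eventually allI, unfold Dj_iff, use uz un lam_bounds in "metis le_less_trans less_trans one_less_numeral_iff semiring_norm(76)")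
 hence lg: "(%n. gl j (u (t n + N)) (z (t n + N))) ----> gl j (fst l) (snd l)" by (simp add:Gm_def cc_def)
 have lA: "(%n. (A o s) (t n + N)) ----> a" "(%n. (B o s) (t n + N)) ----> b"
  using LIMSEQ_subseq_LIMSEQ[OF LIMSEQ_ignore_initial_segment[OF lim(1), of N] t(1)] LIMSEQ_subseq_LIMSEQ[OF LIMSEQ_ignore_initial_segment[OF lim(2), of N] t(1)] by (simp_all add:o_def)
 have "cc:Y" "gl j (fst l) (snd l):Y" using l' j Y_gl by (simp_all add:cc_def Y_center)
 hence "rel0 cc a" "rel0 (gl j (fst l) (snd l)) b"
  using rel0_limit[OF _ ab(1) lc lA(1)] rel0_limit[OF _ ab(2) lg lA(2)] uz by blast+
 thus ?thesis using rel0_sym j l' unfolding relG_def cc_def by blast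
qed

lemma Hausdorff_lq: "Hausdorff_space lq.M"
proof (rule lq.Hausdorff_M)
 fix a b A B assume *: "a:Y" "b:Y" "A ----> a" "B ----> b" "!!n::nat. q (A n) = q (B n)"
 let ?Q = "%n s. if s then rel0 (A n) (B n) else relG (A n) (B n)"
 have "EX s:{True,False}. ?Q n s" for n
  using *(5)[of n] q_eq rel_def by auto
 from subseq_choice[where Q="?Q", OF finite_insert[THEN iffD2, OF finite_insert[THEN iffD2, OF finite.emptyI]] this]
 obtain s and r :: "nat => nat" where s: "strict_mono r" "ALL n. if s then rel0 (A (r n)) (B (r n)) else relG (A (r n)) (B (r n))"
  by blast
 have l: "(A o r) ----> a" "(B o r) ----> b" using LIMSEQ_subseq_LIMSEQ * s(1) by blast+
 have "rel a b"
 proof (cases s)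
  case True thus ?thesis using rel0_limit[OF *(1,2) l] s(2) by (simp add:rel_def)
 next
  case False thus ?thesis using relG_limit[OF *(1,2) l] s(2) by (simp add:rel_def)
 qed
 thus "q a = q b" by (simp add:q_eq)
qed

text \<open>The heights start at \<open>1/2\<close> and not at \<open>1\<close>, since this is what
  \<open>KK_reach\<close> guarantees after a crossing.\<close>

definition KK :: "pt set" where
 "KK = (cbox (0,0) (2*Kl,4*Kl) - Zn (1/lam)) \<times> ({- lam..- (1/2)} Un {1/2..lam})"

lemma compact_KK: "compact KK"
 unfolding KK_def by (intro compact_Times compact_diff compact_Un compact_Icc compact_cbox open_Zn)

lemma KK_Y: "KK<=Y"
proof -
 have "p:U" if "p~:Zn (1/lam)" for p using that cen_Zn[of "1/lam"] by (auto simp:U_def)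
 thus ?thesis by (auto simp:KK_def Y_def)
qed

lemma KK_reach1: "p~:Zn (1/lam) ==> 1/2<=abs z ==> EX b:KK. rel0 (p,z) b"
proof -
 assume p: "p~:Zn (1/lam)" and z: "1/2<=abs z"
 have l: "1/lam<=lam" using lam_bounds using lam_inverse by linarith
 obtain n where n: "1/2<=abs(z/lam^n)" "abs(z/lam^n)<=lam"
 proof (cases "abs z<=lam")
  case True thus ?thesis using that[of 0] z by simp
 next
  case False
  hence "1<=abs z" using lam_bounds by linarith
  then obtain n where "1<=abs z/lam^n" "abs z/lam^n<=lam" using lam_bracket by blast
  thus ?thesis using that[of n] by force
 qed
 obtain v where v: "v:Lat" "(fm^^n) p - v:cbox (0,0) (2*Kl,4*Kl)" using Lat_cover by blast
 have "(fm^^n) p - v~:Zn (1/lam)"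
 proof
  assume "(fm^^n) p - v:Zn (1/lam)"
  then obtain w j u where *: "w:Lat" "j<3" "nrm u<1/lam" "(fm^^n) p - v = w + cs j + u" by (rule ZnE)
  hence "(fm^^n) p = (w + v) + cs j + u" by (simp add:algebra_simps)
  hence "(fm^^n) p:Zn (1/lam)" using ZnI[OF Lat_add[OF *(1) v(1)] *(2,3)] by simp
  thus False using off_forward[OF l p] by blast
 qed
 moreover have "z/lam^n:{- lam..- (1/2)} Un {1/2..lam}" using n unfolding Un_iff atLeastAtMost_iff by linarith
 ultimately have "TT (- v) ((FF^^n) (p,z)):KK" using v unfolding KK_def TT_def FF_pow by simp
 thus ?thesis using rel0_trans[OF rel0_FI(2) rel0_FI(4)[OF Lat_uminus[OF v(1)]]] by blast
qed

text \<open>A point too close to a source is sent through the glueing, where it is again close to a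
  source, and then driven outwards by \<open>fm\<close>. This costs powers of \<open>lam\<close> in
  height, but the factor \<open>1 / sq u\<close> gained at the crossing outweighs them.\<close>

lemma KK_reach: "a:Y ==> EX b:KK. rel a b"
proof -
 assume a: "a:Y"
 have "EX b:Y. rel0 a b & 1<=abs(snd b) & abs(snd b)<=lam"
 proof (cases "1<=abs(snd a)")
  case True
  then obtain n where "1<=abs(snd a)/lam^n" "abs(snd a)/lam^n<=lam" using lam_bracket by blast
  thus ?thesis using a rel0_FI(2) Y_pow(1) by (intro bexI[of _ "(FF^^n) a"]) (auto simp:FF_pow)
 next
  case False
  hence "0<abs(snd a)" "abs(snd a)<=1" using a by (auto simp:Y_def)
  then obtain n where "1<=lam^n*abs(snd a)" "lam^n*abs(snd a)<=lam" using lam_bracket_small by blast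
  thus ?thesis using a rel0_FI(1) Y_pow(2) by (intro bexI[of _ "(FI^^n) a"]) (auto simp:FI_pow)
 qed
 then obtain b where b: "b:Y" "rel0 a b" "1<=abs(snd b)" "abs(snd b)<=lam" by blast
 have "EX c:KK. rel b c"
 proof (cases "fst b:Zn (1/lam)")
  case False thus ?thesis using KK_reach1[OF False, of "snd b"] b by (auto simp:rel_def)
 next
  case True
  then obtain v j u where u: "v:Lat" "j<3" "nrm u<1/lam" "fst b = v + cs j + u" by (rule ZnE)
  have l1: "1/lam<=1" by simp
  have "nrm u<=lam" "nrm u<lam" using u(3) l1 lam_bounds by linarith+
  have u0: "u~=0" using b(1) u U_iff[OF u(1,2) `nrm u<=lam`] by (auto simp:Y_def)
  have z0: "snd b~=0" using b by auto
  have r1: "rel0 b (cs j + u,snd b)"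
  proof -
   have "TT (- v) b = (cs j + u,snd b)" using u by (simp add:TT_def)
   thus ?thesis using rel0_FI(4)[OF Lat_uminus[OF u(1)], of b] by simp
  qed
  define u1 where "u1 = ee j (snd b) *R rot u"
  define z1 where "z1 = - (1/(snd b * sq u))"
  have g: "gl j u (snd b) = (cs (pj j) + u1,z1)" "nrm u1 = nrm u" using gl_form[OF u0 z0, of j] by (simp_all add:u1_def z1_def)
  have r2: "relG b (cs (pj j) + u1,z1)"
   unfolding relG_def g(1)[symmetric] using u(2) u0 z0 `nrm u<lam` r1 by (intro exI[of _ j] conjI exI[of _ u]) auto
  have np: "0<nrm u" using nrm_pos u0 by blast
  obtain m where m: "1<=lam^m*nrm u" "lam^m*nrm u<=lam" using lam_bracket_small[OF np] u(3) l1 by auto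
  define u2 where "u2 = (lam^m/lam) *R u1"
  have n2: "nrm u2 = lam^m*nrm u/lam" by (simp add:u2_def nrm_scale g)
  have u2: "1/lam<=nrm u2" "nrm u2<=1" using m unfolding n2 by (auto simp:field_simps)
  have "m~=0" using m u(3) l1 by (cases m) auto
  then obtain k where k: "m = Suc k" by (cases m) auto
  have lu2: "nrm u2<=lam" using u2 lam_bounds by linarith
  have "(FI^^k) (cs (pj j) + u2,z1/lam^k) = (cs (pj j) + u1,z1)"
   using FI_pow_lin[of "pj j" u2 k "z1/lam^k"] u(2) lu2 k by (simp add:u2_def)
  hence r3: "rel0 (cs (pj j) + u1,z1) (cs (pj j) + u2,z1/lam^k)" using rel0_sym rel0_FI(1) by metis
  have off: "cs (pj j) + u2~:Zn (1/lam)"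
   using nrm_Zn_iff[OF Lat_0, of "pj j" u2 "1/lam"] u(2) u2 by auto
  have "1/2<=abs(z1/lam^k)"
  proof -
   have s: "sq u>0" using sq_pos u0 by blast
   have e: "abs(z1/lam^k) = 1/(abs(snd b) * sq u*lam^k)" using s by (simp add:z1_def abs_mult)
   have "lam^k*nrm u<=1" using m(2) k by simp
   have "abs(snd b) * sq u*lam^k<=lam*(2*nrm u^2)*lam^k"
    using b(4) sq_nrm(2)[of u] s by (intro mult_mono) auto
   also have "... = (lam*nrm u)*(2*(lam^k*nrm u))" by (simp add:power2_eq_square)
   also have "... <= 1*(2*1)" using u(3) `lam^k*nrm u<=1` by (intro mult_mono) (auto simp:field_simps)
   finally have "abs(snd b) * sq u*lam^k<=2" by simp
   thus ?thesis unfolding e using z0 s by simp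
  qed
  then obtain c where "c:KK" "rel0 (cs (pj j) + u2,z1/lam^k) c" using KK_reach1[OF off] by blast
  thus ?thesis using relG_rel0(1)[OF r2 rel0_trans[OF r3]] rel_def by blast
 qed
 thus ?thesis using rel_equiv(3) b(2) rel_def by blast
qed

lemma KK_onto: "q ` KK = q ` Y"
 using KK_Y KK_reach q_eq by blast

lemma Y_half_connected: "connected (Y Int {a. snd a>0})" "connected (Y Int {a. snd a<0})"
proof -
 have "Y Int {a. snd a>0} = U \<times> {0<..}" "Y Int {a. snd a<0} = U \<times> {..<0}" by (auto simp:Y_def)
 thus "connected (Y Int {a. snd a>0})" "connected (Y Int {a. snd a<0})" by (simp_all add:connected_U)
qed

text \<open>Each half is connected, as \<open>U\<close> is the complement of a countable set; the
  glueing at source \<open>0\<close> joins them.\<close>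

lemma connected_lq: "connected_space lq.M" and nonempty_lq: "topspace lq.M~={}"
proof -
 let ?P = "Y Int {a. snd a>0}" and ?N = "Y Int {a. snd a<0}"
 define a where "a = (cs 0 + (1,0),1 :: real)"
 have a: "a:Dj 0" by (simp add:a_def Dj_iff nrm_def zero_prod_def)
 have aY: "a:?P" using Dj_Y(1)[of 0] a by (auto simp:a_def)
 have gN: "Gm 0 a:?N" using Dj_Y(2)[of 0] a by (auto simp:a_def Gm_def gl_def sq_def)
 have "relG a (Gm 0 a)" unfolding relG_def Gm_def by (rule exI[of _ 0], rule conjI[OF _ exI[of _ "fst a - cs 0"]], simp, rule exI[of _ "snd a"]) (use a in "simp add:Dj_def")
 hence e: "q a = q (Gm 0 a)" by (simp add:q_eq rel_def)
 have c: "connectedin lq.M (q ` S)" if "connected S" "S<=Y" for S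
  by (rule connectedin_continuous_map_image[OF lq.continuous_q]) (use that in "simp add:connectedin_subtopology")
 have "q a:q ` ?P" "q a:q ` ?N" using aY gN e by (metis imageI)+
 hence "connectedin lq.M (q ` ?P Un q ` ?N)" using c[OF Y_half_connected(1)] c[OF Y_half_connected(2)] by (intro connectedin_Un) auto
 moreover have "q ` ?P Un q ` ?N = q ` Y"
 proof -
  have "?P Un ?N = Y" by (auto simp:Y_def)
  thus ?thesis by auto
 qed
 ultimately show "connected_space lq.M" using connectedin_topspace[of lq.M] by simp
 show "topspace lq.M~={}" using aY by auto
qed

lemma closed_3_manifold_lq: "closed_3_manifold lq.M lq.qatlas"
 unfolding closed_3_manifold_def using Hausdorff_lq lq.second_countable_M lq.compact_M[OF compact_KK KK_Y KK_onto] connected_lq nonempty_lq lq.smooth_atlas_qatlas by blast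

end

lemma (in local_quotient) smooth_cover_M:
 assumes m: "closed_3_manifold M qatlas" and K: "compact K" "K<=Y" "q ` K = q ` Y"
 shows "smooth_cover M qatlas Y q K"
proof
 show "continuous_map (top_of_set Y) M q" by (rule continuous_q)
 fix c assume c: "c:qatlas"
 then obtain V where V: "V:sheets" "c = qchart V" by (auto simp:qatlas_def)
 show "smooth_on (Y Int q -` fst c) (%e. snd c (q e))" using smooth_chart_q[OF V(1)] by (simp add:V qchart_def)
 fix a assume a: "a:Y" "q a:fst c"
 then obtain b where b: "b:V" "q b = q a" by (auto simp:V qchart_def)
 have VV: "open V" "V<=Y" "inj_on q V" using V by (auto simp:sheets_def)
 obtain U th0 where U: "open U" "b:U" "U<=Y" "smooth_on U th0" "th0 b = a" "th0 ` U<=Y" "ALL u:U. q (th0 u) = q u"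
  using pseudo[of b a] b VV a(1) by blast
 let ?W = "L ` (U Int V)"
 have W: "open ?W" using open_L U VV by blast
 have "smooth_on ?W (%x. th0 (L' x))"
  by (rule smooth_on_compose[OF U(4) smooth_on_L'[OF W smooth_on_id[OF W]] W U(1)]) auto
 moreover have s: "snd c (q x) = L x" if "x:V" for x using that VV(3) by (simp add:V qchart_def)
 moreover have "q (th0 (L' x)):fst c & snd c (q (th0 (L' x))) = x" if "x:?W" for x
 proof -
  have "EX w. w:U & w:V & x = L w" using that by blast
  then obtain w where "w:U" "w:V" "x = L w" by blast
  thus ?thesis using U(7) s by (simp add:V qchart_def)
 qed
 moreover have "snd c (q a) = L b" using s b by metis
 moreover have "?W<=snd c ` fst c" using qchart_image[OF V(1)] V by auto
 moreover have "snd c (q a):?W" "th0 (L' (snd c (q a))) = a" unfolding `snd c (q a) = L b` using U(2,5) b by simp_all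
 moreover have "th0 (L' (L w)):Y" if "w:U" for w using U(6) that by auto
 hence "(%x. th0 (L' x)) ` ?W<=Y" by blast
 moreover note this
 ultimately show "EX W rh. open W & snd c (q a):W & W<=snd c ` fst c & smooth_on W rh & rh ` W<=Y &
    rh (snd c (q a)) = a & (ALL x:W. q (rh x):fst c & snd c (q (rh x)) = x)"
  using W by blast
 next
 show "openin M (q ` U)" if "open U" "U<=Y" for U using open_q that .
 show "EX U. open U & a:U & U<=Y & inj_on q U" if "a:Y" for a using loc_inj that .
qed (rule m Y_open topspace_M[symmetric] K)+

text \<open>Precomposition with a diffeomorphism of \<open>Y\<close> changes the fibres of the
  projection but keeps the manifold. In this way the second flow is placed on the manifold of the
  first.\<close>

lemma (in smooth_cover) smooth_cover_comp:
 assumes Ps: "smooth_on Y Ps" "smooth_on Y Ps'" "!!a. a:Y ==> Ps a:Y & Ps' a:Y & Ps (Ps' a) = a & Ps' (Ps a) = a"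
 shows "smooth_cover X A Y (%a. q (Ps a)) (Ps' ` K)"
proof
 have c: "continuous_on Y Ps" "continuous_on Y Ps'" using Ps smooth_on_continuous by blast+
 have im: "Ps ` Y = Y" "Ps' ` Y = Y"
 proof -
  have "Ps ` Y<=Y" "Ps' ` Y<=Y" using Ps(3) by blast+
  moreover have "a:Ps ` Y" "a:Ps' ` Y" if "a:Y" for a using Ps(3)[OF that] by (metis imageI)+
  ultimately show "Ps ` Y = Y" "Ps' ` Y = Y" by blast+
 qed
 have im2: "Ps ` U = Y Int Ps' -` U" if "U<=Y" for U using that Ps(3) by (auto simp:image_iff) metis
 have op: "open (Ps ` U)" if "open U" "U<=Y" for U
  unfolding im2[OF that(2)] by (rule continuous_open_preimage[OF c(2) Y_open that(1)])
 show "closed_3_manifold X A" "open Y" by (rule mfd, rule Y_open)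
 show "(%a. q (Ps a)) ` Y = topspace X" using im q_onto by (metis image_image)
 show "compact (Ps' ` K)" using compact_continuous_image[OF continuous_on_subset[OF c(2) K(2)] K(1)] .
 show "Ps' ` K<=Y" using im K by blast
 have "Ps ` Ps' ` K = K" using Ps(3) K(2) by (force simp:image_iff)
 thus "(%a. q (Ps a)) ` Ps' ` K = (%a. q (Ps a)) ` Y" using im K(3) by (metis image_image)
 have "continuous_map (top_of_set Y) (top_of_set Y) Ps" using c(1) im by auto
 from continuous_map_compose[OF this cont_q] show "continuous_map (top_of_set Y) X (%a. q (Ps a))" by (simp add:o_def)
 show "openin X ((%a. q (Ps a)) ` U)" if "open U" "U<=Y" for U
  using open_q[OF op[OF that]] im that by (metis image_image image_mono)
 show "EX U. open U & a:U & U<=Y & inj_on (%a. q (Ps a)) U" if a: "a:Y" for a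
 proof -
  obtain V where V: "open V" "Ps a:V" "V<=Y" "inj_on q V" using loc_inj Ps(3) a by blast
  let ?U = "Y Int Ps -` V"
  have "inj_on (%a. q (Ps a)) ?U" using V(4) Ps(3) by (intro inj_onI) (metis IntE inj_onD vimage_eq)
  moreover have "open ?U" by (rule continuous_open_preimage[OF c(1) Y_open V(1)])
  ultimately show ?thesis using V a by blast
 qed
 show "smooth_on (Y Int (%a. q (Ps a)) -` fst c) (%e. snd c (q (Ps e)))" if cA: "c:A" for c
 proof -
  have o: "open (Y Int (%a. q (Ps a)) -` fst c)"
  proof -
   have "Y Int (%a. q (Ps a)) -` fst c = Y Int Ps -` (Y Int q -` fst c)" using Ps(3) by auto
   thus ?thesis using continuous_open_preimage[OF c(1) Y_open chart_dom_open[OF cA]] by simp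
  qed
  show ?thesis
   by (rule smooth_on_compose[OF smooth_h[OF cA] smooth_on_subset[OF Ps(1)] o chart_dom_open[OF cA]]) (use Ps(3) in auto)
 qed
 show "EX W rh. open W & snd c (q (Ps a)):W & W<=snd c ` fst c & smooth_on W rh & rh ` W<=Y &
    rh (snd c (q (Ps a))) = a & (ALL x:W. q (Ps (rh x)):fst c & snd c (q (Ps (rh x))) = x)"
  if cA: "c:A" "a:Y" "q (Ps a):fst c" for c a
 proof -
  obtain W rh where W: "open W" "snd c (q (Ps a)):W" "W<=snd c ` fst c" "smooth_on W rh" "rh ` W<=Y"
   "rh (snd c (q (Ps a))) = Ps a" "ALL x:W. q (rh x):fst c & snd c (q (rh x)) = x"
   using sect[OF cA(1) _ cA(3)] Ps(3) cA(2) by blast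
  have "smooth_on W (%x. Ps' (rh x))" by (rule smooth_on_compose[OF Ps(2) W(4,1) Y_open]) (use W(5) in auto)
  moreover have "Ps (Ps' (rh x)) = rh x" "Ps' (rh x):Y" if "x:W" for x using that W(5) Ps(3) by auto
  ultimately show ?thesis using W Ps(3) cA(2) by (intro exI[of _ W] exI[of _ "%x. Ps' (rh x)"]) auto
 qed
qed

section \<open>The flow on the glued manifold\<close>

lemma (in da_map) Zn_add: "v:Lat ==> p + v:Zn r <-> p:Zn r"
proof -
 have *: "p + v:Zn r" if v: "v:Lat" and p: "p:Zn r" for p v
 proof -
  obtain w j u where "w:Lat" "j<3" "nrm u<r" "p = w + cs j + u" using ZnE[OF p] .
  thus ?thesis using ZnI[OF Lat_add[OF _ v], of w j u r] by (simp add:add_ac)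
 qed
 show "v:Lat ==> ?thesis" using *[of v p] *[of "- v" "p + v"] Lat_uminus by auto
qed

lemma pos_scale: "0<k ==> 0<s*(k*x) <-> 0<s*x" "0<k ==> 0<s*(x/k) <-> 0<s*x" for k s x :: real
 by (auto simp:zero_less_mult_iff zero_less_divide_iff mult_less_0_iff)

context glued
begin

definition Ft :: "real => pt => pt" where "Ft t a = (fst a,exp (t * sgn (snd a)) * snd a)"

lemma Ft_0 [simp]: "Ft 0 a = a" by (simp add:Ft_def)
lemma sgn_Ft [simp]: "sgn (snd (Ft t a)) = sgn (snd a)" "fst (Ft t a) = fst a" by (simp_all add:Ft_def sgn_mult)
lemma Ft_add: "Ft (s + t) a = Ft s (Ft t a)" by (simp add:Ft_def sgn_mult distrib_right exp_add)
lemma Ft_Y [simp]: "Ft t a:Y <-> a:Y" by (simp add:Y_def Ft_def)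
lemma Ft_FF: "Ft t (FF a) = FF (Ft t a)" "Ft t (FI a) = FI (Ft t a)" "Ft t (TT v a) = TT v (Ft t a)"
 by (simp_all add:Ft_def FF_def FI_def TT_def sgn_mult)
lemma Ft_pow: "Ft t ((FF^^n) a) = (FF^^n) (Ft t a)" "Ft t ((FI^^n) a) = (FI^^n) (Ft t a)"
 by (induction n) (auto simp:Ft_FF)

text \<open>The glueing inverts the modulus of \<open>z\<close> and changes its sign, so growth in
  one piece matches decay in the other.\<close>

lemma Ft_gl: "u~=0 ==> z~=0 ==> Ft t (gl j u z) = gl j u (exp (t * sgn z)*z)"
proof -
 assume a: "u~=0" "z~=0"
 have s: "sq u>0" using sq_pos a by blast
 hence "sgn (z * sq u) = sgn z" by (simp add:sgn_mult)
 hence sg: "sgn (- (1/(z * sq u))) = - sgn z" by simp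
 have ez: "ee j (exp (t * sgn z)*z) = ee j z" by (simp add:ee_def zero_less_mult_iff)
 show ?thesis unfolding gl_def Ft_def snd_conv sg ez by (simp add:exp_minus field_simps)
qed

lemma Ft_Gm: "a:Dj j ==> Ft t a:Dj j & Gm j (Ft t a) = Ft t (Gm j a)"
 using Ft_gl[of "fst a - cs j" "snd a" t j] by (simp add:Gm_def Dj_def Ft_def)

lemma Ft_rel0: "rel0 a b ==> rel0 (Ft t a) (Ft t b)"
 unfolding rel0_def by (metis Ft_pow(2) Ft_FF(3))

lemma Ft_rel: "rel a b ==> rel (Ft t a) (Ft t b)"
proof (cases "rel0 a b")
 case False
 assume "rel a b"
 then obtain j u z where *: "j<3" "u~=0" "nrm u<lam" "z~=0" "rel0 a (cs j + u,z)" "rel0 b (gl j u z)"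
  using False unfolding rel_def relG_def by blast
 have "rel0 (Ft t a) (cs j + u,exp (t * sgn z)*z)" using Ft_rel0[OF *(5), of t] by (simp add:Ft_def)
 moreover have "rel0 (Ft t b) (gl j u (exp (t * sgn z)*z))" using Ft_rel0[OF *(6), of t] Ft_gl[OF *(2,4)] by simp
 ultimately have "relG (Ft t a) (Ft t b)" using * unfolding relG_def by (intro exI[of _ j] conjI exI[of _ u] exI[of _ "exp (t * sgn z)*z"]) auto
 thus ?thesis by (simp add:rel_def)
qed (auto simp:rel_def dest:Ft_rel0)

lemma rel_Gm: "j<3 ==> a:Dj j ==> rel a (Gm j a)"
 unfolding rel_def relG_def Gm_def by (rule disjI2, rule exI[of _ j], rule conjI, assumption, rule exI[of _ "fst a - cs j"], rule exI[of _ "snd a"]) (simp add:Dj_def)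

lemma smooth_Ft: "smooth_on (UNIV \<times> Y) (%(t,y). Ft t y)"
proof (rule smooth_on_local)
 fix x :: "real \<times> pt" assume x: "x:UNIV \<times> Y"
 let ?s = "sgn (snd (snd x))"
 let ?V = "(UNIV \<times> Y) Int {y. snd (snd y) * snd (snd x)>0}"
 have V: "open ?V" by (intro open_Int open_Times open_UNIV open_Y open_Collect_less continuous_intros)
 have e: "(%(t,y). Ft t y) y = (fst (snd y),exp (fst y*?s) * snd (snd y))" if "y:?V" for y
  using that by (auto simp:Ft_def zero_less_mult_iff)
 have "smooth_on ?V (%y. fst y*?s)" by (intro smooth_on_mult smooth_on_fst smooth_on_id smooth_on_const V)
 hence "smooth_on ?V (%y. exp (fst y*?s))" by (rule smooth_on_compose_real[OF smooth_on_exp[OF open_UNIV] V])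
 hence "smooth_on ?V (%y. (fst (snd y),exp (fst y*?s) * snd (snd y)))"
  by (intro smooth_on_Pair smooth_on_mult smooth_on_fst smooth_on_snd smooth_on_id V)
 hence "smooth_on ?V (%(t,y). Ft t y)" by (simp only:smooth_on_cong[OF V e])
 moreover have "x:?V" using x by (auto simp:Y_def zero_less_mult_iff)
 ultimately show "EX V. open V & x:V & smooth_on V (%(t,y). Ft t y)" using V by blast
qed

definition Zt :: "pt => pt" where "Zt a = (0,abs(snd a))"

lemma Ft_gen: "((%t. Ft t a) has_vector_derivative Zt a) (at 0)"
proof -
 have "((%t. exp (t * sgn (snd a)) * snd a) has_vector_derivative (abs(snd a))) (at 0)"
  unfolding has_real_derivative_iff_has_vector_derivative[symmetric] by (auto intro!:derivative_eq_intros simp:abs_sgn)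
 thus ?thesis unfolding Ft_def Zt_def using has_vector_derivative_Pair[OF has_vector_derivative_const] by fastforce
qed

definition sig :: "real*real => real" where
 "sig = (SOME sg0. continuous_on U sg0 & (ALL p:U. sg0 (fm p) = (Fx p * sg0 p + Fy p)/lam) & (ALL p:U Int Zn lam. sg0 p = 0) &
   (ALL v:Lat. ALL p:U. sg0 (p + v) = sg0 p))"

definition cc :: "real*real => real" where
 "cc = (SOME c. continuous_on U c & (ALL p:U. c (fm p) = c p/lam) &
   (ALL v:Lat. ALL j<3. ALL u. u~=0 --> nrm u<lam --> c (v + cs j + u) = c0 u) &
   (ALL v:Lat. ALL p:U. c (p + v) = c p))"

lemma sig: "continuous_on U sig" "p:U ==> sig (fm p) = (Fx p * sig p + Fy p)/lam" "p:U ==> p:Zn lam ==> sig p = 0"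
  "v:Lat ==> p:U ==> sig (p + v) = sig p"
 using someI_ex[OF sigma_exists] unfolding sig_def[symmetric] by blast+

lemma cc: "continuous_on U cc" "p:U ==> cc (fm p) = cc p/lam"
  "v:Lat ==> j<3 ==> u~=0 ==> nrm u<lam ==> cc (v + cs j + u) = c0 u" "v:Lat ==> p:U ==> cc (p + v) = cc p"
 using someI_ex[OF c_exists] unfolding cc_def[symmetric] by blast+

definition wv :: "pt => pt" where "wv a = ((sig (fst a),1),snd a*cc (fst a))"

text \<open>\<open>Es 1\<close> is the stable field and \<open>Es (-1)\<close> the unstable one. The
  horizontal direction is contracted in the piece \<open>z > 0\<close> and expanded in the other
  piece, where time is reversed; \<open>wv\<close> is the complementary direction.\<close>

definition Es :: "real => pt => pt" where
 "Es s a = (if s * snd a>0 then ((1,0),0) else wv a)"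

lemma Es_cont: "continuous_on Y (Es s)"
proof -
 have o: "open (Y Int {a. s * snd a>0})" "open (Y Int {a. s * snd a<0})" if "s~=0" for s
  by (intro open_Int open_Y open_Collect_less continuous_intros)+
 have w: "continuous_on Y wv"
  unfolding wv_def by (intro continuous_intros continuous_on_compose2[OF sig(1)] continuous_on_compose2[OF cc(1)]) (auto simp:Y_def)
 show ?thesis
 proof (cases "s = 0")
  case True thus ?thesis using w unfolding Es_def by simp
 next
  case False
  have Y: "Y = (Y Int {a. s * snd a>0}) Un (Y Int {a. s * snd a<0})"
   using False by (auto simp:Y_def mult_less_0_iff zero_less_mult_iff linorder_neq_iff)
  have "continuous_on (Y Int {a. s * snd a>0}) (Es s)"
   by (rule continuous_on_eq[OF continuous_on_const[of _ "((1,0),0)"]]) (auto simp:Es_def)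
  moreover have "continuous_on (Y Int {a. s * snd a<0}) (Es s)"
   by (rule continuous_on_eq[OF continuous_on_subset[OF w]]) (auto simp:Es_def)
  ultimately show ?thesis by (subst Y) (rule continuous_on_open_Un[OF o[OF False]])
 qed
qed

lemma Es_FF: 
 assumes a: "a:Y"
 shows "FD FF (at a) (Es s a) = (if s * snd a>0 then Fx (fst a) else lam) *R Es s (FF a)"
  "FD FI (at a) (Es s a) = (if s * snd a>0 then 1/Fx (fi (fst a)) else 1/lam) *R Es s (FI a)"
proof -
 have p: "fst a:U" "fi (fst a):U" using a fi_U by (auto simp:Y_def)
 have s: "s * snd (FF a)>0 <-> s * snd a>0" "s * snd (FI a)>0 <-> s * snd a>0"
  using pos_scale[OF lam_pos(1)] by (simp_all add:FF_def FI_def)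
 have D: "FD FF (at a) = (%h. ((Fx (fst a) * fst (fst h) + Fy (fst a) * snd (fst h),lam * snd (fst h)),snd h/lam))"
  "FD FI (at a) = (%h. (((fst (fst h) - Fy (fi (fst a))*(snd (fst h)/lam))/Fx (fi (fst a)),snd (fst h)/lam),lam * snd h))"
  using frechet_derivative_at[OF FF_deriv] frechet_derivative_at[OF FI_deriv] by simp_all
 show "FD FF (at a) (Es s a) = (if s * snd a>0 then Fx (fst a) else lam) *R Es s (FF a)"
  using sig(2)[OF p(1)] cc(2)[OF p(1)] unfolding Es_def s D wv_def by (simp add:FF_def)
 have "sig (fst a) = (Fx (fi (fst a)) * sig (fi (fst a)) + Fy (fi (fst a)))/lam" "cc (fst a) = cc (fi (fst a))/lam"
  using sig(2)[OF p(2)] cc(2)[OF p(2)] by simp_all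
 thus "FD FI (at a) (Es s a) = (if s * snd a>0 then 1/Fx (fi (fst a)) else 1/lam) *R Es s (FI a)"
  using Fx_pos[of "fi (fst a)"] unfolding Es_def s D wv_def by (simp add:FI_def field_simps)
qed

text \<open>The quarter turn exchanges the horizontal field and \<open>wv\<close>. The third
  components match because \<open>cc\<close> is equal to \<open>c0\<close> around the
  sources.\<close>

lemma Es_Gm:
 assumes j: "j<3" and a: "a:Dj j" and s: "s~=0"
 shows "FD (Gm j) (at a) (Es s a) = (if s * snd a>0 then ee j (snd a) else - ee j (snd a)) *R Es s (Gm j a)"
proof -
 define u where "u = fst a - cs j"
 have u: "u~=0" "nrm u<lam" "snd a~=0" using a by (auto simp:u_def Dj_def)
 have q: "sq u>0" using sq_pos u by blast
 note g = gl_form[OF u(1,3), of j]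
 have G: "Gm j a = (cs (pj j) + ee j (snd a) *R rot u,- (1/(snd a * sq u)))" using g by (simp add:Gm_def u_def)
 have sg: "s * snd (Gm j a)>0 <-> ~ s * snd a>0"
  using s u q by (auto simp:G zero_less_mult_iff mult_less_0_iff divide_less_0_iff)
 have pU: "cs (pj j) + ee j (snd a) *R rot u:U" using Dj_Y(2)[OF j] a G by (auto simp:Y_def)
 have "0 + cs (pj j) + ee j (snd a) *R rot u:Zn lam" by (rule ZnI) (use j g u in auto)
 hence s0: "sig (cs (pj j) + ee j (snd a) *R rot u) = 0" using sig(3)[OF pU] by simp
 have s1: "sig (fst a) = 0"
 proof -
  have "fst a:U" using Dj_Y(1)[OF j] a by (auto simp:Y_def)
  moreover have "0 + cs j + u:Zn lam" by (rule ZnI) (use j u in auto)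
  ultimately show ?thesis using sig(3)[of "fst a"] by (simp add:u_def)
 qed
 have c: "cc (fst a) = c0 u" using cc(3)[OF Lat_0 j u(1,2)] by (simp add:u_def)
 have c': "cc (cs (pj j) + ee j (snd a) *R rot u) = c0 (ee j (snd a) *R rot u)"
  using cc(3)[OF Lat_0, of "pj j" "ee j (snd a) *R rot u"] j g u by simp
 have e2: "ee j (snd a)^2 = 1" by (simp add:power2_eq_square)
 have "c0 (ee j (snd a) *R rot u) = - 2*ee j (snd a) * fst u/sq u"
  by (simp add:c0_def rot_def power_mult_distrib e2 sq_def add.commute)
 note c' = c'[unfolded this]
 have c: "cc (fst a) = - 2 * snd u/sq u" using c by (simp add:c0_def sq_def)
 have D: "FD (Gm j) (at a) = (%h. (ee j (snd a) *R rot (fst h),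
   snd h/(snd a^2 * sq u) + 2*(fst u * fst (fst h) + snd u * snd (fst h))/(snd a * sq u^2)))"
  using Gm_deriv[OF a] by (auto simp:u_def)
 show ?thesis
 proof (cases "s * snd a>0")
  case True
  have "ee j (snd a)*(- (1/(snd a * sq u))*(- 2*ee j (snd a) * fst u/sq u)) = (ee j (snd a)*ee j (snd a))*(2 * fst u/(snd a * sq u^2))"
   by (simp add:power2_eq_square ac_simps)
  thus ?thesis using True sg unfolding Es_def D wv_def G fst_conv s0 c' by (simp add:rot_def)
 next
  case False
  thus ?thesis using sg unfolding Es_def D wv_def s1 c by (simp add:rot_def power2_eq_square)
 qed
qed

lemma Es_TT: "v:Lat ==> a:Y ==> Es s (TT v a) = Es s a"
 using sig(4) cc(4) by (simp add:Es_def wv_def TT_def Y_def)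

lemma Es_invfield: "s~=0 ==> invfield (Es s)"
 unfolding invfield_def using Es_FF Es_TT Es_Gm by blast

end

locale glued_cover = glued +
 fixes X :: "'a topology" and A :: "'a chart set" and Q :: "pt => 'a" and K :: "pt set"
 assumes cover: "smooth_cover X A Y Q K" and ker: "!!a b. Q a = Q b <-> rel a b"

sublocale glued_cover \<subseteq> sc: smooth_cover X A Y Q K by (rule cover)

context glued_cover
begin

definition fl :: "real => 'a => 'a" where "fl t x = Q (Ft t (SOME a. Q a = x))"

lemma fl_Q: "fl t (Q a) = Q (Ft t a)"
proof -
 have "Q (SOME b. Q b = Q a) = Q a" by (rule someI) simp
 thus ?thesis unfolding fl_def using ker Ft_rel by blast
qed

end

sublocale glued_cover \<subseteq> cf: cover_flow X A Y Q K fl Ft Zt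
 by unfold_locales (simp_all add:fl_Q Ft_add smooth_Ft Ft_gen)

context glued_cover
begin

lemma deck_Q: "deck Y q V th0 a b <-> deck Y Q V th0 a b"
 by (simp only:deck_def q_eq ker)

lemma field_inv_Es: "s~=0 ==> sc.field_inv (Es s)"
proof -
 assume s: "s~=0"
 have "EX V th0 k. deck Y Q V th0 a b & FD th0 (at a) (Es s a) = k *R Es s b"
  if "a:Y" "b:Y" "Q a = Q b" for a b
  using link_rel[of "{Es s}" a b] Es_invfield[OF s] that ker unfolding link_def deck_Q by blast
 moreover have "Es s a~=0" for a by (simp add:Es_def wv_def zero_prod_def)
 ultimately show ?thesis unfolding sc.field_inv_def using Es_cont by blast
qed

lemma pushed_Es: "cf.pushed (Es s)"
 unfolding cf.pushed_def
proof (intro allI ballI)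
 fix t a assume a: "a:Y"
 let ?s = "sgn (snd a)"
 let ?V = "{b. snd b * snd a>0} :: pt set"
 have V: "open ?V" by (intro open_Collect_less continuous_intros)
 have aV: "a:?V" using a by (auto simp:Y_def zero_less_mult_iff)
 have e: "Ft t y = (fst y,exp (t*?s) * snd y)" if "y:?V" for y
  using that by (auto simp:Ft_def zero_less_mult_iff)
 have "((%y :: pt. (fst y,exp (t*?s) * snd y)) has_derivative (%h. (fst h,exp (t*?s) * snd h))) (at a)"
  by (auto intro!:derivative_eq_intros)
 from frechet_derivative_cong_open(2)[OF V aV e this]
 have "cf.DF t a = (%h. (fst h,exp (t*?s) * snd h))" by (simp add:cf.DF_def)
 moreover have "s * snd (Ft t a)>0 <-> s * snd a>0" by (simp add:Ft_def pos_scale(1)[OF exp_gt_zero])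
 ultimately show "cf.DF t a (Es s a) = Es s (Ft t a)" by (simp add:Es_def wv_def Ft_def)
qed

lemma bounded_off:
 assumes "continuous_on Y nu0" and per: "!!v a. v:Lat ==> a:Y ==> nu0 (TT v a) = nu0 a" and z: "z~=0"
 shows "EX C::real. ALL p. p~:Zn lam --> nu0 (p,z)<=C"
proof -
 let ?S = "(cbox (0,0) (2*Kl,4*Kl) - Zn lam) \<times> {z}"
 have U: "p:U" if "p~:Zn lam" for p using that cen_Zn[of lam] by (auto simp:U_def)
 have "compact ?S" by (intro compact_Times compact_diff open_Zn) auto
 moreover have "?S<=Y" using U z by (auto simp:Y_def)
 ultimately have "compact (nu0 ` ?S)" using compact_continuous_image continuous_on_subset assms(1) by blast
 then obtain C where C: "ALL x:nu0 ` ?S. norm x<=C" using compact_imp_bounded bounded_iff by blast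
 have "nu0 (p,z)<=C" if p: "p~:Zn lam" for p
 proof -
  obtain v where v: "v:Lat" "p - v:cbox (0,0) (2*Kl,4*Kl)" using Lat_cover by blast
  have "p - v~:Zn lam" using Zn_add[OF v(1), of "p - v" lam] p by simp
  hence "norm (nu0 (p - v,z))<=C" using C v(2) by blast
  moreover have "nu0 (TT v (p - v,z)) = nu0 (p - v,z)" using per[OF v(1), of "(p - v,z)"] U `p - v~:Zn lam` z by (simp add:Y_def)
  ultimately show ?thesis by (simp add:TT_def)
 qed
 thus ?thesis by blast
qed

text \<open>Where the field is horizontal, the forward orbit of the base point finally avoids the
  sources, and every further step contracts by at least \<open>1/lam\<close>. Where it is
  \<open>wv\<close>, either a backward image is near a source and the glueing leads to the first
  case, or the backward orbit avoids the sources and the norm is \<open>1/lam^n\<close> times a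
  bounded quantity.\<close>

lemma Es_contract:
 assumes nu0: "cf.adapted (Es s) nu0" and s: "s = 1 | s = -1" and y: "y:Y"
 shows "EX t>0. nu0 (Ft (s*t) y)<nu0 y"
proof -
 have c: "continuous_on Y nu0" and pos: "!!y. y:Y ==> nu0 y>0"
  and ad: "!!a b V th0 k. a:Y ==> deck Y Q V th0 a b ==> FD th0 (at a) (Es s a) = k *R Es s b ==> nu0 a = abs k*nu0 b"
  using nu0 unfolding cf.adapted_def by blast+
 have s0: "s~=0" using s by auto
 have dFF: "deck Y Q Y FF a (FF a)" if "a:Y" for a
 proof -
  have "Q (FF b) = Q b" for b using ker rel0_sym[OF rel0_FI(3)] rel_def by blast
  thus ?thesis unfolding deck_def using that open_Y smooth_FF[OF open_Y] Y_FF(1) by blast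
 qed
 have nFF: "nu0 a = (if s * snd a>0 then Fx (fst a) else lam)*nu0 (FF a)" if "a:Y" for a
  using ad[OF that dFF[OF that] Es_FF(1)[OF that]] Fx_pos[of "fst a"] by simp
 have nTT: "nu0 (TT v a) = nu0 a" if "v:Lat" "a:Y" for v a
 proof -
  have "Q (TT v b) = Q b" for b using ker rel0_sym[OF rel0_FI(4)[OF that(1)]] rel_def by blast
  hence "deck Y Q Y (TT v) a (TT v a)"
   unfolding deck_def using that open_Y smooth_TT[OF open_Y] Y_FF(3)[OF that(1)] by blast
  from ad[OF that(2) this, of 1] show ?thesis using Es_TT[OF that] by (simp add:TT_deriv)
 qed
 have nG: "nu0 a = nu0 (Gm j a)" if "j<3" "a:Dj j" for j a
 proof -
  have "deck Y Q (Dj j) (Gm j) a (Gm j a)"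
   unfolding deck_def using that(2) open_Dj smooth_Gm Dj_Y[OF that(1)] ker rel_equiv(2)[OF rel_Gm[OF that(1)]] by blast
  from ad[OF _ this Es_Gm[OF that s0]] show ?thesis using Dj_Y(1)[OF that(1)] that(2) by auto
 qed
 \<comment> \<open>Stronger than the goal, but stable under rescaling of the norm, so that it can be
   transported by \<open>FI\<close> and across the glueing.\<close>
 define D where "D y <-> (ALL de>0. EX t>0. nu0 (Ft (s*t) y)<de)" for y
 have D_scale: "D a" if b: "D b" and k: "k>0" "!!t. nu0 (Ft t a) = k*nu0 (Ft t b)" for a b k
  unfolding D_def
 proof (intro allI impI)
  fix de :: real assume "de>0"
  then obtain t where "t>0" "nu0 (Ft (s*t) b)<de/k" using b k(1) unfolding D_def by (meson divide_pos_pos)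
  thus "EX t>0. nu0 (Ft (s*t) a)<de" using k by (intro exI[of _ t]) (simp add:field_simps)
 qed
 have D1: "D a" if a: "a:Y" "s * snd a>0" for a
  unfolding D_def
 proof (intro allI impI)
  fix de :: real assume de: "de>0"
  have aU: "fst a:U" and sa: "snd a~=0" using a by (auto simp:Y_def)
  obtain N where N: "!!n. n>=N ==> (fm^^n) (fst a)~:Zn lam" using exit_Zn[OF aU] by blast
  obtain C where C: "!!p. p~:Zn lam ==> nu0 (p,snd a)<=C" using bounded_off[OF c nTT sa] by blast
  define L where "L n = (\<Prod>i<n. Fx ((fm^^i) (fst a)))" for n
  have L0: "L n>0" for n unfolding L_def by (intro prod_pos) (simp add:Fx_pos)
  have step: "nu0 (fst a,z) = L n*nu0 ((fm^^n) (fst a),z/lam^n)" if "s*z>0" for z n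
  proof (induction n)
   case (Suc n)
   have "z~=0" using that by auto
   hence 1: "((fm^^n) (fst a),z/lam^n):Y" using aU fm_pow_U by (auto simp:Y_def)
   have 2: "s*(z/lam^n)>0" using that by simp
   show ?case using Suc nFF[OF 1] 2 by (simp add:L_def FF_def mult_ac)
  qed (simp add:L_def)
  have LN: "L (N + n)<=L N*(1/lam)^n" for n
  proof (induction n)
   case (Suc n)
   have "L (N + n)*Fx ((fm^^(N + n)) (fst a))<=(L N*(1/lam)^n)*(1/lam)"
    using Suc Fx_off[OF N[of "N + n"]] L0[of N] by (intro mult_mono) (auto intro!:less_imp_le Fx_pos)
   thus ?case by (simp add:L_def)
  qed simp
  have "(%n. L N*(1/lam)^n*C) ----> L N*0*C"
   by (intro tendsto_intros) auto
  hence "\<forall>\<^sub>F n in sequentially. L N*(1/lam)^n*C<de" using de by (simp add:order_tendstoD)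
  then obtain m where m: "!!n. n>=m ==> L N*(1/lam)^n*C<de" unfolding eventually_sequentially by blast
  define n where "n = N + Suc m"
  \<comment> \<open>During this time the modulus of the height is multiplied by
    \<open>lam^n\<close>, so \<open>n\<close> applications of \<open>FF\<close> restore the height
    \<open>snd a\<close>.\<close>
  define t where "t = ln (lam^n)"
  have t: "t>0" "exp t = lam^n" by (simp_all add:t_def n_def del:power_Suc)
  have "sgn (snd a) = s" using s a(2) by auto
  hence F: "Ft (s*t) a = (fst a,lam^n * snd a)" using s t by (auto simp:Ft_def)
  have "s*(lam^n * snd a)>0" using a(2) pos_scale(1) by simp
  hence "nu0 (fst a,lam^n * snd a) = L n*nu0 ((fm^^n) (fst a),snd a)" using step[of "lam^n * snd a" n] by simp
  also have "... <= L n*C" using C[OF N[of n]] L0[of n] by (intro mult_left_mono) (auto simp:n_def)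
  also have "... <= (L N*(1/lam)^Suc m)*C"
  proof -
   have "0<nu0 ((fm^^n) (fst a),snd a)" using pos fm_pow_U aU sa by (simp add:Y_def)
   hence "0<=C" using C[OF N[of n]] by (simp add:n_def)
   thus ?thesis using LN[of "Suc m"] by (intro mult_right_mono) (auto simp:n_def)
  qed
  also have "... < de" by (rule m) simp
  finally show "EX t>0. nu0 (Ft (s*t) a)<de" using t F by auto
 qed
 have D2: "D a" if a: "a:Y" "~ s * snd a>0" for a
 proof -
  have aU: "fst a:U" and sa: "snd a~=0" using a by (auto simp:Y_def)
  have step: "nu0 ((FI^^n) b) = lam^n*nu0 b" if "b:Y" "~ s * snd b>0" for n b
  proof (induction n)
   case (Suc n)
   have 1: "(FI^^Suc n) b:Y" using that(1) Y_pow(2)[of "Suc n"] by simp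
   have 2: "~ s * snd ((FI^^Suc n) b)>0" using that(2) pos_scale(1)[of "lam^Suc n"] unfolding FI_pow by simp
   show ?case using Suc nFF[OF 1] 2 by simp
  qed simp
  show ?thesis
  proof (cases "EX n. (fi^^n) (fst a):Zn lam")
   case True
   then obtain n where "(fi^^n) (fst a):Zn lam" by blast
   then obtain v j u where v: "v:Lat" "j<3" "nrm u<lam" "(fi^^n) (fst a) = v + cs j + u" by (rule ZnE)
   define b where "b = TT (- v) ((FI^^n) a)"
   have bY: "b:Y" using a(1) Y_pow(2) Y_FF(3)[OF Lat_uminus[OF v(1)]] by (simp add:b_def)
   have b: "b = (cs j + u,lam^n * snd a)" using v by (simp add:b_def TT_def FI_pow)
   have bD: "b:Dj j" using bY Y_center[OF v(2,3)] v(3) unfolding b Dj_iff by blast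
   have sb: "~ s * snd b>0" using a(2) pos_scale(1) by (simp add:b)
   have gY: "Gm j b:Y" using Dj_Y(2)[OF v(2)] bD by blast
   have "s * snd (Gm j b)>0"
   proof -
    have u: "u~=0" and "snd b~=0" using bD by (auto simp:Dj_def b)
    have "sq u>0" using sq_pos u by blast
    hence "snd (Gm j b)>0 <-> snd b<0" "snd (Gm j b)~=0" using `snd b~=0` by (auto simp:Gm_def gl_def b mult_less_0_iff)
    thus ?thesis using sb s `snd b~=0` by auto
   qed
   hence "D (Gm j b)" using D1 gY by blast
   hence "D b" by (rule D_scale[of _ 1]) (use nG[OF v(2)] Ft_Gm[OF bD] in auto)
   thus ?thesis
   proof (rule D_scale[of _ "1/lam^n"])
    fix t
    have "nu0 (Ft t b) = nu0 ((FI^^n) (Ft t a))"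
     unfolding b_def Ft_FF Ft_pow by (rule nTT[OF Lat_uminus[OF v(1)]]) (simp add:Y_pow a(1))
    also have "... = lam^n*nu0 (Ft t a)" by (rule step) (use a in "simp_all add:pos_scale(1)[OF exp_gt_zero] Ft_def[of _ a] Ft_Y[unfolded Ft_def]")
    finally show "nu0 (Ft t a) = 1/lam^n*nu0 (Ft t b)" by simp
   qed simp
  next
   case False
   obtain C where C: "!!p. p~:Zn lam ==> nu0 (p,snd a)<=C" using bounded_off[OF c nTT sa] by blast
   show ?thesis unfolding D_def
   proof (intro allI impI)
    fix de :: real assume de: "de>0"
    obtain n0 where "C/de<lam^n0" using real_arch_pow[of lam] by auto
    hence n0: "C/de<lam^Suc n0" using lam_bounds power_strict_increasing[of n0 "Suc n0" lam] by linarith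
    define n where "n = Suc n0"
    define t where "t = ln (lam^n)"
    have t: "t>0" "exp t = lam^n" by (simp_all add:t_def n_def del:power_Suc)
    have "sgn (snd a) = - s" using s a(2) sa by auto
    hence F: "Ft (s*t) a = (fst a,snd a/lam^n)" using s t by (auto simp:Ft_def exp_minus field_simps)
    have "nu0 ((FI^^n) (Ft (s*t) a)) = lam^n*nu0 (Ft (s*t) a)" by (rule step) (use a in "simp_all add:pos_scale(1)[OF exp_gt_zero] Ft_def[of _ a] Ft_Y[unfolded Ft_def]")
    moreover have "(FI^^n) (Ft (s*t) a) = ((fi^^n) (fst a),snd a)" by (simp add:F FI_pow)
    ultimately have "lam^n*nu0 (Ft (s*t) a)<=C" using C[of "(fi^^n) (fst a)"] False by simp
    also have "C<lam^n*de" using n0 de by (simp add:n_def divide_less_eq)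
    finally show "EX t>0. nu0 (Ft (s*t) a)<de" using t by auto
   qed
  qed
 qed
 show ?thesis using D1[OF y] D2[OF y] pos[OF y] unfolding D_def by blast
qed

theorem anosov_fl: "anosov_flow X A fl"
proof (rule cf.anosov_flow_phi)
 show "sc.field_inv (Es 1)" "cf.pushed (Es 1)" "sc.field_inv (Es (-1))" "cf.pushed (Es (-1))"
  using field_inv_Es pushed_Es by simp_all
 fix y :: pt assume y: "y:Y"
 hence z: "snd y~=0" by (simp add:Y_def)
 show "EX r s t. v = r *R Es 1 y + s *R Zt y + t *R Es (-1) y" for v
 proof (cases "snd y>0")
  case True
  thus ?thesis
   by (intro exI[of _ "fst (fst v) - snd (fst v) * sig (fst y)"] exI[of _ "(snd v - snd (fst v)*(snd y*cc (fst y)))/abs(snd y)"] exI[of _ "snd (fst v)"]) (simp add:Es_def wv_def Zt_def)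
 next
  case False
  thus ?thesis using z by (intro exI[of _ "snd (fst v)"] exI[of _ "(snd v - snd (fst v)*(snd y*cc (fst y)))/abs(snd y)"] exI[of _ "fst (fst v) - snd (fst v) * sig (fst y)"]) (simp add:Es_def wv_def Zt_def)
 qed
 show "r = 0 & s = 0 & t = 0" if "r *R Es 1 y + s *R Zt y + t *R Es (-1) y = 0" for r s t
  using that z by (auto simp:Es_def wv_def Zt_def prod_eq_iff split:if_splits)
next
 fix nu0 y assume "y:Y"
 { assume "cf.adapted (Es 1) nu0"
  thus "EX t>0. nu0 (Ft t y)<nu0 y" using Es_contract[of 1 nu0 y] `y:Y` by simp }
 { assume "cf.adapted (Es (-1)) nu0"
  thus "EX t>0. nu0 (Ft (- t) y)<nu0 y" using Es_contract[of "-1" nu0 y] `y:Y` by simp }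
qed

end

section \<open>Twisting the glueing\<close>

definition rt :: "real => real*real => real*real" where
 "rt t u = (cos t * fst u - sin t * snd u,sin t * fst u + cos t * snd u)"

lemma rt_simps [simp]: "rt 0 u = u" "rt t 0 = 0"
 by (simp_all add:rt_def prod_eq_iff)

lemma rt_rt: "rt s (rt t u) = rt (s + t) u" by (simp add:rt_def cos_add sin_add algebra_simps)
lemma rt_scale: "rt t (c *R u) = c *R rt t u" by (simp add:rt_def algebra_simps)
lemma rt_rot: "rt t (rot u) = rot (rt t u)" by (simp add:rt_def rot_def)
lemma rt_pi: "rt pi u = - u" by (simp add:rt_def prod_eq_iff)
lemma sq_rt [simp]: "sq (rt t u) = sq u"
proof -
 have "sq (rt t u) = (sin t^2 + cos t^2) * sq u" unfolding sq_def rt_def by (simp only:fst_conv snd_conv) algebra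
 thus ?thesis by simp
qed

lemma sq_norm: "sq u = (norm u)\<^sup>2" by (simp add:sq_def norm_prod_def)
lemma sq_0 [simp]: "sq u = 0 <-> u = 0" "sq u>=0" by (auto simp:sq_def prod_eq_iff)
lemma sq_nrm_less: "sq u<1 ==> nrm u<1"
 using sq_nrm(1)[of u] by (metis less_le_trans linorder_not_less one_power2 power_mono zero_le_one)

context glued
begin

lemma FI_pow_center: "v:Lat ==> j<3 ==> EX w:Lat. ALL u z. nrm u<=lam --> (FI^^k) (v + cs j + u,z) = (w + cs j + (1/lam^k) *R u,lam^k*z)"
proof -
 assume v: "v:Lat" "j<3"
 have "EX w:Lat. ALL a. (FI^^k) (TT v a) = TT w ((FI^^k) a)"
 proof (induction k)
  case 0 thus ?case using v by auto
 next
  case (Suc k) then obtain w where "w:Lat" "ALL a. (FI^^k) (TT v a) = TT w ((FI^^k) a)" by blast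
  thus ?case by (intro bexI[of _ "Ainv w"]) (auto simp:FI_TT Lat_lin)
 qed
 then obtain w where w: "w:Lat" "!!a. (FI^^k) (TT v a) = TT w ((FI^^k) a)" by blast
 have "(FI^^k) (v + cs j + u,z) = (w + cs j + (1/lam^k) *R u,lam^k*z)" if "nrm u<=lam" for u z
  using w(2)[of "(cs j + u,z)"] FI_pow_lin[OF v(2) that, of k z] by (simp add:TT_def add_ac)
 thus ?thesis using w(1) by blast
qed

text \<open>The first entry counts the backward steps to the disc around source \<open>j\<close>. It
  is not unique; \<open>tw_eq\<close> shows that the choice does not matter.\<close>

definition near :: "nat => real => pt => nat \<times> (real*real) \<times> (real*real) \<times> real => bool" where
 "near j s a d <-> (case d of (n,v,u,z) => v:Lat & sq u<1 & s*z>0 & (FI^^n) a = (v + cs j + u,z))"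

text \<open>The angle is a function of \<open>z^2 * sq u\<close> because this is unchanged by
  \<open>u |-> u / lam, z |-> lam * z\<close>; hence the twist commutes with
  \<open>FI\<close>.\<close>

definition tw :: "nat => real => (real => real) => pt => pt" where
 "tw j s al a = (if EX d. near j s a d then (case SOME d. near j s a d of (n,v,u,z) =>
   (FF^^n) (v + cs j + rt (al (z\<^sup>2 * sq u)) u,z)) else a)"

lemma near_shift:
 assumes "near j s a (n,v,u,z)" "j<3"
 shows "EX w. near j s a (n + k,w,(1/lam^k) *R u,lam^k*z) &
  (ALL t. (FI^^k) (v + cs j + rt t u,z) = (w + cs j + rt t ((1/lam^k) *R u),lam^k*z))"
proof -
 have a: "v:Lat" "sq u<1" "s*z>0" "(FI^^n) a = (v + cs j + u,z)" using assms(1) by (auto simp:near_def)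
 obtain w where w: "w:Lat" "!!u z. nrm u<=lam ==> (FI^^k) (v + cs j + u,z) = (w + cs j + (1/lam^k) *R u,lam^k*z)"
  using FI_pow_center[OF a(1) assms(2)] by blast
 have l: "nrm u<=lam" if "sq u<1" for u using sq_nrm_less[OF that] lam_bounds by linarith
 have "(1/lam^k)\<^sup>2<=1" by (simp add:power_divide)
 hence "(1/lam^k)\<^sup>2 * sq u<=1 * sq u" by (intro mult_right_mono) auto
 hence "sq ((1/lam^k) *R u)<1" using a(2) by simp
 moreover have "(FI^^(n + k)) a = (w + cs j + (1/lam^k) *R u,lam^k*z)"
  using w(2)[OF l[OF a(2)]] a(4) by (simp add:add.commute[of n] funpow_add)
 moreover have "(FI^^k) (v + cs j + rt t u,z) = (w + cs j + rt t ((1/lam^k) *R u),lam^k*z)" for t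
  using w(2)[of "rt t u"] l[of "rt t u"] a(2) by (simp add:rt_scale)
 ultimately show ?thesis using w(1) a(3) pos_scale(1)[of "lam^k" s z] unfolding near_def by (intro exI[of _ w]) simp
qed

lemma near_unique:
 assumes "near j s a (n,v,u,z)" "near k s' a (n,v',u',z')" "j<3" "k<3"
 shows "j = k & v = v' & u = u' & z = z'"
proof -
 have a: "v:Lat" "sq u<1" "(FI^^n) a = (v + cs j + u,z)" "v':Lat" "sq u'<1" "(FI^^n) a = (v' + cs k + u',z')"
  using assms(1,2) by (auto simp:near_def)
 have "v + cs j + u = v' + cs k + u'" using a(3,6) by simp
 from cs_unique[OF a(1,4) assms(3,4) this] show ?thesis using sq_nrm_less[OF a(2)] sq_nrm_less[OF a(5)] a(3,6) by auto
qed

lemma tw_eq: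
 assumes d: "near j s a (n,v,u,z)" and j: "j<3"
 shows "tw j s al a = (FF^^n) (v + cs j + rt (al (z\<^sup>2 * sq u)) u,z)"
proof -
 let ?g = "%(n,v,u,z). (FF^^n) (v + cs j + rt (al (z\<^sup>2 * sq u)) u,z)"
 have shift: "?g (n,v,u,z) = ?g d'" if a: "near j s a (n,v,u,z)" "near j s a d'" "n<=fst d'" for n v u z d'
 proof -
  obtain m v' u' z' where d': "d' = (m,v',u',z')" by (cases d')
  define k where "k = m - n"
  have m: "m = n + k" using a(3) by (simp add:k_def d')
  obtain w where w: "near j s a (n + k,w,(1/lam^k) *R u,lam^k*z)"
   "!!t. (FI^^k) (v + cs j + rt t u,z) = (w + cs j + rt t ((1/lam^k) *R u),lam^k*z)"
   using near_shift[OF a(1) j] by blast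
  have e: "w = v'" "(1/lam^k) *R u = u'" "lam^k*z = z'" using near_unique[OF w(1) a(2)[unfolded d' m] j j] by auto
  have "z'\<^sup>2 * sq u' = z\<^sup>2 * sq u" unfolding e[symmetric] by (simp add:power_mult_distrib power_divide)
  hence "(FF^^m) (v' + cs j + rt (al (z'\<^sup>2 * sq u')) u',z') = (FF^^n) ((FF^^k) ((FI^^k) (v + cs j + rt (al (z\<^sup>2 * sq u)) u,z)))"
   unfolding w(2) e m by (simp add:funpow_add)
  thus ?thesis by (simp add:d')
 qed
 define d' where "d' = (SOME d. near j s a d)"
 have d': "near j s a d'" unfolding d'_def by (rule someI) (rule d)
 have "tw j s al a = ?g d'" unfolding tw_def d'_def[symmetric] using exI[of "near j s a", OF d] by simp
 also have "... = ?g (n,v,u,z)"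
 proof (cases "n<=fst d'")
  case True thus ?thesis using shift[OF d d'] by simp
 next
  case False
  obtain m v' u' z' where e: "d' = (m,v',u',z')" by (cases d')
  show ?thesis using shift[OF d'[unfolded e] d] False e by simp
 qed
 finally show ?thesis by simp
qed

lemma tw_id: "~ (EX d. near j s a d) ==> tw j s al a = a" by (simp only:tw_def if_False)

lemma near_tw:
 assumes "near j s a (n,v,u,z)" "j<3"
 shows "near j s (tw j s al a) (n,v,rt (al (z\<^sup>2 * sq u)) u,z)"
 using assms(1) unfolding tw_eq[OF assms] by (auto simp:near_def)

lemma tw_tw: "j<3 ==> tw j s al (tw j s be a) = tw j s (%x. al x + be x) a"
proof (cases "EX d. near j s a d")
 case True
 assume j: "j<3"
 obtain n v u z where d: "near j s a (n,v,u,z)" using True by auto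
 show ?thesis using tw_eq[OF near_tw[OF d j] j] tw_eq[OF d j] by (simp add:rt_rt)
qed (simp add:tw_id del:split_paired_Ex)

lemma snd_tw: "j<3 ==> snd (tw j s al a) = snd a"
proof (cases "EX d. near j s a d")
 case True
 assume j: "j<3"
 obtain n v u z where d: "near j s a (n,v,u,z)" using True by auto
 hence "z = lam^n * snd a" by (auto simp:near_def FI_pow)
 thus ?thesis using tw_eq[OF d j] by (simp add:FF_pow)
qed (simp add:tw_id del:split_paired_Ex)

lemma tw_Y: "j<3 ==> tw j s al a:Y <-> a:Y"
proof (cases "EX d. near j s a d")
 case True
 assume j: "j<3"
 obtain n v u z where d: "near j s a (n,v,u,z)" using True by auto
 have d': "v:Lat" "sq u<1" "(FI^^n) a = (v + cs j + u,z)" using d by (auto simp:near_def)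
 have l: "nrm u<=lam" if "sq u<1" for u using sq_nrm_less[OF that] lam_bounds by linarith
 have *: "(v + cs j + u,z):Y <-> u~=0 & z~=0" if "sq u<1" for u
  using U_iff[OF d'(1) j l[OF that]] by (simp add:Y_def)
 have "a:Y <-> (v + cs j + u,z):Y" using Y_pow(2)[of n a] d'(3) by simp
 also have "... <-> (v + cs j + rt (al (z\<^sup>2 * sq u)) u,z):Y"
 proof -
  have "rt t u = 0 <-> u = 0" for t u using sq_rt[of t u] sq_0(1) by metis
  thus ?thesis using *[OF d'(2)] *[of "rt (al (z\<^sup>2 * sq u)) u"] d'(2) by simp
 qed
 finally show ?thesis using tw_eq[OF d j] Y_pow(1) by simp
qed (simp add:tw_id del:split_paired_Ex)

lemma tw_FI: assumes j: "j<3" shows "tw j s al (FI a) = FI (tw j s al a)"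
proof (cases "EX d. near j s a d")
 case True
 obtain n v u z where d: "near j s a (n,v,u,z)" using True by auto
 obtain w where w: "near j s a (n + 1,w,(1/lam^1) *R u,lam^1*z)"
   "!!t. (FI^^1) (v + cs j + rt t u,z) = (w + cs j + rt t ((1/lam^1) *R u),lam^1*z)"
   using near_shift[OF d j] by blast
 have n: "near j s (FI a) (n,w,(1/lam) *R u,lam*z)" using w(1) by (simp add:near_def funpow_swap1)
 have "(lam*z)\<^sup>2 * sq ((1/lam) *R u) = z\<^sup>2 * sq u" by (simp add:power_mult_distrib power_divide)
 hence "tw j s al (FI a) = (FF^^n) (w + cs j + rt (al (z\<^sup>2 * sq u)) ((1/lam) *R u),lam*z)" using tw_eq[OF n j, of al] by (simp only:)
 also have "... = (FF^^n) (FI (v + cs j + rt (al (z\<^sup>2 * sq u)) u,z))" using w(2) by simp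
 also have "... = FI ((FF^^n) (v + cs j + rt (al (z\<^sup>2 * sq u)) u,z))"
  by (metis FF_FI(1,2) funpow_swap1)
 finally show ?thesis using tw_eq[OF d j] by simp
next
 case False
 have "~ near j s (FI a) d" for d
 proof
  assume "near j s (FI a) d"
  hence "near j s a (Suc (fst d),snd d)" by (auto simp:near_def funpow_swap1)
  thus False using False by blast
 qed
 thus ?thesis using False tw_id by metis
qed

lemma tw_FF: "j<3 ==> tw j s al (FF a) = FF (tw j s al a)" using tw_FI[of j s al "FF a"] by simp

lemma near_TT: "w:Lat ==> near j s a (n,v,u,z) ==> EX w':Lat. (FI^^n) (TT w a) = TT w' ((FI^^n) a) & near j s (TT w a) (n,v + w',u,z)"
 using FI_pow_TT[of w n a] Lat_add unfolding near_def TT_def by auto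

lemma tw_TT: assumes j: "j<3" and w: "w:Lat" shows "tw j s al (TT w a) = TT w (tw j s al a)"
proof (cases "EX d. near j s a d")
 case True
 obtain n v u z where d: "near j s a (n,v,u,z)" using True by auto
 obtain w' where w': "w':Lat" "(FI^^n) (TT w a) = TT w' ((FI^^n) a)" "near j s (TT w a) (n,v + w',u,z)"
  using near_TT[OF w d] by blast
 obtain w2 where w2: "w2:Lat" "!!b. (FF^^n) (TT w' b) = TT w2 ((FF^^n) b)"
 proof -
  have "EX w2:Lat. ALL b. (FF^^n) (TT w' b) = TT w2 ((FF^^n) b)" for n
  proof (induction n)
   case 0 thus ?case using w' by auto
  next
   case (Suc k) then obtain w where "w:Lat" "ALL a. (FF^^k) (TT w' a) = TT w ((FF^^k) a)" by blast
   thus ?case by (intro bexI[of _ "Alin w"]) (auto simp:FF_TT Lat_lin)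
  qed
  thus ?thesis using that by blast
 qed
 have "TT w a = TT w2 a" using w2(2)[of "(FI^^n) a"] arg_cong[OF w'(2), of "FF^^n"] by simp
 hence "w2 = w" by (simp add:TT_def)
 moreover have "(v + w' + cs j + x,z) = TT w' (v + cs j + x,z)" for x by (simp add:TT_def)
 ultimately show ?thesis using tw_eq[OF w'(3) j] tw_eq[OF d j] w2(2) by simp
next
 case False
 have "~ near j s (TT w a) d" for d
 proof
  assume d: "near j s (TT w a) d"
  obtain n v u z where e: "d = (n,v,u,z)" by (cases d)
  have "TT (- w) (TT w a) = a" by simp
  thus False using near_TT[OF Lat_uminus[OF w] d[unfolded e]] False by metis
 qed
 thus ?thesis using False tw_id by metis
qed

lemma tw_other: "k<3 ==> j<3 ==> k~=j ==> sq u<1 ==> tw j s al (cs k + u,z) = (cs k + u,z)"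
proof (rule tw_id, rule notI)
 assume k: "k<3" "j<3" "k~=j" "sq u<1" and "EX d. near j s (cs k + u,z) d"
 then obtain n v u' z' where d: "near j s (cs k + u,z) (n,v,u',z')" by auto
 have z: "s*z>0" using d pos_scale(1)[of "lam^n" s z] by (auto simp:near_def FI_pow)
 have "near k s (cs k + u,z) (0,0,u,z)" using k z by (simp add:near_def)
 from near_shift[OF this k(1), of n] obtain w where "near k s (cs k + u,z) (n,w,(1/lam^n) *R u,lam^n*z)" by auto
 thus False using near_unique[OF d] k by blast
qed

lemma tw_center: "j<3 ==> sq u<1 ==> s*z>0 ==> tw j s al (cs j + u,z) = (cs j + rt (al (z\<^sup>2 * sq u)) u,z)"
 using tw_eq[of j s "(cs j + u,z)" 0 0 u z al] by (simp add:near_def)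

lemma tw_far: "ALL n. (fi^^n) (fst a)~:Zn lam ==> j<3 ==> tw j s al a = a"
proof (rule tw_id, rule notI)
 assume a: "ALL n. (fi^^n) (fst a)~:Zn lam" "j<3" and "EX d. near j s a d"
 then obtain n v u z where d: "near j s a (n,v,u,z)" by auto
 hence d': "v:Lat" "sq u<1" "(fi^^n) (fst a) = v + cs j + u" by (auto simp:near_def FI_pow)
 have "nrm u<lam" using sq_nrm_less[OF d'(2)] lam_bounds by linarith
 thus False using ZnI[OF d'(1) a(2)] a(1) d'(3) by metis
qed

lemma smooth_pow: "smooth_on UNIV (%a. (FF^^n) a)" "smooth_on UNIV (%a. (FI^^n) a)"
proof (induction n)
 case (Suc n)
 { case 1 thus ?case using smooth_on_compose[OF smooth_FF[OF open_UNIV] Suc(1)] by simp }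
 { case 2 thus ?case using smooth_on_compose[OF smooth_FI[OF open_UNIV] Suc(2)] by simp }
qed (simp_all add:id_def smooth_on_id)

text \<open>The only problem is a point outside the twisted region that might be a limit of twisted
  ones. Points nearby enter the disc late, so their parameter \<open>z^2 * sq u\<close> exceeds
  \<open>2\<close>, where the angle is zero.\<close>

lemma smooth_tw:
 assumes j: "j<3" and s: "s~=0" and al: "smooth_on UNIV al" and far: "!!x. x>=2 ==> al x = 0"
 shows "smooth_on Y (tw j s al)"
proof (rule smooth_on_local)
 fix a assume a: "a:Y"
 show "EX V. open V & a:V & smooth_on V (tw j s al)"
 proof (cases "EX d. near j s a d")
  case True
  obtain n v u z where d: "near j s a (n,v,u,z)" using True by auto
  let ?c = "v + cs j"
  let ?V = "{b. sq (fst ((FI^^n) b) - ?c)<1 & s * snd ((FI^^n) b)>0}"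
  have ctFI: "continuous_on UNIV (FI^^n)" by (rule smooth_on_continuous[OF smooth_pow(2)])
  have V: "open ?V" unfolding sq_def by (intro open_Collect_conj open_Collect_less continuous_intros continuous_on_compose2[OF ctFI]) auto
  have e: "tw j s al b = (FF^^n) ((%y. (?c + rt (al ((snd y)\<^sup>2 * sq (fst y - ?c))) (fst y - ?c),snd y)) ((FI^^n) b))" if "b:?V" for b
   using tw_eq[of j s b n v "fst ((FI^^n) b) - ?c" "snd ((FI^^n) b)" al] j d that by (simp add:near_def)
  let ?x = "%y :: pt. fst (fst y - ?c)" and ?y = "%y :: pt. snd (fst y - ?c)"
  have xy: "smooth_on UNIV ?x" "smooth_on UNIV ?y" by (intro smooth_on_diff smooth_on_fst smooth_on_snd smooth_on_id smooth_on_const open_UNIV)+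
  have "smooth_on UNIV (%y :: pt. (snd y)\<^sup>2*(?x y^2 + ?y y^2))"
   by (intro smooth_on_mult smooth_on_add smooth_on_power xy smooth_on_snd smooth_on_id open_UNIV)
  from smooth_on_compose_real[OF al open_UNIV this]
  have A: "smooth_on UNIV (%y :: pt. al ((snd y)\<^sup>2*(?x y^2 + ?y y^2)))" .
  note cs = smooth_on_compose_real[OF conjunct1[OF smooth_on_cos_sin[OF open_UNIV]] open_UNIV A] smooth_on_compose_real[OF conjunct2[OF smooth_on_cos_sin[OF open_UNIV]] open_UNIV A]
  have "smooth_on UNIV (%y :: pt. (?c + (cos (al ((snd y)\<^sup>2*(?x y^2 + ?y y^2)))*?x y - sin (al ((snd y)\<^sup>2*(?x y^2 + ?y y^2)))*?y y,
    sin (al ((snd y)\<^sup>2*(?x y^2 + ?y y^2)))*?x y + cos (al ((snd y)\<^sup>2*(?x y^2 + ?y y^2)))*?y y),snd y))"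
   by (intro smooth_on_Pair smooth_on_add smooth_on_diff smooth_on_mult cs xy smooth_on_const smooth_on_snd smooth_on_id open_UNIV)
  hence "smooth_on UNIV (%y :: pt. (?c + rt (al ((snd y)\<^sup>2 * sq (fst y - ?c))) (fst y - ?c),snd y))"
   unfolding rt_def sq_def .
  from smooth_on_compose[OF smooth_pow(1) smooth_on_compose[OF this smooth_pow(2) open_UNIV open_UNIV UNIV_I] open_UNIV open_UNIV UNIV_I]
  have "smooth_on ?V (%b. (FF^^n) ((%y. (?c + rt (al ((snd y)\<^sup>2 * sq (fst y - ?c))) (fst y - ?c),snd y)) ((FI^^n) b)))"
   by (rule smooth_on_subset) simp
  hence "smooth_on ?V (tw j s al)" by (simp only:smooth_on_cong[OF V e])
  moreover have "a:?V" using d by (auto simp:near_def)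
  ultimately show ?thesis using V by blast
 next
  case False
  have z: "abs(snd a)>0" using a by (simp add:Y_def)
  show ?thesis
  proof (cases "s * snd a>0")
   case neg: False
   let ?V = "{b. s * snd b<0} :: pt set"
   have V: "open ?V" by (intro open_Collect_less continuous_intros)
   have "tw j s al b = b" if "b:?V" for b
   proof (rule tw_id, rule notI)
    assume "EX d. near j s b d"
    then obtain n v u z where "near j s b (n,v,u,z)" by auto
    thus False using that pos_scale(1)[of "lam^n" s "snd b"] by (auto simp:near_def FI_pow)
   qed
   hence "smooth_on ?V (tw j s al)" using smooth_on_cong[OF V, of "tw j s al" "%b. b"] smooth_on_id[OF V] by blast
   moreover have "a:?V" using neg z s by (auto simp:linorder_not_less le_less)
   ultimately show ?thesis using V by blast
  next
   case pos: True
   \<comment> \<open>Near \<open>a\<close>, an entrance after more than \<open>n\<close> steps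
     forces a parameter above \<open>2\<close>; no entrance happens within \<open>n\<close> steps,
     as \<open>(fi^^n) (fst a)\<close> has distance at least \<open>lam\<close> from the translates
     of source \<open>j\<close>.\<close>
   obtain n where n: "4/abs(snd a)<lam^n" using real_arch_pow[of lam] by auto
   have far_a: "lam<=norm ((fi^^n) (fst a) - v - cs j)" if v: "v:Lat" for v
   proof (rule ccontr)
    assume *: "~ lam<=norm ((fi^^n) (fst a) - v - cs j)"
    define u where "u = (fi^^n) (fst a) - v - cs j"
    have u: "norm u<lam" "(fi^^n) (fst a) = v + cs j + u" using * by (auto simp:u_def)
    have "nrm u<=norm u" using norm_fst_le[of "fst u" "snd u"] norm_snd_le[of "snd u" "fst u"] by (simp add:nrm_def)
    hence nu: "nrm u<=lam" using u by linarith
    obtain w where w: "w:Lat" "!!u z. nrm u<=lam ==> (FI^^1) (v + cs j + u,z) = (w + cs j + (1/lam^1) *R u,lam^1*z)"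
     using FI_pow_center[OF v j] by blast
    have "(FI^^(n + 1)) a = FI (v + cs j + u,lam^n * snd a)" using u(2) by (simp add:FI_pow[of n])
    also have "... = (w + cs j + (1/lam) *R u,lam*(lam^n * snd a))" using w(2)[OF nu] by simp
    finally have e: "(FI^^(n + 1)) a = (w + cs j + (1/lam) *R u,lam*(lam^n * snd a))" .
    have "(norm u)\<^sup>2<lam\<^sup>2" using u(1) by (intro power_strict_mono) auto
    hence "sq ((1/lam) *R u)<1" unfolding sq_norm by (simp add:power_divide)
    hence "near j s a (n + 1,w,(1/lam) *R u,lam*(lam^n * snd a))"
     using e w(1) pos pos_scale(1)[of "lam^Suc n" s "snd a"] by (simp add:near_def)
    thus False using False by blast
   qed
   let ?V = "{b. abs(snd a)/2<abs(snd b) & norm (fst ((FI^^n) b) - (fi^^n) (fst a))<1} :: pt set"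
   have ctFI: "continuous_on UNIV (FI^^n)" by (rule smooth_on_continuous[OF smooth_pow(2)])
   have V: "open ?V" by (intro open_Collect_conj open_Collect_less continuous_intros continuous_on_compose2[OF ctFI]) auto
   have "tw j s al b = b" if b: "b:?V" for b
   proof (cases "EX d. near j s b d")
    case True
    define m where "m = (LEAST m. EX d. near j s b (m,d))"
    have "EX m. EX d. near j s b (m,d)" using True by auto
    hence "EX d. near j s b (m,d)" unfolding m_def by (rule LeastI_ex)
    then obtain v u z where d: "near j s b (m,v,u,z)" by auto
    hence d': "v:Lat" "sq u<1" "s*z>0" "(FI^^m) b = (v + cs j + u,z)" by (auto simp:near_def)
    have "m>n"
    proof (rule ccontr)
     assume "~ m>n"
     then obtain w u' z' where w: "near j s b (n,w,u',z')" using near_shift[OF d j, of "n - m"] by (metis add_diff_inverse_nat)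
     hence "w:Lat" "(norm u')\<^sup>2<1" "fst ((FI^^n) b) = w + cs j + u'" by (auto simp:near_def sq_norm)
     hence "norm u'<1" by (metis one_power2 power2_less_imp_less zero_le_one)
     have "norm ((fi^^n) (fst a) - w - cs j)<=norm (fst ((FI^^n) b) - (fi^^n) (fst a)) + norm u'"
      using norm_triangle_ineq4[of u' "fst ((FI^^n) b) - (fi^^n) (fst a)"] `fst ((FI^^n) b) = w + cs j + u'` by (simp add:algebra_simps)
     thus False using far_a[OF `w:Lat`] b `norm u'<1` lam_bounds by simp
    qed
    then obtain k where k: "m = Suc k" "n<=k" by (cases m) auto
    have "1/lam\<^sup>2<=sq u"
    proof (rule ccontr)
     assume c: "~ 1/lam\<^sup>2<=sq u"
     have "nrm u<=1" using sq_nrm_less[OF d'(2)] by simp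
     from fm_lin[OF d'(1) j this] have "FF (v + cs j + u,z) = (Alin v + cs j + lam *R u,z/lam)" by (simp add:FF_def)
     moreover have "FF ((FI^^m) b) = (FI^^k) b" by (simp add:k)
     ultimately have "(FI^^k) b = (Alin v + cs j + lam *R u,z/lam)" using d'(4) by simp
     moreover have "sq (lam *R u)<1" using c by (simp add:field_simps)
     ultimately have "near j s b (k,Alin v,lam *R u,z/lam)" using d'(1,3) Lat_lin by (simp add:near_def)
     hence "m<=k" unfolding m_def by (intro Least_le) blast
     thus False using k by simp
    qed
    hence "z\<^sup>2*(1/lam\<^sup>2)<=z\<^sup>2 * sq u" by (intro mult_left_mono) auto
    moreover have "z\<^sup>2*(1/lam\<^sup>2) = (lam^k*abs(snd b))\<^sup>2"
    proof -
     have "z = lam*(lam^k * snd b)" using arg_cong[OF d'(4), of snd] unfolding k FI_pow by simp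
     thus ?thesis by (simp add:power_mult_distrib)
    qed
    moreover have "2<=(lam^k*abs(snd b))\<^sup>2"
    proof -
     have "lam^n*(abs(snd a)/2)<=lam^k*abs(snd b)" using b k by (intro mult_mono) auto
     moreover have "2<lam^n*(abs(snd a)/2)" using n z by (simp add:field_simps)
     ultimately have "2<=lam^k*abs(snd b)" by linarith
     hence "2\<^sup>2<=(lam^k*abs(snd b))\<^sup>2" by (intro power_mono) auto
     thus ?thesis by simp
    qed
    ultimately have "al (z\<^sup>2 * sq u) = 0" using far by simp
    thus ?thesis using tw_eq[OF d j, of al] d'(4)[symmetric] by simp
   qed (rule tw_id)
   hence "smooth_on ?V (tw j s al)" using smooth_on_cong[OF V, of "tw j s al" "%b. b"] smooth_on_id[OF V] by blast
   moreover have "a:?V" using z by (simp add:FI_pow)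
   ultimately show ?thesis using V by blast
  qed
 qed
qed

text \<open>The twist interpolates between the identity near the basic sets and a half turn where the
  second glueing differs from the first; \<open>al\<close> acts for \<open>z > 0\<close> and \<open>be\<close> for \<open>z < 0\<close>.\<close>

definition Psi :: "(real => real) => (real => real) => pt => pt" where
 "Psi al be a = (if snd a>0 then tw 1 1 al a else tw 0 (- 1) be a)"

lemma snd_Psi [simp]: "snd (Psi al be a) = snd a" by (simp add:Psi_def snd_tw)

lemma Psi_Psi: "(!!x. al x + al' x = 0) ==> (!!x. be x + be' x = 0) ==> Psi al be (Psi al' be' a) = a"
proof -
 have z: "tw j s (%x. 0) a = a" if "j<3" for j s
 proof (cases "EX d. near j s a d")
  case True
  then obtain n v u z where d: "near j s a (n,v,u,z)" by auto
  hence "(FI^^n) a = (v + cs j + u,z)" by (simp add:near_def)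
  thus ?thesis using tw_eq[OF d that, of "%x. 0"] by (metis FF_FI_pow(1) rt_simps(1))
 qed (rule tw_id)
 assume "!!x. al x + al' x = 0" "!!x. be x + be' x = 0"
 thus ?thesis using z by (simp add:Psi_def snd_tw tw_tw)
qed

lemma Psi_Y: "Psi al be a:Y <-> a:Y" by (simp add:Psi_def tw_Y)

lemma smooth_Psi:
 assumes "smooth_on UNIV al" "!!x. x>=2 ==> al x = 0" "smooth_on UNIV be" "!!x. x>=2 ==> be x = 0"
 shows "smooth_on Y (Psi al be)"
proof (rule smooth_on_local)
 fix a assume a: "a:Y"
 let ?P = "Y Int {b. snd b>0}" and ?N = "Y Int {b. snd b<0}"
 have o: "open ?P" "open ?N" by (intro open_Int open_Y open_Collect_less continuous_intros)+
 have "smooth_on ?P (tw 1 1 al)" "smooth_on ?N (tw 0 (-1) be)"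
  by (rule smooth_on_subset[OF smooth_tw[OF _ _ assms(1,2)]] smooth_on_subset[OF smooth_tw[OF _ _ assms(3,4)]]; simp)+
 hence "smooth_on ?P (Psi al be)" "smooth_on ?N (Psi al be)"
  using smooth_on_cong[OF o(1), of "Psi al be" "tw 1 1 al"] smooth_on_cong[OF o(2), of "Psi al be" "tw 0 (-1) be"] by (simp_all add:Psi_def)
 moreover have "a:?P | a:?N" using a by (auto simp:Y_def)
 ultimately show "EX V. open V & a:V & smooth_on V (Psi al be)" using o by blast
qed

lemma Psi_rel0: "rel0 a b ==> rel0 (Psi al be a) (Psi al be b)"
proof -
 assume ab: "rel0 a b"
 have FI: "Psi al be (FI a) = FI (Psi al be a)" for a
 proof -
  have "snd (FI a)>0 <-> snd a>0" by (simp add:FI_def zero_less_mult_iff)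
  thus ?thesis by (simp add:Psi_def tw_FI)
 qed
 have FF: "Psi al be (FF a) = FF (Psi al be a)" for a
 proof -
  have "snd (FF a)>0 <-> snd a>0" by (simp add:FF_def zero_less_divide_iff)
  thus ?thesis by (simp add:Psi_def tw_FF)
 qed
 have TT: "Psi al be (TT v a) = TT v (Psi al be a)" if "v:Lat" for v a 
 proof -
  have "snd (TT v a)>0 <-> snd a>0" by (simp add:TT_def)
  thus ?thesis using that by (simp add:Psi_def tw_TT)
 qed
 have pow: "Psi al be ((FI^^n) a) = (FI^^n) (Psi al be a)" "Psi al be ((FF^^n) a) = (FF^^n) (Psi al be a)" for n a
  by (induction n) (simp_all add:FI FF)
 from ab show ?thesis unfolding rel0_def using TT pow by metis
qed

lemma glued_flip: "glued P P' X0 (ep(1 := - ep 1))"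
proof -
 have "da_map P P' X0" ..
 moreover have "(ep(1 := - ep 1)) j = 1 | (ep(1 := - ep 1)) j = - 1" for j using eps[of j] by auto
 ultimately show ?thesis unfolding glued_def glued_axioms_def by blast
qed

lemma relG_small: "relG a b ==> EX j<3. EX u z. u~=0 & sq u<1 & z~=0 & rel0 a (cs j + u,z) & rel0 b (gl j u z)"
proof -
 assume "relG a b"
 then obtain j u z where *: "j<3" "u~=0" "nrm u<lam" "z~=0" "rel0 a (cs j + u,z)" "rel0 b (gl j u z)"
  unfolding relG_def by blast
 let ?u = "(1/lam^2) *R u"
 have l: "nrm u<=lam" using * by simp
 have "rel0 a (cs j + ?u,lam^2*z)" "rel0 b (gl j ?u (lam^2*z))"
  using rel0_trans[OF *(5) rel0_FI(1)[of _ 2]] rel0_trans[OF *(6) rel0_FI(1)[of _ 2]] FI_pow_lin[OF *(1) l] FI_pow_gl[OF *(1) l] by simp_all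
 moreover have "sq ?u<1"
 proof -
  have "nrm u^2<lam^2" using * by (intro power_strict_mono) auto
  hence "sq u<2*lam^2" using sq_nrm(2)[of u] by linarith
  also have "... <= lam^2*lam^2" using lam_bounds by (intro mult_right_mono) (auto simp:power2_eq_square intro:order_trans[OF _ mult_mono[of 1 lam 2 lam]])
  finally show ?thesis by (simp add:power_divide)
 qed
 ultimately show ?thesis using * by (intro exI[of _ j] conjI exI[of _ ?u] exI[of _ "lam^2*z"]) auto
qed

text \<open>\<open>Psi\<close> descends from the flipped quotient to the given one. Crossing the
  glueing inverts \<open>z^2 * sq u\<close>, so \<open>al\<close> at \<open>x\<close> meets
  \<open>be\<close> at \<open>1/x\<close>; assumption \<open>c\<close> says that the two rotations
  differ by the half turn distinguishing the glueings.\<close>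

lemma Psi_rel:
 assumes c: "!!x u. x>0 ==> rt (be (1/x)) (- u) = rt (al x) u"
  and ab: "glued.rel P X0 (ep(1 := - ep 1)) a b"
 shows "rel (Psi al be a) (Psi al be b)"
proof -
 interpret g2: glued P P' X0 "ep(1 := - ep 1)" by (rule glued_flip)
 note [simp] = pj_def and [simp del] = One_nat_def
 \<comment> \<open>The case \<open>j = 0\<close>, \<open>z < 0\<close> is the crossing
   \<open>j = 1\<close>, \<open>z > 0\<close> read backwards. It is left out here and recovered
   below by symmetry.\<close>
 have key: "relG (Psi al be a) (Psi al be b)"
  if j: "j<3" and u: "u~=0" "sq u<1" "z~=0" "rel0 a (cs j + u,z)" "rel0 b (g2.gl j u z)" and nj: "~ (j = 0 & z<0)" for j u z a b
 proof -
  have s: "sq u>0" using sq_pos u by blast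
  define z' where "z' = - (1/(z * sq u))"
  have z': "z'>0 <-> z<0" using s by (simp add:z'_def mult_less_0_iff)
  have e2: "g2.ee j z = (if j = 1 & z>0 then - ee j z else ee j z)" using nj u by (auto simp:g2.ee_def ee_def)
  define w where "w = g2.ee j z *R rot u"
  have gw: "g2.gl j u z = (cs (pj j) + w,z')" by (simp add:g2.gl_def w_def z'_def)
  have sw: "sq w = sq u" by (simp add:w_def power2_eq_square)
  have pj3: "pj j<3" using j by simp
  show ?thesis
  proof (cases "j = 1 & z>0")
   case True
   define u' where "u' = rt (al (z\<^sup>2 * sq u)) u"
   have u': "u'~=0" "sq u'<1" using u sq_rt[of _ u] unfolding u'_def by (metis sq_0(1), simp)
   have A: "Psi al be (cs j + u,z) = (cs j + u',z)" using True tw_center[of 1 u 1 z al] u by (simp add:Psi_def u'_def)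
   have "z'\<^sup>2 * sq w = 1/(z\<^sup>2 * sq u)" by (simp add:z'_def sw power2_eq_square)
   hence "Psi al be (cs 0 + w,z') = (cs 0 + rt (be (1/(z\<^sup>2 * sq u))) w,z')"
    using True tw_center[of 0 w "-1" z' be] u sw s by (auto simp:Psi_def z'_def mult_less_0_iff)
   also have "rt (be (1/(z\<^sup>2 * sq u))) w = ee j z *R rot u'"
    using c[of "z\<^sup>2 * sq u" "ee j z *R rot u"] s e2 True by (simp add:w_def u'_def rt_scale rt_rot)
   finally have B: "Psi al be (g2.gl j u z) = gl j u' z" using gw True by (simp add:gl_def u'_def z'_def)
   have "nrm u'<lam" using sq_nrm_less[OF u'(2)] lam_bounds by linarith
   thus ?thesis using Psi_rel0[OF u(4), of al be] Psi_rel0[OF u(5), of al be] u' j u(3) unfolding A B relG_def by blast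
  next
   case False
   have A: "Psi al be (cs j + u,z) = (cs j + u,z)" using False nj u j by (auto simp:Psi_def intro!:tw_other)
   have "Psi al be (cs (pj j) + w,z') = (cs (pj j) + w,z')"
    using False nj u z' sw pj3 by (auto simp:Psi_def intro!:tw_other split:if_splits)
   hence B: "Psi al be (g2.gl j u z) = gl j u z" unfolding gw using e2 False by (simp add:gl_def w_def z'_def)
   have "nrm u<lam" using sq_nrm_less[OF u(2)] lam_bounds by linarith
   thus ?thesis using Psi_rel0[OF u(4), of al be] Psi_rel0[OF u(5), of al be] u j unfolding A B relG_def by blast
  qed
 qed
 show ?thesis
 proof (cases "rel0 a b")
  case True thus ?thesis using Psi_rel0 rel_def by blast
 next
  case False
  hence "g2.relG a b" using ab unfolding g2.rel_def by blast
  then obtain j u z where *: "j<3" "u~=0" "sq u<1" "z~=0" "rel0 a (cs j + u,z)" "rel0 b (g2.gl j u z)" using g2.relG_small by blast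
  have "relG (Psi al be a) (Psi al be b)"
  proof (cases "j = 0 & z<0")
   case False thus ?thesis using key[OF *] by blast
  next
   case True
   note g = g2.gl_form[OF *(2,4), of j]
   have s: "sq (g2.ee j z *R rot u)<1" using *(3) by (simp add:power2_eq_square)
   have "relG (Psi al be b) (Psi al be a)"
    by (rule key[of 1 "g2.ee j z *R rot u" "- (1/(z * sq u))"]) (use * g s True in simp_all)
   thus ?thesis by (rule relG_sym)
  qed
  thus ?thesis by (simp add:rel_def)
 qed
qed

end

text \<open>\<open>al\<close> climbs from \<open>- pi\<close> to \<open>0\<close> on the interval
  from \<open>1\<close> to \<open>2\<close>, and \<open>be\<close> is arranged so that
  \<open>be (1/x) + pi = al x + 2 * pi\<close>. Both vanish from \<open>2\<close> on, as
  \<open>smooth_tw\<close> demands.\<close>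

lemma twist_functions:
 obtains al be :: "real => real" where "smooth_on UNIV al" "!!x. x>=2 ==> al x = 0" "smooth_on UNIV be" "!!x. x>=2 ==> be x = 0"
  "!!x u. x>0 ==> rt (be (1/x)) (- u) = rt (al x) u" "!!x u. x>0 ==> rt (- be (1/x)) (- u) = rt (- al x) u"
proof -
 define al where "al x = pi * smooth_step (x - 1) - pi" for x
 \<comment> \<open>For \<open>0 < x <= 1/4\<close> the step has already reached \<open>1\<close>;
   the constant clause continues it smoothly across \<open>0\<close>.\<close>
 define be where "be x = (if x<=1/4 then pi else pi * smooth_step (1/x - 1))" for x
 have step: "smooth_on S (%x. smooth_step (g x - 1))" if "open S" "smooth_on S g" for S :: "real set" and g
  by (rule smooth_on_compose_real[OF smooth_on_smooth_step that(1)]) (intro smooth_on_diff smooth_on_const that)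
 have 1: "smooth_on UNIV al" unfolding al_def by (intro smooth_on_diff smooth_on_mult smooth_on_const step smooth_on_id open_UNIV)
 have b: "be x = pi * smooth_step (1/x - 1)" if "x>0" for x
 proof (cases "x<=1/4")
  case True
  hence "1/x - 1>=1" using that by (simp add:field_simps)
  thus ?thesis using smooth_step_1 by (simp add:be_def)
 qed (simp add:be_def)
 have "smooth_on {..<1/4} be"
  using smooth_on_cong[of "{..<1/4}" be "%x. pi"] smooth_on_const[of _ pi] by (simp add:be_def)
 moreover have "smooth_on {0<..} be"
 proof -
  have "smooth_on {0<..} (%x::real. pi * smooth_step (inverse x - 1))"
   by (intro smooth_on_mult smooth_on_const step smooth_on_inverse smooth_on_id) auto
  thus ?thesis using smooth_on_cong[of "{0<..}" be "%x. pi * smooth_step (inverse x - 1)"] b by (simp add:inverse_eq_divide)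
 qed
 ultimately have 2: "smooth_on UNIV be"
  by (intro smooth_on_local) (metis open_lessThan open_greaterThan lessThan_iff greaterThan_iff linorder_not_less less_le_trans zero_less_divide_1_iff zero_less_numeral)
 have 3: "al x = 0" if "x>=2" for x using smooth_step_1[of "x - 1"] that by (simp add:al_def)
 have 4: "be x = 0" if "x>=2" for x using smooth_step_0[of "1/x - 1"] that b[of x] by simp
 have 5: "be (1/x) + pi = al x + 2*pi" if "x>0" for x using b[of "1/x"] that by (simp add:al_def)
 have rt2: "rt (t + 2*pi) u = rt t u" "rt (t - 2*pi) u = rt t u" for t u by (simp_all add:rt_def sin_diff cos_diff)
 have 6: "rt t (- u) = rt (t + pi) u" for t u by (simp add:rt_pi flip:rt_rt)
 have 7: "rt (be (1/x)) (- u) = rt (al x) u" if "x>0" for x u unfolding 6 5[OF that] rt2 ..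
 have 8: "rt (- be (1/x)) (- u) = rt (- al x) u" if "x>0" for x u
 proof -
  have "- be (1/x) + pi = - al x" using 5[OF that] by simp
  thus ?thesis unfolding 6 by simp
 qed
 show ?thesis by (rule that[OF 1 3 2 4 7 8])
qed

section \<open>Stable and unstable leaves of the planar map\<close>

context da_map
begin

lemma snd_pow [simp]: "snd ((fm^^n) p) = lam^n * snd p" "snd ((fi^^n) p) = snd p/lam^n"
 by (induction n) auto

lemma fm_pow_mono: "x<x' ==> fst ((fm^^n) (x,y))<fst ((fm^^n) (x',y))"
proof (induction n)
 case (Suc n)
 have "(fm^^n) (w,y) = (fst ((fm^^n) (w,y)),lam^n*y)" for w by (simp add:prod_eq_iff)
 thus ?case using fst_fm_mono[OF Suc.IH[OF Suc.prems], of "lam^n*y"] by simp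
qed simp

lemma fm_pow_mono_iff: "fst ((fm^^n) (x,y))<fst ((fm^^n) (x',y)) <-> x<x'"
 using fm_pow_mono[of x x' n y] fm_pow_mono[of x' x n y] by (metis less_asym linorder_neqE)

lemma fi_pow_mono_iff: "fst ((fi^^n) (x,y))<fst ((fi^^n) (x',y)) <-> x<x'"
proof -
 have "(fi^^n) (w,y) = (fst ((fi^^n) (w,y)),y/lam^n)" for w by (simp add:prod_eq_iff)
 thus ?thesis using fm_pow_mono_iff[of n "fst ((fi^^n) (x,y))" "y/lam^n" "fst ((fi^^n) (x',y))"] by simp
qed

lemma between_fi:
 assumes "fst ((fi^^n) (x,y))<=w" "w<=fst ((fi^^n) (x',y))"
 obtains t where "x<=t" "t<=x'" "(fi^^n) (t,y) = (w,y/lam^n)"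
proof -
 define t where "t = fst ((fm^^n) (w,y/lam^n))"
 have t: "(fm^^n) (w,y/lam^n) = (t,y)" by (simp add:t_def prod_eq_iff)
 hence e: "(fi^^n) (t,y) = (w,y/lam^n)" by (metis fi_pow_fm_pow(1))
 have "~ t<x" "~ x'<t" using fi_pow_mono_iff[of n t y x] fi_pow_mono_iff[of n x' y t] assms e by auto
 thus ?thesis using that[of t] e by simp
qed

lemma between_fm:
 assumes "fst ((fm^^n) (x,y))<=w" "w<=fst ((fm^^n) (x',y))"
 obtains t where "x<=t" "t<=x'" "(fm^^n) (t,y) = (w,lam^n*y)"
proof -
 define t where "t = fst ((fi^^n) (w,lam^n*y))"
 have t: "(fi^^n) (w,lam^n*y) = (t,y)" by (simp add:t_def prod_eq_iff)
 hence e: "(fm^^n) (t,y) = (w,lam^n*y)" by (metis fi_pow_fm_pow(2))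
 have "~ t<x" "~ x'<t" using fm_pow_mono_iff[of n t y x] fm_pow_mono_iff[of n x' y t] assms e by auto
 thus ?thesis using that[of t] e by simp
qed

lemma contract_step:
 assumes "x<=x'" "!!w. x<=w ==> w<=x' ==> (w,y)~:Zn lam"
 shows "fst (fm (x',y)) - fst (fm (x,y))<=(x' - x)/lam"
proof (cases "x = x'")
 case False
 hence "x<x'" using assms by simp
 obtain z where z: "x<z" "z<x'" "fst (fm (x',y)) - fst (fm (x,y)) = (x' - x)*Fx (z,y)"
  using MVT2[OF `x<x'`, of "%w. fst (fm (w,y))" "%w. Fx (w,y)"] fst_fm_deriv by blast
 hence "Fx (z,y)<=1/lam" using Fx_off assms(2) by simp
 hence "(x' - x)*Fx (z,y)<=(x' - x)*(1/lam)" using `x<x'` by (intro mult_left_mono) auto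
 thus ?thesis using z by simp
qed simp

lemma expand_fi:
 assumes "x<=x'" "!!w m. x<=w ==> w<=x' ==> (fi^^m) (w,y)~:Zn lam"
 shows "lam^n*(x' - x)<=fst ((fi^^n) (x',y)) - fst ((fi^^n) (x,y))"
proof (induction n)
 case (Suc n)
 let ?a = "fst ((fi^^Suc n) (x,y))" and ?b = "fst ((fi^^Suc n) (x',y))"
 have e: "fm (fst ((fi^^Suc n) (w,y)),y/lam^Suc n) = (fi^^n) (w,y)" for w
 proof -
  have "(fst ((fi^^Suc n) (w,y)),y/lam^Suc n) = fi ((fi^^n) (w,y))" by (simp add:prod_eq_iff)
  thus ?thesis by simp
 qed
 have "?a<=?b" using fi_pow_mono_iff[of "Suc n" x' y x] assms(1) by linarith
 moreover have "(w,y/lam^Suc n)~:Zn lam" if w: "?a<=w" "w<=?b" for w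
  by (rule between_fi[OF w]) (metis assms(2))
 ultimately have "fst (fm (?b,y/lam^Suc n)) - fst (fm (?a,y/lam^Suc n))<=(?b - ?a)/lam" by (rule contract_step)
 hence "lam*(lam^n*(x' - x))<=lam*((?b - ?a)/lam)" using Suc e by (intro mult_left_mono) auto
 thus ?case by simp
qed simp

text \<open>The points which never come close to a source under \<open>fi\<close>: the lift of the attractor of \<open>fm\<close>.\<close>

definition Lm :: "(real*real) set" where "Lm = {p. ALL n. (fi^^n) p~:Zn lam}"

lemma Lm_off: "p:Lm ==> (fi^^n) p~:Zn lam" "p:Lm ==> p~:Zn lam"
proof -
 assume p: "p:Lm"
 thus "(fi^^n) p~:Zn lam" for n by (simp add:Lm_def)
 from this[of 0] show "p~:Zn lam" by simp
qed

lemma Lm_U: "p:Lm ==> p:U" using Lm_off(2)[of p] cen_Zn[of lam] by (auto simp:U_def)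

lemma Lm_fm: "fm p:Lm <-> p:Lm" "fi p:Lm <-> p:Lm"
proof -
 have *: "fi p:Lm <-> p:Lm" for p
 proof
  assume "p:Lm"
  hence "(fi^^Suc n) p~:Zn lam" for n using Lm_off(1) by blast
  thus "fi p:Lm" unfolding Lm_def by (simp add:funpow_swap1)
 next
  assume a: "fi p:Lm"
  have "p~:Zn lam" using fm_off[OF Lm_off(2)[OF a]] by simp
  moreover have "(fi^^Suc n) p~:Zn lam" for n using Lm_off(1)[OF a, of n] by (simp add:funpow_swap1)
  ultimately have "(fi^^n) p~:Zn lam" for n by (cases n) auto
  thus "p:Lm" by (simp add:Lm_def)
 qed
 show "fi p:Lm <-> p:Lm" "fm p:Lm <-> p:Lm" using * *[of "fm p"] by simp_all
qed

lemma fi_pow_add: "v:Lat ==> EX w:Lat. ALL p. (fi^^n) (p + v) = (fi^^n) p + w"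
proof (induction n)
 case (Suc n)
 then obtain w where "w:Lat" "ALL p. (fi^^n) (p + v) = (fi^^n) p + w" by blast
 thus ?case by (intro bexI[of _ "Ainv w"]) (auto simp:fi_add Lat_lin)
qed auto

lemma fm_pow_add: "v:Lat ==> EX w:Lat. ALL p. (fm^^n) (p + v) = (fm^^n) p + w"
proof (induction n)
 case (Suc n)
 then obtain w where "w:Lat" "ALL p. (fm^^n) (p + v) = (fm^^n) p + w" by blast
 thus ?case by (intro bexI[of _ "Alin w"]) (auto simp:fm_add Lat_lin)
qed auto

lemma Lm_add: "v:Lat ==> p + v:Lm <-> p:Lm"
proof -
 assume v: "v:Lat"
 have "(fi^^n) (p + v):Zn lam <-> (fi^^n) p:Zn lam" for n
 proof -
  obtain w where "w:Lat" "(fi^^n) (p + v) = (fi^^n) p + w" using fi_pow_add[OF v] by blast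
  thus ?thesis using Zn_add by simp
 qed
 thus ?thesis by (simp add:Lm_def)
qed

lemma continuous_pow: "continuous_on S (fm^^n)" "continuous_on S (fi^^n)"
proof -
 have "continuous_on UNIV fm" "continuous_on UNIV fi" using smooth_fm fi_deriv_smooth(1) smooth_on_continuous by blast+
 note c = this
 have "continuous_on UNIV (fm^^n) & continuous_on UNIV (fi^^n)"
 proof (induction n)
  case (Suc n)
  thus ?case using continuous_on_compose[of UNIV "fm^^n" fm] continuous_on_compose[of UNIV "fi^^n" fi] c by (auto intro:continuous_on_subset)
 qed (auto simp:id_def)
 thus "continuous_on S (fm^^n)" "continuous_on S (fi^^n)" by (auto intro:continuous_on_subset)
qed

text \<open>Powers of the unit \<open>lam\<close> give a lattice vector \<open>w\<close> of height
  below \<open>de\<close>. Adding multiples of \<open>w\<close> to a vector from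
  \<open>Lat_cover\<close> adjusts the height, and \<open>R\<close> bounds the horizontal distance
  spent.\<close>

lemma Lat_dense:
 assumes "de>0"
 shows "EX R>0. ALL x0 y0. EX v:Lat. abs(snd v - y0)<de & x0<=fst v & fst v<=x0 + R"
proof -
 obtain n where n: "Kl/de<lam^n" using real_arch_pow[of lam] by auto
 define w where "w = (lam^n*Kl,Kl/lam^n)"
 have "(lam^n*Kl,Kl/lam^n):Lat" for n
 proof (induction n)
  case 0 have "(Kl*(of_int 1 + of_int 0/lam),Kl*(of_int 1 + of_int 0*lam)):Lat" unfolding Lat_def by blast
  thus ?case by simp
 next
  case (Suc n) thus ?case using Lat_lin(2)[OF Suc] by (simp add:Ainv_def mult_ac)
 qed
 hence w: "w:Lat" by (simp add:w_def)
 have wy: "0<snd w" "snd w<de" using n assms Kl_pos by (simp_all add:w_def field_simps)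
 have wx: "0<fst w" using Kl_pos by (simp add:w_def)
 have mw: "of_int m *R w:Lat" for m :: int
 proof -
  have nat: "of_nat k *R w:Lat" for k by (induction k) (auto simp:algebra_simps w intro:Lat_add)
  show ?thesis using nat[of "nat m"] Lat_uminus[OF nat[of "nat (- m)"]] by (cases "m>=0") auto
 qed
 define R1 where "R1 = (4*Kl/snd w + 1) * fst w"
 have R1: "R1>0" unfolding R1_def using Kl_pos wy wx by (intro mult_pos_pos add_pos_pos) auto
 show ?thesis
 proof (intro exI[of _ "2*(2*Kl + R1)"] conjI allI)
  show "0<2*(2*Kl + R1)" using Kl_pos R1 by simp
  fix x0 y0 :: real
  obtain v where v: "v:Lat" "(x0 + 2*Kl + R1,y0) - v:cbox (0,0) (2*Kl,4*Kl)" using Lat_cover by blast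
  hence v': "0<=x0 + 2*Kl + R1 - fst v" "x0 + 2*Kl + R1 - fst v<=2*Kl" "0<=y0 - snd v" "y0 - snd v<=4*Kl"
   by (auto simp:cbox_Pair_eq mem_Times_iff)
  define m where "m = \<lfloor>(y0 - snd v)/snd w\<rfloor>"
  have m: "0<=m" "of_int m<=(y0 - snd v)/snd w" "(y0 - snd v)/snd w < of_int m + 1" using v' wy by (auto simp:m_def)
  have "of_int m * snd w<=y0 - snd v" "y0 - snd v < of_int m * snd w + snd w"
   using m wy by (simp_all add:field_simps)
  hence y: "abs(snd (v + of_int m *R w) - y0)<de" using wy by simp
  have "(y0 - snd v)/snd w<=4*Kl/snd w" using v' wy by (intro divide_right_mono) auto
  hence "of_int m * fst w<=R1" unfolding R1_def using m(2) wx by simp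
  moreover have "0 <= of_int m * fst w" using m wx by simp
  ultimately have x: "x0<=fst (v + of_int m *R w)" "fst (v + of_int m *R w)<=x0 + 2*(2*Kl + R1)" using v' by auto
  show "EX v:Lat. abs(snd v - y0)<de & x0<=fst v & fst v<=x0 + 2*(2*Kl + R1)"
   using Lat_add[OF v(1) mw] x y by blast
 qed
qed

text \<open>A horizontal segment in \<open>Lm\<close> would be expanded by \<open>fi\<close> beyond
  the length \<open>R\<close> of \<open>Lat_dense\<close> and then meet a square around a
  source.\<close>

lemma Lm_interior:
 assumes N: "open N" "p:N" shows "EX q:N. q~:Lm"
proof (rule ccontr)
 assume a: "~ ?thesis"
 obtain e where e: "e>0" "ball p e<=N" using N open_contains_ball by blast
 obtain x y where p: "p = (x,y)" by (cases p)
 have "(w,y):Lm" if "x<=w" "w<=x + e/2" for w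
 proof -
  have "dist p (w,y)<e" using that e(1) by (simp add:p dist_Pair_Pair dist_real_def)
  thus ?thesis using a e(2) by auto
 qed
 note L = this
 obtain R where R: "R>0" "!!x0 y0. EX v:Lat. abs(snd v - y0)<1 & x0<=fst v & fst v<=x0 + R" using Lat_dense[of 1] by auto
 obtain n where n: "R/(e/2)<lam^n" using real_arch_pow[of lam] by auto
 have "R<lam^n*(x + e/2 - x)" using n e by (simp add:field_simps)
 also have "... <= fst ((fi^^n) (x + e/2,y)) - fst ((fi^^n) (x,y))" by (rule expand_fi) (use e L Lm_off(1) in auto)
 finally have big: "R<fst ((fi^^n) (x + e/2,y)) - fst ((fi^^n) (x,y))" .
 obtain v where v: "v:Lat" "abs(snd v - y/lam^n)<1" "fst ((fi^^n) (x,y)) - src 0<=fst v" "fst v<=fst ((fi^^n) (x,y)) - src 0 + R"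
  using R(2) by blast
 obtain t where t: "x<=t" "t<=x + e/2" "(fi^^n) (t,y) = (fst v + src 0,y/lam^n)"
  by (rule between_fi[of n x y "fst v + src 0" "x + e/2"]) (use v big in auto)
 have "v + cs 0 + (0,y/lam^n - snd v):Zn lam" by (rule ZnI) (use v lam_bounds in "auto simp:nrm_def")
 moreover have "v + cs 0 + (0,y/lam^n - snd v) = (fi^^n) (t,y)" unfolding t(3) by (simp add:cs_def prod_eq_iff)
 ultimately show False using Lm_off(1)[OF L[OF t(1,2)], of n] by simp
qed

text \<open>Between the saddle and distance \<open>lam\<close> from the source the slope is at most
  \<open>1/lam\<close>; within distance \<open>1\<close> the map is linear of slope
  \<open>lam\<close>; in between monotonicity suffices.\<close>

lemma P_between:
 assumes j: "j<3"
 shows "sad j<x ==> x<src j ==> P x<x" "src j<x ==> x<sad (Suc j) ==> x<P x"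
proof -
 note b = src_bounds(2,3)[of j] lam_bounds
 have small: "P w - P x<=(w - x)/lam" if a: "x<w" "!!t. x<=t ==> t<=w ==> lam<=abs(t - src j)" "sad j<=x" "w<=sad (Suc j)" for x w
 proof -
  obtain t where t: "x<t" "t<w" "P w - P x = (w - x)*P' t" using MVT2[OF a(1), of P P'] P_deriv by blast
  have "lam<=abs(t - src k)" if "k<3" for k
  proof (cases "k = j")
   case False
   hence "12<abs(src j - src k)" using src_sep[OF j that] by auto
   moreover have "abs(t - src j)<=gap/2" using t a(3,4) unfolding src_def sad_def abs_le_iff by (simp add:algebra_simps)
   moreover have "gap<16" by (rule gap_bounds)
   ultimately show ?thesis using lam_bounds by linarith
  qed (use a(2)[of t] t in auto)
  hence "(w - x)*P' t<=(w - x)*(1/lam)" using P'_small a(1) by (intro mult_left_mono) auto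
  thus ?thesis using t by simp
 qed
 have strict: "d/lam<d" if "d>0" for d using that by (simp add:divide_less_eq)
 have near: "P x = src j + lam*(x - src j)" if "abs(x - src j)<=1" for x using P_src[OF j that] .
 show "P x<x" if x: "sad j<x" "x<src j"
 proof -
  consider "x<=src j - lam" | "src j - lam<x" "x<src j - 1" | "src j - 1<=x" by linarith
  thus ?thesis
  proof cases
   case 1
   have "P x - P (sad j)<=(x - sad j)/lam" by (rule small) (use 1 x b in auto)
   thus ?thesis using P_sad[of j] j strict[of "x - sad j"] x by simp
  next
   case 2
   thus ?thesis using P_mono[OF 2(2)] near[of "src j - 1"] by simp
  next
   case 3
   have "lam*(x - src j)<x - src j" using x by simp
   moreover have "P x = src j + lam*(x - src j)" by (rule near) (use 3 x in "simp add:abs_le_iff")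
   ultimately show ?thesis by linarith
  qed
 qed
 show "x<P x" if x: "src j<x" "x<sad (Suc j)"
 proof -
  consider "src j + lam<=x" | "x<src j + lam" "src j + 1<x" | "x<=src j + 1" by linarith
  thus ?thesis
  proof cases
   case 1
   have "P (sad (Suc j)) - P x<=(sad (Suc j) - x)/lam" by (rule small) (use 1 x b in auto)
   thus ?thesis using P_sad[of "Suc j"] j strict[of "sad (Suc j) - x"] x by simp
  next
   case 2
   thus ?thesis using P_mono[OF 2(2)] near[of "src j + 1"] by simp
  next
   case 3
   have "x - src j<lam*(x - src j)" using x by simp
   moreover have "P x = src j + lam*(x - src j)" by (rule near) (use 3 x in "simp add:abs_le_iff")
   ultimately show ?thesis by linarith
  qed
 qed
qed

lemma src_ends: "j<3 ==> sad 0<=sad j & sad (Suc j)<=sad 3 & sad j<src j & src j<sad (Suc j)"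
 using sad_bounds(3)[of j] sad_bounds(4)[of "Suc j"] src_bounds(2,3)[of j] by auto

lemma fi_strip:
 assumes y: "abs y<=lam" and x: "sad 0<=x" "x<=sad 3"
 shows "fi (x,y) = (Pi' x,y/lam)"
 using fi_Box[OF Lat_0, of "(x,y)"] assms by (simp add:Alin_add)

text \<open>Under \<open>fi\<close> the abscissa increases to a fixed point of \<open>P\<close>,
  which by \<open>P_between\<close> can only be \<open>src j\<close>. The mirror image is
  \<open>strip_right\<close>.\<close>

lemma strip_left:
 assumes j: "j<3" and x: "sad j<x" "x<src j" and y: "abs y<=1"
 shows "x<=fst ((fi^^n) (x,y)) & fst ((fi^^n) (x,y))<src j"
  and "EX n u. (fi^^n) (x,y) = cs j + u & nrm u<1 & fst u<0 & snd u = y/lam^n"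
proof -
 note e = src_ends[OF j]
 have srcfix: "P (src j) = src j" using P_src[OF j, of "src j"] by simp
 have yn: "abs(y/lam^n)<=lam" for n
 proof -
  have "abs y/lam^n<=abs y/1" by (intro divide_left_mono) auto
  thus ?thesis using y lam_bounds by simp
 qed
 define X where "X n = fst ((fi^^n) (x,y))" for n
 have fX: "(fi^^n) (x,y) = (X n,y/lam^n)" for n by (simp add:X_def prod_eq_iff)
 have step: "X n<X (Suc n) & X (Suc n)<src j & P (X (Suc n)) = X n" if "sad j<X n" "X n<src j" for n
 proof -
  have b: "sad 0<=X n" "X n<=sad 3" using that e by auto
  have "fi (X n,y/lam^n) = (Pi' (X n),y/lam^n/lam)" by (rule fi_strip[OF yn b])
  have "X (Suc n) = fst (fi ((fi^^n) (x,y)))" by (simp add:X_def)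
  hence X': "X (Suc n) = Pi' (X n)" unfolding fX `fi (X n,y/lam^n) = _` by simp
  have P: "P (X (Suc n)) = X n" using Pi'_in[OF b] X' by simp
  have lt: "X (Suc n)<src j" using P_mono_le[of "src j" "X (Suc n)"] srcfix P that(2) by linarith
  have gt: "sad j<X (Suc n)" using P_mono_le[of "X (Suc n)" "sad j"] P_sad[of j] j P that(1) by linarith
  show ?thesis using P_between(1)[OF j gt lt] P lt by simp
 qed
 have inv: "x<=X n & sad j<X n & X n<src j" for n
 proof (induction n)
  case 0 thus ?case using x by (simp add:X_def)
 next
  case (Suc n) thus ?case using step[of n] by linarith
 qed
 show "x<=fst ((fi^^n) (x,y)) & fst ((fi^^n) (x,y))<src j" using inv[of n] by (simp add:X_def)
 have "incseq X" by (rule incseq_SucI, rule less_imp_le) (use step inv in blast)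
 moreover have "norm (X n)<=abs x + abs(src j)" for n using inv[of n] unfolding real_norm_def by linarith
 hence "Bseq X" by (rule BseqI')
 ultimately obtain l where l: "X ----> l" using Bseq_monoseq_convergent[of X] unfolding convergent_def by (auto simp:incseq_imp_monoseq)
 have cP: "isCont P l" using DERIV_isCont[OF P_deriv] .
 have "(%n. P (X (Suc n))) ----> P l" by (rule isCont_tendsto_compose[OF cP LIMSEQ_Suc[OF l]])
 moreover have PX: "P (X (Suc n)) = X n" for n using step inv by blast
 ultimately have "X ----> P l" by simp
 hence "P l = l" by (rule LIMSEQ_unique[OF _ l])
 have "x<=l" by (rule LIMSEQ_le_const[OF l]) (use inv in auto)
 have "l<=src j" by (rule LIMSEQ_le_const2[OF l], rule exI[of _ 0]) (use inv less_imp_le in blast)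
 hence "l = src j" using P_between(1)[OF j, of l] `P l = l` `x<=l` x by force
 hence "\<forall>\<^sub>F n in sequentially. X n>src j - 1" using l by (auto intro:order_tendstoD(1))
 then obtain n where n: "X n>src j - 1" "n>=1" by (metis eventually_at_top_linorder linorder_le_cases)
 have "abs y/lam^n<1"
 proof -
  have "lam^1<=lam^n" using n by (intro power_increasing) auto
  hence "abs y<lam^n" using y lam_bounds by simp
  thus ?thesis by simp
 qed
 hence "nrm (X n - src j,y/lam^n)<1" using n inv[of n] by (simp add:nrm_def)
 thus "EX n u. (fi^^n) (x,y) = cs j + u & nrm u<1 & fst u<0 & snd u = y/lam^n"
  using inv[of n] by (intro exI[of _ n] exI[of _ "(X n - src j,y/lam^n)"]) (simp add:fX cs_def)
qed

lemma strip_right: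
 assumes j: "j<3" and x: "src j<x" "x<sad (Suc j)" and y: "abs y<=1"
 shows "src j<fst ((fi^^n) (x,y)) & fst ((fi^^n) (x,y))<=x"
  and "EX n u. (fi^^n) (x,y) = cs j + u & nrm u<1 & fst u>0 & snd u = y/lam^n"
proof -
 note e = src_ends[OF j]
 have srcfix: "P (src j) = src j" using P_src[OF j, of "src j"] by simp
 have yn: "abs(y/lam^n)<=lam" for n
 proof -
  have "abs y/lam^n<=abs y/1" by (intro divide_left_mono) auto
  thus ?thesis using y lam_bounds by simp
 qed
 define X where "X n = fst ((fi^^n) (x,y))" for n
 have fX: "(fi^^n) (x,y) = (X n,y/lam^n)" for n by (simp add:X_def prod_eq_iff)
 have step: "X (Suc n)<X n & src j<X (Suc n) & P (X (Suc n)) = X n" if "src j<X n" "X n<sad (Suc j)" for n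
 proof -
  have b: "sad 0<=X n" "X n<=sad 3" using that e by auto
  have "fi (X n,y/lam^n) = (Pi' (X n),y/lam^n/lam)" by (rule fi_strip[OF yn b])
  have "X (Suc n) = fst (fi ((fi^^n) (x,y)))" by (simp add:X_def)
  hence X': "X (Suc n) = Pi' (X n)" unfolding fX `fi (X n,y/lam^n) = _` by simp
  have P: "P (X (Suc n)) = X n" using Pi'_in[OF b] X' by simp
  have gt: "src j<X (Suc n)" using P_mono_le[of "X (Suc n)" "src j"] srcfix P that(1) by linarith
  have lt: "X (Suc n)<sad (Suc j)" using P_mono_le[of "sad (Suc j)" "X (Suc n)"] P_sad[of "Suc j"] j P that(2) by linarith
  show ?thesis using P_between(2)[OF j gt lt] P gt by simp
 qed
 have inv: "X n<=x & src j<X n & X n<sad (Suc j)" for n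
 proof (induction n)
  case 0 thus ?case using x by (simp add:X_def)
 next
  case (Suc n) thus ?case using step[of n] by linarith
 qed
 show "src j<fst ((fi^^n) (x,y)) & fst ((fi^^n) (x,y))<=x" using inv[of n] by (simp add:X_def)
 have "decseq X" by (rule decseq_SucI, rule less_imp_le) (use step inv in blast)
 moreover have "norm (X n)<=abs x + abs(src j)" for n using inv[of n] unfolding real_norm_def by linarith
 hence "Bseq X" by (rule BseqI')
 ultimately obtain l where l: "X ----> l" using Bseq_monoseq_convergent[of X] unfolding convergent_def by (auto simp:decseq_imp_monoseq)
 have cP: "isCont P l" using DERIV_isCont[OF P_deriv] .
 have "(%n. P (X (Suc n))) ----> P l" by (rule isCont_tendsto_compose[OF cP LIMSEQ_Suc[OF l]])
 moreover have PX: "P (X (Suc n)) = X n" for n using step inv by blast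
 ultimately have "X ----> P l" by simp
 hence "P l = l" by (rule LIMSEQ_unique[OF _ l])
 have "l<=x" by (rule LIMSEQ_le_const2[OF l]) (use inv in auto)
 have "src j<=l" by (rule LIMSEQ_le_const[OF l], rule exI[of _ 0]) (use inv less_imp_le in blast)
 hence "l = src j" using P_between(2)[OF j, of l] `P l = l` `l<=x` x by force
 hence "\<forall>\<^sub>F n in sequentially. X n<src j + 1" using l by (auto intro:order_tendstoD(2))
 then obtain n where n: "X n<src j + 1" "n>=1" by (metis eventually_at_top_linorder linorder_le_cases)
 have "abs y/lam^n<1"
 proof -
  have "lam^1<=lam^n" using n by (intro power_increasing) auto
  hence "abs y<lam^n" using y lam_bounds by simp
  thus ?thesis by simp
 qed
 hence "nrm (X n - src j,y/lam^n)<1" using n inv[of n] by (simp add:nrm_def)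
 thus "EX n u. (fi^^n) (x,y) = cs j + u & nrm u<1 & fst u>0 & snd u = y/lam^n"
  using inv[of n] by (intro exI[of _ n] exI[of _ "(X n - src j,y/lam^n)"]) (simp add:fX cs_def)
qed

text \<open>Any other point between the sources would be driven into a source by \<open>fi\<close>
  (\<open>strip_left\<close>, \<open>strip_right\<close>) and so not lie in
  \<open>Lm\<close>.\<close>

lemma src_between:
 assumes "src k<x" "x<src j" "k<3" "j<3" "!!l. l<3 ==> x~=src l" "abs y<=1" "(x,y):Lm"
 shows "EX i:{1,2}. x = sad i"
proof (rule ccontr)
 assume n: "~ ?thesis"
 have bad: False if l: "l<3" "(sad l<x & x<src l) | (src l<x & x<sad (Suc l))" for l
 proof -
  obtain n u where u: "(fi^^n) (x,y) = cs l + u" "nrm u<1" using strip_left(2)[OF l(1) _ _ assms(6)] strip_right(2)[OF l(1) _ _ assms(6)] l(2) by metis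
  have "0 + cs l + u:Zn lam" by (rule ZnI) (use u l lam_bounds in auto)
  thus False using Lm_off(1)[OF assms(7), of n] u(1) by simp
 qed
 have e: "src 0<sad 1" "sad 1<src 1" "src 1<sad 2" "sad 2<src 2"
  using src_bounds(2)[of 1] src_bounds(2)[of 2] src_bounds(3)[of 0] src_bounds(3)[of 1] by (simp_all add:numeral_2_eq_2)
 have "k = 0 | k = 1 | k = 2" "j = 0 | j = 1 | j = 2" using assms by auto
 hence "src 0<x" "x<src 2" using assms(1,2) e by auto
 thus False using bad[of 0] bad[of 1] bad[of 2] n assms(5)[of 1] by (auto simp:numeral_2_eq_2) (metis linorder_neqE)
qed

text \<open>The union of the unstable leaf of the \<open>i\<close>-th saddle and its lattice
  translates.\<close>

definition Vu :: "nat => (real*real) set" where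
 "Vu i = {p. EX n. EX v:Lat. EX t. abs t<1 & (fi^^n) p = v + (sad i,t)}"

text \<open>Apply \<open>fi\<close> to a horizontal segment around \<open>p\<close>. If it becomes
  long, it meets the vertical segment of a saddle, by \<open>Lat_dense\<close>. If it stays short,
  points on both sides of \<open>p\<close> run into sources; these belong to one lattice translate,
  and \<open>src_between\<close> puts \<open>p\<close> itself on the vertical leaf of a
  saddle.\<close>

lemma Vu_dense:
 assumes p: "p:Lm" and N: "open N" "p:N" shows "EX i:{1,2}. N Int Vu i~={}"
proof (rule ccontr)
 assume no: "~ ?thesis"
 obtain e where e: "e>0" "ball p e<=N" using N open_contains_ball by blast
 obtain x y where pxy: "p = (x,y)" by (cases p)
 define d where "d = e/2"
 have d: "d>0" using e by (simp add:d_def)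
 have J: "(w,y):N" if "abs(w - x)<=d" for w
 proof -
  have "dist p (w,y)<e" using that e(1) by (simp add:pxy dist_Pair_Pair dist_real_def d_def abs_minus_commute)
  thus ?thesis using e(2) by auto
 qed
 obtain R where R: "R>0" "!!x0 y0. EX v:Lat. abs(snd v - y0)<1 & x0<=fst v & fst v<=x0 + R" using Lat_dense[of 1] by auto
 define g where "g n w = fst ((fi^^n) (w,y))" for n w
 have fg: "(fi^^n) (w,y) = (g n w,y/lam^n)" for n w by (simp add:g_def prod_eq_iff)
 have len: "g n (x + d) - g n (x - d)<R" for n
 proof (rule ccontr)
  assume big: "~ ?thesis"
  obtain v where v: "v:Lat" "abs(snd v - y/lam^n)<1" "g n (x - d) - sad 1<=fst v" "fst v<=g n (x - d) - sad 1 + R" using R(2) by blast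
  obtain t where t: "x - d<=t" "t<=x + d" "(fi^^n) (t,y) = (fst v + sad 1,y/lam^n)"
   by (rule between_fi[of n "x - d" y "fst v + sad 1" "x + d"]) (use v big in "auto simp:g_def")
  have "(fi^^n) (t,y) = v + (sad 1,y/lam^n - snd v)" using t(3) by (simp add:prod_eq_iff)
  moreover have "abs(y/lam^n - snd v)<1" using v(2) by simp
  ultimately have "(t,y):Vu 1" using v(1) unfolding Vu_def by blast
  moreover have "(t,y):N" using J t by simp
  ultimately show False using no by blast
 qed
 have gm: "g n w<g n w' <-> w<w'" for n w w' unfolding g_def by (rule fi_pow_mono_iff)
 obtain n0 where n0: "R/d<lam^n0" using real_arch_pow[of lam] by auto
 have n0': "R<lam^n0*d" using n0 d by (simp add:field_simps)
 have "EX w n. x<=w & w<=x + d & (fi^^n) (w,y):Zn lam"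
 proof (rule ccontr)
  assume "~ ?thesis"
  hence "lam^n0*(x + d - x)<=g n0 (x + d) - g n0 x" unfolding g_def by (intro expand_fi) (use d in auto)
  thus False using n0' len[of n0] gm[of n0 "x - d" x] d by auto
 qed
 then obtain w1 n1 where 1: "x<=w1" "w1<=x + d" "(fi^^n1) (w1,y):Zn lam" by blast
 have "EX w n. x - d<=w & w<=x & (fi^^n) (w,y):Zn lam"
 proof (rule ccontr)
  assume "~ ?thesis"
  hence "lam^n0*(x - (x - d))<=g n0 x - g n0 (x - d)" unfolding g_def by (intro expand_fi) (use d in auto)
  thus False using n0' len[of n0] gm[of n0 x "x + d"] d by auto
 qed
 then obtain w2 n2 where 2: "x - d<=w2" "w2<=x" "(fi^^n2) (w2,y):Zn lam" by blast
 \<comment> \<open>After \<open>m\<close> more steps both points are so close to sources that the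
   two lattice vectors almost agree in height; being at most \<open>R + 60\<close> apart
   horizontally, they must be equal by \<open>Lat_big\<close>.\<close>
 obtain m0 where m0: "4*(R + 60)/Kl^2<lam^m0" using real_arch_pow[of lam] by auto
 define m where "m = Suc m0"
 define n where "n = n1 + n2 + m"
 have conv: "EX v:Lat. EX j<3. EX u. (fi^^(k + n')) q = v + cs j + u & nrm u<lam/lam^k" if q: "(fi^^n') q:Zn lam" for k n' q
 proof -
  have z: "(fi^^k) ((fi^^n') q):Zn (lam/lam^k)" by (rule fi_pow_Zn[OF q])
  then obtain v j u where "v:Lat" "j<3" "nrm u<lam/lam^k" "(fi^^k) ((fi^^n') q) = v + cs j + u" by (rule ZnE)
  thus ?thesis unfolding funpow_add o_apply by blast
 qed
 obtain v j u where v: "v:Lat" "j<3" "(fi^^n) (w1,y) = v + cs j + u" "nrm u<lam/lam^(n2 + m)"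
  using conv[OF 1(3), of "n2 + m"] by (auto simp:n_def add_ac)
 obtain v' k u' where v': "v':Lat" "k<3" "(fi^^n) (w2,y) = v' + cs k + u'" "nrm u'<lam/lam^(n1 + m)"
  using conv[OF 2(3), of "n1 + m"] by (auto simp:n_def add_ac)
 have low: "lam/lam^(l + m)<=lam/lam^m" for l
  by (intro divide_left_mono) auto
 have nu: "nrm u<lam/lam^m" "nrm u'<lam/lam^m" using v(4) v'(4) low[of n2] low[of n1] by auto
 have lm: "lam/lam^m<=lam" by (simp add:divide_le_eq)
 have nul: "nrm u<lam" "nrm u'<lam" using nu lm by auto
 have G: "g n w1 = fst v + src j + fst u" "y/lam^n = snd v + snd u" "g n w2 = fst v' + src k + fst u'" "y/lam^n = snd v' + snd u'"
  using v(3) v'(3) unfolding fg by (auto simp:cs_def prod_eq_iff)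
 have order: "g n w2<=g n x" "g n x<=g n w1" "g n w1 - g n w2<R"
  using gm[of n x w2] gm[of n w1 x] 1 2 len[of n] gm[of n "x + d" w1] gm[of n w2 "x - d"] by auto
 have vv: "v = v'"
 proof (rule ccontr)
  assume ne: "v~=v'"
  have "Kl\<^sup>2<=abs(fst (v - v'))*abs(snd (v - v'))" using Lat_big[OF Lat_diff[OF v(1) v'(1)]] ne by simp
  also have "... <= (R + 60)*(2*(lam/lam^m))"
  proof (intro mult_mono)
   have "abs(fst u)<=nrm u" "abs(fst u')<=nrm u'" "abs(snd u)<=nrm u" "abs(snd u')<=nrm u'" by (auto simp:nrm_def)
   note n = this nu nul
   show "abs(snd (v - v'))<=2*(lam/lam^m)" using G n by simp
   show "abs(fst (v - v'))<=R + 60" 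
    using G(1,3) n(1,2,7,8) order src_bounds(1)[OF v(2)] src_bounds(1)[OF v'(2)] lam_bounds(2) unfolding fst_diff abs_le_iff abs_less_iff by linarith
  qed (use R in auto)
  finally have "Kl\<^sup>2*lam^m<=(R + 60)*(2*lam)" by (simp add:field_simps)
  also have "... <= (R + 60)*8" using R lam_bounds by (intro mult_left_mono) auto
  finally have "Kl\<^sup>2*(lam*lam^m0)<=(R + 60)*8" by (simp add:m_def)
  moreover have "4*(R + 60)<Kl\<^sup>2*lam^m0" using m0 Kl_pos by (simp add:field_simps)
  hence "lam*(4*(R + 60))<lam*(Kl\<^sup>2*lam^m0)" by simp
  moreover have "2*(4*(R + 60))<=lam*(4*(R + 60))" using lam_bounds R(1) by (intro mult_right_mono) auto
  ultimately show False by (simp add:algebra_simps)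
 qed
 have pn: "(fi^^n) p:Lm" using p Lm_fm(2) by (induction n) auto
 define c where "c = (g n x - fst v,y/lam^n - snd v)"
 have pc: "(fi^^n) p = c + v" by (simp add:c_def pxy fg prod_eq_iff)
 hence cL: "c:Lm" using pn Lm_add[OF v(1)] by simp
 have "lam/lam^m<=1" by (simp add:m_def)
 hence n1: "nrm u<1" "nrm u'<1" using nu by linarith+
 have uu: "abs(fst u)<=nrm u" "abs(fst u')<=nrm u'" "abs(snd u)<=nrm u" by (auto simp:nrm_def)
 have sc: "snd c = snd u" using G by (simp add:c_def)
 hence sm: "abs(snd c)<1" using uu n1 by simp
 have off: "lam<=abs(fst c - src l)" if "l<3" for l
 proof (rule ccontr)
  assume "~ lam<=abs(fst c - src l)"
  hence "nrm (fst c - src l,snd c)<lam" using sm lam_bounds by (simp add:nrm_def)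
  from ZnI[OF Lat_0 that this] have "c:Zn lam" by (simp add:cs_def)
  thus False using Lm_off(2)[OF cL] by blast
 qed
 have b1: "src k<fst c" using order(1) G(3) vv off[OF v'(2)] n1 uu lam_bounds unfolding c_def by (simp add:abs_if split:if_splits)
 have b2: "fst c<src j" using order(2) G(1) off[OF v(2)] n1 uu lam_bounds unfolding c_def by (simp add:abs_if split:if_splits)
 obtain i where i: "i:{1,2}" "fst c = sad i"
  using src_between[OF b1 b2 v'(2) v(2), of "snd c"] off sm cL by force
 have "(fi^^n) p = v + (sad i,snd c)" using pc i(2) by (simp add:prod_eq_iff)
 hence "p:Vu i" using v(1) sm unfolding Vu_def by blast
 thus False using no N(2) i(1) by blast
qed

end

text \<open>For a saturated set closures can be computed upstairs, because \<open>q\<close> is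
  continuous and open.\<close>

lemma (in smooth_cover) closure_Q:
 assumes B: "B<=Y" "!!a b. a:B ==> b:Y ==> q a = q b ==> b:B" and b: "b:Y"
 shows "q b:X closure_of (q ` B) <-> b:closure B"
proof
 assume cl: "q b:X closure_of (q ` B)"
 show "b:closure B"
 proof (rule ccontr)
  assume n: "b~:closure B"
  let ?V = "Y Int - closure B"
  have "openin X (q ` ?V)" by (rule open_q) (auto intro:Y_open)
  moreover have "q b:q ` ?V" using b n by blast
  ultimately obtain x where "x:q ` B" "x:q ` ?V" using cl unfolding in_closure_of by meson
  then obtain a v where "a:B" "v:Y" "v~:closure B" "q a = q v" by auto
  thus False using B(2) closure_subset by blast
 qed
next
 assume cl: "b:closure B"
 show "q b:X closure_of (q ` B)" unfolding in_closure_of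
 proof (intro conjI allI impI)
  show "q b:topspace X" using q_onto b by blast
  fix T assume T: "q b:T & openin X T"
  hence "open (Y Int q -` T)" "b:Y Int q -` T" using preimage_open b by auto
  then obtain a where "a:B" "a:Y Int q -` T" using cl by (metis closure_iff_nhds_not_empty disjoint_iff order_refl)
  thus "EX y. y:q ` B & y:T" by blast
 qed
qed

context da_map
begin

text \<open>Compactness gives a common time after which the whole segment has left the sources; from
  then on \<open>contract_step\<close> applies to all of it.\<close>

lemma stable_segment:
 assumes x: "x<=x'" and free: "!!w. x<=w ==> w<=x' ==> (w,y):U"
 shows "(%n. fst ((fm^^n) (x',y)) - fst ((fm^^n) (x,y))) ----> 0"
proof -
 have "EX n. (fm^^n) (w,y)~:Zn lam" if "x<=w" "w<=x'" for w
  using exit_Zn[OF free[OF that]] by blast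
 then obtain k where k: "!!w. x<=w ==> w<=x' ==> (fm^^k w) (w,y)~:Zn lam" by metis
 define O' where "O' w = {t. dist ((fm^^k w) (t,y)) ((fm^^k w) (w,y))<1/2}" for w
 have op: "open (O' w)" for w
 proof -
  have "continuous_on UNIV (%t. (t,y))" by (intro continuous_intros)
  hence "continuous_on UNIV (%t. (fm^^k w) (t,y))" by (rule continuous_on_compose2[OF continuous_pow(1)[of UNIV]]) simp
  thus ?thesis unfolding O'_def by (intro open_Collect_less continuous_on_dist continuous_on_const)
 qed
 have cov: "{x..x'}<=(UN w:{x..x'}. O' w)" by (intro subsetI UN_I, assumption) (simp add:O'_def)
 obtain S where S: "S<={x..x'}" "finite S" "{x..x'}<=(UN w:S. O' w)"
  by (rule compactE_image[OF compact_Icc op cov])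
 define N where "N = Suc (Max (insert 0 (k ` S)))"
 have off: "(fm^^(N + n)) (w,y)~:Zn lam" if w: "x<=w" "w<=x'" for w n
 proof -
  obtain s where s: "s:S" "w:O' s" 
  proof -
   have "w:{x..x'}" using w by simp
   hence "w:(UN w:S. O' w)" using S(3) by auto
   thus ?thesis using that by auto
  qed
  let ?p = "(fm^^k s) (w,y)" and ?s = "(fm^^k s) (s,y)"
  have "?p~:Zn 1"
  proof
   assume "?p:Zn 1"
   then obtain v j u where u: "v:Lat" "j<3" "nrm u<1" "?p = v + cs j + u" by (rule ZnE)
   have d: "norm (?s - ?p)<1/2" using s(2) by (simp add:O'_def dist_norm norm_minus_commute)
   have "abs(fst (?s - ?p))<1/2" "abs(snd (?s - ?p))<1/2"
    using d norm_fst_le[of "fst (?s - ?p)" "snd (?s - ?p)"] unfolding prod.collapse by auto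
   hence "nrm (u + (?s - ?p))<lam" using u(3) lam_bounds unfolding nrm_def fst_add snd_add by linarith
   hence "?s:Zn lam" using ZnI[OF u(1,2), of "u + (?s - ?p)" lam] u(4) by simp
   thus False using k[of s] s(1) S(1) by auto
  qed
  hence 1: "fm ?p~:Zn lam" using Zn_fi[of "fm ?p"] by auto
  have "k s<=Max (insert 0 (k ` S))" using S(2) s(1) by simp
  then obtain m where m: "N + n = m + Suc (k s)" unfolding N_def by (metis add.commute add_Suc_right le_Suc_ex add.assoc)
  have "(fm^^(N + n)) (w,y) = (fm^^m) (fm ?p)" unfolding m by (simp only:funpow_add o_apply funpow.simps)
  thus ?thesis using fm_pow_off[OF 1] by simp
 qed
 define D where "D n = fst ((fm^^n) (x',y)) - fst ((fm^^n) (x,y))" for n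
 have fm_pair: "(fm^^n) (w,y) = (fst ((fm^^n) (w,y)),lam^n*y)" for n w by (simp add:prod_eq_iff)
 have Dpos: "0<=D n" for n using fm_pow_mono_iff[of n x' y x] x unfolding D_def by linarith
 have step: "D (Suc (N + n))<=D (N + n)/lam" for n
 proof -
  have e: "fst ((fm^^Suc (N + n)) (w,y)) = fst (fm (fst ((fm^^(N + n)) (w,y)),lam^(N + n)*y))" for w
   using fm_pair[of "N + n" w] by simp
  show ?thesis unfolding D_def e
  proof (rule contract_step)
   show "fst ((fm^^(N + n)) (x,y))<=fst ((fm^^(N + n)) (x',y))" using Dpos[of "N + n"] by (simp add:D_def)
   fix w assume w: "fst ((fm^^(N + n)) (x,y))<=w" "w<=fst ((fm^^(N + n)) (x',y))"
   show "(w,lam^(N + n)*y)~:Zn lam" by (rule between_fm[OF w]) (metis off)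
  qed
 qed
 have bound: "D (N + n)<=D N*(1/lam)^n" for n
 proof (induction n)
  case (Suc n)
  have "D (N + n)/lam<=D N*(1/lam)^n/lam" using Suc by (intro divide_right_mono) auto
  thus ?case using step[of n] by simp
 qed simp
 have "(%n. D N*(1/lam)^n) ----> D N*0" by (intro tendsto_intros) auto
 hence "(%n. D (N + n)) ----> 0"
  by (intro tendsto_sandwich[of "%_. 0" "%n. D (N + n)" sequentially "%n. D N*(1/lam)^n"]) (use Dpos bound in auto)
 hence "(%n. D (n + N)) ----> 0" by (simp add:add.commute)
 thus ?thesis unfolding D_def by (rule LIMSEQ_offset)
qed

text \<open>Lying on one orbit of the torus map induced by \<open>fm\<close>, expressed in the
  plane.\<close>

definition rp :: "real*real => real*real => bool" where
 "rp p p' <-> (EX n m. EX v:Lat. (fi^^n) p = (fi^^m) p' + v)"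

lemma countable_Lat: "countable Lat"
proof -
 have "Lat = (%(a,b). (Kl*(of_int a + of_int b/lam),Kl*(of_int a + of_int b*lam))) ` (UNIV :: (int \<times> int) set)"
  unfolding Lat_def by auto
 thus ?thesis by simp
qed

text \<open>These continuous injections of the plane enumerate an \<open>rp\<close> class and move
  its points around, which makes the class homogeneous.\<close>

definition hh :: "nat => nat => real*real => real*real => real*real" where
 "hh n m v p = (fm^^m) ((fi^^n) p - v)"

lemma rp_hh: "rp p p' <-> (EX n m. EX v:Lat. p' = hh n m v p)"
proof -
 have "(fi^^n) p = (fi^^m) p' + v <-> p' = hh n m v p" for n m v
  unfolding hh_def by auto
 thus ?thesis by (simp add:rp_def)
qed

lemma hh_inj: "hh n m v p = hh n m v p' ==> p = p'"
 unfolding hh_def by (metis diff_add_cancel fi_pow_fm_pow)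

lemma continuous_hh: "continuous_on UNIV (hh n m v)"
 unfolding hh_def[abs_def] by (intro continuous_on_compose2[OF continuous_pow(1)[of UNIV]] continuous_intros continuous_pow(2)) auto

text \<open>A nonempty countable closed set has an isolated point, by Baire; through the maps
  \<open>hh\<close> then every point of the class is isolated. So the class meets a compact
  fundamental box in finitely many points, and two forward images of \<open>p\<close> agree modulo
  the lattice. The assumptions \<open>tr\<close> and \<open>sy\<close> are established afterwards by
  means of \<open>rel0\<close>.\<close>

lemma periodic_of_closed:
 assumes tr: "!!a b c. rp a b ==> rp b c ==> rp a c" and sy: "!!a b. rp a b ==> rp b a"
  and cl: "closed {p'. rp p p'}"
 shows "EX k>0. EX v:Lat. (fm^^k) p = p + v"
proof -
 let ?A = "{p'. rp p p'}"
 have "?A = (%(n,m,v). hh n m v p) ` (UNIV \<times> UNIV \<times> Lat)" unfolding rp_hh by force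
 hence cA: "countable ?A" by (simp add:countable_Lat)
 have "rp p p" unfolding rp_def by (intro exI[of _ 0]) auto
 have "EX a:?A. ~ a islimpt ?A"
 proof (rule ccontr)
  assume n: "~ ?thesis"
  have "?A<=closure (\<Inter> ((%a. ?A - {a}) ` ?A))"
  proof (rule Baire[OF cl])
   show "countable ((%a. ?A - {a}) ` ?A)" using cA by simp
   fix T assume "T:(%a. ?A - {a}) ` ?A"
   then obtain a where a: "a:?A" "T = ?A - {a}" by blast
   have "openin (top_of_set ?A) (?A Int - {a})" by auto
   moreover have "b:closure (?A - {a})" if b: "b:?A" for b
   proof (cases "b = a")
    case True
    hence "b islimpt ?A" using n b by blast
    thus ?thesis using True by (simp add:islimpt_in_closure)
   next
    case False
    hence "b:?A - {a}" using b by blast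
    thus ?thesis by (rule subsetD[OF closure_subset])
   qed
   hence "?A<=closure (?A - {a})" by blast
   moreover note this
   ultimately show "openin (top_of_set ?A) T & ?A<=closure T" by (simp add:a(2) Diff_eq)
  qed
  also have "\<Inter> ((%a. ?A - {a}) ` ?A) = {}" using `rp p p` by blast
  finally have "?A = {}" by simp
  thus False using `rp p p` by blast
 qed
 then obtain a where a: "rp p a" "~ a islimpt ?A" by blast
 have iso: "~ b islimpt ?A" if b: "rp p b" for b
 proof
  assume lim: "b islimpt ?A"
  obtain n m v where h: "v:Lat" "a = hh n m v b" using tr[OF sy[OF b] a(1)] rp_hh by blast
  obtain N where N: "open N" "a:N" "!!c. c:?A ==> c:N ==> c = a" using a(2) unfolding islimpt_def by blast
  have "open (hh n m v -` N)" using continuous_hh N(1) by (simp add:open_vimage)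
  then obtain c where c: "c:?A" "c:hh n m v -` N" "c~=b" using lim h N(2) unfolding islimpt_def by (metis vimageI2)
  have "rp c (hh n m v c)" using h(1) rp_hh by blast
  hence "hh n m v c = a" using N(3) c tr by blast
  thus False using hh_inj h(2) c(3) by metis
 qed
 have "EX v. v:Lat & (fm^^n) p - v:cbox (0,0) (2*Kl,4*Kl)" for n using Lat_cover by blast
 then obtain v where v: "!!n. v n:Lat" "!!n. (fm^^n) p - v n:cbox (0,0) (2*Kl,4*Kl)" by metis
 define c where "c n = (fm^^n) p - v n" for n
 have cA: "c n:?A" for n
 proof -
  have "(fi^^n) (c n + v n) = p" by (simp add:c_def)
  moreover obtain w where "w:Lat" "(fi^^n) (c n + v n) = (fi^^n) (c n) + w" using fi_pow_add[OF v(1)] by blast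
  ultimately show ?thesis unfolding rp_def by (intro CollectI exI[of _ 0] exI[of _ n]) auto
 qed
 have "~ inj c"
 proof
  assume "inj c"
  hence "infinite (range c)" by (simp add:finite_image_iff)
  moreover have "range c<=?A Int cbox (0,0) (2*Kl,4*Kl)" using cA v(2) unfolding c_def by blast
  moreover have "compact (?A Int cbox (0,0) (2*Kl,4*Kl))" using cl by auto
  ultimately obtain l where "l:?A" "l islimpt range c" unfolding compact_eq_Bolzano_Weierstrass by blast
  hence "l islimpt ?A" using islimpt_subset cA by blast
  thus False using iso `l:?A` by blast
 qed
 then obtain n m where nm: "n<m" "c n = c m" unfolding inj_def by (metis linorder_neqE_nat)
 have "(fm^^m) p = c n + v m" using nm(2) by (simp add:c_def)
 hence "(fm^^m) p = (fm^^n) p + (v m - v n)" by (simp add:c_def)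
 hence "(fi^^n) ((fm^^m) p) = (fi^^n) ((fm^^n) p + (v m - v n))" by simp
 moreover have "(fi^^n) ((fm^^m) p) = (fm^^(m - n)) p"
 proof -
  have "(fm^^m) p = (fm^^n) ((fm^^(m - n)) p)" using nm(1) funpow_add[of n "m - n" fm] by simp
  thus ?thesis by simp
 qed
 moreover obtain w where "w:Lat" "(fi^^n) ((fm^^n) p + (v m - v n)) = (fi^^n) ((fm^^n) p) + w"
  using fi_pow_add[OF Lat_diff[OF v(1) v(1)]] by blast
 ultimately show ?thesis using nm(1) by (intro exI[of _ "m - n"]) auto
qed

text \<open>Consequently all sources on one horizontal line belong to a single lattice
  translate.\<close>

lemma Lat_snd_inj: "v:Lat ==> w:Lat ==> snd v = snd w ==> v = w"
 using Lat_big[of "v - w"] Lat_diff[of v w] Kl_pos by auto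

definition strip :: "nat => (real*real) set" where
 "strip i = {p. src (i - 1)<fst p & fst p<src i & abs(snd p)<1}"

text \<open>The stable leaf of the \<open>i\<close>-th saddle: its trace on the axis is the open
  segment between the two adjacent sources.\<close>

definition Ax :: "nat => (real*real) set" where
 "Ax i = {p. EX t. src (i - 1)<t & t<src i & rp p (t,0)}"

lemma open_strip: "open (strip i)"
 unfolding strip_def by (intro open_Collect_conj open_Collect_less continuous_intros)

lemma idx: assumes "i:{1,2}"
 shows "i<3" "i - 1<3" "Suc (i - 1) = i" "src (i - 1)<sad i" "sad i<src i" "abs(src i)<24" "abs(src (i - 1))<24"
  "sad 0<=sad i" "sad i<=sad 3"
proof -
 show i: "i<3" "i - 1<3" "Suc (i - 1) = i" using assms by auto
 show "src (i - 1)<sad i" "sad i<src i" using src_ends[OF i(1)] src_ends[OF i(2)] unfolding i(3) by auto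
 show "abs(src i)<24" "abs(src (i - 1))<24" using src_bounds(1) i by auto
 show "sad 0<=sad i" "sad i<=sad 3" using sad_bounds(3,4)[of i] i by auto
qed

lemma abs_div_pow: "abs(y/lam^n)<=abs y"
proof -
 have "abs y/lam^n<=abs y/1" by (intro divide_left_mono) auto
 thus ?thesis by simp
qed

lemma sad_strip: "i:{1,2} ==> abs t<1 ==> (sad i,t):strip i" using idx[of i] by (simp add:strip_def)

lemma fi_sad: "i:{1,2} ==> abs t<=1 ==> (fi^^n) (sad i,t) = (sad i,t/lam^n)"
proof (induction n)
 case (Suc n)
 have "abs(t/lam^n)<=lam" using Suc.prems lam_bounds abs_div_pow[of t n] by linarith
 moreover have "Pi' (sad i) = sad i" using Pi'_in[of "sad i"] idx(8,9)[OF Suc.prems(1)] P_sad[of i] P_inj[of "Pi' (sad i)" "sad i"] idx(1)[OF Suc.prems(1)] by simp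
 ultimately show ?case using Suc fi_strip[of "t/lam^n" "sad i"] idx(8,9)[OF Suc.prems(1)] by simp
qed simp

lemma fi_strip_pow:
 assumes i: "i:{1,2}" and p: "p:strip i"
 shows "(fi^^n) p:strip i & abs(fst p - sad i)<=abs(fst ((fi^^n) p) - sad i)"
proof -
 obtain x y where pxy: "p = (x,y)" by (cases p)
 have xy: "src (i - 1)<x" "x<src i" "abs y<=1" "abs y<1" using p by (auto simp:strip_def pxy)
 note ii = idx[OF i]
 have y: "abs(y/lam^n)<1" using xy(4) abs_div_pow[of y n] by linarith
 consider "x = sad i" | "x<sad i" | "sad i<x" by linarith
 thus ?thesis
 proof cases
  case 1 thus ?thesis using fi_sad[OF i xy(3), of n] y ii by (simp add:pxy strip_def)
 next
  case 2
  have "src (i - 1)<fst ((fi^^n) (x,y)) & fst ((fi^^n) (x,y))<=x" by (rule strip_right(1)[OF ii(2)]) (use xy 2 ii in auto)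
  thus ?thesis using y 2 ii by (auto simp:pxy strip_def)
 next
  case 3
  have "x<=fst ((fi^^n) (x,y)) & fst ((fi^^n) (x,y))<src i" by (rule strip_left(1)[OF ii(1)]) (use xy 3 in auto)
  thus ?thesis using y 3 ii by (auto simp:pxy strip_def)
 qed
qed

lemma strip_unique: "i:{1,2} ==> v:Lat ==> p:strip i ==> p + v:strip i ==> v = 0"
 using idx(6,7)[of i] X0 by (intro Lat_small) (auto simp:strip_def)

lemma strip_U: "i:{1,2} ==> p:strip i ==> p:U"
proof (unfold U_def, rule ComplI)
 assume i: "i:{1,2}" "p:strip i" "p:cen"
 obtain v j where v: "v:Lat" "j<3" "p = v + cs j" using cenE[OF i(3)] .
 have "abs(fst v)<=2*(X0 + 1)" "abs(snd v)<=6" using v(3) i(2) idx(6,7)[OF i(1)] src_bounds(1)[OF v(2)] X0 by (auto simp:strip_def cs_def)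
 hence "v = 0" by (rule Lat_small[OF v(1)])
 hence s: "src (i - 1)<src j" "src j<src i" using v(3) i(2) by (auto simp:strip_def cs_def)
 have "0<gap" using gap_bounds by simp
 hence "real (i - 1)<real j" "real j<real i" using s by (simp_all add:src_def)
 thus False by auto
qed

lemma rp_cases0: "rp p p' ==> (EX k. EX v:Lat. p' = (fi^^k) p + v) | (EX k. EX v:Lat. p = (fi^^k) p' + v)"
proof -
 assume "rp p p'"
 then obtain n m v where a: "v:Lat" "(fi^^n) p = (fi^^m) p' + v" by (auto simp:rp_def)
 have *: "EX k. EX v:Lat. p' = (fi^^k) p + v" if th: "m<=n" "v:Lat" "(fi^^n) p = (fi^^m) p' + v" for n m v p p'
 proof -
  have "(fi^^n) p = (fi^^m) ((fi^^(n - m)) p)" using th(1) by (metis funpow_add le_add_diff_inverse o_apply)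
  hence "(fi^^m) p' = (fi^^m) ((fi^^(n - m)) p) + (- v)" using th(3) by (simp add:algebra_simps)
  hence "p' = (fm^^m) ((fi^^m) ((fi^^(n - m)) p) + (- v))" by (metis fi_pow_fm_pow(2))
  moreover obtain w where "w:Lat" "(fm^^m) ((fi^^m) ((fi^^(n - m)) p) + (- v)) = (fm^^m) ((fi^^m) ((fi^^(n - m)) p)) + w"
   using fm_pow_add[OF Lat_uminus[OF th(2)]] by blast
  ultimately show ?thesis by auto
 qed
 show ?thesis
 proof (cases "m<=n")
  case True thus ?thesis using *[OF True a] by blast
 next
  case False
  have "(fi^^m) p' = (fi^^n) p + (- v)" using a(2) by simp
  thus ?thesis using *[OF _ Lat_uminus[OF a(1)], of n m p' p] False by auto
 qed
qed

text \<open>Of two points of one orbit in the strip the lower one is the later one under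
  \<open>fi\<close>, and \<open>fi\<close> pushes away from the vertical line of the saddle.\<close>

lemma strip_away:
 assumes i: "i:{1,2}" and p: "p:strip i" "p':strip i" "rp p p'" and s: "abs(snd p')<abs(snd p)"
 shows "abs(fst p - sad i)<=abs(fst p' - sad i)"
 using rp_cases0[OF p(3)]
proof
 assume "EX k. EX v:Lat. p' = (fi^^k) p + v"
 then obtain k v where v: "v:Lat" "p' = (fi^^k) p + v" by blast
 note f = fi_strip_pow[OF i p(1), of k]
 have "v = 0" using strip_unique[OF i v(1) conjunct1[OF f]] v(2) p(2) by simp
 thus ?thesis using f v(2) by simp
next
 assume "EX k. EX v:Lat. p = (fi^^k) p' + v"
 then obtain k v where v: "v:Lat" "p = (fi^^k) p' + v" by blast
 note f = fi_strip_pow[OF i p(2), of k]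
 have "v = 0" using strip_unique[OF i v(1) conjunct1[OF f]] v(2) p(1) by simp
 hence "abs(snd p) = abs(snd p')/lam^k" using v(2) by simp
 also have "... <= abs(snd p')/1" by (intro divide_left_mono) auto
 finally show ?thesis using s by simp
qed

end

section \<open>Invariants of orbit equivalence\<close>

text \<open>For the flows at hand, \<open>iso_pt\<close> singles out the orbits of the saddles, and \<open>Zset\<close> is the union
  of the two leaves through such an orbit. The predicate \<open>opposite\<close> says that two components of \<open>Sset\<close>
  meet at two saddle orbits, and at the first one only along that orbit.\<close>

definition Zset :: "'a topology => (real => 'a => 'a) => 'a => 'a set" where
 "Zset X ph x = {y:topspace X. x:X closure_of (flow_orbit ph y)}"

definition iso_pt :: "'a topology => (real => 'a => 'a) => 'a => bool" where
 "iso_pt X ph x <-> x:topspace X & X closure_of (flow_orbit ph x) = flow_orbit ph x & X closure_of (Zset X ph x)~=topspace X"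

definition Sset :: "'a topology => (real => 'a => 'a) => 'a set" where
 "Sset X ph = topspace X - X closure_of (\<Union> (Zset X ph ` {x. iso_pt X ph x}))"

definition cmp :: "'a topology => (real => 'a => 'a) => 'a => 'a set" where
 "cmp X ph y = {y'. EX C. connectedin X C & C<=Sset X ph & y:C & y':C}"

definition opposite :: "'a topology => (real => 'a => 'a) => bool" where
 "opposite X ph <-> (EX x x' y y'. iso_pt X ph x & iso_pt X ph x' & x'~:flow_orbit ph x & y:Sset X ph & y':Sset X ph &
   y'~:cmp X ph y & {x,x'}<=X closure_of (cmp X ph y) Int X closure_of (cmp X ph y') &
   X closure_of (cmp X ph y) Int X closure_of (cmp X ph y') Int Zset X ph x<=flow_orbit ph x)"

text \<open>All ingredients are built from orbits as sets, closures and connectedness, so a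
  homeomorphism transports them whether or not it respects the orientation of orbits.\<close>

lemma opposite_invariant:
 assumes "orbit_equivalent X ph ps" and orb: "!!x. x:topspace X ==> flow_orbit ph x<=topspace X" and op: "opposite X ph"
 shows "opposite X ps"
proof -
 obtain h where h: "homeomorphic_map X X h" "!!p. p:topspace X ==> h ` flow_orbit ph p = flow_orbit ps (h p)"
  using assms(1) unfolding orbit_equivalent_def by blast
 have inj: "inj_on h (topspace X)" and im: "h ` topspace X = topspace X"
  using h(1) by (auto simp:homeomorphic_imp_injective_map homeomorphic_imp_surjective_map)
 have cl: "X closure_of (h ` S) = h ` (X closure_of S)" if "S<=topspace X" for S
  using homeomorphic_map_closure_of[OF h(1) that] by simp
 have in_cl: "h x:X closure_of (h ` S) <-> x:X closure_of S" if "S<=topspace X" "x:topspace X" for S x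
  unfolding cl[OF that(1)] using inj_on_image_mem_iff[OF inj that(2) closure_of_subset_topspace] .
 have Z: "Zset X ps (h x) = h ` Zset X ph x" if x: "x:topspace X" for x
 proof -
  have *: "y:Zset X ph x <-> h y:Zset X ps (h x)" if "y:topspace X" for y
   using in_cl[OF orb[OF that] x] h(2)[OF that] that im unfolding Zset_def by auto
  show ?thesis
  proof (intro equalityI subsetI)
   fix w assume w: "w:Zset X ps (h x)"
   hence "w:h ` topspace X" unfolding im by (simp add:Zset_def)
   thus "w:h ` Zset X ph x" using * w by blast
  next
   fix w assume "w:h ` Zset X ph x"
   then obtain y where "w = h y" "y:Zset X ph x" by blast
   moreover hence "y:topspace X" by (simp add:Zset_def)
   ultimately show "w:Zset X ps (h x)" using * by blast
  qed
 qed
 have iso: "iso_pt X ps (h x) <-> iso_pt X ph x" if x: "x:topspace X" for x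
 proof -
  have "Zset X ph x<=topspace X" by (auto simp:Zset_def)
  note c = cl[OF this] cl[OF orb[OF x]]
  have e: "h ` A = h ` B <-> A = B" if "A<=topspace X" "B<=topspace X" for A B
   using inj_on_image_eq_iff[OF inj that] .
  have "h ` (X closure_of (Zset X ph x)) = topspace X <-> X closure_of (Zset X ph x) = topspace X"
   using e[of "X closure_of (Zset X ph x)" "topspace X", OF closure_of_subset_topspace order_refl] im by simp
  moreover have "h ` (X closure_of (flow_orbit ph x)) = h ` flow_orbit ph x <-> X closure_of (flow_orbit ph x) = flow_orbit ph x"
   by (rule e[OF closure_of_subset_topspace orb[OF x]])
  moreover have "h x:topspace X" using im x by blast
  ultimately show ?thesis unfolding iso_pt_def Z[OF x] h(2)[OF x, symmetric] c using x by simp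
 qed
 have "\<Union> (Zset X ps ` {x. iso_pt X ps x}) = h ` \<Union> (Zset X ph ` {x. iso_pt X ph x})"
 proof -
  have "{x. iso_pt X ps x} = h ` {x. iso_pt X ph x}"
  proof (intro equalityI subsetI)
   fix y assume "y:{x. iso_pt X ps x}"
   moreover then obtain x where "x:topspace X" "y = h x" using im by (auto simp:iso_pt_def)
   ultimately show "y:h ` {x. iso_pt X ph x}" using iso by blast
  next
   fix y assume "y:h ` {x. iso_pt X ph x}"
   then obtain x where "iso_pt X ph x" "y = h x" by blast
   moreover hence "x:topspace X" by (simp add:iso_pt_def)
   ultimately show "y:{x. iso_pt X ps x}" using iso by simp
  qed
  moreover have "Zset X ps (h x) = h ` Zset X ph x" if "iso_pt X ph x" for x using Z that by (simp add:iso_pt_def)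
  ultimately show ?thesis by auto
 qed
 moreover have sub: "\<Union> (Zset X ph ` {x. iso_pt X ph x})<=topspace X" by (auto simp:Zset_def)
 ultimately have S: "Sset X ps = h ` Sset X ph"
  unfolding Sset_def using cl[OF sub] inj_on_image_set_diff[OF inj Diff_subset closure_of_subset_topspace] im by simp
 have Ssub: "Sset X ph<=topspace X" by (auto simp:Sset_def)
 have conn: "connectedin X C <-> connectedin X (h ` C)" if "C<=topspace X" for C
  using homeomorphic_map_connectedness[OF h(1) that] by simp
 have cm: "cmp X ps (h y) = h ` cmp X ph y" if y: "y:topspace X" for y
 proof (intro equalityI subsetI)
  fix w assume "w:cmp X ps (h y)"
  then obtain C where C: "connectedin X C" "C<=h ` Sset X ph" "h y:C" "w:C" by (auto simp:cmp_def S)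
  then obtain B where B: "B<=Sset X ph" "C = h ` B" by (meson subset_image_iff)
  have "y:B" using C(3) B inj_on_image_mem_iff[OF inj y] Ssub by blast
  moreover obtain b where "b:B" "w = h b" using C B by blast
  ultimately show "w:h ` cmp X ph y" using C B conn[of B] Ssub unfolding cmp_def by blast
 next
  fix w assume "w:h ` cmp X ph y"
  then obtain b C where "w = h b" "connectedin X C" "C<=Sset X ph" "y:C" "b:C" by (auto simp:cmp_def)
  thus "w:cmp X ps (h y)" using conn[of C] Ssub unfolding cmp_def S by blast
 qed
 obtain x x' y y' where o: "iso_pt X ph x" "iso_pt X ph x'" "x'~:flow_orbit ph x" "y:Sset X ph" "y':Sset X ph"
   "y'~:cmp X ph y" "{x,x'}<=X closure_of (cmp X ph y) Int X closure_of (cmp X ph y')"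
   "X closure_of (cmp X ph y) Int X closure_of (cmp X ph y') Int Zset X ph x<=flow_orbit ph x"
  using op unfolding opposite_def by blast
 have t: "x:topspace X" "x':topspace X" "y:topspace X" "y':topspace X" using o Ssub by (auto simp:iso_pt_def)
 have cs: "cmp X ph y<=topspace X" for y using Ssub by (auto simp:cmp_def)
 have mem: "h a:h ` A <-> a:A" if "a:topspace X" "A<=topspace X" for a A by (rule inj_on_image_mem_iff[OF inj that])
 note cc = cl[OF cs]
 have Zs: "Zset X ph x<=topspace X" by (auto simp:Zset_def)
 have "h ` (X closure_of (cmp X ph y)) Int h ` (X closure_of (cmp X ph y')) Int h ` Zset X ph x
  = h ` (X closure_of (cmp X ph y) Int X closure_of (cmp X ph y') Int Zset X ph x)"
 proof -
  have "X closure_of (cmp X ph y) Int X closure_of (cmp X ph y')<=topspace X" using closure_of_subset_topspace[of X] by blast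
  thus ?thesis
   using inj_on_image_Int[OF inj closure_of_subset_topspace closure_of_subset_topspace, of "cmp X ph y" "cmp X ph y'"] inj_on_image_Int[OF inj _ Zs, of "X closure_of (cmp X ph y) Int X closure_of (cmp X ph y')"] by simp
 qed
 hence "h ` (X closure_of (cmp X ph y)) Int h ` (X closure_of (cmp X ph y')) Int h ` Zset X ph x<=h ` flow_orbit ph x"
  using o(8) by auto
 moreover have "h x'~:h ` flow_orbit ph x" using mem[OF t(2) orb[OF t(1)]] o(3) by simp
 moreover have "h y'~:h ` cmp X ph y" using mem[OF t(4) cs] o(6) by simp
 moreover have "{h x,h x'}<=h ` (X closure_of (cmp X ph y)) Int h ` (X closure_of (cmp X ph y'))" using o(7) by blast
 moreover have "iso_pt X ps (h x)" "iso_pt X ps (h x')" using iso t o by simp_all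
 moreover have "h y:h ` Sset X ph" "h y':h ` Sset X ph" using o by blast+
 ultimately show ?thesis unfolding opposite_def S[symmetric] cc[symmetric] cm[OF t(3), symmetric] cm[OF t(4), symmetric] Z[OF t(1), symmetric] h(2)[OF t(1)] by blast
qed

context glued
begin

lemma rp_rel0: "rp p p' ==> EX c>0. ALL z. rel0 (p,z) (p',c*z)"
proof -
 assume "rp p p'"
 then obtain n m v where a: "v:Lat" "(fi^^n) p = (fi^^m) p' + v" by (auto simp:rp_def)
 have "(FI^^n) (p,z) = TT v ((FI^^m) (p',lam^n/lam^m*z))" for z using a by (simp add:FI_pow TT_def)
 thus ?thesis using a(1) unfolding rel0_def by (intro exI[of _ "lam^n/lam^m"]) auto
qed

lemma rel0_rp: "rel0 a b ==> rp (fst a) (fst b)"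
 unfolding rel0_def rp_def by (auto simp:FI_pow TT_def)

lemma rp_refl: "rp p p" using rel0_rp[OF rel0_refl, of "(p,1)"] by simp

lemma rp_sym: "rp p p' ==> rp p' p"
 using rp_rel0[of p p'] rel0_rp[OF rel0_sym] by fastforce

lemma rp_trans: "rp p p' ==> rp p' p'' ==> rp p p''"
proof -
 assume "rp p p'" "rp p' p''"
 then obtain c c' where "!!z. rel0 (p,z) (p',c*z)" "!!z. rel0 (p',z) (p'',c'*z)" using rp_rel0 by meson
 hence "rel0 (p,1) (p'',c'*(c*1))" using rel0_trans by blast
 thus ?thesis using rel0_rp by fastforce
qed

lemma rp_gen: "rp p ((fi^^n) p)" "rp p ((fm^^n) p)" "v:Lat ==> rp p (p + v)"
 using rel0_rp[OF rel0_FI(1), of "(p,1)" n] rel0_rp[OF rel0_FI(2), of "(p,1)" n] rel0_rp[OF rel0_FI(4), of v "(p,1)"] by (simp_all add:FI_pow FF_pow TT_def)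

lemma rp_Lm: "rp p p' ==> p:Lm <-> p':Lm"
proof -
 have n: "(fi^^k) p:Lm <-> p:Lm" for k p by (induction k) (auto simp:Lm_fm)
 assume "rp p p'"
 thus ?thesis using rp_cases0[of p p'] n Lm_add by metis
qed

lemma rp_U: "rp p p' ==> p:U <-> p':U"
 using rp_cases0[of p p'] fm_pow_U(2) U_add by metis

lemma Vu_rp: "i:{1,2} ==> p:Vu i <-> (EX t. abs t<1 & rp p (sad i,t))"
proof
 assume i: "i:{1,2}"
 { assume "p:Vu i"
  then obtain n v t where v: "v:Lat" "abs t<1" "(fi^^n) p = v + (sad i,t)" by (auto simp:Vu_def)
  hence "rp p (sad i,t)" unfolding rp_def by (intro exI[of _ n] exI[of _ 0]) auto
  thus "EX t. abs t<1 & rp p (sad i,t)" using v by blast }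
 { assume "EX t. abs t<1 & rp p (sad i,t)"
  then obtain t n m v where v: "abs t<1" "v:Lat" "(fi^^n) p = (fi^^m) (sad i,t) + v" by (auto simp:rp_def)
  hence "(fi^^n) p = v + (sad i,t/lam^m)" using fi_sad[OF i] by simp
  moreover have "abs(t/lam^m)<1" using abs_div_pow[of t m] v by linarith
  ultimately show "p:Vu i" using v(2) unfolding Vu_def by blast }
qed

text \<open>An orbit accumulating at the saddle visits the strip, say in \<open>p0\<close>. If
  \<open>p0\<close> were on neither leaf, every lower visit would be at least as far from the
  vertical line by \<open>strip_away\<close>, contradicting accumulation.\<close>

lemma zs1:
 assumes i: "i:{1,2}" and cl: "(sad i,0):closure {p'. rp p p'}" shows "p:Vu i Un Ax i"
proof -
 have meets: "EX p':N. rp p p'" if "open N" "(sad i,0):N" for N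
  using cl that by (auto simp:closure_iff_nhds_not_empty)
 obtain p0 where p0: "p0:strip i" "rp p p0" using meets[OF open_strip sad_strip[OF i]] by auto
 consider "fst p0 = sad i" | "snd p0 = 0" | "fst p0~=sad i" "snd p0~=0" by blast
 thus ?thesis
 proof cases
  case 1
  hence "p0 = (sad i,snd p0)" "abs(snd p0)<1" using p0(1) by (auto simp:prod_eq_iff strip_def)
  hence "p:Vu i" using p0(2) Vu_rp[OF i, of p] by metis
  thus ?thesis ..
 next
  case 2
  hence "p0 = (fst p0,0)" by (simp add:prod_eq_iff)
  thus ?thesis using p0 unfolding Ax_def strip_def by auto
 next
  case 3
  let ?N = "strip i Int {p. abs(fst p - sad i)<abs(fst p0 - sad i)} Int {p. abs(snd p)<abs(snd p0)}"
  have "open ?N" by (intro open_Int open_strip open_Collect_less continuous_intros)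
  moreover have "(sad i,0):?N" using 3 sad_strip[OF i] by simp
  ultimately obtain p1 where p1: "p1:?N" "rp p p1" using meets by blast
  have "abs(fst p0 - sad i)<=abs(fst p1 - sad i)"
   by (rule strip_away[OF i p0(1)]) (use p1 rp_trans[OF rp_sym[OF p0(2)]] in auto)
  thus ?thesis using p1 by auto
 qed
qed

lemma closure_rpI: "[|!!n::nat. rp p (s n); s ----> l|] ==> l:closure {p'. rp p p'}"
 unfolding closure_sequential by auto

text \<open>Backward iterates converge to the saddle on the vertical leaf, forward iterates on the
  horizontal one, the latter by \<open>stable_segment\<close>.\<close>

lemma zs2:
 assumes i: "i:{1,2}" and p: "p:Vu i Un Ax i" shows "(sad i,0):closure {p'. rp p p'}"
 using p
proof
 assume "p:Vu i"
 then obtain t where t: "abs t<1" "rp p (sad i,t)" using Vu_rp[OF i] by blast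
 show ?thesis
 proof (rule closure_rpI)
  show "rp p ((fi^^n) (sad i,t))" for n using rp_trans[OF t(2) rp_gen(1)] .
  have "(%n. t*(1/lam)^n) ----> t*0" by (intro tendsto_intros) auto
  hence "(%n. t/lam^n) ----> 0" by (simp add:power_one_over)
  hence "(%n. (sad i,t/lam^n)) ----> (sad i,0)" by (intro tendsto_intros)
  thus "(%n. (fi^^n) (sad i,t)) ----> (sad i,0)" using fi_sad[OF i] t(1) by simp
 qed
next
 assume "p:Ax i"
 then obtain t where t: "src (i - 1)<t" "t<src i" "rp p (t,0)" by (auto simp:Ax_def)
 have U: "(w,0):U" if "src (i - 1)<w" "w<src i" for w
  using strip_U[OF i, of "(w,0)"] that by (simp add:strip_def)
 have fx: "(fm^^n) (sad i,0) = (sad i,0)" for n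
 proof -
  have "(fi^^n) (sad i,0) = (sad i,0)" using fi_sad[OF i, of 0 n] by simp
  thus ?thesis by (metis fi_pow_fm_pow(2))
 qed
 have "(%n. fst ((fm^^n) (t,0))) ----> sad i"
 proof (cases "t<=sad i")
  case True
  have "(%n. fst ((fm^^n) (sad i,0)) - fst ((fm^^n) (t,0))) ----> 0"
   by (rule stable_segment[OF True]) (use t idx(4,5)[OF i] in "auto intro!:U")
  from tendsto_diff[OF tendsto_const[of "sad i"] this] show ?thesis by (simp add:fx)
 next
  case False
  have "(%n. fst ((fm^^n) (t,0)) - fst ((fm^^n) (sad i,0))) ----> 0"
   by (rule stable_segment) (use False t idx(4,5)[OF i] in "auto intro!:U")
  from tendsto_add[OF this tendsto_const[of "sad i"]] show ?thesis by (simp add:fx)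
 qed
 hence "(%n. (fst ((fm^^n) (t,0)),0)) ----> (sad i,0)" by (intro tendsto_intros)
 moreover have e: "(fst ((fm^^n) (t,0)),0) = (fm^^n) (t,0)" for n by (simp add:prod_eq_iff)
 from `(%n. (fst ((fm^^n) (t,0)),0)) ----> (sad i,0)` have "(%n. (fm^^n) (t,0)) ----> (sad i,0)" by (subst (asm) e)
 thus ?thesis using rp_trans[OF t(3) rp_gen(2)] by (intro closure_rpI[of p "%n. (fm^^n) (t,0)"])
qed

definition orel :: "pt => pt => bool" where "orel a b <-> (EX t. rel (Ft t a) b)"

lemma orel_rel: "rel a b ==> orel a b" unfolding orel_def by (intro exI[of _ 0]) simp
lemma orel_sym: "orel a b ==> orel b a"
proof -
 assume "orel a b"
 then obtain t where "rel (Ft t a) b" by (auto simp:orel_def)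
 hence "rel (Ft (- t) (Ft t a)) (Ft (- t) b)" by (rule Ft_rel)
 moreover have "Ft (- t) (Ft t a) = a" by (simp flip:Ft_add)
 ultimately show ?thesis unfolding orel_def using rel_equiv(2) by metis
qed
lemma orel_trans: "orel a b ==> orel b c ==> orel a c"
 unfolding orel_def by (metis Ft_add Ft_rel rel_equiv(3))

lemma Ft_to: "snd a*z>0 ==> EX t. Ft t a = (fst a,z)"
proof -
 assume s: "snd a*z>0"
 hence p: "z/snd a>0" by (auto simp:zero_less_mult_iff zero_less_divide_iff)
 have "sgn (snd a) * sgn (snd a) = 1" using s by auto
 hence "Ft (sgn (snd a)*ln (z/snd a)) a = (fst a,z)" using p by (auto simp:Ft_def sgn_if)
 thus ?thesis by blast
qed

text \<open>A glueing changes the sign of the height, so between heights of equal sign only the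
  planar relation is left; the flow adjusts the height.\<close>

lemma orel_same: "snd a * snd b>0 ==> orel a b <-> rp (fst a) (fst b)"
proof
 assume s: "snd a * snd b>0"
 { assume "orel a b"
  then obtain t where t: "rel (Ft t a) b" by (auto simp:orel_def)
  have "~ relG (Ft t a) b" using relG_sign[OF relG_sym, of "Ft t a" b] s by (auto simp:Ft_def zero_less_mult_iff mult_less_0_iff)
  thus "rp (fst a) (fst b)" using t rel0_rp[of "Ft t a" b] by (simp add:rel_def) }
 { assume "rp (fst a) (fst b)"
  then obtain c where c: "c>0" "!!z. rel0 (fst a,z) (fst b,c*z)" using rp_rel0 by blast
  have "snd a*(snd b/c)>0" using s c(1) by simp
  then obtain t where "Ft t a = (fst a,snd b/c)" using Ft_to by blast
  moreover have "rel0 (fst a,snd b/c) b" using c(2)[of "snd b/c"] c(1) by simp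
  ultimately have "rel (Ft t a) b" by (simp add:rel_def)
  thus "orel a b" unfolding orel_def by blast }
qed

text \<open>Points outside \<open>Lm\<close> come near a source under \<open>fi\<close> and can then
  be read in the other piece through the glueing.\<close>

lemma W_other:
 assumes b: "b:Y" "fst b~:Lm"
 shows "EX n v j u. v:Lat & j<3 & nrm u<lam & u~=0 & (fi^^n) (fst b) = v + cs j + u & rel b (gl j u (lam^n * snd b)) &
  gl j u (lam^n * snd b):Y & snd b * snd (gl j u (lam^n * snd b))<0"
proof -
 obtain n where "(fi^^n) (fst b):Zn lam" using b(2) by (auto simp:Lm_def)
 then obtain v j u where v: "v:Lat" "j<3" "nrm u<lam" "(fi^^n) (fst b) = v + cs j + u" by (rule ZnE)
 have z: "snd b~=0" using b by (simp add:Y_def)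
 have "(FI^^n) b:Y" using b(1) Y_pow by simp
 hence "fst ((FI^^n) b):U" by (simp add:Y_def)
 hence u: "u~=0" using U_iff[OF v(1,2), of u] v(3,4) by (simp add:FI_pow)
 have "rel0 b (TT (- v) ((FI^^n) b))" using rel0_trans[OF rel0_FI(1) rel0_FI(4)[OF Lat_uminus[OF v(1)]]] .
 moreover have "TT (- v) ((FI^^n) b) = (cs j + u,lam^n * snd b)" using v(4) by (simp add:FI_pow TT_def)
 ultimately have "relG b (gl j u (lam^n * snd b))" unfolding relG_def using v u z by (intro exI[of _ j] conjI exI[of _ u] exI[of _ "lam^n * snd b"]) auto
 moreover have "snd b * snd (gl j u (lam^n * snd b))<0"
 proof -
  have "sq u>0" using sq_pos u by blast
  thus ?thesis using z by (simp add:gl_def)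
 qed
 ultimately show ?thesis using v u Y_gl[OF v(2,3) u, of "lam^n * snd b"] z by (intro exI[of _ n] exI[of _ v] exI[of _ j] exI[of _ u]) (simp add:rel_def)
qed

end

lemma (in da_map) closed_Lm: "closed Lm"
proof -
 have "p:Lm <-> p:(\<Inter>n. - ((fi^^n) -` Zn lam))" for p by (simp add:Lm_def)
 hence "Lm = (\<Inter>n. - ((fi^^n) -` Zn lam))" by blast
 thus ?thesis by (auto intro!:open_vimage[OF open_Zn continuous_pow(2)])
qed

text \<open>Points over \<open>Lm\<close> never come into the domain of a glueing, so their orbits
  remain in one piece.\<close>

lemma (in glued) orel_Lm_sign: "orel a b ==> a:Y ==> b:Y ==> fst a:Lm ==> snd a * snd b>0"
proof -
 assume a: "orel a b" "a:Y" "b:Y" "fst a:Lm"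
 obtain t where t: "rel (Ft t a) b" using a(1) by (auto simp:orel_def)
 have "~ relG (Ft t a) b"
 proof
  assume "relG (Ft t a) b"
  then obtain j u z where *: "j<3" "nrm u<lam" "rel0 (Ft t a) (cs j + u,z)" by (auto simp:relG_def)
  have "cs j + u:Lm" using rp_Lm[OF rel0_rp[OF *(3)]] a(4) by simp
  thus False using Lm_off(2) ZnI[OF Lat_0 *(1,2)] by auto
 qed
 hence "rel0 (Ft t a) b" using t by (simp add:rel_def)
 hence "snd a>0 <-> snd b>0" using rel0_sign by (fastforce simp:Ft_def zero_less_mult_iff)
 thus ?thesis using a(2,3) by (auto simp:Y_def zero_less_mult_iff)
qed

section \<open>Closures of orbits, and closed orbits\<close>

context glued_cover
begin

definition fs :: "pt set => bool" where "fs B <-> B<=Y & (ALL a:B. ALL b:Y. orel a b --> b:B)"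

lemma fs_slice: "fs B ==> (p,z):B ==> z*w>0 ==> (p,w):B"
proof -
 assume B: "fs B" "(p,z):B" "z*w>0"
 have "(p,z):Y" using B unfolding fs_def by blast
 hence "(p,w):Y" using B(3) by (auto simp:Y_def)
 moreover have "orel (p,z) (p,w)" using orel_same[of "(p,z)" "(p,w)"] rp_refl B(3) by simp
 ultimately show ?thesis using B unfolding fs_def by blast
qed

text \<open>A flow-saturated set is locally a product with the height coordinate, so its closure is
  decided in the plane at one fixed height.\<close>

lemma cl_sat: "fs B ==> b:Y ==> Q b:X closure_of (Q ` B) <-> fst b:closure {p. (p,snd b):B}"
proof -
 assume B: "fs B" and b: "b:Y"
 have "Q b:X closure_of (Q ` B) <-> b:closure B"
  by (rule sc.closure_Q) (use B b orel_rel ker in "auto simp:fs_def")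
 also have "... <-> fst b:closure {p. (p,snd b):B}"
 proof
  assume cl: "b:closure B"
  show "fst b:closure {p. (p,snd b):B}" unfolding closure_iff_nhds_not_empty
  proof (intro allI impI)
   fix A N assume N: "N<=A" "open N" "fst b:N"
   have "b:N \<times> {z. z * snd b>0}" using N(3) b by (cases b) (auto simp:Y_def zero_less_mult_iff)
   moreover have "open (N \<times> {z. z * snd b>0})" by (intro open_Times N(2) open_Collect_less continuous_intros)
   ultimately have "B Int (N \<times> {z. z * snd b>0})~={}" using cl unfolding closure_iff_nhds_not_empty by blast
   then obtain a where "a:B" "fst a:N" "snd a * snd b>0" by auto
   thus "{p. (p,snd b):B} Int A~={}" using fs_slice[OF B, of "fst a" "snd a" "snd b"] N(1) by auto
  qed
 next
  assume "fst b:closure {p. (p,snd b):B}"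
  then obtain s where s: "!!n. (s n,snd b):B" "s ----> fst b" unfolding closure_sequential by auto
  have "(%n. (s n,snd b)) ----> (fst b,snd b)" by (intro tendsto_intros s)
  thus "b:closure B" unfolding closure_sequential using s(1) by force
 qed
 finally show ?thesis .
qed

lemma cl_orel: "fs B ==> b:Y ==> orel b c ==> Q b:X closure_of (Q ` B) ==> Q c:X closure_of (Q ` B)"
proof -
 assume B: "fs B" "b:Y" and bc: "orel b c" and cl: "Q b:X closure_of (Q ` B)"
 obtain t where t: "rel (Ft t b) c" using bc by (auto simp:orel_def)
 have s: "snd b * snd (Ft t b)>0" "snd (Ft t b) * snd b>0" using B(2) by (auto simp:Ft_def Y_def zero_less_mult_iff mult_less_0_iff)
 have "{p. (p,snd (Ft t b)):B} = {p. (p,snd b):B}" using fs_slice[OF B(1) _ s(1)] fs_slice[OF B(1) _ s(2)] by blast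
 hence "Q (Ft t b):X closure_of (Q ` B)" using cl cl_sat[OF B] cl_sat[OF B(1), of "Ft t b"] B(2) by simp
 thus ?thesis using t ker by metis
qed

lemma orb: "a:Y ==> flow_orbit fl (Q a) = Q ` {b:Y. orel a b}"
proof (intro equalityI subsetI)
 fix x assume a: "a:Y"
 { assume "x:flow_orbit fl (Q a)"
  then obtain t where "x = Q (Ft t a)" by (auto simp:flow_orbit_def fl_Q)
  moreover have "orel a (Ft t a)" unfolding orel_def using rel_equiv(1) by blast
  ultimately show "x:Q ` {b:Y. orel a b}" using a by simp }
 { assume "x:Q ` {b:Y. orel a b}"
  then obtain b t where "x = Q b" "rel (Ft t a) b" by (auto simp:orel_def)
  hence "x = fl t (Q a)" using ker fl_Q by metis
  thus "x:flow_orbit fl (Q a)" by (simp add:flow_orbit_def) }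
qed

lemma fs_orb: "fs {b:Y. orel a b}" unfolding fs_def using orel_trans by blast

lemma orb_mem: "a:Y ==> b:Y ==> Q b:flow_orbit fl (Q a) <-> orel a b"
proof
 assume a: "a:Y" "b:Y"
 { assume "Q b:flow_orbit fl (Q a)"
  then obtain c where "orel a c" "Q b = Q c" unfolding orb[OF a(1)] by blast
  thus "orel a b" using ker rel_equiv(2) orel_rel orel_trans by blast }
 { assume "orel a b" thus "Q b:flow_orbit fl (Q a)" unfolding orb[OF a(1)] using a(2) by blast }
qed

lemma orb_top: "x:topspace X ==> flow_orbit fl x<=topspace X"
 using orb sc.q_onto by (metis (no_types, lifting) imageE image_mono mem_Collect_eq subsetI)

lemma Zset_mem: "a:Y ==> b:Y ==> Q b:Zset X fl (Q a) <-> fst a:closure {p. p:U & orel b (p,snd a)}"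
proof -
 assume a: "a:Y" "b:Y"
 have "Q b:topspace X" using a sc.q_onto by blast
 moreover have "(p,snd a):Y <-> p:U" for p using a(1) by (simp add:Y_def)
 ultimately show ?thesis using cl_sat[OF fs_orb a(1), of b] by (simp add:Zset_def orb[OF a(2)])
qed

lemma Zset_same: "a:Y ==> b:Y ==> snd b * snd a>0 ==> Q b:Zset X fl (Q a) <-> fst a:closure {p. rp (fst b) p}"
proof -
 assume a: "a:Y" "b:Y" "snd b * snd a>0"
 have "{p. p:U & orel b (p,snd a)} = {p. rp (fst b) p}"
  using orel_same[of b "(_,snd a)"] a rp_U[of "fst b"] unfolding Y_def by auto
 thus ?thesis using Zset_mem[OF a(1,2)] by simp
qed

lemma Zset_orel: "b:Y ==> c:Y ==> orel b c ==> Q b:Zset X fl x <-> Q c:Zset X fl x"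
proof -
 assume b: "b:Y" "c:Y" "orel b c"
 have "{d:Y. orel b d} = {d:Y. orel c d}" using b(3) orel_trans orel_sym by blast
 thus ?thesis unfolding Zset_def using orb[OF b(1)] orb[OF b(2)] b sc.q_onto by auto
qed

lemma closed_orbit:
 assumes a: "a:Y" and cl: "X closure_of (flow_orbit fl (Q a)) = flow_orbit fl (Q a)"
  and p: "p:U" "p:closure {p'. rp (fst a) p'}"
 shows "rp (fst a) p"
proof -
 have z: "snd a * snd a>0" "(p,snd a):Y" using a p by (auto simp:Y_def zero_less_mult_iff)
 have "{p'. (p',snd a):{b:Y. orel a b}} = {p'. rp (fst a) p'}"
  using orel_same[of a "(_,snd a)"] a z(1) rp_U[of "fst a"] unfolding Y_def by auto
 hence "Q (p,snd a):flow_orbit fl (Q a)" using cl_sat[OF fs_orb z(2), of a] p cl orb[OF a] by simp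
 thus ?thesis using orb_mem[OF a z(2)] orel_same[of a "(p,snd a)"] z by simp
qed

text \<open>Late forward images, translated into a box, have a limit \<open>c\<close> off the
  sources. As the orbit is closed, \<open>c\<close> lies on it and hence outside \<open>Lm\<close>,
  so some \<open>(fi^^m) c\<close> is near a source. But \<open>fi^^m\<close> of a late forward
  image is still a late forward image, and these avoid the sources.\<close>

lemma closed_orbit_Lm:
 assumes a: "a:Y" and cl: "X closure_of (flow_orbit fl (Q a)) = flow_orbit fl (Q a)"
 shows "fst a:Lm"
proof (rule ccontr)
 let ?p = "fst a"
 assume nL: "?p~:Lm"
 have pU: "?p:U" using a by (simp add:Y_def)
 obtain N where N: "!!n. n>=N ==> (fm^^n) ?p~:Zn lam" using exit_Zn[OF pU] by blast
 have "EX v. v:Lat & (fm^^n) ?p - v:cbox (0,0) (2*Kl,4*Kl)" for n using Lat_cover by blast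
 then obtain v where v: "!!n. v n:Lat" "!!n. (fm^^n) ?p - v n:cbox (0,0) (2*Kl,4*Kl)" by metis
 define d where "d n = (fm^^(n + N)) ?p - v (n + N)" for n
 have offd: "d n~:Zn lam" for n using Zn_add[OF v(1), of "d n" "n + N" lam] N[of "n + N"] by (simp add:d_def)
 have "compact (cbox (0,0) (2*Kl,4*Kl) - Zn lam)" by (intro compact_diff compact_cbox open_Zn)
 hence "seq_compact (cbox (0,0) (2*Kl,4*Kl) - Zn lam)" by (rule compact_imp_seq_compact)
 moreover have "ALL n. d n:cbox (0,0) (2*Kl,4*Kl) - Zn lam" using offd v(2) unfolding d_def by blast
 ultimately obtain c and r :: "nat => nat" where c: "c:cbox (0,0) (2*Kl,4*Kl) - Zn lam" and r: "strict_mono r" "(d o r) ----> c"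
  by (rule seq_compactE)
 have "rp ?p (d n)" for n using rp_trans[OF rp_gen(2) rp_gen(3)[OF Lat_uminus[OF v(1)]]] by (simp add:d_def)
 hence "c:closure {p'. rp ?p p'}" by (intro closure_rpI[OF _ r(2)]) simp
 moreover have "c:U" using c cen_Zn[of lam] by (auto simp:U_def)
 ultimately have "c~:Lm" using closed_orbit[OF a cl] rp_Lm nL by blast
 then obtain m where m: "(fi^^m) c:Zn lam" by (auto simp:Lm_def)
 have "(%n. (fi^^m) ((d o r) n)) ----> (fi^^m) c" by (rule continuous_on_tendsto_compose[OF continuous_pow(2)[of UNIV] r(2)]) auto
 hence "\<forall>\<^sub>F n in sequentially. (fi^^m) ((d o r) n):Zn lam" by (rule topological_tendstoD[OF _ open_Zn m])
 then obtain n where n: "n>=m" "(fi^^m) (d (r n)):Zn lam" unfolding eventually_sequentially o_def by (metis le_cases)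
 have rn: "r n>=m" using seq_suble[OF r(1), of n] n(1) by linarith
 obtain w where w: "w:Lat" "(fi^^m) ((fm^^(r n + N)) ?p + - v (r n + N)) = (fi^^m) ((fm^^(r n + N)) ?p) + w"
  using fi_pow_add[OF Lat_uminus[OF v(1)]] by blast
 have "(fm^^(r n + N)) ?p = (fm^^m) ((fm^^(r n - m + N)) ?p)" using rn funpow_add[of m "r n - m + N" fm] by simp
 hence "(fi^^m) (d (r n)) = (fm^^(r n - m + N)) ?p + w" using w(2) by (simp add:d_def)
 thus False using n(2) Zn_add[OF w(1)] N[of "r n - m + N"] by simp
qed

text \<open>A closed orbit comes from a periodic planar point. If it is not an inner saddle, one
  half of its horizontal leaf is free of sources: otherwise it would lie between two sources of one
  translate, against \<open>src_between\<close>. The free half leaf is attracted to the orbit and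
  its translates are dense, so \<open>Zset\<close> would be dense.\<close>

lemma iso_saddle:
 assumes a: "a:Y" and iso: "iso_pt X fl (Q a)"
 shows "EX i:{1,2}. EX v:Lat. fst a = v + (sad i,0)"
proof (rule ccontr)
 assume no: "~ ?thesis"
 let ?p = "fst a"
 have cl: "X closure_of (flow_orbit fl (Q a)) = flow_orbit fl (Q a)" and nd: "X closure_of (Zset X fl (Q a))~=topspace X"
  using iso by (simp_all add:iso_pt_def)
 have L: "?p:Lm" by (rule closed_orbit_Lm[OF a cl])
 have clA: "closed {p'. rp ?p p'}"
 proof -
  have "closure {p'. rp ?p p'}<=Lm" by (rule closure_minimal[OF _ closed_Lm]) (use rp_Lm L in blast)
  thus ?thesis using closed_orbit[OF a cl] Lm_U closure_subset_eq by blast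
 qed
 have "EX k>0. EX v:Lat. (fm^^k) ?p = ?p + v"
 proof (rule periodic_of_closed)
  fix a b c assume "rp a b" "rp b c" thus "rp a c" by (rule rp_trans)
 next
  fix a b assume "rp a b" thus "rp b a" by (rule rp_sym)
 qed (rule clA)
 then obtain k v0 where k: "k>0" "v0:Lat" "(fm^^k) ?p = ?p + v0" by auto
 obtain x y where p: "?p = (x,y)" by (cases ?p)
 have free: "(ALL t>=0. (x + t,y):U) | (ALL t>=0. (x - t,y):U)"
 proof (rule ccontr)
  assume "~ ?thesis"
  then obtain t t' where t: "t>=0" "(x + t,y):cen" "t'>=0" "(x - t',y):cen" by (auto simp:U_def)
  obtain v j where v: "v:Lat" "j<3" "(x + t,y) = v + cs j" using cenE[OF t(2)] .
  obtain v' j' where v': "v':Lat" "j'<3" "(x - t',y) = v' + cs j'" using cenE[OF t(4)] .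
  have "snd v = y" "snd v' = y" using v(3) v'(3) by (auto simp:cs_def prod_eq_iff)
  hence vv: "v' = v" using Lat_snd_inj[OF v'(1) v(1)] by simp
  define c where "c = x - fst v"
  have pc: "?p = v + (c,0)" using `snd v = y` by (simp add:p c_def prod_eq_iff)
  have cL: "(c,0):Lm" using L Lm_add[OF v(1), of "(c,0)"] by (simp add:pc add.commute)
  have ne: "c~=src l" if "l<3" for l
  proof
   assume "c = src l"
   hence "0 + cs l + 0 = (c,0)" by (simp add:cs_def)
   thus False using Lm_off(2)[OF cL] ZnI[OF Lat_0 that, of 0 lam] by simp
  qed
  have "src j'<c" "c<src j" using v(3) v'(3) t ne[OF v(2)] ne[OF v'(2)] by (auto simp:c_def cs_def vv prod_eq_iff)
  then obtain i where "i:{1,2}" "c = sad i" using src_between[OF _ _ v'(2) v(2) ne, where y=0] cL by auto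
  thus False using no pc v(1) by blast
 qed
 have z: "snd a * snd a>0" using a by (auto simp:Y_def zero_less_mult_iff)
 have per: "EX w:Lat. (fm^^(k*n)) ?p = ?p + w" for n
 proof (induction n)
  case (Suc n)
  then obtain w where w: "w:Lat" "(fm^^(k*n)) ?p = ?p + w" by blast
  obtain w' where "w':Lat" "(fm^^k) (?p + w) = (fm^^k) ?p + w'" using fm_pow_add[OF w(1)] by blast
  thus ?case using w k by (intro bexI[of _ "v0 + w'"]) (simp_all add:funpow_add Lat_add)
 qed (auto simp:exI)
 then obtain w where w: "!!n. w n:Lat" "!!n. (fm^^(k*n)) ?p = ?p + w n" by metis
 have inZ: "Q ((x',y) + v,snd a):Zset X fl (Q a)"
  if fr: "(ALL t>=0. (x + t,y):U) & x<=x' | (ALL t>=0. (x - t,y):U) & x'<=x" and v: "v:Lat" for x' v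
 proof -
  have "(%n. fst ((fm^^n) (x',y)) - fst ((fm^^n) (x,y))) ----> 0"
   using fr
  proof
   assume h: "(ALL t>=0. (x + t,y):U) & x<=x'"
   show ?thesis
   proof (rule stable_segment)
    show "(s,y):U" if "x<=s" for s using h that by (metis diff_add_cancel diff_ge_0_iff_ge add.commute)
   qed (use h in simp)
  next
   assume h: "(ALL t>=0. (x - t,y):U) & x'<=x"
   have "(%n. fst ((fm^^n) (x,y)) - fst ((fm^^n) (x',y))) ----> 0"
   proof (rule stable_segment)
    show "(s,y):U" if "s<=x" for s using h that by (metis diff_diff_eq2 diff_add_cancel diff_ge_0_iff_ge add.commute)
   qed (use h in simp)
   from tendsto_minus[OF this] show ?thesis by simp
  qed
  from LIMSEQ_subseq_LIMSEQ[OF this, of "%n. k*n"] k(1)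
  have d: "(%n. fst ((fm^^(k*n)) (x',y)) - fst ((fm^^(k*n)) (x,y))) ----> 0" by (auto simp:o_def strict_mono_def)
  have e: "(fm^^(k*n)) (x',y) - w n = ?p + (fst ((fm^^(k*n)) (x',y)) - fst ((fm^^(k*n)) (x,y)),0)" for n
   using w(2)[of n] by (simp add:p prod_eq_iff)
  have "(%n. (fm^^(k*n)) (x',y) - w n) ----> ?p + (0,0)" unfolding e by (intro tendsto_intros d)
  hence lim: "(%n. (fm^^(k*n)) (x',y) - w n) ----> ?p" by (simp flip:zero_prod_def)
  have "(x',y):U" using fr
  proof
   assume "(ALL t>=0. (x + t,y):U) & x<=x'" thus ?thesis by (elim conjE allE[of _ "x' - x"]) simp
  next
   assume "(ALL t>=0. (x - t,y):U) & x'<=x" thus ?thesis by (elim conjE allE[of _ "x - x'"]) simp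
  qed
  hence Y': "((x',y) + v,snd a):Y" using U_add[OF v] a by (simp add:Y_def)
  have "rp ((x',y) + v) ((fm^^(k*n)) (x',y) - w n)" for n
   using rp_trans[OF rp_sym[OF rp_gen(3)[OF v]] rp_trans[OF rp_gen(2) rp_gen(3)[OF Lat_uminus[OF w(1)]]]] by simp
  from closure_rpI[OF this lim] show ?thesis using Zset_same[OF a Y'] z by simp
 qed
 let ?C = "X closure_of (Zset X fl (Q a))"
 \<comment> \<open>Density in the piece containing \<open>a\<close>: some lattice translate of the
   free half leaf passes within \<open>e\<close> of any given point.\<close>
 have same: "Q c:?C" if c: "c:Y" "snd c * snd a>0" for c
  unfolding in_closure_of
 proof (intro conjI allI impI)
  show "Q c:topspace X" using c sc.q_onto by blast
  fix T assume T: "Q c:T & openin X T"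
  obtain e where e: "e>0" "ball c e<=Y Int Q -` T" using sc.preimage_open[of T] T c(1) by (metis IntI open_contains_ball_eq vimageI)
  obtain R where R: "R>0" "!!x0 y0. EX v:Lat. abs(snd v - y0)<e & x0<=fst v & fst v<=x0 + R" using Lat_dense[OF e(1)] by blast
  obtain v where v: "v:Lat" "abs(snd v - (snd (fst c) - y))<e" and
    fr: "(ALL t>=0. (x + t,y):U) & x<=fst (fst c) - fst v | (ALL t>=0. (x - t,y):U) & fst (fst c) - fst v<=x"
  proof (cases "ALL t>=0. (x + t,y):U")
   case True
   obtain v where "v:Lat" "abs(snd v - (snd (fst c) - y))<e" "fst v<=(fst (fst c) - x - R) + R" using R(2) by blast
   thus ?thesis using that True by auto
  next
   case False
   obtain v where "v:Lat" "abs(snd v - (snd (fst c) - y))<e" "fst (fst c) - x<=fst v" using R(2) by blast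
   moreover hence "fst (fst c) - fst v<=x" by linarith
   moreover have "ALL t>=0. (x - t,y):U" using False free by blast
   ultimately show ?thesis using that[of v] by blast
  qed
  have Z: "Q ((fst (fst c) - fst v,y) + v,snd a):Zset X fl (Q a)" by (rule inZ[OF fr v(1)])
  let ?d = "((fst (fst c),y + snd v),snd c)"
  have "dist c ?d<e" using v(2) by (cases c) (auto simp:dist_Pair_Pair dist_real_def)
  hence d: "?d:Y" "Q ?d:T" using e(2) by auto
  have eq: "(fst (fst c) - fst v,y) + v = (fst (fst c),y + snd v)" by (simp add:prod_eq_iff)
  have "((fst (fst c),y + snd v),snd a):Y" using d(1) a by (simp add:Y_def)
  moreover have "orel ((fst (fst c),y + snd v),snd a) ?d" using orel_same[of "((fst (fst c),y + snd v),snd a)" ?d] c(2) rp_refl by (simp add:mult.commute)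
  ultimately have "Q ?d:Zset X fl (Q a)" using Z Zset_orel d(1) unfolding eq by blast
  thus "EX y. y:Zset X fl (Q a) & y:T" using d(2) by blast
 qed
 \<comment> \<open>In the other piece the points outside \<open>Lm\<close> are dense by
   \<open>Lm_interior\<close>, and \<open>W_other\<close> represents them in the piece of
   \<open>a\<close>.\<close>
 have "topspace X<=?C"
 proof
  fix q0 assume "q0:topspace X"
  then obtain b where b: "b:Y" "q0 = Q b" using sc.q_onto by blast
  show "q0:?C"
  proof (rule ccontr)
   assume n: "q0~:?C"
   have "openin X (topspace X - ?C)" by auto
   hence o: "open (Y Int Q -` (topspace X - ?C))" by (rule sc.preimage_open)
   let ?N = "(%p. (p,snd b)) -` (Y Int Q -` (topspace X - ?C))"
   have "open ?N" by (intro o continuous_intros)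
   moreover have "fst b:?N" using b n `q0:topspace X` by simp
   ultimately obtain p where p: "p:?N" "p~:Lm" using Lm_interior by blast
   hence pb: "(p,snd b):Y" "Q (p,snd b)~:?C" by auto
   obtain c where c: "c:Y" "rel (p,snd b) c" "snd b * snd c<0" using W_other[OF pb(1)] p(2) unfolding fst_conv snd_conv by blast
   have "snd b * snd a<0 | snd b * snd a>0" using a b by (auto simp:Y_def mult_less_0_iff zero_less_mult_iff)
   thus False
   proof
    assume "snd b * snd a>0" thus False using same[OF pb(1)] pb(2) by simp
   next
    assume "snd b * snd a<0"
    hence "snd c * snd a>0" using c(3) by (auto simp:mult_less_0_iff zero_less_mult_iff)
    thus False using same[OF c(1)] ker[of "(p,snd b)" c] c(2) pb(2) by simp
   qed
  qed
 qed
 thus False using nd closure_of_subset_topspace[of X "Zset X fl (Q a)"] by blast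
qed

end

text \<open>The horizontal rays that lead from source \<open>j\<close> to one of the inner saddles:
  on both sides for the middle source, on the inner side for the outer ones.\<close>

definition vis :: "nat => real*real => bool" where
 "vis j u <-> snd u = 0 & (fst u<0 & j:{1,2} | fst u>0 & j:{0,1})"

lemma (in da_map) sad_Lm: "i:{1,2} ==> abs t<1 ==> (sad i,t):Lm"
proof -
 assume i: "i:{1,2}" and t: "abs t<1"
 have "(sad i,s)~:Zn lam" if s: "abs s<1" for s
 proof
  assume "(sad i,s):Zn lam"
  then obtain v j u where u: "v:Lat" "j<3" "nrm u<lam" "(sad i,s) = v + cs j + u" by (rule ZnE)
  have uu: "abs(fst u)<lam" "abs(snd u)<lam" using u(3) by (auto simp:nrm_def)
  have e: "fst v = sad i - src j - fst u" "snd v = s - snd u" using u(4) by (auto simp:cs_def prod_eq_iff)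
  have "- 24<sad i" "sad i<24" using idx(4-7)[OF i] by auto
  hence "abs(fst v)<=2*(X0 + 1)"
   unfolding e using uu src_bounds(1)[OF u(2)] X0 lam_bounds by (auto simp:abs_less_iff)
  moreover have "abs(snd v)<=6" unfolding e using uu s lam_bounds by linarith
  ultimately have "v = 0" by (rule Lat_small[OF u(1)])
  hence "abs(sad i - src j)<lam" using e uu by simp
  moreover have "j = i - 1 | j = i | (i = 1 & j = 2) | (i = 2 & j = 0)" using i u(2) by auto
  ultimately show False using gap_bounds lam_bounds i by (auto simp:sad_def src_def)
 qed
 moreover have "abs(t/lam^n)<1" for n using abs_div_pow[of t n] t by linarith
 ultimately have "(fi^^n) (sad i,t)~:Zn lam" for n using fi_sad[OF i, of t n] t by simp
 thus ?thesis by (simp add:Lm_def)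
qed

context glued
begin

lemma rp_center:
 assumes "rp (cs j + u) (cs j' + u')" "j<3" "j'<3" "nrm u<lam" "nrm u'<lam"
 shows "j = j' & (EX c>0. u' = c *R u)"
proof -
 obtain n m v where v: "v:Lat" "(fi^^n) (cs j + u) = (fi^^m) (cs j' + u') + v" using assms(1) by (auto simp:rp_def)
 have small: "nrm ((1/lam^n) *R u)<=3" if "nrm u<lam" for n u
 proof -
  have "1/lam^n*nrm u<=1*lam" using that by (intro mult_mono) auto
  thus ?thesis using lam_bounds by (simp add:nrm_scale)
 qed
 have "0 + cs j + (1/lam^n) *R u = v + cs j' + (1/lam^m) *R u'"
  using v(2) assms fi_pow_lin0[of j u n] fi_pow_lin0[of j' u' m] by simp
 from cs_unique[OF Lat_0 v(1) assms(2,3) this] have "j = j'" "(1/lam^n) *R u = (1/lam^m) *R u'" using small assms by auto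
 hence "lam^m *R (1/lam^n) *R u = u'" by simp
 thus ?thesis using `j = j'` by (intro conjI exI[of _ "lam^m/lam^n"]) auto
qed

lemma strip_dir:
 assumes i: "i:{1,2}" and p: "p:strip i" "fst p~=sad i"
 shows "EX u. rp p (cs (if fst p>sad i then i else i - 1) + u) & nrm u<1 & fst u*(fst p - sad i)<0 & sgn (snd u) = sgn (snd p)"
proof -
 note ii = idx[OF i]
 have y: "abs(snd p)<=1" "src (i - 1)<fst p" "fst p<src i" using p by (auto simp:strip_def)
 show ?thesis
 proof (cases "fst p>sad i")
  case True
  obtain n u where "(fi^^n) p = cs i + u" "nrm u<1" "fst u<0" "snd u = snd p/lam^n"
   using strip_left(2)[OF ii(1) True y(3,1)] by auto
  thus ?thesis using True rp_gen(1)[of p n] by (intro exI[of _ u]) (auto simp:mult_neg_pos)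
 next
  case False
  then obtain n u where "(fi^^n) p = cs (i - 1) + u" "nrm u<1" "fst u>0" "snd u = snd p/lam^n"
   using strip_right(2)[OF ii(2) y(2) _ y(1)] p(2) unfolding ii(3) by auto
  thus ?thesis using False p(2) rp_gen(1)[of p n] by (intro exI[of _ u]) (auto simp:mult_pos_neg)
 qed
qed

lemma rp_sad: "i:{1,2} ==> rp (sad i,0) p ==> p - (sad i,0):Lat"
proof -
 assume i: "i:{1,2}" and "rp (sad i,0) p"
 from rp_cases0[OF this(2)] show ?thesis
 proof
  assume "EX k. EX v:Lat. p = (fi^^k) (sad i,0) + v" thus ?thesis using fi_sad[OF i, of 0] by auto
 next
  assume "EX k. EX v:Lat. (sad i,0) = (fi^^k) p + v"
  then obtain k v where v: "v:Lat" "(sad i,0) = (fi^^k) p + v" by blast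
  obtain w where w: "w:Lat" "(fm^^k) ((fi^^k) p + v) = (fm^^k) ((fi^^k) p) + w" using fm_pow_add[OF v(1)] by blast
  have "(fm^^k) (sad i,0) = (sad i,0)" using fi_sad[OF i, of 0 k] fi_pow_fm_pow(2)[of k "(sad i,0)"] by simp
  hence "p - (sad i,0) = - w" using w(2) v(2)[symmetric] by simp
  thus ?thesis using Lat_uminus[OF w(1)] by simp
 qed
qed

lemma orel_gl:
 assumes j: "j<3" and u: "u~=0" "nrm u<lam" and z: "z*w<0"
 shows "orel (cs j + u,z) (cs (pj j) + ee j z *R rot u,w)"
proof -
 have s: "sq u>0" using sq_pos u by blast
 have z0: "z~=0" using z by auto
 have "relG (cs j + u,z) (gl j u z)" unfolding relG_def using j u z0 by (intro exI[of _ j] conjI exI[of _ u]) auto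
 hence "orel (cs j + u,z) (gl j u z)" by (intro orel_rel) (simp add:rel_def)
 moreover have "orel (gl j u z) (cs (pj j) + ee j z *R rot u,w)"
 proof -
  have "snd (gl j u z)*w>0" using z s by (auto simp:gl_def mult_less_0_iff divide_less_0_iff)
  thus ?thesis using orel_same[of "gl j u z" "(cs (pj j) + ee j z *R rot u,w)"] rp_refl by (simp add:gl_def)
 qed
 ultimately show ?thesis by (rule orel_trans)
qed

lemma orel_eq: "z*w>0 ==> rp p p' ==> orel (p,z) (p',w)" using orel_same[of "(p,z)" "(p',w)"] by simp

lemma rot_nz: "u~=0 ==> ee j z *R rot u~=0" using nrm_rot[of u] nrm_0(1) by (metis ee_sq(3) scaleR_eq_0_iff)

end

section \<open>The sectors at the sources and the components of wandering orbits\<close>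

locale glued_std = glued_cover + assumes e0: "ep 0 = 1" and e2: "ep 2 = 1"
begin

text \<open>Near the \<open>j\<close>-th source the traces of the saddle leaves from both pieces are rays (\<open>vis\<close>);
  the sectors which they cut out are numbered by \<open>m\<close>.\<close>

definition reg :: "nat => nat => (real*real) set" where
 "reg j m = {u. if j = 0 then (if m = 0 then fst u<0 else if m = 1 then fst u>0 & snd u>0 else m = 2 & fst u>0 & snd u<0)
   else if j = 1 then (if m = 0 then ep 1 * snd u>0 else if m = 1 then ep 1 * snd u<0 & fst u>0 else m = 2 & ep 1 * snd u<0 & fst u<0)
   else (if m = 0 then fst u>0 | snd u<0 else m = 1 & fst u<0 & snd u>0)}"

lemma reg_cone: "c>0 ==> c *R u:reg j m <-> u:reg j m"
 by (auto simp:reg_def zero_less_mult_iff mult_less_0_iff)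

lemma reg_disj: "u:reg j m ==> u:reg j m' ==> m = m'"
 by (auto simp:reg_def split:if_splits)

lemma reg_vis: "j<3 ==> u:reg j m ==> u~=0 & ~ vis j u & ~ vis (pj j) (ep j *R rot u)"
proof -
 assume a: "j<3" "u:reg j m"
 have "u~=0" using a(2) by (auto simp:reg_def split:if_splits)
 moreover have "j = 0 | j = 1 | j = 2" using a(1) by auto
 ultimately show ?thesis using a(2) e2 by (elim disjE) (auto simp:reg_def vis_def pj_def rot_def split:if_splits)
qed

lemma vis_reg: "j<3 ==> u~=0 ==> ~ vis j u ==> ~ vis (pj j) (ep j *R rot u) ==> EX m<3. u:reg j m"
proof -
 assume a: "j<3" "u~=0" "~ vis j u" "~ vis (pj j) (ep j *R rot u)"
 obtain x y where u: "u = (x,y)" by (cases u)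
 have u0: "x~=0 | y~=0" using a(2) by (auto simp:u zero_prod_def)
 consider "j = 0" | "j = 1" "ep 1 = 1" | "j = 1" "ep 1 = -1" | "j = 2" using a(1) eps[of 1] by fastforce
 hence "u:reg j 0 | u:reg j 1 | u:reg j 2"
  by cases (insert u0 a(3,4) e0 e2, simp_all add:u reg_def vis_def pj_def rot_def del:One_nat_def, linarith+)
 thus ?thesis by (auto intro:exI[of _ 0] exI[of _ 1] exI[of _ 2])
qed

lemma open_reg: "open (reg j m)"
 unfolding reg_def by (cases "j = 0"; cases "j = 1"; cases "m = 0"; cases "m = 1"; cases "m = 2"; simp;
  (intro open_Collect_conj open_Collect_disj open_Collect_less continuous_intros)?)

lemma conn_reg: "connected (reg j m Int {u. nrm u<lam})"
proof -
 have n: "nrm u<lam <-> fst u:{- lam<..<lam} & snd u:{- lam<..<lam}" for u by (auto simp:nrm_def)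
 have b: "connected S" if "S = {a<..<b} \<times> {c<..<d}" for S and a b c d :: real using that by simp
 note rn = reg_def n set_eq_iff
 have l: "!!x. x<0 ==> x<lam" "!!x. 0<x ==> - lam<x" "lam>0" using lam_bounds by auto
 consider "m>2" | "j = 0" "m = 0" | "j = 0" "m = 1" | "j = 0" "m = 2" | "j = 1" "m = 0" "ep 1 = 1" | "j = 1" "m = 1" "ep 1 = 1" | "j = 1" "m = 2" "ep 1 = 1"
  | "j = 1" "m = 0" "ep 1 = -1" | "j = 1" "m = 1" "ep 1 = -1" | "j = 1" "m = 2" "ep 1 = -1"
  | "j>1" "m = 0" | "j>1" "m = 1" | "j>1" "m = 2"
 proof -
  have "j = 0 | j = 1 | j>1" "m = 0 | m = 1 | m = 2 | m>2" by auto
  thus thesis using eps[of 1] by (elim disjE) (rule that; assumption)+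
 qed
 thus ?thesis
 proof cases
  case 2 show ?thesis by (rule b[of _ "- lam" 0 "- lam" lam]) (use 2 l in "auto simp:rn")
 next
  case 3 show ?thesis by (rule b[of _ 0 lam 0 lam]) (use 3 l in "auto simp:rn")
 next
  case 4 show ?thesis by (rule b[of _ 0 lam "- lam" 0]) (use 4 l in "auto simp:rn")
 next
  case 5 show ?thesis by (rule b[of _ "- lam" lam 0 lam]) (use 5 l in "auto simp:rn")
 next
  case 6 show ?thesis by (rule b[of _ 0 lam "- lam" 0]) (use 6 l in "auto simp:rn")
 next
  case 7 show ?thesis by (rule b[of _ "- lam" 0 "- lam" 0]) (use 7 l in "auto simp:rn")
 next
  case 8 show ?thesis by (rule b[of _ "- lam" lam "- lam" 0]) (use 8 l in "auto simp:rn")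
 next
  case 9 show ?thesis by (rule b[of _ 0 lam 0 lam]) (use 9 l in "auto simp:rn")
 next
  case 10 show ?thesis by (rule b[of _ "- lam" 0 0 lam]) (use 10 l in "auto simp:rn")
 next
  case 11
  have e: "reg j m Int {u. nrm u<lam} = {0<..<lam} \<times> {- lam<..<lam} Un {- lam<..<lam} \<times> {- lam<..<0}" using 11 by (auto simp:rn)
  have "(1,-1):{0<..<lam} \<times> {- lam<..<lam} Int {- lam<..<lam} \<times> {- lam<..<0}" using lam_bounds by auto
  hence "{0<..<lam} \<times> {- lam<..<lam} Int {- lam<..<lam} \<times> {- lam<..<0}~={}"
  proof (rule contrapos_pn)
   assume "{0<..<lam} \<times> {- lam<..<lam} Int {- lam<..<lam} \<times> {- lam<..<0} = {}"
   thus "(1,-1)~:{0<..<lam} \<times> {- lam<..<lam} Int {- lam<..<lam} \<times> {- lam<..<0}" by simp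
  qed
  thus ?thesis unfolding e by (rule connected_Un[OF b[OF refl] b[OF refl]])
 next
  case 12 show ?thesis by (rule b[of _ "- lam" 0 0 lam]) (use 12 l in "auto simp:rn")
 qed (auto simp:reg_def)
qed

text \<open>All representatives, in both pieces, of the orbits through a sector. Height
  \<open>1\<close> is a normalisation, available because a wandering orbit has representatives with
  \<open>z > 0\<close>.\<close>

definition RR :: "nat => nat => pt set" where
 "RR j m = {b:Y. EX u:reg j m. nrm u<lam & orel b (cs j + u,1)}"

lemma fs_RR: "fs (RR j m)" unfolding fs_def RR_def using orel_trans orel_sym by blast

lemma RR_center: "j<3 ==> j'<3 ==> u~=0 ==> nrm u<lam ==> z>0 ==> (cs j' + u,z):RR j m <-> j = j' & u:reg j m"
proof
 assume a: "j<3" "j'<3" "u~=0" "nrm u<lam" "z>0"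
 { assume "(cs j' + u,z):RR j m"
  then obtain w where w: "w:reg j m" "nrm w<lam" "orel (cs j' + u,z) (cs j + w,1)" by (auto simp:RR_def)
  have "rp (cs j' + u) (cs j + w)" using w(3) orel_same[of "(cs j' + u,z)" "(cs j + w,1)"] a(5) by simp
  thus "j = j' & u:reg j m" using rp_center[OF _ a(2,1,4) w(2)] w(1) reg_cone by metis }
 { assume "j = j' & u:reg j m"
  thus "(cs j' + u,z):RR j m" using a orel_eq[of z 1 "cs j' + u", OF _ rp_refl] Y_center[OF a(2,4), of z] unfolding RR_def by auto }
qed

lemma RR_sub: "b:RR j m ==> j<3 ==> EX u:reg j m. u~=0 & nrm u<lam & orel b (cs j + u,1) & (cs j + u,1):RR j m & (cs j + u,1):Y"
proof -
 assume b: "b:RR j m" "j<3"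
 then obtain u where u: "u:reg j m" "nrm u<lam" "orel b (cs j + u,1)" by (auto simp:RR_def)
 hence "u~=0" using reg_vis b(2) by blast
 thus ?thesis using u RR_center[OF b(2,2) _ u(2), of 1 m] Y_center[OF b(2) u(2), of 1] by auto
qed

lemma RR_disj: "b:RR j m ==> b:RR j' m' ==> j<3 ==> j'<3 ==> j = j' & m = m'"
proof -
 assume b: "b:RR j m" "b:RR j' m'" "j<3" "j'<3"
 obtain u where u: "u:reg j m" "u~=0" "nrm u<lam" "orel b (cs j + u,1)" "(cs j + u,1):Y" using RR_sub[OF b(1,3)] by blast
 have "(cs j + u,1):RR j' m'" using fs_RR[of j' m'] b(2) u(4,5) unfolding fs_def by blast
 thus ?thesis using RR_center[OF b(4,3) u(2,3), of 1 m'] reg_disj[OF u(1), of m'] by auto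
qed

text \<open>The projection is already covered by a truncated cone times the positive heights, which
  is open and connected.\<close>

lemma RR_img: "j<3 ==> EX B. open B & B<=Y & connected B & Q ` RR j m = Q ` B"
proof -
 assume j: "j<3"
 let ?B = "{a :: pt. fst a - cs j:reg j m & nrm (fst a - cs j)<lam & snd a>0}"
 have o1: "open ((%a :: pt. fst a - cs j) -` reg j m)" by (intro open_reg continuous_intros)
 have o2: "open {a :: pt. nrm (fst a - cs j)<lam & snd a>0}" by (intro open_Collect_conj open_Collect_less continuous_intros)
 have eq: "?B = (%a :: pt. fst a - cs j) -` reg j m Int {a :: pt. nrm (fst a - cs j)<lam & snd a>0}" by auto
 have o: "open ?B" by (subst eq) (rule open_Int[OF o1 o2])
 have BR: "a:RR j m & a:Y" if a: "a:?B" for a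
  using RR_center[OF j j, of "fst a - cs j" "snd a" m] reg_vis[OF j, of "fst a - cs j" m] a fs_RR[of j m] by (auto simp:fs_def)
 have "?B<=(%a. (cs j + fst a,snd a)) ` ((reg j m Int {u. nrm u<lam}) \<times> {0<..})"
 proof
  fix a assume "a:?B"
  thus "a:(%a. (cs j + fst a,snd a)) ` ((reg j m Int {u. nrm u<lam}) \<times> {0<..})"
   by (intro image_eqI[of _ _ "(fst a - cs j,snd a)"]) simp_all
 qed
 hence "(%a. (cs j + fst a,snd a)) ` ((reg j m Int {u. nrm u<lam}) \<times> {0<..}) = ?B" by auto
 moreover have "connected ((%a. (cs j + fst a,snd a)) ` ((reg j m Int {u. nrm u<lam}) \<times> {0 :: real<..}))"
 proof (rule connected_continuous_image)
  show "connected ((reg j m Int {u. nrm u<lam}) \<times> {0 :: real<..})" by (rule connected_Times[OF conn_reg connected_Ioi])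
 qed (intro continuous_intros)
 ultimately have c: "connected ?B" by simp
 have "Q b:Q ` ?B" if b: "b:RR j m" for b
 proof -
  obtain u where u: "u:reg j m" "nrm u<lam" "orel (cs j + u,1) b" using b orel_sym unfolding RR_def by blast
  then obtain t where t: "rel (Ft t (cs j + u,1)) b" unfolding orel_def by blast
  have 1: "Ft t (cs j + u,1):?B" using u by (simp add:Ft_def)
  have 2: "Q b = Q (Ft t (cs j + u,1))" using ker[THEN iffD2, OF t] by simp
  show ?thesis unfolding 2 by (rule imageI[OF 1])
 qed
 hence "Q ` RR j m<=Q ` ?B" by auto
 moreover have "Q ` ?B<=Q ` RR j m" using BR by auto
 ultimately have "Q ` RR j m = Q ` ?B" by simp
 thus ?thesis using o c BR by auto
qed

lemma RR_open: "j<3 ==> openin X (Q ` RR j m)" and RR_conn: "j<3 ==> connectedin X (Q ` RR j m)"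
proof -
 assume "j<3"
 then obtain B where B: "open B" "B<=Y" "connected B" "Q ` RR j m = Q ` B" using RR_img[OF `j<3`, of m] by auto
 from sc.open_q[OF B(1,2)] show "openin X (Q ` RR j m)" unfolding B(4) .
 show "connectedin X (Q ` RR j m)" unfolding B(4) by (rule connectedin_continuous_map_image[OF sc.cont_q]) (use B in "simp add:connectedin_subtopology")
qed

lemma RR_Q: "b:Y ==> Q b:Q ` RR j m <-> b:RR j m"
proof
 assume b: "b:Y" "Q b:Q ` RR j m"
 then obtain c where c: "c:RR j m" "Q b = Q c" by auto
 have "orel c b" using ker[of c b] c(2) by (intro orel_rel) simp
 thus "b:RR j m" using fs_RR[of j m] c(1) b(1) unfolding fs_def by blast
qed (rule imageI)

text \<open>A point near a source is not in \<open>Lm\<close>, so it is not on the vertical leaf. It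
  is on the horizontal one, whose points run backwards into an adjacent source along a visible
  ray.\<close>

lemma zs_vis:
 assumes i: "i:{1,2}" and k: "k<3" "w~=0" "nrm w<lam" "s*z>0" and Z: "Q (cs k + w,s):Zset X fl (Q ((sad i,0),z))"
 shows "vis k w"
proof -
 have s: "s~=0" "z~=0" using k by auto
 have Y: "((sad i,0),z):Y" "(cs k + w,s):Y" using Lm_U[OF sad_Lm[OF i, of 0]] Y_center[OF k(1,3)] k(2) s by (auto simp:Y_def)
 have nL: "cs k + w~:Lm" using ZnI[OF Lat_0 k(1,3)] Lm_off(2)[of "cs k + w"] by auto
 have "cs k + w:Vu i Un Ax i" using Zset_same[OF Y] Z k(4) zs1[OF i] by simp
 moreover have "cs k + w~:Vu i" using Vu_rp[OF i] rp_Lm sad_Lm[OF i] nL by blast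
 ultimately obtain t where t: "src (i - 1)<t" "t<src i" "rp (cs k + w) (t,0)" by (auto simp:Ax_def)
 have ts: "t~=sad i" using rp_Lm[OF t(3)] sad_Lm[OF i, of 0] nL by auto
 then obtain u where u: "rp (t,0) (cs (if t>sad i then i else i - 1) + u)" "nrm u<1" "fst u*(t - sad i)<0" "snd u = 0"
  using strip_dir[OF i, of "(t,0)"] t by (auto simp:strip_def sgn_zero_iff)
 have jk: "(if t>sad i then i else i - 1)<3" using idx(1,2)[OF i] by simp
 have "nrm u<lam" using u(2) lam_bounds by linarith
 from rp_center[OF rp_trans[OF t(3) u(1)] k(1) jk k(3) this]
 obtain c where c: "k = (if t>sad i then i else i - 1)" "c>0" "u = c *R w" by blast
 thus ?thesis using i u(3,4) by (auto simp:vis_def mult_less_0_iff zero_less_mult_iff)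
qed

lemma RR_Zset:
 assumes b: "b:RR j m" "j<3" and i: "i:{1,2}" "z~=0" shows "Q b~:Zset X fl (Q ((sad i,0),z))"
proof
 assume Z: "Q b:Zset X fl (Q ((sad i,0),z))"
 have bY: "b:Y" using b by (auto simp:RR_def)
 obtain u where u: "u:reg j m" "u~=0" "nrm u<lam" "orel b (cs j + u,1)" "(cs j + u,1):Y" using RR_sub[OF b] by blast
 note v = reg_vis[OF b(2) u(1)]
 show False
 proof (cases "z>0")
  case True
  have "Q (cs j + u,1):Zset X fl (Q ((sad i,0),z))" using Z Zset_orel[OF bY u(5,4)] by simp
  thus False using zs_vis[OF i(1) b(2) u(2,3), of 1 z] True v by simp
 next
  case False
  have o: "orel b (cs (pj j) + ep j *R rot u,-1)" using orel_trans[OF u(4) orel_gl[OF b(2) u(2,3), of 1 "-1"]] by (simp add:ee_def)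
  have nz: "ep j *R rot u~=0" "nrm (ep j *R rot u)<lam" using rot_nz[OF u(2), of j 1] u(3) eps[of j] by (auto simp:nrm_scale)
  hence "(cs (pj j) + ep j *R rot u,-1):Y" using Y_center[of "pj j"] b(2) by simp
  hence "Q (cs (pj j) + ep j *R rot u,-1):Zset X fl (Q ((sad i,0),z))" using Z Zset_orel[OF bY _ o] by simp
  thus False using zs_vis[OF i(1) _ nz, of "pj j" "-1" z] False i(2) b(2) v by simp
 qed
qed

lemma sad_Y: "i:{1,2} ==> z~=0 ==> abs t<1 ==> ((sad i,t),z):Y" using Lm_U[OF sad_Lm] by (simp add:Y_def)

text \<open>The orbit is closed because the lattice is closed, and its \<open>Zset\<close> misses
  the nonempty open set \<open>RR 0 1\<close>.\<close>

lemma iso_sad: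
 assumes i: "i:{1,2}" and z: "z~=0" shows "iso_pt X fl (Q ((sad i,0),z))"
proof -
 let ?a = "((sad i,0),z)"
 have aY: "?a:Y" using sad_Y[OF i z] by simp
 have T: "Q ?a:topspace X" using aY sc.q_onto by blast
 have "X closure_of (flow_orbit fl (Q ?a))<=flow_orbit fl (Q ?a)"
 proof
  fix x assume x: "x:X closure_of (flow_orbit fl (Q ?a))"
  hence "x:topspace X" by (meson closure_of_subset_topspace subsetD)
  then obtain b where b: "b:Y" "x = Q b" using sc.q_onto by blast
  have "fst b:closure {p. (p,snd b):{c:Y. orel ?a c}}" using x unfolding orb[OF aY] b(2) cl_sat[OF fs_orb b(1)] .
  then obtain s where s: "!!n. (s n,snd b):Y" "!!n. orel ?a (s n,snd b)" "s ----> fst b" unfolding closure_sequential by auto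
  have sg: "z * snd b>0" using orel_Lm_sign[OF s(2) aY s(1)] sad_Lm[OF i, of 0] by simp
  have "s n - (sad i,0):Lat" for n
  proof -
   have "rp (sad i,0) (s n)" using orel_same[of ?a "(s n,snd b)"] s(2) sg by simp
   thus ?thesis by (rule rp_sad[OF i])
  qed
  hence "fst b - (sad i,0):Lat" by (rule Lat_closed[OF _ tendsto_diff[OF s(3) tendsto_const]])
  hence "rp (sad i,0) (fst b)" using rp_gen(3)[of "fst b - (sad i,0)" "(sad i,0)"] by simp
  hence "orel ?a b" using orel_same[of ?a b] sg by simp
  thus "x:flow_orbit fl (Q ?a)" using orb_mem[OF aY b(1)] b(2) by simp
 qed
 hence 1: "X closure_of (flow_orbit fl (Q ?a)) = flow_orbit fl (Q ?a)" using closure_of_subset[OF orb_top[OF T]] by blast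
 have "(cs 0 + (1,1),1):RR 0 1" using RR_center[of 0 0 "(1,1)" 1 1] by (simp add:reg_def nrm_def zero_prod_def)
 hence ne: "Q (cs 0 + (1,1),1):Q ` RR 0 1" by blast
 have "Q ` RR 0 1 Int Zset X fl (Q ?a) = {}" using RR_Zset[OF _ _ i z] by auto
 hence "Q (cs 0 + (1,1),1)~:X closure_of (Zset X fl (Q ?a))" using ne RR_open[of 0 1] unfolding in_closure_of by auto
 moreover have "Q (cs 0 + (1,1),1):topspace X" using ne openin_subset[OF RR_open[of 0 1]] by auto
 ultimately show ?thesis using 1 T unfolding iso_pt_def by blast
qed

lemma iso_form: "iso_pt X fl x ==> EX i:{1,2}. EX z. z~=0 & x = Q ((sad i,0),z)"
proof -
 assume x: "iso_pt X fl x"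
 hence "x:Q ` Y" unfolding sc.q_onto by (simp add:iso_pt_def)
 then obtain a where a: "a:Y" "x = Q a" by blast
 obtain i v where i: "i:{1,2}" "v:Lat" "fst a = v + (sad i,0)" using iso_saddle[OF a(1)] x a(2) by blast
 have "TT v ((sad i,0),snd a) = a" using i(3) by (simp add:TT_def prod_eq_iff)
 hence "rel ((sad i,0),snd a) a" using rel0_FI(4)[OF i(2), of "((sad i,0),snd a)"] by (simp add:rel_def)
 hence "x = Q ((sad i,0),snd a)" using ker a(2) by metis
 thus ?thesis using i(1) a(1) by (auto simp:Y_def)
qed

lemma Zset_axis: "j<3 ==> nrm u<lam ==> vis j u ==> z~=0 ==> EX i:{1,2}. Q (cs j + u,z):Zset X fl (Q ((sad i,0),z))"
proof -
 assume a: "j<3" "nrm u<lam" "vis j u" "z~=0"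
 have u: "u = (fst u,0)" "abs(fst u)<lam" "fst u~=0" using a by (auto simp:vis_def nrm_def prod_eq_iff)
 define i where "i = (if fst u<0 then j else Suc j)"
 have i: "i:{1,2}" using a(1,3) by (auto simp:vis_def i_def)
 have "src (i - 1)<src j + fst u & src j + fst u<src i" using u(2,3) i gap_bounds lam_bounds by (auto simp:i_def src_def)
 hence "cs j + u:Ax i" 
 proof -
  have "cs j + u = (src j + fst u,0)" using a(3) by (simp add:cs_def prod_eq_iff vis_def)
  thus ?thesis unfolding Ax_def using rp_refl `src (i - 1)<src j + fst u & _` by auto
 qed
 hence "(sad i,0):closure {p. rp (cs j + u) p}" using zs2[OF i] by blast
 moreover have "(cs j + u,z):Y" using Y_center[OF a(1,2)] a(4) u(3) by auto
 ultimately show ?thesis using Zset_same[OF sad_Y[OF i a(4), of 0], of "(cs j + u,z)"] i a(4) by force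
qed

end

context glued_std
begin

text \<open>The leaves miss the open sets \<open>RR\<close>. Conversely, a remaining point either
  lies on a visible ray of one of the pieces, hence on a leaf, or over \<open>Lm\<close>, where the
  unstable leaves are dense by \<open>Vu_dense\<close>.\<close>

lemma Sset_eq: "Sset X fl = Q ` (\<Union>j<3. \<Union>m<3. RR j m)"
proof -
 let ?Z = "\<Union> (Zset X fl ` {x. iso_pt X fl x})"
 have ZT: "?Z<=topspace X" by (auto simp:Zset_def)
 have 1: "Q b~:X closure_of ?Z" if b: "b:RR j m" "j<3" for b j m
 proof -
  have "Q ` RR j m Int ?Z = {}" using RR_Zset[OF _ b(2)] iso_form by fastforce
  thus ?thesis using b RR_open[OF b(2), of m] unfolding in_closure_of by auto
 qed
 have 2: "Q b:X closure_of ?Z" if b: "b:Y" "!!j m. j<3 ==> m<3 ==> b~:RR j m" for b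
 proof (cases "fst b:Lm")
  case False
  have sb: "snd b~=0" using b by (simp add:Y_def)
  obtain n v j u where v: "v:Lat" "j<3" "nrm u<lam" "u~=0" "(fi^^n) (fst b) = v + cs j + u" using W_other[OF b(1) False] by blast
  have "rp (fst b) ((fi^^n) (fst b) + - v)" by (rule rp_trans[OF rp_gen(1) rp_gen(3)[OF Lat_uminus[OF v(1)]]])
  hence r: "rp (fst b) (cs j + u)" unfolding v(5) by simp
  obtain j u where j: "j<3" "nrm u<lam" "u~=0" "orel b (cs j + u,1)"
  proof (cases "snd b>0")
   case True
   thus ?thesis using that[OF v(2-4)] orel_same[of b "(cs j + u,1)"] r by simp
  next
   case False
   have "orel b (cs j + u,-1)" using orel_same[of b "(cs j + u,-1)"] r sb False by simp
   from orel_trans[OF this orel_gl[OF v(2,4,3), of "-1" 1]] show ?thesis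
    by (intro that[of "pj j" "ee j (-1) *R rot u"]) (use v rot_nz[OF v(4)] in "auto simp:nrm_scale")
  qed
  have "~ (EX m<3. u:reg j m)" using b(2)[OF j(1)] j b(1) by (auto simp:RR_def)
  hence "vis j u | vis (pj j) (ep j *R rot u)" using vis_reg[OF j(1,3)] by blast
  hence "EX c:Y. orel b c & (EX x. iso_pt X fl x & Q c:Zset X fl x)"
  proof
   assume "vis j u"
   thus ?thesis using Zset_axis[OF j(1,2), of 1] iso_sad j(4) Y_center[OF j(1,2), of 1] j(3) by (metis zero_neq_one)
  next
   assume vv: "vis (pj j) (ep j *R rot u)"
   have nz: "ep j *R rot u~=0" "nrm (ep j *R rot u)<lam" using rot_nz[OF j(3), of j 1] j(2) eps[of j] by (auto simp:nrm_scale)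
   have "orel b (cs (pj j) + ep j *R rot u,-1)" using orel_trans[OF j(4) orel_gl[OF j(1,3,2), of 1 "-1"]] by (simp add:ee_def)
   moreover have "(cs (pj j) + ep j *R rot u,-1):Y" using Y_center[OF _ nz(2), of "pj j" "-1"] nz j(1) by simp
   ultimately show ?thesis using Zset_axis[OF _ nz(2) vv, of "-1"] iso_sad j(1) by (metis neg_equal_0_iff_equal pj_less zero_neq_one)
  qed
  hence "Q b:?Z" using Zset_orel[OF b(1)] by blast
  thus ?thesis using closure_of_subset[OF ZT] by blast
 next
  case True
  have sb: "snd b~=0" using b by (simp add:Y_def)
  show ?thesis unfolding in_closure_of
  proof (intro conjI allI impI)
   show "Q b:topspace X" using b sc.q_onto by blast
   fix T assume T: "Q b:T & openin X T"
   let ?N = "(%p. (p,snd b)) -` (Y Int Q -` T)"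
   have "open ?N" using T by (intro sc.preimage_open continuous_intros) auto
   moreover have "fst b:?N" using b T by simp
   ultimately obtain i p where p: "i:{1,2}" "p:?N" "p:Vu i" using Vu_dense[OF True] by (meson disjoint_iff)
   have "(sad i,0):closure {p'. rp p p'}" using zs2[OF p(1)] p(3) by blast
   hence "Q (p,snd b):Zset X fl (Q ((sad i,0),snd b))"
    using Zset_same[OF sad_Y[OF p(1) sb, of 0], of "(p,snd b)"] p(2) sb by force
   thus "EX y. y:?Z & y:T" using iso_sad[OF p(1) sb] p(2) by auto
  qed
 qed
 have "x:Sset X fl <-> x:Q ` (\<Union>j<3. \<Union>m<3. RR j m)" for x
 proof
  assume "x:Sset X fl"
  hence "x:Q ` Y" and nx: "x~:X closure_of ?Z" unfolding Sset_def sc.q_onto by blast+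
  then obtain b where b: "b:Y" "x = Q b" by blast
  then obtain j m where "j<3" "m<3" "b:RR j m" using 2[OF b(1)] nx by blast
  thus "x:Q ` (\<Union>j<3. \<Union>m<3. RR j m)" using b(2) by blast
 next
  assume "x:Q ` (\<Union>j<3. \<Union>m<3. RR j m)"
  then obtain b j m where "x = Q b" "b:RR j m" "j<3" by auto
  thus "x:Sset X fl" using 1 openin_subset[OF RR_open] unfolding Sset_def by blast
 qed
 thus ?thesis by blast
qed

lemma cmp_eq: "b:RR j m ==> j<3 ==> m<3 ==> cmp X fl (Q b) = Q ` RR j m"
proof (intro equalityI subsetI)
 assume b: "b:RR j m" "j<3" "m<3"
 fix x
 { assume "x:Q ` RR j m"
  thus "x:cmp X fl (Q b)" unfolding cmp_def Sset_eq using RR_conn[OF b(2), of m] b by blast }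
 { assume "x:cmp X fl (Q b)"
  then obtain C where C: "connectedin X C" "C<=Q ` (\<Union>j<3. \<Union>m<3. RR j m)" "Q b:C" "x:C" unfolding cmp_def Sset_eq by blast
  let ?A = "Q ` RR j m" and ?B = "\<Union>j'<3. UN m':{..<3} - (if j' = j then {m} else {}). Q ` RR j' m'"
  have "openin X ?A" "openin X ?B" using RR_open b(2) by auto
  moreover have CAB: "C<=?A Un ?B"
  proof
   fix y assume "y:C"
   then obtain j' m' where y: "j'<3" "m'<3" "y:Q ` RR j' m'" using C(2) by blast
   show "y:?A Un ?B"
   proof (cases "j' = j & m' = m")
    case False hence "m':{..<3} - (if j' = j then {m} else {})" using y(2) by auto
    thus ?thesis using y by blast
   qed (use y in blast)
  qed
  moreover have "?A Int ?B Int C = {}"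
  proof -
   have False if yA: "y:?A" and yB: "y:?B" for y
   proof -
    obtain a where a: "y = Q a" "a:RR j m" using yA by blast
    obtain j' m' where j': "j'<3" "m':{..<3} - (if j' = j then {m} else {})" "y:Q ` RR j' m'" using yB by blast
    have "a:Y" using a(2) by (simp add:RR_def)
    hence "a:RR j' m'" using j'(3) RR_Q[OF `a:Y`, of j' m'] a(1) by simp
    hence "j' = j" "m' = m" using RR_disj[OF a(2) _ b(2) j'(1)] by blast+
    thus False using j'(2) by simp
   qed
   thus ?thesis by blast
  qed
  ultimately have "~ (?A Int C~={} & ?B Int C~={})" using C(1) unfolding connectedin by meson
  moreover have "Q b:?A Int C" using C(3) b(1) by simp
  ultimately have nB: "?B Int C = {}" by auto
  show "x:Q ` RR j m" using subsetD[OF CAB C(4)]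
  proof
   assume "x:?B"
   hence "x:?B Int C" using C(4) by simp
   thus ?thesis unfolding nB by simp
  qed }
qed

end

context glued_std
begin

text \<open>The index \<open>(j, m)\<close> of the component containing a quadrant at the \<open>i\<close>-th saddle, in the piece
  \<open>z > 0\<close> if \<open>pos\<close>; \<open>sg0\<close> stands for the right and \<open>ta\<close> for the upper half.\<close>

definition lab :: "bool => nat => bool => bool => nat \<times> nat" where
 "lab pos i sg0 ta = (if pos
   then (if i = 1 then (if sg0 then (1,if ta = (ep 1 = 1) then 0 else 2) else (0,if ta then 1 else 2))
      else (if sg0 then (2,if ta then 1 else 0) else (1,if ta = (ep 1 = 1) then 0 else 1)))
   else (if i = 1 then (if sg0 then (0,if ta then 1 else 0) else (1,if ta = (ep 1 = 1) then 1 else 2))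
      else (if sg0 then (2,if ta then 0 else 1) else (0,if ta then 2 else 0))))"

lemma RR_orel: "a:Y ==> b:Y ==> orel a b ==> a:RR j m <-> b:RR j m"
 using fs_RR[of j m] orel_sym[of a b] unfolding fs_def by blast

text \<open>Verifies the table. From the quadrant \<open>fi\<close> leads to source
  \<open>k\<close>; for \<open>z > 0\<close> the sector is read off there, for \<open>z < 0\<close>
  after crossing the glueing, whose sign is then \<open>- ep (pj k)\<close>.\<close>

lemma lab_reg:
 assumes i: "i:{1,2}" and m: "m<3" and u: "fst u<0 <-> sg0" "fst u>0 <-> ~ sg0" "snd u>0 <-> ta" "snd u<0 <-> ~ ta"
  and k: "k = (if sg0 then i else i - 1)"
 shows "j = k & u:reg j m <-> (j,m) = lab True i sg0 ta"
  "j = pj k & - ep (pj k) *R rot u:reg j m <-> (j,m) = lab False i sg0 ta"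
proof -
 have c: "ep 1 = 1 | ep 1 = -1" "m = 0 | m = 1 | m = 2" using eps m by auto
 note d = lab_def reg_def pj_def rot_def u e0 e2
 show "j = k & u:reg j m <-> (j,m) = lab True i sg0 ta" unfolding k using i c by (elim disjE insertE emptyE; cases sg0; cases ta; simp add:d One_nat_def[symmetric] cong:conj_cong del:One_nat_def)
 show "j = pj k & - ep (pj k) *R rot u:reg j m <-> (j,m) = lab False i sg0 ta" unfolding k using i c by (elim disjE insertE emptyE; cases sg0; cases ta; simp add:d cong:conj_cong del:One_nat_def)
qed

lemma strip_lab:
 assumes i: "i:{1,2}" and p: "p:strip i" "fst p~=sad i" "snd p~=0" and z: "z~=0" and j: "j<3" "m<3"
 shows "(p,z):RR j m <-> (j,m) = lab (z>0) i (fst p>sad i) (snd p>0)"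
proof -
 define k where "k = (if fst p>sad i then i else i - 1)"
 obtain u where u: "rp p (cs k + u)" "nrm u<1" "fst u*(fst p - sad i)<0" "sgn (snd u) = sgn (snd p)"
  using strip_dir[OF i p(1,2)] unfolding k_def by blast
 have k: "k<3" unfolding k_def using idx(1,2)[OF i] by simp
 have nu: "u~=0" "nrm u<lam" using u(2,3) lam_bounds by auto
 have uY: "(cs k + u,w):Y" if "w~=0" for w using Y_center[OF k nu(2)] nu(1) that by simp
 have pY: "(p,z):Y" using strip_U[OF i p(1)] z by (simp add:Y_def)
 have "fst u<0 <-> fst p>sad i" "fst u>0 <-> ~ fst p>sad i" using u(3) by (auto simp:mult_less_0_iff)
 moreover have "snd u>0 <-> snd p>0" "snd u<0 <-> ~ snd p>0" using u(4) p(3) by (auto simp:sgn_if split:if_splits)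
 ultimately have l: "(j = k & u:reg j m) = ((j,m) = lab True i (fst p>sad i) (snd p>0))"
  "(j = pj k & - ep (pj k) *R rot u:reg j m) = ((j,m) = lab False i (fst p>sad i) (snd p>0))"
  using lab_reg[OF i j(2) _ _ _ _ k_def, where j = j and u = u and ta = "snd p>0"] by simp_all
 show ?thesis
 proof (cases "z>0")
  case True
  have "(p,z):RR j m <-> (cs k + u,1):RR j m" using RR_orel[OF pY uY[of 1] orel_eq[OF _ u(1)]] True by simp
  also have "... <-> j = k & u:reg j m" using RR_center[OF j(1) k nu] by simp
  also have "... <-> (j,m) = lab (z>0) i (fst p>sad i) (snd p>0)"
   using l(1) True by simp
  finally show ?thesis .
 next
  case False
  let ?w = "ee k (-1) *R rot u"
  have nw: "?w~=0" "nrm ?w<lam" using rot_nz[OF nu(1)] nu(2) by (auto simp:nrm_scale)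
  have kp: "pj k<3" using k by simp
  have "orel (p,z) (cs (pj k) + ?w,1)"
   using orel_trans[OF orel_eq[OF _ u(1), of z "-1"] orel_gl[OF k nu, of "-1" 1]] False z by simp
  hence "(p,z):RR j m <-> (cs (pj k) + ?w,1):RR j m"
   using RR_orel[OF pY, of "(cs (pj k) + ?w,1)"] Y_center[OF kp nw(2)] nw(1) by simp
  also have "... <-> j = pj k & ?w:reg j m" using RR_center[OF j(1) kp nw] by simp
  also have "... <-> (j,m) = lab (z>0) i (fst p>sad i) (snd p>0)"
   using l(2) False by (simp add:ee_def)
  finally show ?thesis .
 qed
qed

text \<open>Describes the quadrants whose closure contains \<open>p\<close>: on a leaf the side of
  that leaf is left open, at the saddle both sides are.\<close>

definition adj :: "nat => real*real => real => nat => nat => bool" where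
 "adj i p z j m <-> (EX sg0 ta. (fst p~=sad i --> sg0 = (fst p>sad i)) & (snd p~=0 --> ta = (snd p>0)) & lab (z>0) i sg0 ta = (j,m))"

text \<open>Points of a component near \<open>p\<close> avoid both leaves, so they lie in open
  quadrants, where \<open>strip_lab\<close> decides; conversely \<open>p\<close> is pushed slightly
  into a suitable quadrant.\<close>

lemma closure_RR:
 assumes i: "i:{1,2}" and p: "p:strip i" and z: "z~=0" and j: "j<3" "m<3"
 shows "Q (p,z):X closure_of (Q ` RR j m) <-> adj i p z j m"
proof -
 have pY: "(p,z):Y" using strip_U[OF i p(1)] z by (simp add:Y_def)
 have "Q (p,z):X closure_of (Q ` RR j m) <-> p:closure {p'. (p',z):RR j m}" using cl_sat[OF fs_RR pY] by simp
 also have "... <-> adj i p z j m"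
 proof
  assume cl: "p:closure {p'. (p',z):RR j m}"
  define N where "N = strip i Int {p'. (fst p>sad i --> fst p'>sad i) & (fst p<sad i --> fst p'<sad i)
   & (snd p>0 --> snd p'>0) & (snd p<0 --> snd p'<0)}"
  have "open {p' :: real*real. a --> fst p'>s}" "open {p' :: real*real. a --> fst p'<s}"
   "open {p' :: real*real. a --> snd p'>s}" "open {p' :: real*real. a --> snd p'<s}" for a s
   by (cases a; simp; intro open_Collect_less continuous_intros)+
  hence "open N" unfolding N_def by (intro open_Int open_strip open_Collect_conj)
  moreover have "p:N" using p by (simp add:N_def)
  ultimately obtain p' where p': "p':N" "(p',z):RR j m" using cl unfolding closure_iff_nhds_not_empty by blast
  have st: "p':strip i" using p' by (simp add:N_def)
  have Y': "(p',z):Y" using p'(2) by (simp add:RR_def)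
  have nz: "p'~:Vu i Un Ax i"
  proof
   assume "p':Vu i Un Ax i"
   from zs2[OF i this] have "Q (p',z):Zset X fl (Q ((sad i,0),z))"
    using Zset_same[OF sad_Y[OF i z, of 0] Y'] z by force
   thus False using RR_Zset[OF p'(2) j(1) i z] by blast
  qed
  have 1: "fst p'~=sad i"
  proof
   assume "fst p' = sad i"
   hence "rp p' (sad i,snd p')" using rp_refl[of p'] by (metis prod.collapse)
   thus False using nz Vu_rp[OF i, of p'] st unfolding strip_def by auto
  qed
  have 2: "snd p'~=0"
  proof
   assume "snd p' = 0"
   hence "rp p' (fst p',0)" using rp_refl[of p'] by (metis prod.collapse)
   thus False using nz st unfolding strip_def Ax_def by blast
  qed
  have "lab (z>0) i (fst p'>sad i) (snd p'>0) = (j,m)" using strip_lab[OF i st 1 2 z j] p'(2) by simp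
  thus "adj i p z j m" unfolding adj_def using p'(1) by (intro exI[of _ "fst p'>sad i"] exI[of _ "snd p'>0"] conjI) (auto simp:N_def)
 next
  assume "adj i p z j m"
  then obtain sg0 ta where s: "fst p~=sad i --> sg0 = (fst p>sad i)" "snd p~=0 --> ta = (snd p>0)" "lab (z>0) i sg0 ta = (j,m)"
   unfolding adj_def by force
  show "p:closure {p'. (p',z):RR j m}" unfolding closure_approachable
  proof (intro allI impI)
   fix e :: real assume e: "e>0"
   obtain d where d: "d>0" "ball p d<=strip i" using open_strip p open_contains_ball by meson
   define r where "r = min d e/3"
   have r: "r>0" "2*r<d" "2*r<e" using d(1) e by (auto simp:r_def)
   define h where "h = (if sg0 then r else - r,if ta then r else - r)"
   have "norm h<=norm (fst h) + norm (snd h)" using norm_Pair_le[of "fst h" "snd h"] by simp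
   also have "... = 2*r" using r by (simp add:h_def)
   finally have h: "norm h<d" "norm h<e" using r by auto
   have "p + h:strip i" using d(2) h(1) by (auto simp:dist_norm)
   moreover have "fst (p + h)~=sad i & (fst (p + h)>sad i) = sg0" using s(1) r(1) by (cases sg0) (auto simp:h_def)
   moreover have "snd (p + h)~=0 & (snd (p + h)>0) = ta" using s(2) r(1) by (cases ta) (auto simp:h_def)
   ultimately have "(p + h,z):RR j m" using strip_lab[OF i _ _ _ z j, of "p + h"] s(3) by simp
   thus "EX y:{p'. (p',z):RR j m}. dist y p<e" using h(2) by (intro bexI[of _ "p + h"]) (auto simp:dist_norm)
  qed
 qed
 finally show ?thesis .
qed

lemma sad_self: "i:{1,2} ==> (sad i,0):strip i" using sad_strip[of i 0] by simp

lemma lab_less: "lab pos i sg0 ta = (j,m) ==> j<3 & m<3" by (auto simp:lab_def split:if_splits)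

lemma RR_ne:
 assumes "lab True i sg0 ta = (j,m)" "i:{1,2}"
 shows "EX b:Y. b:RR j m"
proof -
 have "adj i (sad i,0) 1 j m" using assms(1) by (auto simp:adj_def)
 hence "Q ((sad i,0),1):X closure_of (Q ` RR j m)" using closure_RR[OF assms(2) sad_self[OF assms(2)], of 1] lab_less[OF assms(1)] by simp
 hence "RR j m~={}" by auto
 thus ?thesis by (auto simp:RR_def)
qed

lemma Zset_point:
 assumes i: "i:{1,2}" and b: "b:Y" "Q b:Zset X fl (Q ((sad i,0),1))"
 obtains p where "p:strip i" "orel b (p,1)" "fst p = sad i | snd p = 0"
proof -
 have aY: "((sad i,0),1):Y" using sad_Y[OF i] by simp
 have "(sad i,0):closure {p. p:U & orel b (p,1)}" using Zset_mem[OF aY b(1)] b(2) by simp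
 hence "{p. p:U & orel b (p,1)}~={}" by force
 then obtain p where p: "p:U" "orel b (p,1)" by blast
 have pY: "(p,1):Y" using p by (simp add:Y_def)
 have "Q (p,1):Zset X fl (Q ((sad i,0),1))" using Zset_orel[OF b(1) pY p(2)] b(2) by simp
 hence "(sad i,0):closure {p'. rp p p'}" using Zset_same[OF aY pY] by simp
 hence "p:Vu i Un Ax i" by (rule zs1[OF i])
 thus thesis
 proof
  assume "p:Vu i"
  then obtain t where t: "abs t<1" "rp p (sad i,t)" using Vu_rp[OF i] by blast
  show thesis by (rule that[of "(sad i,t)"]) (use t sad_strip[OF i] orel_trans[OF p(2) orel_eq[OF _ t(2), of 1 1]] in auto)
 next
  assume "p:Ax i"
  then obtain t where t: "src (i - 1)<t" "t<src i" "rp p (t,0)" unfolding Ax_def by blast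
  show thesis by (rule that[of "(t,0)"]) (use t orel_trans[OF p(2) orel_eq[OF _ t(3), of 1 1]] in "auto simp:strip_def")
 qed
qed

text \<open>The components \<open>(0, 1)\<close> and \<open>(1, 2)\<close> are the upper left and
  lower right quadrants at saddle \<open>1\<close> of the piece \<open>z > 0\<close>. At saddle
  \<open>1\<close> of the other piece they are the upper right and lower left ones.\<close>

lemma opposite_pos: assumes e1: "ep 1 = 1" shows "opposite X fl"
proof -
 have i: "(1 :: nat):{1,2}" by simp
 let ?a = "((sad 1,0),1) :: pt" and ?a' = "((sad 1,0),-1) :: pt"
 have aY: "?a:Y" "?a':Y" using sad_Y[OF i] by auto
 have l: "lab True 1 False True = (0,1)" "lab True 1 True False = (1,2)" "lab False 1 True True = (0,1)" "lab False 1 False False = (1,2)"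
  using e1 by (simp_all add:lab_def)
 obtain b where b: "b:Y" "b:RR 0 1" using RR_ne[OF l(1)] by auto
 obtain b' where b': "b':Y" "b':RR 1 2" using RR_ne[OF l(2)] by auto
 have c: "cmp X fl (Q b) = Q ` RR 0 1" "cmp X fl (Q b') = Q ` RR 1 2" using cmp_eq[OF b(2)] cmp_eq[OF b'(2)] by auto
 have adj: "adj 1 (sad 1,0) 1 0 1" "adj 1 (sad 1,0) 1 1 2" "adj 1 (sad 1,0) (-1) 0 1" "adj 1 (sad 1,0) (-1) 1 2"
  using l by (auto simp:adj_def)
 show ?thesis unfolding opposite_def
 proof (intro exI conjI)
  show "iso_pt X fl (Q ?a)" "iso_pt X fl (Q ?a')" using iso_sad[OF i] by auto
  show "Q ?a'~:flow_orbit fl (Q ?a)"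
   using orb_mem[OF aY] orel_Lm_sign[OF _ aY] sad_Lm[OF i, of 0] by auto
  show "Q b:Sset X fl" unfolding Sset_eq using b(2) by force
  show "Q b':Sset X fl" unfolding Sset_eq using b'(2) by force
  show "Q b'~:cmp X fl (Q b)" unfolding c using RR_Q[OF b'(1), of 0 1] RR_disj[OF b'(2), of 0 1] by auto
  show "{Q ?a,Q ?a'}<=X closure_of (cmp X fl (Q b)) Int X closure_of (cmp X fl (Q b'))"
   unfolding c using closure_RR[OF i sad_self[OF i]] adj by simp
  show "X closure_of (cmp X fl (Q b)) Int X closure_of (cmp X fl (Q b')) Int Zset X fl (Q ?a)<=flow_orbit fl (Q ?a)"
   unfolding c
  proof (intro subsetI, elim IntE)
   fix x assume x: "x:X closure_of (Q ` RR 0 1)" "x:X closure_of (Q ` RR 1 2)" "x:Zset X fl (Q ?a)"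
   hence "x:Q ` Y" unfolding sc.q_onto by (simp add:Zset_def)
   then obtain d where d: "d:Y" "x = Q d" by blast
   obtain p where p: "p:strip 1" "orel d (p,1)" "fst p = sad 1 | snd p = 0" using Zset_point[OF i d(1)] x(3) d(2) by blast
   have "Q (p,1):X closure_of (Q ` RR 0 1)" "Q (p,1):X closure_of (Q ` RR 1 2)"
    using cl_orel[OF fs_RR d(1) p(2)] x(1,2) d(2) by auto
   hence "adj 1 p 1 0 1" "adj 1 p 1 1 2" using closure_RR[OF i p(1)] by auto
   hence "fst p = sad 1" "snd p = 0" using e1 by (auto simp:adj_def lab_def split:if_splits)
   hence "p = (sad 1,0)" by (simp add:prod_eq_iff)
   hence "orel ?a d" using p(2) orel_sym by blast
   thus "x:flow_orbit fl (Q ?a)" using orb_mem[OF aY(1) d(1)] d(2) by simp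
  qed
 qed
qed

lemma lab_same:
 assumes "ep 1 = -1" "i:{1,2}" "lab True i s t = lab False i s' t'"
 shows "i = 1 & t & t' | i = 2 & s & s'"
 using assms(2,3) by (elim insertE emptyE; cases s; cases t; cases s'; cases t'; simp add:lab_def assms(1)[simplified])

lemma lab_diff:
 assumes "ep 1 = -1" "lab pos 1 s t = lab pos' 2 s' t'"
 shows "lab pos 1 s t = (if pos then if pos' then (1,0) else (0,2) else if pos' then (1,1) else (0,0))"
 using assms(2) by (cases pos; cases pos'; cases s; cases t; cases s'; cases t'; simp add:lab_def assms(1)[simplified])

text \<open>For saddles of different index the two signs determine the common component, so two
  distinct ones cannot occur. For equal index the common components lie in the upper half at saddle
  \<open>1\<close> and in the right half at saddle \<open>2\<close>.\<close>

lemma lab_pairs: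
 assumes e: "ep 1 = -1" and i: "i:{1,2}" "i':{1,2}" and n: "~ (i = i' & pos = pos')" "r~=r'"
  and l: "lab pos i s1 t1 = r" "lab pos i s2 t2 = r'" "lab pos' i' s3 t3 = r" "lab pos' i' s4 t4 = r'"
 shows "i = 1 & t1 & t2 | i = 2 & s1 & s2"
proof -
 consider "i = i'" "pos" "~ pos'" | "i = i'" "~ pos" "pos'" | "i = 1" "i' = 2" | "i = 2" "i' = 1" using i n(1) by blast
 thus ?thesis
 proof cases
  case 1
  thus ?thesis using lab_same[OF e i(1), of s1 t1 s3 t3] lab_same[OF e i(1), of s2 t2 s4 t4] l by auto
 next
  case 2
  thus ?thesis using lab_same[OF e i(1), of s3 t3 s1 t1] lab_same[OF e i(1), of s4 t4 s2 t2] l by auto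
 next
  case 3
  hence "r = r'" using lab_diff[OF e, of pos s1 t1 pos' s3 t3] lab_diff[OF e, of pos s2 t2 pos' s4 t4] l by simp
  thus ?thesis using n(2) by simp
 next
  case 4
  hence "r = r'" using lab_diff[OF e, of pos' s3 t3 pos s1 t1] lab_diff[OF e, of pos' s4 t4 pos s2 t2] l by simp
  thus ?thesis using n(2) by simp
 qed
qed

text \<open>By \<open>lab_pairs\<close> the two components are adjacent along a half leaf of the
  first saddle. A point of it, above saddle \<open>1\<close> or to the right of saddle
  \<open>2\<close>, lies in both closures and in \<open>Zset\<close>, but not on the saddle
  orbit.\<close>

lemma opposite_neg: assumes e1: "ep 1 = -1" shows "~ opposite X fl"
proof
 assume "opposite X fl"
 then obtain x x' y y' where x: "iso_pt X fl x" "iso_pt X fl x'" "x'~:flow_orbit fl x" "y:Sset X fl" "y':Sset X fl"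
  "y'~:cmp X fl y" "{x,x'}<=X closure_of (cmp X fl y) Int X closure_of (cmp X fl y')"
  "X closure_of (cmp X fl y) Int X closure_of (cmp X fl y') Int Zset X fl x<=flow_orbit fl x"
  unfolding opposite_def by auto
 obtain i z where i: "i:{1,2}" "z~=0" "x = Q ((sad i,0),z)" using iso_form[OF x(1)] by blast
 obtain i' z' where i': "i':{1,2}" "z'~=0" "x' = Q ((sad i',0),z')" using iso_form[OF x(2)] by blast
 have Sx: "EX j m b. j<3 & m<3 & b:RR j m & y = Q b" if "y:Sset X fl" for y using that unfolding Sset_eq by blast
 obtain j m b where j: "j<3" "m<3" "b:RR j m" "y = Q b" using Sx[OF x(4)] by blast
 obtain j' m' b' where j': "j'<3" "m'<3" "b':RR j' m'" "y' = Q b'" using Sx[OF x(5)] by blast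
 note c = cmp_eq[OF j(3,1,2), folded j(4)] cmp_eq[OF j'(3,1,2), folded j'(4)]
 have ne: "(j,m)~=(j',m')" using x(6) j' unfolding c by blast
 have cls: "x:X closure_of (Q ` RR j m)" "x:X closure_of (Q ` RR j' m')" "x':X closure_of (Q ` RR j m)" "x':X closure_of (Q ` RR j' m')"
  using x(7) unfolding c by blast+
 obtain s1 t1 where 1: "lab (z>0) i s1 t1 = (j,m)" using cls(1) unfolding i(3) closure_RR[OF i(1) sad_self[OF i(1)] i(2) j(1,2)] adj_def by blast
 obtain s2 t2 where 2: "lab (z>0) i s2 t2 = (j',m')" using cls(2) unfolding i(3) closure_RR[OF i(1) sad_self[OF i(1)] i(2) j'(1,2)] adj_def by blast
 obtain s3 t3 where 3: "lab (z'>0) i' s3 t3 = (j,m)" using cls(3) unfolding i'(3) closure_RR[OF i'(1) sad_self[OF i'(1)] i'(2) j(1,2)] adj_def by blast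
 obtain s4 t4 where 4: "lab (z'>0) i' s4 t4 = (j',m')" using cls(4) unfolding i'(3) closure_RR[OF i'(1) sad_self[OF i'(1)] i'(2) j'(1,2)] adj_def by blast
 have aY: "((sad i,0),z):Y" using sad_Y[OF i(1,2)] by simp
 have "~ (i = i' & (z>0) = (z'>0))"
 proof
  assume a: "i = i' & (z>0) = (z'>0)"
  hence "z*z'>0" using i(2) i'(2) by (auto simp:zero_less_mult_iff)
  hence "orel ((sad i,0),z) ((sad i',0),z')" using a orel_eq[OF _ rp_refl] by blast
  thus False using x(3) orb_mem[OF aY sad_Y[OF i'(1,2), of 0]] unfolding i(3) i'(3) by simp
 qed
 from lab_pairs[OF e1 i(1) i'(1) this ne 1 2 3 4] have "i = 1 & t1 & t2 | i = 2 & s1 & s2" .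
 hence "EX p. p:strip i & p:Vu i Un Ax i & ~ rp (sad i,0) p & adj i p z j m & adj i p z j' m'"
 proof
  assume a: "i = 1 & t1 & t2"
  have "~ rp (sad i,0) (sad i,1/2)"
  proof
   assume "rp (sad i,0) (sad i,1/2)"
   from rp_sad[OF i(1) this] have "(0,1/2):Lat" by simp
   from Lat_small[OF this] X0 show False by (simp add:zero_prod_def)
  qed
  moreover have "(sad i,1/2):Vu i" using Vu_rp[OF i(1)] rp_refl[of "(sad i,1/2)"] by force
  moreover have "adj i (sad i,1/2) z j m" unfolding adj_def by (rule exI[of _ s1], rule exI[of _ t1]) (use a 1 in simp)
  moreover have "adj i (sad i,1/2) z j' m'" unfolding adj_def by (rule exI[of _ s2], rule exI[of _ t2]) (use a 2 in simp)
  ultimately show ?thesis using sad_strip[OF i(1), of "1/2"] by auto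
 next
  assume a: "i = 2 & s1 & s2"
  have b: "src (i - 1)<sad i + 1" "sad i + 1<src i" using gap_bounds a by (auto simp:src_def sad_def)
  have "~ rp (sad i,0) (sad i + 1,0)"
  proof
   assume "rp (sad i,0) (sad i + 1,0)"
   from rp_sad[OF i(1) this] have "(1,0):Lat" by simp
   from Lat_small[OF this] X0 show False by (simp add:zero_prod_def)
  qed
  moreover have "(sad i + 1,0):Ax i" unfolding Ax_def using b rp_refl by blast
  moreover have "(sad i + 1,0):strip i" using b by (simp add:strip_def)
  moreover have "adj i (sad i + 1,0) z j m" unfolding adj_def by (rule exI[of _ s1], rule exI[of _ t1]) (use a 1 in simp)
  moreover have "adj i (sad i + 1,0) z j' m'" unfolding adj_def by (rule exI[of _ s2], rule exI[of _ t2]) (use a 2 in simp)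
  ultimately show ?thesis by auto
 qed
 then obtain p where p: "p:strip i" "p:Vu i Un Ax i" "~ rp (sad i,0) p" "adj i p z j m" "adj i p z j' m'" by blast
 have pY: "(p,z):Y" using strip_U[OF i(1) p(1)] i(2) by (simp add:Y_def)
 have zz: "z*z>0" using i(2) by (auto simp:zero_less_mult_iff)
 have "Q (p,z):Zset X fl x" using zs2[OF i(1) p(2)] Zset_same[OF aY pY] zz unfolding i(3) by simp
 moreover have "Q (p,z):X closure_of (Q ` RR j m)" "Q (p,z):X closure_of (Q ` RR j' m')"
  using closure_RR[OF i(1) p(1) i(2)] p(4,5) j(1,2) j'(1,2) by auto
 ultimately have "Q (p,z):flow_orbit fl x" using x(8) unfolding c by blast
 thus False using orb_mem[OF aY pY] orel_same[of "((sad i,0),z)" "(p,z)"] zz p(3) unfolding i(3) by simp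
qed

end

section \<open>Periodic orbits, non-transitivity and the conclusion\<close>

context glued_cover
begin

text \<open>Otherwise the orbit has a representative near a source with displacement
  \<open>u\<close>. A return with the same sign of height is a scaling that fixes \<open>u\<close>,
  so the height is unchanged and the elapsed time is zero.\<close>

lemma periodic_Lm:
 assumes a: "a:Y" and T: "T>0" "fl T (Q a) = Q a" shows "fst a:Lm"
proof (rule ccontr)
 assume "fst a~:Lm"
 from W_other[OF a this] obtain n v j u where v: "v:Lat" "j<3" "nrm u<lam" "u~=0" "(fi^^n) (fst a) = v + cs j + u" by blast
 have sa: "snd a~=0" using a by (simp add:Y_def)
 have "rp (fst a) ((fi^^n) (fst a) + - v)" by (rule rp_trans[OF rp_gen(1) rp_gen(3)[OF Lat_uminus[OF v(1)]]])
 hence r: "rp (fst a) (cs j + u)" unfolding v(5) by simp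
 define b where "b = (cs j + u,snd a)"
 have "snd a * snd b>0" using sa by (auto simp:b_def zero_less_mult_iff)
 hence "orel a b" using orel_same[of a b] r by (simp add:b_def)
 then obtain s where s: "rel (Ft s a) b" unfolding orel_def by blast
 have "Q (Ft T b) = fl T (fl s (Q a))" using s ker fl_Q by metis
 also have "... = fl s (fl T (Q a))" by (simp add:fl_Q flip:Ft_add) (simp add:add.commute)
 also have "... = Q b" using T(2) s ker fl_Q by metis
 finally have "rel (Ft T b) b" using ker by blast
 moreover have "~ relG (Ft T b) b"
  using relG_sign[of "Ft T b" b] sa by (auto simp:b_def Ft_def zero_less_mult_iff)
 ultimately have "rel0 (Ft T b) b" by (simp add:rel_def)
 then obtain n m w where w: "w:Lat" "(FI^^n) (Ft T b) = TT w ((FI^^m) b)" unfolding rel0_def by blast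
 have l: "nrm u<=lam" using v by simp
 have small: "nrm ((1/lam^n) *R u)<=3" for n
 proof -
  have "1/lam^n*nrm u<=1*lam" using l by (intro mult_mono) auto
  thus ?thesis using lam_bounds by (simp add:nrm_scale)
 qed
 have 1: "0 + cs j + (1/lam^n) *R u = w + cs j + (1/lam^m) *R u"
  and 2: "lam^n*(exp (T * sgn (snd a)) * snd a) = lam^m * snd a"
  using w(2) by (simp_all add:b_def Ft_def FI_pow_lin[OF v(2) l] TT_def)
 from cs_unique[OF Lat_0 w(1) v(2,2) 1] small have "(1/lam^n) *R u = (1/lam^m) *R u" by blast
 hence "lam^n = lam^m" using v(4) by simp
 hence "exp (T * sgn (snd a)) = 1" using 2 sa by simp
 thus False using T(1) sa by (simp add:sgn_if split:if_splits)
qed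

end

context glued_std
begin

text \<open>A dense orbit would enter two disjoint open invariant sets, the components
  \<open>(0, 1)\<close> and \<open>(0, 2)\<close>.\<close>

lemma not_transitive: "~ transitive_flow X fl"
proof
 assume "transitive_flow X fl"
 then obtain x where x: "x:topspace X" "X closure_of (flow_orbit fl x) = topspace X" unfolding transitive_flow_def by blast
 obtain a where a: "a:Y" "x = Q a" using x(1) sc.q_onto by blast
 have "EX b:RR 0 m. orel a b" if m: "m = 1 | m = 2" for m
 proof -
  have "EX b. b:RR 0 m" using RR_ne[of 1 False True] RR_ne[of 1 False False] m by (auto simp:lab_def)
  then obtain b where b: "b:RR 0 m" by blast
  hence "Q b:X closure_of (flow_orbit fl x)" unfolding x(2) using sc.q_onto by (auto simp:RR_def)
  then obtain y where y: "y:flow_orbit fl x" "y:Q ` RR 0 m" using RR_open[of 0 m] b unfolding in_closure_of by auto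
  then obtain c where c: "c:RR 0 m" "y = Q c" by blast
  hence "orel a c" using orb_mem[OF a(1), of c] y(1) a(2) by (simp add:RR_def)
  thus ?thesis using c(1) by blast
 qed
 then obtain b c where b: "b:RR 0 1" "orel a b" and c: "c:RR 0 2" "orel a c" by blast
 have "orel b c" using orel_trans[OF orel_sym[OF b(2)] c(2)] .
 hence "c:RR 0 1" using RR_orel[of b c 0 1] b(1) c(1) by (simp add:RR_def)
 thus False using RR_disj[OF c(1), of 0 1] by simp
qed

end

lemma periodic_classes_cong:
 assumes "!!p T. periodic_point X ph p T ==> periodic_point X ps p T & (ALL t. ph t p = ps t p)"
  "!!p T. periodic_point X ps p T ==> periodic_point X ph p T & (ALL t. ph t p = ps t p)"
 shows "periodic_classes X x0 ph = periodic_classes X x0 ps"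
proof -
 have "represents_periodic_orbit X ph a <-> represents_periodic_orbit X ps a" for a
  unfolding represents_periodic_orbit_def using assms by (metis (no_types, lifting) ext)
 thus ?thesis by (simp add:periodic_classes_def)
qed

locale glued_pair = c1: glued_cover P P' X0 ep X A Q K + c2: glued_cover P P' X0 ep' X A Q' K'
 for P P' X0 ep ep' and X :: "'a topology" and A Q Q' K K' +
 assumes agree: "!!a. fst a:da_map.Lm P X0 ==> Q a = Q' a"
begin

text \<open>By \<open>periodic_Lm\<close> periodic points are projections of points over
  \<open>Lm\<close>, which the flow does not leave and where \<open>Q\<close> and \<open>Q'\<close>
  coincide.\<close>

lemma periodic_agree:
 "periodic_point X c1.fl p T ==> c1.fl t p = c2.fl t p" "periodic_point X c2.fl p T ==> c1.fl t p = c2.fl t p"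
proof -
 have e: "c1.fl t (Q a) = c2.fl t (Q a)" if "fst a:c1.Lm" for a t
  using agree[of a] agree[of "c1.Ft t a"] that c1.fl_Q[of t a] c2.fl_Q[of t a] by simp
 { assume p: "periodic_point X c1.fl p T"
  hence "p:Q ` c1.Y" unfolding c1.sc.q_onto by (simp add:periodic_point_def)
  then obtain a where a: "a:c1.Y" "p = Q a" by blast
  show "c1.fl t p = c2.fl t p" using c1.periodic_Lm[OF a(1), of T] p a(2) e by (simp add:periodic_point_def) }
 { assume p: "periodic_point X c2.fl p T"
  hence "p:Q' ` c1.Y" unfolding c2.sc.q_onto by (simp add:periodic_point_def)
  then obtain a where a: "a:c1.Y" "p = Q' a" by blast
  hence L: "fst a:c1.Lm" using c2.periodic_Lm[OF a(1), of T] p by (simp add:periodic_point_def)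
  show "c1.fl t p = c2.fl t p" using e[OF L] agree[OF L] a(2) by simp }
qed

lemma periodic_classes_eq: "periodic_classes X x0 c1.fl = periodic_classes X x0 c2.fl"
proof (rule periodic_classes_cong)
 fix p T
 { assume p: "periodic_point X c1.fl p T"
  show "periodic_point X c2.fl p T & (ALL t. c1.fl t p = c2.fl t p)" using p periodic_agree(1)[OF p] by (simp add:periodic_point_def) }
 { assume p: "periodic_point X c2.fl p T"
  show "periodic_point X c1.fl p T & (ALL t. c1.fl t p = c2.fl t p)" using p periodic_agree(2)[OF p] by (simp add:periodic_point_def) }
qed

end

theorem theorem7p1:
  shows "\<exists>(M :: real topology) A \<phi>1 \<phi>2.
    closed_3_manifold M A \<and>
    anosov_flow M A \<phi>1 \<and> anosov_flow M A \<phi>2 \<and>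
    \<not> transitive_flow M \<phi>1 \<and> \<not> transitive_flow M \<phi>2 \<and>
    \<not> orbit_equivalent M \<phi>1 \<phi>2 \<and>
    (\<forall>x0\<in>topspace M. periodic_classes M x0 \<phi>1 = periodic_classes M x0 \<phi>2)"
proof -
 obtain P P' X0 where "da_map P P' X0"
 proof (rule profile_exists)
  fix P P' :: "real => real" and X0
  assume "smooth_on UNIV P" "!!x. (P has_real_derivative P' x) (at x)" "!!x. P' x>0"
   "!!j x. j<3 ==> abs(x - src j)<=1 ==> P x = src j + lam*(x - src j)"
   "!!x. (!!j. j<3 ==> lam<=abs(x - src j)) ==> P' x<=1/lam"
   "!!i. i<=3 ==> P (sad i) = sad i" "!!x. X0<=abs x ==> P x = x/lam" "X0>64"
  hence "da_map P P' X0" by (rule da_map.intro)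
  thus thesis by (rule that)
 qed
 then interpret da_map P P' X0 .
 define ep where "ep = (%_ :: nat. 1 :: real)"
 interpret a: glued P P' X0 ep by unfold_locales (simp add:ep_def)
 interpret b: glued P P' X0 "ep(1 := - ep 1)" by (rule a.glued_flip)
 \<comment> \<open>Flipping twice restores \<open>ep\<close>, so \<open>Psi_rel\<close>, used for
   either quotient, gives both directions of \<open>ker2\<close>.\<close>
 have flip:"(ep(1 := - ep 1))(1 := - (ep(1 := - ep 1)) 1) = ep" by simp
 obtain al be :: "real => real" where tw: "smooth_on UNIV al" "!!x. x>=2 ==> al x = 0" "smooth_on UNIV be" "!!x. x>=2 ==> be x = 0"
  "!!x u. x>0 ==> rt (be (1/x)) (- u) = rt (al x) u" "!!x u. x>0 ==> rt (- be (1/x)) (- u) = rt (- al x) u"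
  by (rule twist_functions) (rule that)
 define Ps where "Ps = a.Psi al be"
 define Ph where "Ph = a.Psi (%x. - al x) (%x. - be x)"
 have inv: "Ps (Ph c) = c" "Ph (Ps c) = c" for c unfolding Ps_def Ph_def by (simp_all add:a.Psi_Psi)
 have YY: "Ps c:a.Y <-> c:a.Y" "Ph c:a.Y <-> c:a.Y" for c unfolding Ps_def Ph_def by (simp_all add:a.Psi_Y)
 have sm: "smooth_on a.Y Ps" "smooth_on a.Y Ph" unfolding Ps_def Ph_def using a.smooth_Psi[OF tw(1-4)] a.smooth_Psi[OF smooth_on_minus[OF open_UNIV tw(1)] _ smooth_on_minus[OF open_UNIV tw(3)]] tw(2,4) by auto
 have mfd: "closed_3_manifold a.lq.M a.lq.qatlas" by (rule a.closed_3_manifold_lq)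
 have cov1: "smooth_cover a.lq.M a.lq.qatlas a.Y a.q a.KK"
  by (rule a.lq.smooth_cover_M[OF mfd a.compact_KK a.KK_Y a.KK_onto])
 \<comment> \<open>The second flow is realised on the quotient and atlas of the first: its
   projection is precomposed with the twist, and \<open>ker2\<close> identifies the fibres with the
   flipped relation.\<close>
 have cov2: "smooth_cover a.lq.M a.lq.qatlas a.Y (%c. a.q (Ps c)) (Ph ` a.KK)"
  by (rule smooth_cover.smooth_cover_comp[OF cov1 sm]) (simp add:YY inv)
 have ker2: "a.q (Ps c) = a.q (Ps d) <-> b.rel c d" for c d
 proof
  assume "a.q (Ps c) = a.q (Ps d)"
  hence "a.rel (Ps c) (Ps d)" by (simp add:a.q_eq)
  hence "b.rel (Ph (Ps c)) (Ph (Ps d))" unfolding Ph_def by (intro b.Psi_rel) (simp_all only:tw(6) flip)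
  thus "b.rel c d" by (simp add:inv)
 next
  assume "b.rel c d"
  hence "a.rel (Ps c) (Ps d)" unfolding Ps_def by (intro a.Psi_rel tw(5))
  thus "a.q (Ps c) = a.q (Ps d)" by (simp add:a.q_eq)
 qed
 interpret A: glued_std P P' X0 ep a.lq.M a.lq.qatlas a.q a.KK
  by (intro glued_std.intro glued_cover.intro glued_cover_axioms.intro glued_std_axioms.intro a.glued_axioms cov1 a.q_eq) (simp_all add:ep_def)
 interpret B: glued_std P P' X0 "ep(1 := - ep 1)" a.lq.M a.lq.qatlas "%c. a.q (Ps c)" "Ph ` a.KK"
  by (intro glued_std.intro glued_cover.intro glued_cover_axioms.intro glued_std_axioms.intro b.glued_axioms cov2 ker2) (simp_all add:ep_def)
 interpret C: glued_pair P P' X0 ep "ep(1 := - ep 1)" a.lq.M a.lq.qatlas a.q "%c. a.q (Ps c)" a.KK "Ph ` a.KK"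
 proof unfold_locales
  fix c :: pt assume "fst c:Lm"
  hence "Ps c = c" unfolding Ps_def a.Psi_def Lm_def using a.tw_far[of c] by simp
  thus "a.q c = a.q (Ps c)" by simp
 qed
 have "~ orbit_equivalent a.lq.M A.fl B.fl"
 proof
  assume "orbit_equivalent a.lq.M A.fl B.fl"
  hence "opposite a.lq.M B.fl" using opposite_invariant A.opposite_pos A.orb_top by (auto simp:ep_def)
  thus False using B.opposite_neg by (simp add:ep_def)
 qed
 thus ?thesis using mfd A.anosov_fl B.anosov_fl A.not_transitive B.not_transitive C.periodic_classes_eq by blast
qed

end
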